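(* Let $\epsilon \in (0,1)$ and $P_1, P_2 > 0$. There exists an $(n, M_1, M_2, \epsilon, P_1, P_2)$-MAC code for the two-transmitter Gaussian MAC provided that \[ \begin{bmatrix}\log M_1 \\ \log M_2 \\ \log (M_1 M_2)\end{bmatrix} \in n\,\mathbf{C}(P_1,P_2) - \sqrt{n}\, Q_{\mathrm{inv}}(\mathsf{V}(P_1,P_2), \epsilon) + \tfrac12 \log n\, \mathbf{1} + O(1)\,\mathbf{1}, \] where the right-hand side denotes the set of vectors $n\mathbf{C}(P_1,P_2) - \sqrt{n}\,\mathbf{z} + \frac12\log n\,\mathbf{1} + O(1)\mathbf{1}$ with $\mathbf{z} \in Q_{\mathrm{inv}}(\mathsf{V}(P_1,P_2),\epsilon)$, the $O(1)$ term being bounded by a constant independent of $n$.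
   Context: Logarithms are natural. The two-transmitter Gaussian MAC with blocklength $n$ has inputs $\mathbf{X}_1,\mathbf{X}_2 \in \mathbb{R}^n$ and output $\mathbf{Y}_2 = \mathbf{X}_1 + \mathbf{X}_2 + \mathbf{Z}$ with $\mathbf{Z} \sim \mathcal{N}(\mathbf{0}, \mathsf{I}_n)$ independent of the inputs. An $(n, M_1, M_2, \epsilon, P_1, P_2)$-MAC code consists of encoders $\mathsf{f}_1: [M_1]\to\mathbb{R}^n$, $\mathsf{f}_2:[M_2]\to\mathbb{R}^n$ with $\|\mathsf{f}_i(m_i)\|^2 \le nP_i$ for all $i\in\{1,2\}$, $m_i \in [M_i]$, and a decoder $\mathsf{g}:\mathbb{R}^n \to [M_1]\times[M_2]$ such that $\frac{1}{M_1M_2}\sum_{m_1,m_2} \mathbb{P}[\mathsf{g}(\mathbf{Y}_2)\neq (m_1,m_2) \mid (\mathbf{X}_1,\mathbf{X}_2) = (\mathsf{f}_1(m_1),\mathsf{f}_2(m_2))] \le \epsilon$. Let $C(P) = \frac12\log(1+P)$ and $V(P) = \frac{P(P+2)}{2(1+P)^2}$. The capacity vector is $\mathbf{C}(P_1,P_2) = (C(P_1), C(P_2), C(P_1+P_2))^T$. The dispersion matrix is the symmetric $3\times 3$ matrix \[ \mathsf{V}(P_1,P_2) = \begin{bmatrix} V(P_1) & V_{1,2} & V_{1,12} \\ V_{1,2} & V(P_2) & V_{2,12} \\ V_{1,12} & V_{2,12} & V(P_1+P_2) + V_{12}\end{bmatrix}, \] with $V_{1,2} = \frac12\frac{P_1P_2}{(1+P_1)(1+P_2)}$,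 $V_{i,12} = \frac12 \frac{P_i(2+P_1+P_2)}{(1+P_i)(1+P_1+P_2)}$ for $i\in\{1,2\}$, and $V_{12} = \frac{P_1P_2}{(1+P_1+P_2)^2}$. For a $d\times d$ positive semidefinite matrix $\mathsf{V}$ and $\mathbf{W}\sim\mathcal{N}(\mathbf{0},\mathsf{V})$, $Q_{\mathrm{inv}}(\mathsf{V},\epsilon) = \{\mathbf{z}\in\mathbb{R}^d : \mathbb{P}[\mathbf{W} \le \mathbf{z}] \ge 1-\epsilon\}$, with vector inequalities taken componentwise. $\mathbf{1}$ is the all-ones vector. *)

theory Defs
  imports "HOL-Probability.Probability"
begin

text \<open>Vectors in R^n are functions nat => real, meaningful on indices i < n.
  Matrices in R^(3x3) are functions nat => nat => real, meaningful on indices < 3.\<close>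

definition std_normal :: "real measure" where
  "std_normal = density lborel std_normal_density"

definition gauss_vec :: "nat \<Rightarrow> (nat \<Rightarrow> real) measure" where
  "gauss_vec n = PiM {..<n} (\<lambda>_. std_normal)"

definition Cap :: "real \<Rightarrow> real" where
  "Cap P = ln (1 + P) / 2"

definition Disp :: "real \<Rightarrow> real" where
  "Disp P = P * (P + 2) / (2 * (1 + P)^2)"

definition cap_vec :: "real \<Rightarrow> real \<Rightarrow> nat \<Rightarrow> real" where
  "cap_vec P1 P2 = (\<lambda>i. if i = 0 then Cap P1 else if i = 1 then Cap P2 else Cap (P1 + P2))"

definition disp_mat :: "real \<Rightarrow> real \<Rightarrow> nat \<Rightarrow> nat \<Rightarrow> real" where
  "disp_mat P1 P2 = (let
      V12 = (1/2) * (P1 * P2) / ((1 + P1) * (1 + P2));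
      V1_12 = (1/2) * (P1 * (2 + P1 + P2)) / ((1 + P1) * (1 + P1 + P2));
      V2_12 = (1/2) * (P2 * (2 + P1 + P2)) / ((1 + P2) * (1 + P1 + P2));
      Vsum = P1 * P2 / (1 + P1 + P2)^2
    in (\<lambda>i j.
      if i = 0 \<and> j = 0 then Disp P1
      else if i = 1 \<and> j = 1 then Disp P2
      else if i = 2 \<and> j = 2 then Disp (P1 + P2) + Vsum
      else if {i, j} = {0, 1} then V12
      else if {i, j} = {0, 2} then V1_12
      else if {i, j} = {1, 2} then V2_12
      else 0))"

text \<open>A centred Gaussian vector W ~ N(0,V) in R^3 is realised as W = A G, where G ~ N(0,I_3)
  and A is some matrix with A A^T = V (the law does not depend on the choice of A).
  gauss_cdf3 V z = P[W \<le> z] componentwise.\<close>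
definition sqrt_factor :: "(nat \<Rightarrow> nat \<Rightarrow> real) \<Rightarrow> nat \<Rightarrow> nat \<Rightarrow> real" where
  "sqrt_factor V = (SOME A. \<forall>i<3. \<forall>j<3. (\<Sum>k<3. A i k * A j k) = V i j)"

definition gauss_cdf3 :: "(nat \<Rightarrow> nat \<Rightarrow> real) \<Rightarrow> (nat \<Rightarrow> real) \<Rightarrow> real" where
  "gauss_cdf3 V z = measure (gauss_vec 3)
     {g \<in> space (gauss_vec 3). \<forall>i<3. (\<Sum>k<3. sqrt_factor V i k * g k) \<le> z i}"

definition Qinv :: "(nat \<Rightarrow> nat \<Rightarrow> real) \<Rightarrow> real \<Rightarrow> (nat \<Rightarrow> real) set" where
  "Qinv V \<epsilon> = {z. gauss_cdf3 V z \<ge> 1 - \<epsilon>}"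

definition mac_code ::
  "nat \<Rightarrow> nat \<Rightarrow> nat \<Rightarrow> real \<Rightarrow> real \<Rightarrow> real \<Rightarrow>
   (nat \<Rightarrow> nat \<Rightarrow> real) \<Rightarrow> (nat \<Rightarrow> nat \<Rightarrow> real) \<Rightarrow> ((nat \<Rightarrow> real) \<Rightarrow> nat \<times> nat) \<Rightarrow> bool" where
  "mac_code n M1 M2 \<epsilon> P1 P2 f1 f2 g \<longleftrightarrow>
     (\<forall>m<M1. (\<Sum>i<n. (f1 m i)^2) \<le> real n * P1) \<and>
     (\<forall>m<M2. (\<Sum>i<n. (f2 m i)^2) \<le> real n * P2) \<and>
     g \<in> PiM {..<n} (\<lambda>_. lborel) \<rightarrow>\<^sub>M count_space UNIV \<and>
     (\<forall>y. g y \<in> {..<M1} \<times> {..<M2}) \<and>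
     (1 / (real M1 * real M2)) *
       (\<Sum>m1<M1. \<Sum>m2<M2. measure (gauss_vec n)
          {z \<in> space (gauss_vec n).
             g (\<lambda>i\<in>{..<n}. f1 m1 i + f2 m2 i + z i) \<noteq> (m1, m2)}) \<le> \<epsilon>"

definition exists_mac_code :: "nat \<Rightarrow> nat \<Rightarrow> nat \<Rightarrow> real \<Rightarrow> real \<Rightarrow> real \<Rightarrow> bool" where
  "exists_mac_code n M1 M2 \<epsilon> P1 P2 \<longleftrightarrow> (\<exists>f1 f2 g. mac_code n M1 M2 \<epsilon> P1 P2 f1 f2 g)"

end

theory Submission
  imports Defs
begin


text \<open>The code is random: codewords are uniform on the power spheres and decoding is by
  minimum distance. Let Z be the noise and, for kind i = 0, 1, 2, let v_i be Z plus the first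
  codeword, the second codeword, or their sum. A competing pair that is wrong in the messages of
  kind i beats the sent pair only if its signal lies within |Z| of v_i, hence in a cone around v_i
  whose half-angle has sine |Z|/|v_i|. Cap estimates (\<open>cone_bound\<close>,
  \<open>sum_cone_bound\<close>) make this probability at most a constant times n^(-1/2)
  (|Z|/|v_i|)^(n-1), as long as that sine stays away from 1. With the \<open>deficit\<close> D_i =
  sqrt n (C_i - ln(|v_i|/|Z|)), the shortfall of the information density below capacity, this reads
  n^(-1/2) exp((n-1)(D_i/sqrt n - C_i)).

  The union bound over competitors of kind i is paid only while D_i < w_i. Averaging over this event
  gains a second factor n^(-1/2): the law of D_i puts mass O(n^(-1/2)) on every interval of length
  n^(-1/2), and the exponential lives on the last few such intervals (\<open>deficit_slice\<close>,
  \<open>deficit_exp_moment\<close>, \<open>competitor_bound\<close>). The price of kind i is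
  therefore M_i O(1/n) exp((n-1)(w_i/sqrt n - C_i)). Let zeta be a point of \<open>Qinv\<close> and
  w_i at most zeta_i + K/sqrt n. Then the price is still O(n^(-1/2)) when log M_i = n C_i - sqrt n
  zeta_i + (log n)/2 - K, which is where the term (log n)/2 comes from
  (\<open>code_size_bound\<close>).

  There remains the probability that some D_i reaches w_i. It needs no central limit theorem.
  Rotation invariance expresses the inner products of the noise and the two Gaussian vectors behind
  the codewords exactly through three chi and three normal variables, all independent
  (\<open>nn_integral_gram_vec\<close>). The chi variable |Z| is within O(n^(-1/2)) in total
  variation of sqrt(n-1) + N(0, 1/2) (\<open>chi_total_variation\<close>), and the other two chi
  variables only normalise the codewords, a second-order effect. A Taylor expansion
  (\<open>deficit_expansion\<close>) then makes D_i a linear form in four independent Gaussians, up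
  to n^(-1/2) times a quadratic error. A linear form meets a slab of that thickness with probability
  O(n^(-1/2)) (\<open>slab5\<close>), and this gives the Berry-Esseen type bound
  \<open>deficit_bad_event\<close>. The covariance matrix of the three linear forms is the
  dispersion matrix (\<open>row_gram\<close>). Since a centred Gaussian law depends only on its
  covariance (\<open>emeasure_gauss_vec_gram\<close>), the limit is the distribution function F =
  \<open>gauss_cdf3\<close> (\<open>gauss_cdf3_disp_mat\<close>).

  Altogether the error is at most 1 - F(zeta + K/sqrt n) + C/sqrt n, where C does not depend on K.
  Moving all three coordinates of zeta up by h in (0, 1] raises F by at least c h, unless F is
  already at least 1 - \<epsilon>/2 after the move (\<open>lin_cdf_gain\<close>). As F(zeta) \<ge> 1
  - \<epsilon>, the choice K = (C + 1)/c brings the error below \<epsilon> for large n, and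
  \<open>random_coding\<close> extracts a deterministic code from the average.\<close>

section \<open>The standard Gaussian measure and rotations of the plane\<close>

lemma sets_std_normal [simp, measurable_cong]: "sets std_normal = sets borel"
  by (simp add: std_normal_def)

lemma space_std_normal [simp]: "space std_normal = UNIV"
  by (simp add: std_normal_def)

lemma prob_space_std_normal: "prob_space std_normal"
  unfolding std_normal_def by (rule prob_space_normal_density) simp

interpretation std_normal: prob_space std_normal
  by (rule prob_space_std_normal)

interpretation std_normals: product_sigma_finite "\<lambda>_. std_normal"
  by standard

interpretation std_normals: product_prob_space "\<lambda>_. std_normal" I for I
  by standard

lemma nn_integral_std_normal:
  assumes [measurable]: "f \<in> borel_measurable borel"
  shows "(\<integral>\<^sup>+x. f x \<partial>std_normal) = (\<integral>\<^sup>+x. ennreal (std_normal_density x) * f x \<partial>lborel)"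
  unfolding std_normal_def by (subst nn_integral_density) auto

text \<open>For each fixed x the shear is a translation in y. Shears are the only linear
  substitutions in the plane that have to be justified directly.\<close>

lemma nn_integral_lborel_shear:
  assumes [measurable]: "f \<in> borel_measurable (lborel \<Otimes>\<^sub>M lborel)"
  shows "(\<integral>\<^sup>+x. \<integral>\<^sup>+y. f (x, y + t * x) \<partial>lborel \<partial>lborel) = (\<integral>\<^sup>+x. \<integral>\<^sup>+y. f (x, y :: real) \<partial>lborel \<partial>(lborel :: real measure))"
proof (rule nn_integral_cong)
  fix x :: real
  have "(\<integral>\<^sup>+y. f (x, y) \<partial>lborel) = ennreal \<bar>1\<bar> * (\<integral>\<^sup>+y. f (x, t * x + 1 * y) \<partial>lborel)"
    by (subst nn_integral_real_affine[of _ 1 "t * x"]) (auto)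
  then show "(\<integral>\<^sup>+y. f (x, y + t * x) \<partial>lborel) = (\<integral>\<^sup>+y. f (x, y) \<partial>lborel)"
    by (simp add: add.commute)
qed

lemma nn_integral_lborel_shear':
  assumes [measurable]: "f \<in> borel_measurable (lborel \<Otimes>\<^sub>M lborel)"
  shows "(\<integral>\<^sup>+x. \<integral>\<^sup>+y. f (x + t * y, y) \<partial>lborel \<partial>lborel) = (\<integral>\<^sup>+x. \<integral>\<^sup>+y. f (x, y :: real) \<partial>lborel \<partial>(lborel :: real measure))"
proof -
  have "(\<integral>\<^sup>+x. \<integral>\<^sup>+y. f (x + t * y, y) \<partial>lborel \<partial>lborel) = (\<integral>\<^sup>+y. \<integral>\<^sup>+x. f (x + t * y, y) \<partial>lborel \<partial>lborel)"
    by (rule lborel_pair.Fubini') measurable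
  also have "\<dots> = (\<integral>\<^sup>+y. \<integral>\<^sup>+x. f (x, y) \<partial>lborel \<partial>lborel)"
    using nn_integral_lborel_shear[of "\<lambda>(y, x). f (x, y)" t] by simp
  also have "\<dots> = (\<integral>\<^sup>+x. \<integral>\<^sup>+y. f (x, y) \<partial>lborel \<partial>lborel)"
    by (rule lborel_pair.Fubini') measurable
  finally show ?thesis .
qed

text \<open>A rotation other than the half turn is a product of three shears.\<close>
lemma nn_integral_lborel_rotate:
  fixes c s :: real
  assumes [measurable]: "f \<in> borel_measurable (lborel \<Otimes>\<^sub>M lborel)" and cs: "c\<^sup>2 + s\<^sup>2 = 1" "0 \<le> c"
  shows "(\<integral>\<^sup>+x. \<integral>\<^sup>+y. f (c * x - s * y, s * x + c * y) \<partial>lborel \<partial>lborel) = (\<integral>\<^sup>+x. \<integral>\<^sup>+y. f (x, y) \<partial>lborel \<partial>lborel)"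
proof -
  \<comment> \<open>For c and s the cosine and sine of the rotation angle, \<open>t\<close> is minus
    the tangent of half that angle. Non-negativity of c keeps the denominator away from 0.\<close>
  define t where "t = - s / (1 + c)"
  have t: "t * s = c - 1" "t * (1 + c) = - s"
  proof -
    have "s * s = (1 + c) * (1 - c)" using cs by (simp add: power2_eq_square algebra_simps)
    then show "t * s = c - 1" using cs(2) by (simp add: t_def field_simps)
    show "t * (1 + c) = - s" using cs(2) by (simp add: t_def field_simps)
  qed
  have e: "((x + t * y) + t * (y + s * (x + t * y)), y + s * (x + t * y)) = (c * x - s * y, s * x + c * y)" for x y
  proof -
    have a: "y + s * (x + t * y) = s * x + c * y"
      using t(1) by (simp add: algebra_simps) (metis left_diff_distrib mult.commute mult.left_commute mult_1 add_diff_cancel_left' eq_diff_eq)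
    have "(x + t * y) + t * (s * x + c * y) = x * (1 + t * s) + (t * (1 + c)) * y"
      by (simp add: algebra_simps)
    also have "\<dots> = c * x - s * y" unfolding t by (simp add: algebra_simps)
    finally show ?thesis using a by simp
  qed
  have "(\<integral>\<^sup>+x. \<integral>\<^sup>+y. f (x, y) \<partial>lborel \<partial>lborel) = (\<integral>\<^sup>+x. \<integral>\<^sup>+y. f (x + t * y, y) \<partial>lborel \<partial>lborel)"
    by (simp add: nn_integral_lborel_shear')
  also have "\<dots> = (\<integral>\<^sup>+x. \<integral>\<^sup>+y. (\<lambda>(x, y). f (x + t * y, y)) (x, y + s * x) \<partial>lborel \<partial>lborel)"
    by (subst nn_integral_lborel_shear) auto
  also have "\<dots> = (\<integral>\<^sup>+x. \<integral>\<^sup>+y. (\<lambda>(x, y). (\<lambda>(x, y). f (x + t * y, y)) (x, y + s * x)) (x + t * y, y) \<partial>lborel \<partial>lborel)"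
    by (subst nn_integral_lborel_shear') auto
  finally show ?thesis unfolding split e by simp
qed

lemma nn_integral_std_normal2:
  assumes [measurable]: "f \<in> borel_measurable (borel \<Otimes>\<^sub>M borel)"
  shows "(\<integral>\<^sup>+x. \<integral>\<^sup>+y. f (x, y) \<partial>std_normal \<partial>std_normal) =
    (\<integral>\<^sup>+x. \<integral>\<^sup>+y. ennreal (exp (- (x\<^sup>2 + y\<^sup>2) / 2) / (2 * pi)) * f (x, y) \<partial>lborel \<partial>lborel)"
  apply (subst nn_integral_std_normal)
  subgoal by measurable
  apply (rule nn_integral_cong)
  apply (subst nn_integral_std_normal)
  subgoal by measurable
  apply (subst nn_integral_cmult[symmetric])
  subgoal by measurable
  apply (rule nn_integral_cong)
  apply (simp add: mult.assoc[symmetric] ennreal_mult'[symmetric] std_normal_density_def exp_add[symmetric] add_divide_distrib diff_divide_distrib)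
  done

text \<open>The joint density is a function of x^2 + y^2, which the rotation preserves, so the claim
  reduces to Lebesgue measure.\<close>

lemma nn_integral_std_normal_rotate:
  fixes c s :: real
  assumes [measurable]: "f \<in> borel_measurable (borel \<Otimes>\<^sub>M borel)" and cs: "c\<^sup>2 + s\<^sup>2 = 1" "0 \<le> c"
  shows "(\<integral>\<^sup>+x. \<integral>\<^sup>+y. f (c * x - s * y, s * x + c * y) \<partial>std_normal \<partial>std_normal) = (\<integral>\<^sup>+x. \<integral>\<^sup>+y. f (x, y) \<partial>std_normal \<partial>std_normal)"
proof -
  let ?g = "\<lambda>(x, y). ennreal (exp (- (x\<^sup>2 + y\<^sup>2) / 2) / (2 * pi)) * f (x, y)"
  have e: "(c * x - s * y)\<^sup>2 + (s * x + c * y)\<^sup>2 = x\<^sup>2 + y\<^sup>2" for x y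
  proof -
    have "(c * x - s * y)\<^sup>2 + (s * x + c * y)\<^sup>2 = (c\<^sup>2 + s\<^sup>2) * (x\<^sup>2 + y\<^sup>2)"
      by (simp add: power2_eq_square algebra_simps)
    then show ?thesis using cs by simp
  qed
  have [measurable]: "?g \<in> borel_measurable (lborel \<Otimes>\<^sub>M lborel)" by measurable
  have "(\<integral>\<^sup>+x. \<integral>\<^sup>+y. f (c * x - s * y, s * x + c * y) \<partial>std_normal \<partial>std_normal) =
    (\<integral>\<^sup>+x. \<integral>\<^sup>+y. (\<lambda>(x, y). f (c * x - s * y, s * x + c * y)) (x, y) \<partial>std_normal \<partial>std_normal)" by simp
  also have "\<dots> = (\<integral>\<^sup>+x. \<integral>\<^sup>+y. ?g (c * x - s * y, s * x + c * y) \<partial>lborel \<partial>lborel)"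
    apply (subst nn_integral_std_normal2)
    subgoal by measurable
    by (simp only: split e)
  also have "\<dots> = (\<integral>\<^sup>+x. \<integral>\<^sup>+y. ?g (x, y) \<partial>lborel \<partial>lborel)"
    by (rule nn_integral_lborel_rotate) (use cs in auto)
  also have "\<dots> = (\<integral>\<^sup>+x. \<integral>\<^sup>+y. f (x, y) \<partial>std_normal \<partial>std_normal)"
    by (subst nn_integral_std_normal2) auto
  finally show ?thesis .
qed

lemma nn_integral_std_normal_uminus:
  assumes [measurable]: "f \<in> borel_measurable borel"
  shows "(\<integral>\<^sup>+x. f (- x) \<partial>std_normal) = (\<integral>\<^sup>+x. f x \<partial>std_normal)"
proof -
  have "(\<integral>\<^sup>+x. f x \<partial>std_normal) = (\<integral>\<^sup>+x. ennreal (std_normal_density x) * f x \<partial>lborel)"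
    by (rule nn_integral_std_normal) simp
  also have "\<dots> = ennreal \<bar>-1\<bar> * (\<integral>\<^sup>+x. ennreal (std_normal_density (0 + -1 * x)) * f (0 + -1 * x) \<partial>lborel)"
    by (rule nn_integral_real_affine) auto
  also have "\<dots> = (\<integral>\<^sup>+x. f (- x) \<partial>std_normal)"
    by (subst nn_integral_std_normal) (auto simp: std_normal_density_def)
  finally show ?thesis by simp
qed


section \<open>The chi distribution as the law of a Gaussian norm\<close>

text \<open>The chi density with m degrees of freedom without its normalising constant. The constant
  is kept as the integral \<open>chi_const\<close>, since only ratios and limits of it matter later
  and no Gamma function has to be evaluated.\<close>

definition chi_dens :: "nat \<Rightarrow> real \<Rightarrow> real" where
  "chi_dens m r = (if 0 < r then r ^ (m - 1) * exp (- r\<^sup>2 / 2) else 0)"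

definition chi_const :: "nat \<Rightarrow> ennreal" where
  "chi_const m = (\<integral>\<^sup>+r. ennreal (chi_dens m r) \<partial>lborel)"

definition chi :: "nat \<Rightarrow> real measure" where
  "chi m = density lborel (\<lambda>r. ennreal (chi_dens m r) / chi_const m)"

lemma chi_dens_nonneg [simp]: "0 \<le> chi_dens m r"
  by (simp add: chi_dens_def)

lemma measurable_chi_dens [measurable]: "chi_dens m \<in> borel_measurable borel"
  unfolding chi_dens_def[abs_def] by measurable

lemma sets_chi [simp, measurable_cong]: "sets (chi m) = sets borel"
  by (simp add: chi_def)

lemma space_chi [simp]: "space (chi m) = UNIV"
  by (simp add: chi_def)

lemma nn_integral_chi:
  assumes [measurable]: "f \<in> borel_measurable borel"
  shows "(\<integral>\<^sup>+x. f x \<partial>chi m) = (\<integral>\<^sup>+x. ennreal (chi_dens m x) * f x \<partial>lborel) / chi_const m"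
proof -
  have "(\<integral>\<^sup>+x. f x \<partial>chi m) = (\<integral>\<^sup>+x. (ennreal (chi_dens m x) * f x) / chi_const m \<partial>lborel)"
    unfolding chi_def by (subst nn_integral_density) (auto simp: divide_ennreal_def mult_ac)
  then show ?thesis by (simp add: nn_integral_divide)
qed

lemma PiM_std_normal_eq_density:
  assumes "finite I"
  shows "PiM I (\<lambda>_. std_normal) = density (PiM I (\<lambda>_. lborel)) (\<lambda>x. \<Prod>i\<in>I. ennreal (std_normal_density (x i)))"
proof (rule std_normals.PiM_eqI[symmetric, OF assms])
  interpret lb: product_sigma_finite "\<lambda>_. lborel :: real measure" by standard
  show "sets (density (PiM I (\<lambda>_. lborel)) (\<lambda>x. \<Prod>i\<in>I. ennreal (std_normal_density (x i)))) = sets (PiM I (\<lambda>_. std_normal))"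
    by (auto intro!: sets_PiM_cong)
  fix A :: "'a \<Rightarrow> real set" assume A: "\<And>i. i \<in> I \<Longrightarrow> A i \<in> sets std_normal"
  then have A' [measurable]: "\<And>i. i \<in> I \<Longrightarrow> A i \<in> sets borel" by simp
  have "emeasure (density (PiM I (\<lambda>_. lborel)) (\<lambda>x. \<Prod>i\<in>I. ennreal (std_normal_density (x i)))) (Pi\<^sub>E I A) =
    (\<integral>\<^sup>+x. (\<Prod>i\<in>I. ennreal (std_normal_density (x i))) * indicator (Pi\<^sub>E I A) x \<partial>PiM I (\<lambda>_. lborel))"
    using A' assms by (subst emeasure_density) (auto intro!: sets_PiM_I_finite borel_measurable_prod)
  also have "\<dots> = (\<integral>\<^sup>+x. (\<Prod>i\<in>I. ennreal (std_normal_density (x i)) * indicator (A i) (x i)) \<partial>PiM I (\<lambda>_. lborel))"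
  proof (rule nn_integral_cong)
    fix x :: "'a \<Rightarrow> real" assume x: "x \<in> space (PiM I (\<lambda>_. lborel))"
    have "indicator (Pi\<^sub>E I A) x = (\<Prod>i\<in>I. indicator (A i) (x i) :: ennreal)"
    proof (cases "\<forall>i\<in>I. x i \<in> A i")
      case True
      then show ?thesis using x by (auto simp: space_PiM PiE_iff)
    next
      case False
      then obtain i where "i \<in> I" "x i \<notin> A i" by auto
      then have "(\<Prod>i\<in>I. indicator (A i) (x i) :: ennreal) = 0" using assms by (intro prod_zero bexI[of _ i]) auto
      then show ?thesis using False by (auto simp: PiE_iff)
    qed
    then show "(\<Prod>i\<in>I. ennreal (std_normal_density (x i))) * indicator (Pi\<^sub>E I A) x =
       (\<Prod>i\<in>I. ennreal (std_normal_density (x i)) * indicator (A i) (x i))"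
      by (simp add: prod.distrib)
  qed
  also have "\<dots> = (\<Prod>i\<in>I. \<integral>\<^sup>+x. ennreal (std_normal_density x) * indicator (A i) x \<partial>lborel)"
    using assms by (subst lb.product_nn_integral_prod) auto
  also have "\<dots> = (\<Prod>i\<in>I. emeasure std_normal (A i))"
    by (intro prod.cong refl) (auto simp: std_normal_def emeasure_density)
  finally show "emeasure (density (PiM I (\<lambda>_. lborel)) (\<lambda>x. \<Prod>i\<in>I. ennreal (std_normal_density (x i)))) (Pi\<^sub>E I A) =
    (\<Prod>i\<in>I. emeasure std_normal (A i))" .
qed

text \<open>Polar coordinates, obtained by differentiating the ball volume V r^m: both measures
  agree on the half-lines \<open>{..r}\<close>, which generate the Borel sets.\<close>

lemma distr_lborel_norm:
  assumes I: "finite I" "I \<noteq> {}"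
  shows "distr (PiM I (\<lambda>_. lborel)) borel (\<lambda>x. sqrt (\<Sum>i\<in>I. (x i)\<^sup>2)) =
    density lborel (\<lambda>r. ennreal (if 0 < r then unit_ball_vol (card I) * (card I * r ^ (card I - 1)) else 0))" (is "?D = density lborel ?d")
proof (rule measure_eqI_generator_eq[where \<Omega> = UNIV and E = "range (\<lambda>r::real. {..r})" and A = "\<lambda>n. {.. real n}"])
  let ?V = "unit_ball_vol (card I)"
  have [simp]: "0 < card I" using I by (simp add: card_gt_0_iff)
  have D: "emeasure ?D {..r} = ennreal (if 0 < r then ?V * r ^ card I else 0)" for r
  proof -
    have eq: "emeasure ?D {..r} = emeasure (PiM I (\<lambda>_. lborel)) ({f. sqrt (\<Sum>i\<in>I. (f i)\<^sup>2) \<le> r} \<inter> space (PiM I (\<lambda>_. lborel)))"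
      by (subst emeasure_distr) (auto intro!: arg_cong[where f="emeasure _"])
    consider "0 < r" | "r < 0" | "r = 0" by linarith
    then show ?thesis
    proof cases
      case 1
      then show ?thesis unfolding eq using I by (subst emeasure_cball_aux) auto
    next
      case 2
      then have "{f. sqrt (\<Sum>i\<in>I. (f i)\<^sup>2) \<le> r} = {}"
        using real_sqrt_ge_zero[OF sum_nonneg[of I]] by (auto simp: not_le intro: less_le_trans)
      then show ?thesis unfolding eq using 2 by simp
    next
      case 3
      interpret lb: product_sigma_finite "\<lambda>_. lborel :: real measure" by standard
      have z: "(\<Sum>i\<in>I. (x i)\<^sup>2) \<le> 0 \<longleftrightarrow> (\<forall>i\<in>I. x i = 0)" for x :: "'a \<Rightarrow> real"
        using sum_nonneg_eq_0_iff[OF I(1), of "\<lambda>i. (x i)\<^sup>2"] sum_nonneg[of I "\<lambda>i. (x i)\<^sup>2"] by (auto simp: antisym)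
      have "{f. sqrt (\<Sum>i\<in>I. (f i)\<^sup>2) \<le> 0} \<inter> space (PiM I (\<lambda>_. lborel)) = Pi\<^sub>E I (\<lambda>_. {0 :: real})"
        by (auto simp: space_PiM PiE_iff z extensional_def restrict_def fun_eq_iff)
      moreover have "emeasure (PiM I (\<lambda>_. lborel)) (Pi\<^sub>E I (\<lambda>_. {0 :: real})) = 0"
        using I by (subst lb.emeasure_PiM) auto
      ultimately show ?thesis unfolding eq using 3 by simp
    qed
  qed
  have dens: "emeasure (density lborel ?d) {..r} = ennreal (if 0 < r then ?V * r ^ card I else 0)" for r
  proof -
    have "emeasure (density lborel ?d) {..r} = (\<integral>\<^sup>+s. ?d s * indicator {..r} s \<partial>lborel)"
      by (subst emeasure_density) auto
    also have "\<dots> = ennreal (if 0 < r then ?V * r ^ card I else 0)"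
    proof (cases "0 < r")
      case True
      have "(\<integral>\<^sup>+s. ?d s * indicator {..r} s \<partial>lborel) = (\<integral>\<^sup>+s. ennreal (?V * (card I * s ^ (card I - 1))) * indicator {0..r} s \<partial>lborel)"
      proof (rule nn_integral_cong_AE)
        \<comment> \<open>At s = 0 the integrands differ in dimension one, because 0 ^ 0 = 1; hence
          equality only almost everywhere.\<close>
        have "AE s in lborel. s \<noteq> (0::real)" using AE_lborel_singleton by blast
        then show "AE s in lborel. ?d s * indicator {..r} s = ennreal (?V * (card I * s ^ (card I - 1))) * indicator {0..r} s"
          by eventually_elim (auto simp: indicator_def)
      qed
      also have "\<dots> = ennreal (?V * r ^ card I - ?V * 0 ^ card I)"
        using True by (intro nn_integral_FTC_Icc) (auto intro!: derivative_eq_intros)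
      finally show ?thesis using True by (simp add: zero_power)
    next
      case False
      then have "?d s * indicator {..r} s = 0" for s by (auto simp: indicator_def)
      then have "(\<integral>\<^sup>+s. ?d s * indicator {..r} s \<partial>lborel) = (\<integral>\<^sup>+s. 0 \<partial>(lborel :: real measure))" by (intro nn_integral_cong)
      then show ?thesis using False by simp
    qed
    finally show ?thesis .
  qed
  show "emeasure ?D X = emeasure (density lborel ?d) X" if "X \<in> range (\<lambda>r::real. {..r})" for X
    using that D dens by auto
  show "emeasure ?D {..real n} \<noteq> \<infinity>" for n unfolding D by simp
  show "Int_stable (range (\<lambda>r::real. {..r}))" by (auto simp: Int_stable_def)
  show "sets ?D = sigma_sets UNIV (range (\<lambda>r::real. {..r}))"
    by (simp add: borel_eq_atMost)
  show "sets (density lborel ?d) = sigma_sets UNIV (range (\<lambda>r::real. {..r}))"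
    by (simp add: borel_eq_atMost)
  show "(\<Union>n. {..real n}) = UNIV" using real_arch_simple by auto
qed auto

text \<open>The Gaussian density depends on the norm alone, so pushing Lebesgue measure forward
  along the norm yields the chi density up to a constant.\<close>

lemma nn_integral_norm_std_normal:
  assumes I: "finite I" "I \<noteq> {}" and [measurable]: "h \<in> borel_measurable borel"
  shows "(\<integral>\<^sup>+x. h (sqrt (\<Sum>i\<in>I. (x i)\<^sup>2)) \<partial>PiM I (\<lambda>_. std_normal)) = (\<integral>\<^sup>+r. h r \<partial>chi (card I))"
proof -
  let ?m = "card I"
  define c where "c = (1 / sqrt (2 * pi)) ^ ?m * unit_ball_vol ?m * ?m"
  have m0: "0 < ?m" using I by (simp add: card_gt_0_iff)
  then have c0: "0 < c" unfolding c_def by (intro mult_pos_pos) auto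
  have key: "(\<integral>\<^sup>+x. h (sqrt (\<Sum>i\<in>I. (x i)\<^sup>2)) \<partial>PiM I (\<lambda>_. std_normal)) = ennreal c * (\<integral>\<^sup>+r. ennreal (chi_dens ?m r) * h r \<partial>lborel)"
    if [measurable]: "h \<in> borel_measurable borel" for h :: "real \<Rightarrow> ennreal"
  proof -
    have pr: "(\<Prod>i\<in>I. ennreal (std_normal_density (x i))) =
      ennreal ((1 / sqrt (2 * pi)) ^ ?m * exp (- (sqrt (\<Sum>i\<in>I. (x i)\<^sup>2))\<^sup>2 / 2))" for x
    proof -
      have "(\<Prod>i\<in>I. std_normal_density (x i)) = (1 / sqrt (2 * pi)) ^ ?m * (\<Prod>i\<in>I. exp (- (x i)\<^sup>2 / 2))"
        unfolding std_normal_density_def by (simp add: prod.distrib prod_dividef power_divide)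
      also have "(\<Prod>i\<in>I. exp (- (x i)\<^sup>2 / 2)) = exp (\<Sum>i\<in>I. - (x i)\<^sup>2 / 2)"
        using I by (simp add: exp_sum)
      also have "(\<Sum>i\<in>I. - (x i)\<^sup>2 / 2) = - (sqrt (\<Sum>i\<in>I. (x i)\<^sup>2))\<^sup>2 / 2"
        by (simp add: sum_nonneg sum_negf sum_divide_distrib[symmetric])
      finally show ?thesis by (simp add: prod_ennreal)
    qed
    have "(\<integral>\<^sup>+x. h (sqrt (\<Sum>i\<in>I. (x i)\<^sup>2)) \<partial>PiM I (\<lambda>_. std_normal)) =
      (\<integral>\<^sup>+x. ennreal ((1 / sqrt (2 * pi)) ^ ?m * exp (- (sqrt (\<Sum>i\<in>I. (x i)\<^sup>2))\<^sup>2 / 2)) * h (sqrt (\<Sum>i\<in>I. (x i)\<^sup>2)) \<partial>PiM I (\<lambda>_. lborel))"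
      unfolding PiM_std_normal_eq_density[OF I(1)] by (subst nn_integral_density) (auto simp: pr)
    also have "\<dots> = (\<integral>\<^sup>+r. ennreal ((1 / sqrt (2 * pi)) ^ ?m * exp (- r\<^sup>2 / 2)) * h r \<partial>distr (PiM I (\<lambda>_. lborel)) borel (\<lambda>x. sqrt (\<Sum>i\<in>I. (x i)\<^sup>2)))"
      by (subst nn_integral_distr) auto
    also have "\<dots> = (\<integral>\<^sup>+r. ennreal (if 0 < r then unit_ball_vol ?m * (?m * r ^ (?m - 1)) else 0) *
       (ennreal ((1 / sqrt (2 * pi)) ^ ?m * exp (- r\<^sup>2 / 2)) * h r) \<partial>lborel)"
      unfolding distr_lborel_norm[OF I] by (subst nn_integral_density) auto
    also have "\<dots> = (\<integral>\<^sup>+r. ennreal c * (ennreal (chi_dens ?m r) * h r) \<partial>lborel)"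
    proof (rule nn_integral_cong)
      fix r :: real
      have "ennreal (if 0 < r then unit_ball_vol ?m * (?m * r ^ (?m - 1)) else 0) * ennreal ((1 / sqrt (2 * pi)) ^ ?m * exp (- r\<^sup>2 / 2))
        = ennreal c * ennreal (chi_dens ?m r)"
        using c0 by (auto simp: chi_dens_def c_def ennreal_mult'[symmetric] mult_ac)
      then show "ennreal (if 0 < r then unit_ball_vol ?m * (?m * r ^ (?m - 1)) else 0) *
       (ennreal ((1 / sqrt (2 * pi)) ^ ?m * exp (- r\<^sup>2 / 2)) * h r) = ennreal c * (ennreal (chi_dens ?m r) * h r)"
        by (simp only: mult.assoc[symmetric])
    qed
    also have "\<dots> = ennreal c * (\<integral>\<^sup>+r. ennreal (chi_dens ?m r) * h r \<partial>lborel)"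
      by (rule nn_integral_cmult) measurable
    finally show ?thesis .
  qed
  \<comment> \<open>Taking h = 1, total mass one shows that the constant \<open>c\<close> is the
    reciprocal of \<open>chi_const\<close>.\<close>
  have 1: "1 = ennreal c * chi_const ?m"
    using key[of "\<lambda>_. 1"] std_normals.emeasure_space_1[of I]
    by (simp add: chi_const_def)
  have "chi_const ?m = 1 / ennreal c"
    using 1 c0 by (metis ennreal_mult_divide_eq ennreal_neq_top ennreal_less_zero_iff less_irrefl mult.commute)
  then have "(\<integral>\<^sup>+r. h r \<partial>chi (card I)) = (\<integral>\<^sup>+r. ennreal (chi_dens ?m r) * h r \<partial>lborel) * ennreal c"
    using c0 by (subst nn_integral_chi)
      (auto simp: divide_ennreal_def ennreal_inverse_positive inverse_ennreal)
  then show ?thesis by (simp add: key mult.commute)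
qed


section \<open>Isometries that preserve the Gaussian measure\<close>

text \<open>Only coordinates below n count, so the arguments need not lie in the space of
  \<open>gauss_vec n\<close>; codewords can be built as plain functions.\<close>

definition ip :: "nat \<Rightarrow> (nat \<Rightarrow> real) \<Rightarrow> (nat \<Rightarrow> real) \<Rightarrow> real" where
  "ip n x y = (\<Sum>i<n. x i * y i)"

lemma sets_gauss_vec [measurable_cong]: "sets (gauss_vec n) = sets (PiM {..<n} (\<lambda>_. borel))"
  unfolding gauss_vec_def by (rule sets_PiM_cong) auto

lemma space_gauss_vec: "space (gauss_vec n) = (\<Pi>\<^sub>E i\<in>{..<n}. UNIV)"
  unfolding gauss_vec_def by (simp add: space_PiM)

lemma prob_space_gauss_vec: "prob_space (gauss_vec n)"
  unfolding gauss_vec_def by (rule std_normals.prob_space_axioms)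

interpretation gauss_vec: prob_space "gauss_vec n" for n
  by (rule prob_space_gauss_vec)

lemma measurable_gauss_vec_component [measurable]:
  "i < n \<Longrightarrow> (\<lambda>x. x i) \<in> borel_measurable (gauss_vec n)"
  using measurable_component_singleton[of i "{..<n}" "\<lambda>_. borel :: real measure"]
  by (subst measurable_cong_sets[OF sets_gauss_vec refl]) auto

lemma measurable_ip [measurable]:
  assumes [measurable]: "f \<in> M \<rightarrow>\<^sub>M gauss_vec n" "g \<in> M \<rightarrow>\<^sub>M gauss_vec n"
  shows "(\<lambda>w. ip n (f w) (g w)) \<in> borel_measurable M"
proof -
  have "(\<lambda>w. f w i) \<in> borel_measurable M" "(\<lambda>w. g w i) \<in> borel_measurable M" if "i < n" for i
    using measurable_compose[OF assms(1) measurable_gauss_vec_component[OF that]]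
          measurable_compose[OF assms(2) measurable_gauss_vec_component[OF that]] by auto
  then show ?thesis unfolding ip_def by (intro borel_measurable_sum borel_measurable_times) auto
qed

lemma measurable_gauss_vecI:
  assumes "\<And>i. i < n \<Longrightarrow> (\<lambda>w. f w i) \<in> borel_measurable M"
    and "\<And>w i. w \<in> space M \<Longrightarrow> \<not> i < n \<Longrightarrow> f w i = undefined"
  shows "f \<in> M \<rightarrow>\<^sub>M gauss_vec n"
proof -
  have "(\<lambda>w i. f w i) \<in> M \<rightarrow>\<^sub>M PiM {..<n} (\<lambda>_. borel)"
    using assms by (intro measurable_PiM_single') (auto simp: space_PiM)
  then show ?thesis by (subst measurable_cong_sets[OF refl sets_gauss_vec]) simp
qed

lemma nn_integral_gauss_vec_Suc:
  assumes "f \<in> borel_measurable (gauss_vec (Suc n))"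
  shows "(\<integral>\<^sup>+x. f x \<partial>gauss_vec (Suc n)) = (\<integral>\<^sup>+x. \<integral>\<^sup>+y. f (x(n := y)) \<partial>std_normal \<partial>gauss_vec n)"
  using std_normals.product_nn_integral_insert[of "{..<n}" n f] assms
  by (simp add: gauss_vec_def lessThan_Suc)

lemma measurable_gauss_vec_upd:
  "(\<lambda>(x, y). x(n := y)) \<in> gauss_vec n \<Otimes>\<^sub>M std_normal \<rightarrow>\<^sub>M gauss_vec (Suc n)"
  using measurable_add_dim[of n "{..<n}" "\<lambda>_. std_normal"]
  by (simp add: gauss_vec_def lessThan_Suc)

text \<open>An orthogonal map, described by exactly the properties that are used: it preserves
  Gaussian integrals and inner products and fixes the first k coordinates. No matrix and no
  linearity appear.\<close>

definition gauss_isometry :: "nat \<Rightarrow> nat \<Rightarrow> ((nat \<Rightarrow> real) \<Rightarrow> nat \<Rightarrow> real) \<Rightarrow> bool" where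
  "gauss_isometry n k T \<longleftrightarrow>
     T \<in> gauss_vec n \<rightarrow>\<^sub>M gauss_vec n \<and>
     (\<forall>f\<in>borel_measurable (gauss_vec n). (\<integral>\<^sup>+x. f (T x) \<partial>gauss_vec n) = (\<integral>\<^sup>+x. f x \<partial>gauss_vec n)) \<and>
     (\<forall>x y. ip n (T x) (T y) = ip n x y) \<and>
     (\<forall>x. \<forall>i<k. T x i = x i)"

text \<open>Givens rotations: the induction on n kills the last coordinate of \<open>e\<close> by a
  rotation in the plane of coordinates k and n, after the earlier ones have been killed. The sign
  condition on coordinate k is carried along because it supplies the non-negative cosine required by
  \<open>nn_integral_std_normal_rotate\<close>.\<close>

lemma gauss_isometry_ex:
  assumes "k < n"
  shows "\<exists>T. gauss_isometry n k T \<and> (\<forall>i. k < i \<longrightarrow> i < n \<longrightarrow> T e i = 0) \<and> 0 \<le> T e k"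
  using assms
proof (induction n arbitrary: e)
  case 0
  then show ?case by simp
next
  case (Suc n)
  note upd [measurable] = measurable_gauss_vec_upd[of n]
  show ?case
  proof (cases "k = n")
    case True
    \<comment> \<open>Here coordinate k is the last one, so nothing has to be killed and only its
      sign is corrected.\<close>
    define c :: real where "c = (if e n < 0 then - 1 else 1)"
    define T where "T x = x(n := c * x n)" for x :: "nat \<Rightarrow> real"
    have T_meas: "T \<in> gauss_vec (Suc n) \<rightarrow>\<^sub>M gauss_vec (Suc n)"
    proof (rule measurable_gauss_vecI)
      fix i assume i: "i < Suc n"
      show "(\<lambda>w. T w i) \<in> borel_measurable (gauss_vec (Suc n))"
        using i by (cases "i = n") (auto simp: T_def intro: measurable_gauss_vec_component)
    qed (auto simp: T_def space_gauss_vec)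
    have "(\<integral>\<^sup>+x. f (T x) \<partial>gauss_vec (Suc n)) = (\<integral>\<^sup>+x. f x \<partial>gauss_vec (Suc n))"
      if f: "f \<in> borel_measurable (gauss_vec (Suc n))" for f
    proof -
      have "(\<integral>\<^sup>+x. f (T x) \<partial>gauss_vec (Suc n)) = (\<integral>\<^sup>+x. \<integral>\<^sup>+y. f (x(n := c * y)) \<partial>std_normal \<partial>gauss_vec n)"
        using measurable_compose[OF T_meas f] by (subst nn_integral_gauss_vec_Suc) (auto simp: T_def)
      also have "\<dots> = (\<integral>\<^sup>+x. \<integral>\<^sup>+y. f (x(n := y)) \<partial>std_normal \<partial>gauss_vec n)"
      proof (rule nn_integral_cong)
        fix x assume x: "x \<in> space (gauss_vec n)"
        have [measurable]: "(\<lambda>y. f (x(n := y))) \<in> borel_measurable borel"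
          using measurable_compose[OF measurable_Pair1'[OF x] measurable_compose[OF upd f]]
          by (simp add: measurable_cong_sets[OF sets_std_normal refl])
        show "(\<integral>\<^sup>+y. f (x(n := c * y)) \<partial>std_normal) = (\<integral>\<^sup>+y. f (x(n := y)) \<partial>std_normal)"
          using nn_integral_std_normal_uminus[of "\<lambda>y. f (x(n := y))"] by (auto simp: c_def)
      qed
      also have "\<dots> = (\<integral>\<^sup>+x. f x \<partial>gauss_vec (Suc n))"
        using f by (rule nn_integral_gauss_vec_Suc[symmetric])
      finally show ?thesis .
    qed
    moreover have "ip (Suc n) (T x) (T y) = ip (Suc n) x y" for x y
      by (auto simp: ip_def T_def c_def)
    ultimately have "gauss_isometry (Suc n) k T"
      using True T_meas by (auto simp: gauss_isometry_def T_def)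
    moreover have "0 \<le> T e n" by (auto simp: T_def c_def)
    ultimately show ?thesis unfolding True by (meson leD Suc_leI)
  next
    case False
    then have kn: "k < n" using Suc.prems by simp
    obtain T' where T': "gauss_isometry n k T'" "\<And>i. k < i \<Longrightarrow> i < n \<Longrightarrow> T' (restrict e {..<n}) i = 0"
      "0 \<le> T' (restrict e {..<n}) k" using Suc.IH[OF kn, of "restrict e {..<n}"] by blast
    define a where "a = T' (restrict e {..<n}) k"
    \<comment> \<open>The plane rotation with cosine \<open>c\<close> and sine \<open>s\<close>
      sends (a, e n) to (r, 0). If r = 0 both entries vanish already and the identity is
      taken.\<close>
    define r where "r = sqrt (a\<^sup>2 + (e n)\<^sup>2)"
    define c where "c = (if r = 0 then 1 else a / r)"
    define s where "s = (if r = 0 then 0 else - e n / r)"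
    have r2: "r\<^sup>2 = a\<^sup>2 + (e n)\<^sup>2" by (simp add: r_def)
    have cs: "c\<^sup>2 + s\<^sup>2 = 1"
      using r2 by (auto simp: c_def s_def power_divide add_divide_distrib[symmetric])
    have c0: "0 \<le> c" using T'(3) by (auto simp: c_def a_def r_def)
    have r0: "a = 0" "e n = 0" if "r = 0" using that r2 by (auto simp: sum_power2_eq_zero_iff)
    define R where "R = (\<lambda>(u, y). u(k := c * u k - s * y, n := s * u k + c * y))" 
    define T where "T x = R (T' (restrict x {..<n}), x n)" for x :: "nat \<Rightarrow> real"
    have T'_meas [measurable]: "T' \<in> gauss_vec n \<rightarrow>\<^sub>M gauss_vec n"
      and T'_inv: "f \<in> borel_measurable (gauss_vec n) \<Longrightarrow> (\<integral>\<^sup>+x. f (T' x) \<partial>gauss_vec n) = (\<integral>\<^sup>+x. f x \<partial>gauss_vec n)"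
      and T'_ip: "ip n (T' x) (T' y) = ip n x y" and T'_fix: "i < k \<Longrightarrow> T' x i = x i" for f x y i
      using T'(1) by (auto simp: gauss_isometry_def)
    have R_meas [measurable]: "R \<in> gauss_vec n \<Otimes>\<^sub>M std_normal \<rightarrow>\<^sub>M gauss_vec (Suc n)"
    proof (rule measurable_gauss_vecI)
      fix i assume i: "i < Suc n"
      have [measurable]: "(\<lambda>w. fst w k) \<in> borel_measurable (gauss_vec n \<Otimes>\<^sub>M std_normal)"
        using measurable_compose[OF measurable_fst measurable_gauss_vec_component[OF kn]] .
      have *: "i < n \<Longrightarrow> (\<lambda>w. fst w i) \<in> borel_measurable (gauss_vec n \<Otimes>\<^sub>M std_normal)"
        using measurable_compose[OF measurable_fst measurable_gauss_vec_component] .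
      consider "i = n" | "i = k" "i < n" | "i \<noteq> k" "i < n" using i by linarith
      then show "(\<lambda>w. R w i) \<in> borel_measurable (gauss_vec n \<Otimes>\<^sub>M std_normal)"
        using * kn by cases (auto simp: R_def split_beta)
    next
      fix w :: "(nat \<Rightarrow> real) \<times> real" and i
      assume w: "w \<in> space (gauss_vec n \<Otimes>\<^sub>M std_normal)" and i: "\<not> i < Suc n"
      have "fst w \<in> extensional {..<n}" using w by (auto simp: space_gauss_vec space_pair_measure PiE_def)
      then have "fst w i = undefined" using i by (auto simp: extensional_def)
      moreover have "R w i = fst w i" using kn i by (cases w) (simp add: R_def)
      ultimately show "R w i = undefined" by simp
    qed
    have split_meas [measurable]: "(\<lambda>x. (restrict x {..<n}, x n)) \<in> gauss_vec (Suc n) \<rightarrow>\<^sub>M gauss_vec n \<Otimes>\<^sub>M std_normal"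
    proof (rule measurable_Pair)
      show "(\<lambda>x. restrict x {..<n}) \<in> gauss_vec (Suc n) \<rightarrow>\<^sub>M gauss_vec n"
        by (rule measurable_gauss_vecI) (auto simp: measurable_gauss_vec_component)
      show "(\<lambda>x. x n) \<in> gauss_vec (Suc n) \<rightarrow>\<^sub>M std_normal"
        using measurable_gauss_vec_component[of n "Suc n"] by (simp add: measurable_cong_sets[OF refl sets_std_normal])
    qed
    have T_meas: "T \<in> gauss_vec (Suc n) \<rightarrow>\<^sub>M gauss_vec (Suc n)"
    proof -
      have "(\<lambda>x. R (T' (fst x), snd x)) \<in> gauss_vec n \<Otimes>\<^sub>M std_normal \<rightarrow>\<^sub>M gauss_vec (Suc n)"
        by measurable
      from measurable_compose[OF split_meas this] show ?thesis by (simp add: T_def[abs_def])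
    qed
    have inv: "(\<integral>\<^sup>+x. f (T x) \<partial>gauss_vec (Suc n)) = (\<integral>\<^sup>+x. f x \<partial>gauss_vec (Suc n))"
      if f [measurable]: "f \<in> borel_measurable (gauss_vec (Suc n))" for f
    proof -
      have sp: "restrict (x(n := y)) {..<n} = x" if "x \<in> space (gauss_vec n)" for x and y :: real
        using that by (auto simp: space_gauss_vec PiE_def extensional_def restrict_def fun_eq_iff)
      have sp': "restrict x {..<n} = x" if "x \<in> space (gauss_vec n)" for x :: "nat \<Rightarrow> real"
        using that by (auto simp: space_gauss_vec)
      have "(\<integral>\<^sup>+x. f (T x) \<partial>gauss_vec (Suc n)) = (\<integral>\<^sup>+x. \<integral>\<^sup>+y. f (R (T' x, y)) \<partial>std_normal \<partial>gauss_vec n)"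
        using measurable_compose[OF T_meas f]
        by (subst nn_integral_gauss_vec_Suc) (auto simp: T_def sp sp' intro!: nn_integral_cong)
      also have "\<dots> = (\<integral>\<^sup>+x. \<integral>\<^sup>+y. f (R (x, y)) \<partial>std_normal \<partial>gauss_vec n)"
        by (rule T'_inv) measurable
      also have "\<dots> = (\<integral>\<^sup>+x. \<integral>\<^sup>+y. f (x(n := y)) \<partial>std_normal \<partial>gauss_vec n)"
      proof -
        \<comment> \<open>All coordinates other than k and n are integrated last, so that the
          rotation acts on an inner integral over the plane.\<close>
        define J where "J = {..<n} - {k}"
        have J: "{..<n} = insert k J" "finite J" "k \<notin> J" using kn by (auto simp: J_def)
        have gJ: "gauss_vec n = PiM (insert k J) (\<lambda>_. std_normal)" by (simp add: gauss_vec_def J(1))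
        have m1: "(\<lambda>(x, y). x(k := y)) \<in> PiM J (\<lambda>_. std_normal) \<Otimes>\<^sub>M std_normal \<rightarrow>\<^sub>M gauss_vec n"
          unfolding gJ by (rule measurable_add_dim)
        have step: "(\<integral>\<^sup>+x. \<integral>\<^sup>+y. g (x, y) \<partial>std_normal \<partial>gauss_vec n) =
            (\<integral>\<^sup>+w. \<integral>\<^sup>+x. \<integral>\<^sup>+y. g (w(k := x), y) \<partial>std_normal \<partial>std_normal \<partial>PiM J (\<lambda>_. std_normal))"
          if [measurable]: "g \<in> borel_measurable (gauss_vec n \<Otimes>\<^sub>M std_normal)" for g
        proof -
          have "(\<lambda>x. \<integral>\<^sup>+y. g (x, y) \<partial>std_normal) \<in> borel_measurable (gauss_vec n)" by measurable
          then show ?thesis unfolding gJ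
            by (subst std_normals.product_nn_integral_insert[OF J(2,3)]) auto
        qed
        have fR [measurable]: "(\<lambda>x. f (R x)) \<in> borel_measurable (gauss_vec n \<Otimes>\<^sub>M std_normal)" by measurable
        have fU [measurable]: "(\<lambda>(x, y). f (x(n := y))) \<in> borel_measurable (gauss_vec n \<Otimes>\<^sub>M std_normal)"
          using measurable_compose[OF upd f] by (simp add: split_beta')
        have "(\<integral>\<^sup>+x. \<integral>\<^sup>+y. f (R (x, y)) \<partial>std_normal \<partial>gauss_vec n) =
            (\<integral>\<^sup>+w. \<integral>\<^sup>+x. \<integral>\<^sup>+y. f (R (w(k := x), y)) \<partial>std_normal \<partial>std_normal \<partial>PiM J (\<lambda>_. std_normal))"
          by (rule step) measurable
        also have "\<dots> = (\<integral>\<^sup>+w. \<integral>\<^sup>+x. \<integral>\<^sup>+y. f (w(k := x, n := y)) \<partial>std_normal \<partial>std_normal \<partial>PiM J (\<lambda>_. std_normal))"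
        proof (rule nn_integral_cong)
          fix w assume w: "w \<in> space (PiM J (\<lambda>_. std_normal))"
          let ?h = "\<lambda>(x, y). f (w(k := x, n := y))"
          have "(\<lambda>(x, y). (w(k := x), y)) \<in> std_normal \<Otimes>\<^sub>M std_normal \<rightarrow>\<^sub>M gauss_vec n \<Otimes>\<^sub>M std_normal"
          proof -
            have "(\<lambda>x. w(k := x)) \<in> std_normal \<rightarrow>\<^sub>M gauss_vec n"
              using measurable_compose[OF measurable_Pair1'[OF w, of std_normal] m1] by simp
            then show ?thesis by measurable
          qed
          from measurable_compose[OF this fU]
          have h: "?h \<in> borel_measurable (borel \<Otimes>\<^sub>M borel)"
            by (simp add: split_beta' measurable_cong_sets[OF sets_pair_measure_cong[OF sets_std_normal sets_std_normal] refl])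
          have "(\<integral>\<^sup>+x. \<integral>\<^sup>+y. f (R (w(k := x), y)) \<partial>std_normal \<partial>std_normal) = 
             (\<integral>\<^sup>+x. \<integral>\<^sup>+y. ?h (c * x - s * y, s * x + c * y) \<partial>std_normal \<partial>std_normal)"
            by (simp add: R_def)
          also have "\<dots> = (\<integral>\<^sup>+x. \<integral>\<^sup>+y. ?h (x, y) \<partial>std_normal \<partial>std_normal)"
            by (rule nn_integral_std_normal_rotate[OF h cs c0])
          finally show "(\<integral>\<^sup>+x. \<integral>\<^sup>+y. f (R (w(k := x), y)) \<partial>std_normal \<partial>std_normal) = 
            (\<integral>\<^sup>+x. \<integral>\<^sup>+y. f (w(k := x, n := y)) \<partial>std_normal \<partial>std_normal)" by simp
        qed
        also have "\<dots> = (\<integral>\<^sup>+x. \<integral>\<^sup>+y. f (x(n := y)) \<partial>std_normal \<partial>gauss_vec n)"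
          using step[OF fU] by simp
        finally show ?thesis .
      qed
      also have "\<dots> = (\<integral>\<^sup>+x. f x \<partial>gauss_vec (Suc n))"
        using f by (rule nn_integral_gauss_vec_Suc[symmetric])
      finally show ?thesis .
    qed
    have ipT: "ip (Suc n) (T x) (T y) = ip (Suc n) x y" for x y
    proof -
      let ?u = "T' (restrict x {..<n})" and ?v = "T' (restrict y {..<n})"
      have *: "(\<Sum>i<n. g i) = g k + (\<Sum>i\<in>{..<n} - {k}. g i)" for g :: "nat \<Rightarrow> real"
        using kn by (intro sum.remove) auto
      have "ip (Suc n) (T x) (T y) = (\<Sum>i\<in>{..<n} - {k}. ?u i * ?v i) +
          ((c * ?u k - s * x n) * (c * ?v k - s * y n) + (s * ?u k + c * x n) * (s * ?v k + c * y n))"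
        using kn by (simp add: ip_def * T_def R_def)
      also have "(c * ?u k - s * x n) * (c * ?v k - s * y n) + (s * ?u k + c * x n) * (s * ?v k + c * y n)
          = (c\<^sup>2 + s\<^sup>2) * (?u k * ?v k + x n * y n)"
        by (simp add: power2_eq_square algebra_simps)
      also have "\<dots> = ?u k * ?v k + x n * y n" using cs by simp
      finally have "ip (Suc n) (T x) (T y) = (\<Sum>i\<in>{..<n} - {k}. ?u i * ?v i) + (?u k * ?v k + x n * y n)" .
      moreover have "ip n ?u ?v = ?u k * ?v k + (\<Sum>i\<in>{..<n} - {k}. ?u i * ?v i)"
        unfolding ip_def by (rule *)
      ultimately have "ip (Suc n) (T x) (T y) = ip n ?u ?v + x n * y n" by linarith
      also have "ip n ?u ?v = ip n x y" unfolding T'_ip by (simp add: ip_def)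
      finally show ?thesis by (simp add: ip_def)
    qed
    have "gauss_isometry (Suc n) k T"
      using T_meas inv ipT T'_fix kn by (auto simp: gauss_isometry_def T_def R_def)
    moreover have "T e i = 0" if "k < i" "i < Suc n" for i
      using that T'(2)[of i] r0 kn
      by (cases "i = n") (auto simp: T_def R_def a_def[symmetric] c_def s_def)
    moreover have "0 \<le> T e k"
    proof (cases "r = 0")
      case False
      then have "0 < r" unfolding r_def by (simp add: less_le)
      have "T e k = (a\<^sup>2 + (e n)\<^sup>2) / r"
        using kn False by (simp add: T_def R_def a_def[symmetric] c_def s_def power2_eq_square add_divide_distrib)
      then show ?thesis using \<open>0 < r\<close> by simp
    qed (use r0 kn in \<open>auto simp: T_def R_def a_def[symmetric] c_def s_def\<close>)
    ultimately show ?thesis by blast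
  qed
qed


section \<open>Triangular form of three vectors; Gaussian laws determined by Gram matrices\<close>

lemma gauss_isometryD:
  assumes "gauss_isometry n k T"
  shows "T \<in> gauss_vec n \<rightarrow>\<^sub>M gauss_vec n"
    and "f \<in> borel_measurable (gauss_vec n) \<Longrightarrow> (\<integral>\<^sup>+x. f (T x) \<partial>gauss_vec n) = (\<integral>\<^sup>+x. f x \<partial>gauss_vec n)"
    and "ip n (T x) (T y) = ip n x y"
    and "i < k \<Longrightarrow> T x i = x i"
  using assms unfolding gauss_isometry_def by auto

text \<open>The squared norm splits into the fixed first k coordinates and the rest; as the norm is
  preserved, the rest keeps the sum of squares 0.\<close>

lemma gauss_isometry_fixes:
  assumes T: "gauss_isometry n k T" and x: "\<And>i. k \<le> i \<Longrightarrow> i < n \<Longrightarrow> x i = 0" and i: "i < n"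
  shows "T x i = x i"
proof (cases "i < k")
  case True
  then show ?thesis using gauss_isometryD(4)[OF T] by simp
next
  case False
  have ip2: "ip n y y = (\<Sum>j\<in>{..<n} \<inter> {..<k}. (y j)\<^sup>2) + (\<Sum>j\<in>{..<n} - {..<k}. (y j)\<^sup>2)" for y
    unfolding ip_def power2_eq_square by (subst sum.Int_Diff[of _ _ "{..<k}"]) auto
  have "(\<Sum>j\<in>{..<n} - {..<k}. (T x j)\<^sup>2) = (\<Sum>j\<in>{..<n} - {..<k}. (x j)\<^sup>2)"
    using gauss_isometryD(3)[OF T, of x x] gauss_isometryD(4)[OF T, of _ x] unfolding ip2 by simp
  also have "\<dots> = 0" using x by (intro sum.neutral) auto
  finally have "\<forall>j\<in>{..<n} - {..<k}. (T x j)\<^sup>2 = 0"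
    by (subst (asm) sum_nonneg_eq_0_iff) auto
  then show ?thesis using False i x[of i] by auto
qed

lemma gauss_isometry_mono: "gauss_isometry n k T \<Longrightarrow> j \<le> k \<Longrightarrow> gauss_isometry n j T"
  unfolding gauss_isometry_def by auto

lemma gauss_isometry_comp:
  assumes S: "gauss_isometry n k S" and T: "gauss_isometry n k T"
  shows "gauss_isometry n k (\<lambda>x. S (T x))"
  unfolding gauss_isometry_def
proof (intro conjI ballI allI impI)
  show "(\<lambda>x. S (T x)) \<in> gauss_vec n \<rightarrow>\<^sub>M gauss_vec n"
    by (rule measurable_compose[OF gauss_isometryD(1)[OF T] gauss_isometryD(1)[OF S]])
  fix f :: "(nat \<Rightarrow> real) \<Rightarrow> ennreal" assume f: "f \<in> borel_measurable (gauss_vec n)"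
  have "(\<integral>\<^sup>+x. f (S (T x)) \<partial>gauss_vec n) = (\<integral>\<^sup>+x. f (S x) \<partial>gauss_vec n)"
    by (rule gauss_isometryD(2)[OF T measurable_compose[OF gauss_isometryD(1)[OF S] f]])
  also have "\<dots> = (\<integral>\<^sup>+x. f x \<partial>gauss_vec n)" by (rule gauss_isometryD(2)[OF S f])
  finally show "(\<integral>\<^sup>+x. f (S (T x)) \<partial>gauss_vec n) = (\<integral>\<^sup>+x. f x \<partial>gauss_vec n)" .
qed (simp_all add: gauss_isometryD[OF S] gauss_isometryD[OF T])

text \<open>QR decomposition of three vectors. The maps for k = 1 and k = 2 do not disturb the
  vectors already reduced, because these are supported on the coordinates that the later maps
  fix.\<close>

lemma gauss_isometry_triangular:
  assumes n: "3 \<le> n"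
  shows "\<exists>T. gauss_isometry n 0 T \<and> (\<forall>j<3. (\<forall>i. j < i \<longrightarrow> i < n \<longrightarrow> T (r j) i = 0) \<and> 0 \<le> T (r j) j)"
proof -
  obtain T0 where T0: "gauss_isometry n 0 T0" "\<And>i. 0 < i \<Longrightarrow> i < n \<Longrightarrow> T0 (r 0) i = 0" "0 \<le> T0 (r 0) 0"
    using gauss_isometry_ex[of 0 n "r 0"] n by auto
  obtain T1 where T1: "gauss_isometry n 1 T1" "\<And>i. 1 < i \<Longrightarrow> i < n \<Longrightarrow> T1 (T0 (r 1)) i = 0" "0 \<le> T1 (T0 (r 1)) 1"
    using gauss_isometry_ex[of 1 n "T0 (r 1)"] n by auto
  obtain T2 where T2: "gauss_isometry n 2 T2" "\<And>i. 2 < i \<Longrightarrow> i < n \<Longrightarrow> T2 (T1 (T0 (r 2))) i = 0" "0 \<le> T2 (T1 (T0 (r 2))) 2"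
    using gauss_isometry_ex[of 2 n "T1 (T0 (r 2))"] n by auto
  define T where "T x = T2 (T1 (T0 x))" for x
  have 1: "T1 (T0 (r 0)) i = T0 (r 0) i" if "i < n" for i
    using gauss_isometry_fixes[OF T1(1)] T0(2) that by simp
  have 0: "T (r 0) i = T0 (r 0) i" if "i < n" for i
    unfolding T_def using gauss_isometry_fixes[OF T2(1), of "T1 (T0 (r 0))" i] 1 T0(2) that by simp
  have 2: "T (r 1) i = T1 (T0 (r 1)) i" if "i < n" for i
    unfolding T_def using gauss_isometry_fixes[OF T2(1)] T1(2) that by simp
  have "gauss_isometry n 0 T" unfolding T_def
    using gauss_isometry_comp[OF gauss_isometry_mono[OF T2(1)] gauss_isometry_comp[OF gauss_isometry_mono[OF T1(1)] T0(1)]]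
    by simp
  moreover have "(\<forall>i. j < i \<longrightarrow> i < n \<longrightarrow> T (r j) i = 0) \<and> 0 \<le> T (r j) j" if "j < 3" for j :: nat
  proof -
    have "(\<forall>i. 0 < i \<longrightarrow> i < n \<longrightarrow> T (r 0) i = 0) \<and> 0 \<le> T (r 0) 0" using 0 T0(2,3) n by simp
    moreover have "(\<forall>i. 1 < i \<longrightarrow> i < n \<longrightarrow> T (r 1) i = 0) \<and> 0 \<le> T (r 1) 1" using 2 T1(2,3) n by simp
    moreover have "(\<forall>i. 2 < i \<longrightarrow> i < n \<longrightarrow> T (r 2) i = 0) \<and> 0 \<le> T (r 2) 2" using T2(2,3) by (simp add: T_def)
    moreover have "j = 0 \<or> j = 1 \<or> j = 2" using \<open>j < 3\<close> by linarith
    ultimately show ?thesis by metis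
  qed
  ultimately show ?thesis by blast
qed

text \<open>Uniqueness of the Cholesky factor, entry by entry. Diagonal entries are non-negative
  square roots; the entries below them are found by dividing by the first two diagonal entries,
  which the two strict inequalities in \<open>pd\<close> keep nonzero.\<close>

lemma triangular_unique:
  fixes r s :: "nat \<Rightarrow> nat \<Rightarrow> real"
  assumes n: "3 \<le> n"
    and r: "\<And>j i. j < 3 \<Longrightarrow> j < i \<Longrightarrow> i < n \<Longrightarrow> r j i = 0" "\<And>j. j < 3 \<Longrightarrow> 0 \<le> r j j"
    and s: "\<And>j i. j < 3 \<Longrightarrow> j < i \<Longrightarrow> i < n \<Longrightarrow> s j i = 0" "\<And>j. j < 3 \<Longrightarrow> 0 \<le> s j j"
    and eq: "\<And>i j. i < 3 \<Longrightarrow> j < 3 \<Longrightarrow> ip n (r i) (r j) = ip n (s i) (s j)"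
    and pd: "0 < ip n (r 0) (r 0)" "(ip n (r 0) (r 1))\<^sup>2 < ip n (r 0) (r 0) * ip n (r 1) (r 1)"
    and ji: "j < 3" "i < n"
  shows "r j i = s j i"
proof -
  have ip3: "ip n x y = x 0 * y 0 + x 1 * y 1 + x 2 * y 2" if "\<And>i. 2 < i \<Longrightarrow> i < n \<Longrightarrow> x i = 0" for x y
  proof -
    have "ip n x y = (\<Sum>i<3. x i * y i)" unfolding ip_def
      using n that by (intro sum.mono_neutral_right) auto
    then show ?thesis by (simp add: eval_nat_numeral)
  qed
  have r3: "ip n (r j) y = r j 0 * y 0 + r j 1 * y 1 + r j 2 * y 2" if "j < 3" for j y
    using r(1)[OF that] that by (intro ip3) auto
  have s3: "ip n (s j) y = s j 0 * y 0 + s j 1 * y 1 + s j 2 * y 2" if "j < 3" for j y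
    using s(1)[OF that] that by (intro ip3) auto
  have z: "r 0 1 = 0" "r 0 2 = 0" "r 1 2 = 0" "s 0 1 = 0" "s 0 2 = 0" "s 1 2 = 0"
    using r(1)[of 0 1] r(1)[of 0 2] r(1)[of 1 2] s(1)[of 0 1] s(1)[of 0 2] s(1)[of 1 2] n by simp_all
  note z = z z[unfolded One_nat_def]
  have sq: "x = y" if "x * x = y * y" "0 \<le> x" "0 \<le> y" for x y :: real
    by (rule power2_eq_imp_eq[of x y]) (use that in \<open>simp_all add: power2_eq_square\<close>)
  have nn: "0 \<le> r 0 0" "0 \<le> r 1 1" "0 \<le> r 2 2" "0 \<le> s 0 0" "0 \<le> s 1 1" "0 \<le> s 2 2"
    using r(2)[of 0] r(2)[of 1] r(2)[of 2] s(2)[of 0] s(2)[of 1] s(2)[of 2] by simp_all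
  have e00: "r 0 0 * r 0 0 = s 0 0 * s 0 0" using eq[of 0 0] by (simp add: r3 s3 z)
  then have a: "r 0 0 = s 0 0" using nn by (auto intro: sq)
  have a0: "0 < s 0 0" using pd(1) nn a by (auto simp: r3 z less_le)
  have b: "r 1 0 = s 1 0" using eq[of 0 1] a a0 by (simp add: r3 s3 z)
  have "r 1 1 * r 1 1 = s 1 1 * s 1 1" using eq[of 1 1] b by (simp add: r3 s3 z)
  then have c: "r 1 1 = s 1 1" using nn by (auto intro: sq)
  have "r 1 1 \<noteq> 0" using pd(2) by (auto simp: r3 z power2_eq_square)
  then have c0: "s 1 1 \<noteq> 0" using c by simp
  have d: "r 2 0 = s 2 0" using eq[of 0 2] a a0 by (simp add: r3 s3 z)
  have e: "r 2 1 = s 2 1" using eq[of 1 2] b c c0 d by (simp add: r3 s3 z)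
  have "r 2 2 * r 2 2 = s 2 2 * s 2 2" using eq[of 2 2] d e by (simp add: r3 s3 z)
  then have f: "r 2 2 = s 2 2" using nn by (auto intro: sq)
  have j: "j = 0 \<or> j = 1 \<or> j = 2" using ji by linarith
  show ?thesis
  proof (cases "i < 3")
    case True
    then have "i = 0 \<or> i = 1 \<or> i = 2" by linarith
    then show ?thesis using j by (elim disjE) (simp_all add: a b c d e f z b[unfolded One_nat_def] c[unfolded One_nat_def] e[unfolded One_nat_def])
  next
    case False
    then show ?thesis using r(1)[of j i] s(1)[of j i] ji by simp
  qed
qed

text \<open>Both families are rotated into triangular form, which preserves the Gaussian probability
  of the event. Equal Gram matrices have equal triangular forms, so the two events coincide after
  rotation. This makes the law of a Gaussian vector independent of the chosen factor of its
  covariance matrix.\<close>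

lemma emeasure_gauss_vec_gram:
  fixes r s :: "nat \<Rightarrow> nat \<Rightarrow> real"
  assumes n: "3 \<le> n"
    and eq: "\<And>i j. i < 3 \<Longrightarrow> j < 3 \<Longrightarrow> ip n (r i) (r j) = ip n (s i) (s j)"
    and pd: "0 < ip n (r 0) (r 0)" "(ip n (r 0) (r 1))\<^sup>2 < ip n (r 0) (r 0) * ip n (r 1) (r 1)"
  shows "emeasure (gauss_vec n) {g \<in> space (gauss_vec n). \<forall>j<3. ip n (r j) g \<le> z j} =
    emeasure (gauss_vec n) {g \<in> space (gauss_vec n). \<forall>j<3. ip n (s j) g \<le> z j}"
proof -
  have ip_m [measurable]: "(\<lambda>g. ip n x g) \<in> borel_measurable (gauss_vec n)" for x
    unfolding ip_def by measurable
  have inv: "emeasure (gauss_vec n) {g \<in> space (gauss_vec n). \<forall>j<3. ip n (T (r j)) g \<le> z j} =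
    emeasure (gauss_vec n) {g \<in> space (gauss_vec n). \<forall>j<3. ip n (r j) g \<le> z j}"
    if T: "gauss_isometry n 0 T" for T and r :: "nat \<Rightarrow> nat \<Rightarrow> real"
  proof -
    have Ts: "g \<in> space (gauss_vec n) \<Longrightarrow> T g \<in> space (gauss_vec n)" for g
      using measurable_space[OF gauss_isometryD(1)[OF T]] .
    have ms [measurable]: "{g \<in> space (gauss_vec n). \<forall>j<3. ip n (r j) g \<le> z j} \<in> sets (gauss_vec n)" for r :: "nat \<Rightarrow> nat \<Rightarrow> real"
      by measurable
    have "emeasure (gauss_vec n) {g \<in> space (gauss_vec n). \<forall>j<3. ip n (T (r j)) g \<le> z j} =
      (\<integral>\<^sup>+g. indicator {g \<in> space (gauss_vec n). \<forall>j<3. ip n (T (r j)) g \<le> z j} g \<partial>gauss_vec n)"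
      by simp
    also have "\<dots> = (\<integral>\<^sup>+g. indicator {g \<in> space (gauss_vec n). \<forall>j<3. ip n (T (r j)) g \<le> z j} (T g) \<partial>gauss_vec n)"
      by (rule gauss_isometryD(2)[OF T, symmetric]) measurable
    also have "\<dots> = (\<integral>\<^sup>+g. indicator {g \<in> space (gauss_vec n). \<forall>j<3. ip n (r j) g \<le> z j} g \<partial>gauss_vec n)"
      by (intro nn_integral_cong) (auto simp: indicator_def gauss_isometryD(3)[OF T] Ts)
    finally show ?thesis by simp
  qed
  obtain S where S: "gauss_isometry n 0 S" "\<And>j i. j < 3 \<Longrightarrow> j < i \<Longrightarrow> i < n \<Longrightarrow> S (r j) i = 0" "\<And>j. j < 3 \<Longrightarrow> 0 \<le> S (r j) j"
    using gauss_isometry_triangular[OF n, of r] by blast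
  obtain T where T: "gauss_isometry n 0 T" "\<And>j i. j < 3 \<Longrightarrow> j < i \<Longrightarrow> i < n \<Longrightarrow> T (s j) i = 0" "\<And>j. j < 3 \<Longrightarrow> 0 \<le> T (s j) j"
    using gauss_isometry_triangular[OF n, of s] by blast
  have "S (r j) i = T (s j) i" if "j < 3" "i < n" for j i
  proof (rule triangular_unique[OF n, of "\<lambda>j. S (r j)" "\<lambda>j. T (s j)"])
    show "ip n (S (r i)) (S (r j)) = ip n (T (s i)) (T (s j))" if "i < 3" "j < 3" for i j
      using eq that by (simp add: gauss_isometryD(3)[OF S(1)] gauss_isometryD(3)[OF T(1)])
    show "0 < ip n (S (r 0)) (S (r 0))"
        "(ip n (S (r 0)) (S (r 1)))\<^sup>2 < ip n (S (r 0)) (S (r 0)) * ip n (S (r 1)) (S (r 1))"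
      using pd by (simp_all only: gauss_isometryD(3)[OF S(1)])
  qed (use that S(2,3) T(2,3) in \<open>blast+\<close>)
  then have "ip n (S (r j)) g = ip n (T (s j)) g" if "j < 3" for j g
    using that by (simp add: ip_def)
  then show ?thesis using inv[OF S(1), of r] inv[OF T(1), of s] by simp
qed


section \<open>Joint law of the inner products of Gaussian vectors\<close>

lemma measurable_PiM_std_normal_component:
  "i \<in> I \<Longrightarrow> (\<lambda>x. x i) \<in> borel_measurable (PiM I (\<lambda>_. std_normal))"
  using measurable_component_singleton[of i I "\<lambda>_. std_normal"] by (simp add: measurable_cong_sets[OF refl sets_std_normal])

lemma measurable_PiM_std_normal_norm:
  "J \<subseteq> I \<Longrightarrow> (\<lambda>x. sqrt (\<Sum>i\<in>J. (x i)\<^sup>2)) \<in> borel_measurable (PiM I (\<lambda>_. std_normal))"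
  by (rule measurable_compose[OF _ borel_measurable_sqrt],
      intro borel_measurable_sum borel_measurable_power measurable_PiM_std_normal_component) auto

lemma distr_norm_std_normal:
  assumes "finite I" "I \<noteq> {}"
  shows "distr (PiM I (\<lambda>_. std_normal)) borel (\<lambda>x. sqrt (\<Sum>i\<in>I. (x i)\<^sup>2)) = chi (card I)"
proof (rule measure_eqI)
  fix A assume "A \<in> sets (distr (PiM I (\<lambda>_. std_normal)) borel (\<lambda>x. sqrt (\<Sum>i\<in>I. (x i)\<^sup>2)))"
  then have A [measurable]: "A \<in> sets borel" by simp
  have "emeasure (distr (PiM I (\<lambda>_. std_normal)) borel (\<lambda>x. sqrt (\<Sum>i\<in>I. (x i)\<^sup>2))) A =
    (\<integral>\<^sup>+r. indicator A r \<partial>distr (PiM I (\<lambda>_. std_normal)) borel (\<lambda>x. sqrt (\<Sum>i\<in>I. (x i)\<^sup>2)))"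
    by (subst nn_integral_indicator) auto
  also have "\<dots> = (\<integral>\<^sup>+x. indicator A (sqrt (\<Sum>i\<in>I. (x i)\<^sup>2)) \<partial>PiM I (\<lambda>_. std_normal))"
    by (subst nn_integral_distr) (auto intro: measurable_PiM_std_normal_norm)
  also have "\<dots> = (\<integral>\<^sup>+r. indicator A r \<partial>chi (card I))"
    by (rule nn_integral_norm_std_normal[OF assms]) auto
  also have "\<dots> = emeasure (chi (card I)) A" by (subst nn_integral_indicator) auto
  finally show "emeasure (distr (PiM I (\<lambda>_. std_normal)) borel (\<lambda>x. sqrt (\<Sum>i\<in>I. (x i)\<^sup>2))) A = emeasure (chi (card I)) A" .
qed simp

lemma prob_space_chi: "prob_space (chi m)"
proof -
  \<comment> \<open>Truncated subtraction gives both densities the exponent 0, so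
    \<open>chi 0\<close> is \<open>chi 1\<close> and the family consists of probability measures
    without exception.\<close>
  have "chi_dens 0 = chi_dens 1" by (rule ext) (simp add: chi_dens_def)
  then have "chi m = chi (max 1 m)" by (cases m) (simp_all add: chi_def chi_const_def)
  also have "\<dots> = distr (PiM {..<max 1 m} (\<lambda>_. std_normal)) borel (\<lambda>x. sqrt (\<Sum>i<max 1 m. (x i)\<^sup>2))"
    by (subst distr_norm_std_normal) (simp_all add: lessThan_empty_iff)
  finally show ?thesis
    using std_normals.prob_space_distr[OF measurable_PiM_std_normal_norm[OF order.refl, of "{..<max 1 m}"]] by simp
qed

interpretation chi: prob_space "chi m" for m
  by (rule prob_space_chi)

lemma measurable_ip_right [measurable]: "(\<lambda>g. ip n x g) \<in> borel_measurable (gauss_vec n)"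
  unfolding ip_def by measurable

lemma ip_commute: "ip n x y = ip n y x"
  by (simp add: ip_def mult.commute)

lemma nn_integral_gauss_vec_norm:
  assumes "0 < n" and [measurable]: "h \<in> borel_measurable borel"
  shows "(\<integral>\<^sup>+x. h (sqrt (ip n x x)) \<partial>gauss_vec n) = (\<integral>\<^sup>+r. h r \<partial>chi n)"
  using nn_integral_norm_std_normal[of "{..<n}" h] assms by (auto simp: gauss_vec_def ip_def power2_eq_square)

lemma nn_integral_gauss_vec_split1:
  fixes f :: "real \<times> real \<Rightarrow> ennreal"
  assumes n: "2 \<le> n" and [measurable]: "f \<in> borel_measurable borel"
  shows "(\<integral>\<^sup>+x. f (x 0, sqrt (\<Sum>i\<in>{1..<n}. (x i)\<^sup>2)) \<partial>gauss_vec n) = (\<integral>\<^sup>+a. \<integral>\<^sup>+r. f (a, r) \<partial>chi (n - 1) \<partial>std_normal)"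
proof -
  have I: "{..<n} = insert 0 {1..<n}" using n by auto
  have ins: "integral\<^sup>N (PiM (insert 0 {1..<n}) (\<lambda>_. std_normal)) g = (\<integral>\<^sup>+a. \<integral>\<^sup>+x. g (x(0 := a)) \<partial>PiM {1..<n} (\<lambda>_. std_normal) \<partial>std_normal)"
    if "g \<in> borel_measurable (PiM (insert 0 {1..<n}) (\<lambda>_. std_normal))" for g
    using that by (intro std_normals.product_nn_integral_insert_rev) auto
  have "(\<integral>\<^sup>+x. f (x 0, sqrt (\<Sum>i\<in>{1..<n}. (x i)\<^sup>2)) \<partial>gauss_vec n) =
    (\<integral>\<^sup>+a. \<integral>\<^sup>+x. f (a, sqrt (\<Sum>i\<in>{1..<n}. (x i)\<^sup>2)) \<partial>PiM {1..<n} (\<lambda>_. std_normal) \<partial>std_normal)"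
    unfolding gauss_vec_def I
    apply (subst ins)
    subgoal
      by (rule measurable_compose[of _ _ borel], rule borel_measurable_Pair)
        (auto intro!: measurable_PiM_std_normal_norm measurable_PiM_std_normal_component)
    by (intro nn_integral_cong arg_cong[where f=f]) auto
  also have "\<dots> = (\<integral>\<^sup>+a. \<integral>\<^sup>+r. f (a, r) \<partial>chi (n - 1) \<partial>std_normal)"
    using n by (intro nn_integral_cong, subst nn_integral_norm_std_normal) auto
  finally show ?thesis .
qed

lemma nn_integral_gauss_vec_split2:
  fixes f :: "real \<times> real \<times> real \<Rightarrow> ennreal"
  assumes n: "3 \<le> n" and [measurable]: "f \<in> borel_measurable borel"
  shows "(\<integral>\<^sup>+x. f (x 0, x 1, sqrt (\<Sum>i\<in>{2..<n}. (x i)\<^sup>2)) \<partial>gauss_vec n) =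
    (\<integral>\<^sup>+a. \<integral>\<^sup>+b. \<integral>\<^sup>+r. f (a, b, r) \<partial>chi (n - 2) \<partial>std_normal \<partial>std_normal)"
proof -
  have I: "{..<n} = insert 0 {1..<n}" "{1..<n} = insert 1 {2..<n}" using n by auto
  have ins: "integral\<^sup>N (PiM (insert 0 {1..<n}) (\<lambda>_. std_normal)) g = (\<integral>\<^sup>+a. \<integral>\<^sup>+x. g (x(0 := a)) \<partial>PiM {1..<n} (\<lambda>_. std_normal) \<partial>std_normal)"
    if "g \<in> borel_measurable (PiM (insert 0 {1..<n}) (\<lambda>_. std_normal))" for g
    using that by (intro std_normals.product_nn_integral_insert_rev) auto
  have ins2: "integral\<^sup>N (PiM (insert 1 {2..<n}) (\<lambda>_. std_normal)) g = (\<integral>\<^sup>+a. \<integral>\<^sup>+x. g (x(1 := a)) \<partial>PiM {2..<n} (\<lambda>_. std_normal) \<partial>std_normal)"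
    if "g \<in> borel_measurable (PiM (insert 1 {2..<n}) (\<lambda>_. std_normal))" for g
    using that by (intro std_normals.product_nn_integral_insert_rev) auto
  have "(\<integral>\<^sup>+x. f (x 0, x 1, sqrt (\<Sum>i\<in>{2..<n}. (x i)\<^sup>2)) \<partial>gauss_vec n) =
    (\<integral>\<^sup>+a. \<integral>\<^sup>+x. f (a, x 1, sqrt (\<Sum>i\<in>{2..<n}. (x i)\<^sup>2)) \<partial>PiM {1..<n} (\<lambda>_. std_normal) \<partial>std_normal)"
    unfolding gauss_vec_def I(1)
    apply (subst ins)
    subgoal
      by (rule measurable_compose[of _ _ borel], rule borel_measurable_Pair, rule measurable_PiM_std_normal_component, simp, rule borel_measurable_Pair)
        (use n in \<open>auto intro!: measurable_PiM_std_normal_norm measurable_PiM_std_normal_component\<close>)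
    by (intro nn_integral_cong arg_cong[where f=f]) auto
  also have "\<dots> = (\<integral>\<^sup>+a. \<integral>\<^sup>+b. \<integral>\<^sup>+x. f (a, b, sqrt (\<Sum>i\<in>{2..<n}. (x i)\<^sup>2)) \<partial>PiM {2..<n} (\<lambda>_. std_normal) \<partial>std_normal \<partial>std_normal)"
  proof (rule nn_integral_cong)
    fix a :: real
    show "(\<integral>\<^sup>+x. f (a, x 1, sqrt (\<Sum>i\<in>{2..<n}. (x i)\<^sup>2)) \<partial>PiM {1..<n} (\<lambda>_. std_normal)) =
      (\<integral>\<^sup>+b. \<integral>\<^sup>+x. f (a, b, sqrt (\<Sum>i\<in>{2..<n}. (x i)\<^sup>2)) \<partial>PiM {2..<n} (\<lambda>_. std_normal) \<partial>std_normal)"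
      unfolding I(2)
      apply (subst ins2)
      subgoal
        by (rule measurable_compose[of _ _ borel], rule borel_measurable_Pair, simp, rule borel_measurable_Pair)
          (use n in \<open>auto intro!: measurable_PiM_std_normal_norm measurable_PiM_std_normal_component\<close>)
      by (intro nn_integral_cong arg_cong[where f=f]) auto
  qed
  also have "\<dots> = (\<integral>\<^sup>+a. \<integral>\<^sup>+b. \<integral>\<^sup>+r. f (a, b, r) \<partial>chi (n - 2) \<partial>std_normal \<partial>std_normal)"
    using n by (intro nn_integral_cong, subst nn_integral_norm_std_normal) auto
  finally show ?thesis .
qed

lemma ip_split1: "0 < n \<Longrightarrow> ip n x x = (x 0)\<^sup>2 + (sqrt (\<Sum>i\<in>{1..<n}. (x i)\<^sup>2))\<^sup>2"
proof -
  assume n: "0 < n"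
  then have "{..<n} = insert 0 {1..<n}" by auto
  then show ?thesis by (simp add: ip_def power2_eq_square[symmetric] sum_nonneg)
qed

lemma ip_split2: "2 \<le> n \<Longrightarrow> ip n x x = (x 0)\<^sup>2 + (x 1)\<^sup>2 + (sqrt (\<Sum>i\<in>{2..<n}. (x i)\<^sup>2))\<^sup>2"
proof -
  assume n: "2 \<le> n"
  then have "{..<n} = insert 0 (insert 1 {2..<n})" by auto
  then show ?thesis by (simp add: ip_def power2_eq_square[symmetric] sum_nonneg)
qed

lemma ip_axis0: "0 < n \<Longrightarrow> (\<And>i. 0 < i \<Longrightarrow> i < n \<Longrightarrow> y i = 0) \<Longrightarrow> ip n x y = x 0 * y 0"
proof -
  assume n: "0 < n" and y: "\<And>i. 0 < i \<Longrightarrow> i < n \<Longrightarrow> y i = 0"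
  have "ip n x y = (\<Sum>i\<in>{0}. x i * y i)" unfolding ip_def using n y by (intro sum.mono_neutral_right) auto
  then show ?thesis by simp
qed

lemma ip_axis1: "1 < n \<Longrightarrow> (\<And>i. 1 < i \<Longrightarrow> i < n \<Longrightarrow> y i = 0) \<Longrightarrow> ip n x y = x 0 * y 0 + x 1 * y 1"
proof -
  assume n: "1 < n" and y: "\<And>i. 1 < i \<Longrightarrow> i < n \<Longrightarrow> y i = 0"
  have "ip n x y = (\<Sum>i\<in>{0, 1}. x i * y i)" unfolding ip_def
  proof (rule sum.mono_neutral_right)
    show "\<forall>i\<in>{..<n} - {0, 1}. x i * y i = 0" using y by (metis Diff_iff One_nat_def Suc_lessI insertCI lessThan_iff mult_zero_right neq0_conv)
  qed (use n in auto)
  then show ?thesis by simp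
qed

lemma gauss_isometry_axis:
  assumes "0 < n"
  obtains T where "gauss_isometry n 0 T" "\<And>x. ip n x (T z) = sqrt (ip n z z) * x 0"
proof -
  obtain T where T: "gauss_isometry n 0 T" "\<forall>i. 0 < i \<longrightarrow> i < n \<longrightarrow> T z i = 0" "0 \<le> T z 0"
    using gauss_isometry_ex[OF assms, of z] by blast
  have a: "ip n x (T z) = x 0 * T z 0" for x
    using ip_axis0[OF assms, of "T z"] T(2) by simp
  have "ip n z z = (T z 0)\<^sup>2" using a[of "T z"] gauss_isometryD(3)[OF T(1), of z z] by (simp add: power2_eq_square)
  then have "sqrt (ip n z z) = T z 0" using T(3) by simp
  then show ?thesis using a T(1) by (intro that[of T]) (simp_all add: mult.commute)
qed

text \<open>Rotating \<open>z\<close> onto the first axis leaves the first coordinate a of x and the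
  norm r of its remaining coordinates, which are independent.\<close>

lemma nn_integral_gauss_vec_gram1:
  fixes f :: "real \<times> real \<Rightarrow> ennreal"
  assumes n: "2 \<le> n" and [measurable]: "f \<in> borel_measurable borel"
  shows "(\<integral>\<^sup>+x. f (ip n x z, ip n x x) \<partial>gauss_vec n) =
    (\<integral>\<^sup>+a. \<integral>\<^sup>+r. f (sqrt (ip n z z) * a, a\<^sup>2 + r\<^sup>2) \<partial>chi (n - 1) \<partial>std_normal)"
proof -
  have n0: "0 < n" using n by simp
  obtain T where T: "gauss_isometry n 0 T" "\<And>x. ip n x (T z) = sqrt (ip n z z) * x 0"
    using gauss_isometry_axis[OF n0] by blast
  have [measurable]: "(\<lambda>g. ip n g (T z)) \<in> borel_measurable (gauss_vec n)" "(\<lambda>g. ip n g g) \<in> borel_measurable (gauss_vec n)"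
    by (subst ip_commute) measurable
  have "(\<integral>\<^sup>+x. f (ip n x z, ip n x x) \<partial>gauss_vec n) = (\<integral>\<^sup>+x. f (ip n (T x) (T z), ip n (T x) (T x)) \<partial>gauss_vec n)"
    by (simp add: gauss_isometryD(3)[OF T(1)])
  also have "\<dots> = (\<integral>\<^sup>+x. f (ip n x (T z), ip n x x) \<partial>gauss_vec n)"
    by (rule gauss_isometryD(2)[OF T(1)]) measurable
  also have "\<dots> = (\<integral>\<^sup>+x. (\<lambda>(a, r). f (sqrt (ip n z z) * a, a\<^sup>2 + r\<^sup>2)) (x 0, sqrt (\<Sum>i\<in>{1..<n}. (x i)\<^sup>2)) \<partial>gauss_vec n)"
    by (simp only: T(2) ip_split1[OF n0] split)
  also have "\<dots> = (\<integral>\<^sup>+a. \<integral>\<^sup>+r. f (sqrt (ip n z z) * a, a\<^sup>2 + r\<^sup>2) \<partial>chi (n - 1) \<partial>std_normal)"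
    by (subst nn_integral_gauss_vec_split1[OF n]) (auto simp: borel_prod[symmetric])
  finally show ?thesis .
qed

text \<open>First \<open>z\<close> is rotated onto axis 0; then, for each x, the tail of x is
  rotated onto axis 1. In these coordinates x = (a, r) and y = (b, g, tail of norm t), whence the
  inner product a b + r g. All five variables are independent, with r and t chi distributed.\<close>

lemma nn_integral_gauss_vec_gram2:
  fixes f :: "real \<times> real \<times> real \<times> real \<times> real \<Rightarrow> ennreal"
  assumes n: "3 \<le> n" and [measurable]: "f \<in> borel_measurable borel"
  shows "(\<integral>\<^sup>+x. \<integral>\<^sup>+y. f (ip n x z, ip n y z, ip n x y, ip n x x, ip n y y) \<partial>gauss_vec n \<partial>gauss_vec n) =
    (\<integral>\<^sup>+a. \<integral>\<^sup>+r. \<integral>\<^sup>+b. \<integral>\<^sup>+g. \<integral>\<^sup>+t. f (sqrt (ip n z z) * a, sqrt (ip n z z) * b, a * b + r * g, a\<^sup>2 + r\<^sup>2, b\<^sup>2 + g\<^sup>2 + t\<^sup>2)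
       \<partial>chi (n - 2) \<partial>std_normal \<partial>std_normal \<partial>chi (n - 1) \<partial>std_normal)"
proof -
  define q where "q = sqrt (ip n z z)"
  have n0: "0 < n" "1 < n" "2 \<le> n" using n by auto
  obtain T where T: "gauss_isometry n 0 T" "\<And>x. ip n x (T z) = q * x 0"
    using gauss_isometry_axis[OF n0(1), of z] unfolding q_def by blast
  have Tm [measurable]: "T \<in> gauss_vec n \<rightarrow>\<^sub>M gauss_vec n" by (rule gauss_isometryD(1)[OF T(1)])
  have c0 [measurable]: "(\<lambda>x. x 0) \<in> borel_measurable (gauss_vec n)" and c1 [measurable]: "(\<lambda>x. x 1) \<in> borel_measurable (gauss_vec n)"
    using n by (auto intro: measurable_gauss_vec_component)
  have c0f [measurable]: "(\<lambda>x. fst x 0) \<in> borel_measurable (gauss_vec n \<Otimes>\<^sub>M gauss_vec n)"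
     "(\<lambda>x. snd x 0) \<in> borel_measurable (gauss_vec n \<Otimes>\<^sub>M gauss_vec n)"
    using measurable_compose[OF measurable_fst c0] measurable_compose[OF measurable_snd c0] by auto
  have gm [measurable]: "(\<lambda>w. f (q * fst w 0, q * snd w 0, ip n (fst w) (snd w), ip n (fst w) (fst w), ip n (snd w) (snd w)))
      \<in> borel_measurable (gauss_vec n \<Otimes>\<^sub>M gauss_vec n)"
    by measurable
  have gm' [measurable]: "(\<lambda>(x, y). f (q * x 0, q * y 0, ip n x y, ip n x x, ip n y y))
      \<in> borel_measurable (gauss_vec n \<Otimes>\<^sub>M gauss_vec n)"
    using gm by (simp add: split_beta')
  have gmx: "(\<lambda>y. f (q * x 0, q * y 0, ip n x y, ip n x x, ip n y y)) \<in> borel_measurable (gauss_vec n)" for x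
    by measurable
  have "(\<integral>\<^sup>+x. \<integral>\<^sup>+y. f (ip n x z, ip n y z, ip n x y, ip n x x, ip n y y) \<partial>gauss_vec n \<partial>gauss_vec n) =
    (\<integral>\<^sup>+x. \<integral>\<^sup>+y. f (ip n (T x) (T z), ip n (T y) (T z), ip n (T x) (T y), ip n (T x) (T x), ip n (T y) (T y)) \<partial>gauss_vec n \<partial>gauss_vec n)"
    by (simp add: gauss_isometryD(3)[OF T(1)])
  also have "\<dots> = (\<integral>\<^sup>+x. \<integral>\<^sup>+y. f (q * T x 0, q * T y 0, ip n (T x) (T y), ip n (T x) (T x), ip n (T y) (T y)) \<partial>gauss_vec n \<partial>gauss_vec n)"
    by (simp only: T(2))
  also have "\<dots> = (\<integral>\<^sup>+x. \<integral>\<^sup>+y. f (q * T x 0, q * y 0, ip n (T x) y, ip n (T x) (T x), ip n y y) \<partial>gauss_vec n \<partial>gauss_vec n)"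
    by (rule nn_integral_cong) (rule gauss_isometryD(2)[OF T(1) gmx])
  also have "\<dots> = (\<integral>\<^sup>+x. \<integral>\<^sup>+y. f (q * x 0, q * y 0, ip n x y, ip n x x, ip n y y) \<partial>gauss_vec n \<partial>gauss_vec n)"
    by (rule gauss_isometryD(2)[OF T(1), of "\<lambda>x. \<integral>\<^sup>+y. f (q * x 0, q * y 0, ip n x y, ip n x x, ip n y y) \<partial>gauss_vec n"])
       (use gm' in measurable)
  also have "\<dots> = (\<integral>\<^sup>+x. (\<lambda>(a, r). \<integral>\<^sup>+b. \<integral>\<^sup>+g. \<integral>\<^sup>+t. f (q * a, q * b, a * b + r * g, a\<^sup>2 + r\<^sup>2, b\<^sup>2 + g\<^sup>2 + t\<^sup>2)
       \<partial>chi (n - 2) \<partial>std_normal \<partial>std_normal) (x 0, sqrt (\<Sum>i\<in>{1..<n}. (x i)\<^sup>2)) \<partial>gauss_vec n)"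
  proof (rule nn_integral_cong, unfold split)
    fix x assume "x \<in> space (gauss_vec n)"
    define R where "R = sqrt (\<Sum>i\<in>{1..<n}. (x i)\<^sup>2)"
    \<comment> \<open>The isometry depends on x but acts on y only, under the inner integral, and it
      fixes coordinate 0, so the products with \<open>z\<close> are kept.\<close>
    obtain S where S: "gauss_isometry n 1 S" "\<forall>i. 1 < i \<longrightarrow> i < n \<longrightarrow> S x i = 0" "0 \<le> S x 1"
      using gauss_isometry_ex[OF n0(2), of x] by blast
    have S0: "S y 0 = y 0" for y using gauss_isometryD(4)[OF S(1)] by simp
    have ipS: "ip n (S x) y = x 0 * y 0 + S x 1 * y 1" for y
      using ip_axis1[OF n0(2), of "S x" y] S(2) by (simp add: S0 ip_commute mult.commute)
    have "(x 0)\<^sup>2 + R\<^sup>2 = (x 0)\<^sup>2 + (S x 1)\<^sup>2"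
      using ipS[of "S x"] gauss_isometryD(3)[OF S(1), of x x] ip_split1[OF n0(1), of x]
      by (simp add: S0 R_def power2_eq_square)
    then have R: "S x 1 = R" using S(3) by (simp add: R_def sum_nonneg)
    have "(\<integral>\<^sup>+y. f (q * x 0, q * y 0, ip n x y, ip n x x, ip n y y) \<partial>gauss_vec n) =
      (\<integral>\<^sup>+y. f (q * x 0, q * S y 0, ip n (S x) (S y), ip n x x, ip n (S y) (S y)) \<partial>gauss_vec n)"
      by (simp add: gauss_isometryD(3)[OF S(1)] S0)
    also have "\<dots> = (\<integral>\<^sup>+y. f (q * x 0, q * y 0, ip n (S x) y, ip n x x, ip n y y) \<partial>gauss_vec n)"
      by (rule gauss_isometryD(2)[OF S(1)]) measurable
    also have "\<dots> = (\<integral>\<^sup>+y. (\<lambda>(b, g, t). f (q * x 0, q * b, x 0 * b + R * g, (x 0)\<^sup>2 + R\<^sup>2, b\<^sup>2 + g\<^sup>2 + t\<^sup>2)) (y 0, y 1, sqrt (\<Sum>i\<in>{2..<n}. (y i)\<^sup>2)) \<partial>gauss_vec n)"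
      by (simp only: split ipS R ip_split1[OF n0(1), of x, folded R_def]) (simp only: ip_split2[OF n0(3)])
    also have "\<dots> = (\<integral>\<^sup>+b. \<integral>\<^sup>+g. \<integral>\<^sup>+t. f (q * x 0, q * b, x 0 * b + R * g, (x 0)\<^sup>2 + R\<^sup>2, b\<^sup>2 + g\<^sup>2 + t\<^sup>2)
       \<partial>chi (n - 2) \<partial>std_normal \<partial>std_normal)"
      by (subst nn_integral_gauss_vec_split2[OF n]) (auto simp: borel_prod[symmetric])
    finally show "(\<integral>\<^sup>+y. f (q * x 0, q * y 0, ip n x y, ip n x x, ip n y y) \<partial>gauss_vec n) =
      (\<integral>\<^sup>+b. \<integral>\<^sup>+g. \<integral>\<^sup>+t. f (q * x 0, q * b, x 0 * b + sqrt (\<Sum>i\<in>{1..<n}. (x i)\<^sup>2) * g,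
         (x 0)\<^sup>2 + (sqrt (\<Sum>i\<in>{1..<n}. (x i)\<^sup>2))\<^sup>2, b\<^sup>2 + g\<^sup>2 + t\<^sup>2) \<partial>chi (n - 2) \<partial>std_normal \<partial>std_normal)"
      unfolding R_def .
  qed
  also have "\<dots> = (\<integral>\<^sup>+a. \<integral>\<^sup>+r. \<integral>\<^sup>+b. \<integral>\<^sup>+g. \<integral>\<^sup>+t. f (q * a, q * b, a * b + r * g, a\<^sup>2 + r\<^sup>2, b\<^sup>2 + g\<^sup>2 + t\<^sup>2)
       \<partial>chi (n - 2) \<partial>std_normal \<partial>std_normal \<partial>chi (n - 1) \<partial>std_normal)"
    by (subst nn_integral_gauss_vec_split1[OF n0(3)]) (auto simp: borel_prod[symmetric])
  finally show ?thesis unfolding q_def .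
qed


section \<open>The chi density near its mode\<close>

text \<open>The derivative of \<open>G\<close> is s^2/(1 + s), which lies between 0 and 3 s^2 for s
  \<ge> -1/2. Hence both \<open>G\<close> and s^3 - G are nondecreasing, and both vanish at
  0.\<close>

lemma ln_one_plus_cubic_bound:
  fixes t :: real
  assumes t: "- 1 / 2 \<le> t"
  shows "\<bar>ln (1 + t) - t + t\<^sup>2 / 2\<bar> \<le> \<bar>t\<bar> ^ 3"
proof -
  define G where "G s = ln (1 + s) - s + s\<^sup>2 / 2" for s :: real
  have D: "(G has_real_derivative s\<^sup>2 / (1 + s)) (at s)" if "- 1 / 2 \<le> s" for s
  proof -
    have "(G has_real_derivative (1 / (1 + s) - 1 + s)) (at s)"
      unfolding G_def using that by (auto intro!: derivative_eq_intros)
    moreover have "1 / (1 + s) - 1 + s = s\<^sup>2 / (1 + s)"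
      using that by (simp add: field_simps power2_eq_square)
    ultimately show ?thesis by simp
  qed
  have D3: "((\<lambda>s. s ^ 3) has_real_derivative 3 * s\<^sup>2) (at s)" for s :: real
    by (auto intro!: derivative_eq_intros)
  have b: "0 \<le> s\<^sup>2 / (1 + s)" "s\<^sup>2 / (1 + s) \<le> 3 * s\<^sup>2" if "- 1 / 2 \<le> s" for s :: real
  proof -
    show "0 \<le> s\<^sup>2 / (1 + s)" using that by simp
    have "s\<^sup>2 * 1 \<le> s\<^sup>2 * (3 * (1 + s))" using that by (intro mult_left_mono) auto
    then show "s\<^sup>2 / (1 + s) \<le> 3 * s\<^sup>2" using that by (simp add: divide_le_eq algebra_simps)
  qed
  have G0: "G 0 = 0" by (simp add: G_def)
  have mono1: "G a \<le> G b" if "- 1 / 2 \<le> a" "a \<le> b" for a b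
  proof (rule DERIV_nonneg_imp_nondecreasing[of a b G])
    fix x assume "a \<le> x" "x \<le> b"
    then have x: "- 1 / 2 \<le> x" using that by simp
    show "\<exists>y. (G has_real_derivative y) (at x) \<and> 0 \<le> y"
      by (rule exI[of _ "x\<^sup>2 / (1 + x)"]) (use D[OF x] b(1)[OF x] in auto)
  qed (use that in auto)
  have mono2: "a ^ 3 - G a \<le> b ^ 3 - G b" if "- 1 / 2 \<le> a" "a \<le> b" for a b
  proof (rule DERIV_nonneg_imp_nondecreasing[of a b "\<lambda>s. s ^ 3 - G s"])
    fix x assume "a \<le> x" "x \<le> b"
    then have x: "- 1 / 2 \<le> x" using that by simp
    show "\<exists>y. ((\<lambda>s. s ^ 3 - G s) has_real_derivative y) (at x) \<and> 0 \<le> y"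
      by (rule exI[of _ "3 * x\<^sup>2 - x\<^sup>2 / (1 + x)"]) (use DERIV_diff[OF D3 D[OF x]] b(2)[OF x] in auto)
  qed (use that in auto)
  show ?thesis
  proof (cases "0 \<le> t")
    case True
    then show ?thesis using mono1[of 0 t] mono2[of 0 t] G0 by (simp add: G_def)
  next
    case False
    then have "\<bar>t\<bar> ^ 3 = - (t ^ 3)" by (simp add: abs_if power3_eq_cube)
    then show ?thesis using False mono1[of t 0] mono2[of t 0] G0 t by (simp add: G_def)
  qed
qed

text \<open>Up to the factor in \<open>chi_dens_shift\<close>, the chi density with \<open>k + 1\<close> degrees of freedom, recentred at
  its mode \<open>sqrt k\<close>.\<close>
definition chi_shift :: "nat \<Rightarrow> real \<Rightarrow> real" where
  "chi_shift k v = (if - sqrt k < v then exp (k * (ln (1 + v / sqrt k) - v / sqrt k) - v\<^sup>2 / 2) else 0)"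

definition chi_peak :: "nat \<Rightarrow> real" where
  "chi_peak k = sqrt k ^ k * exp (- real k / 2)"

lemma measurable_chi_shift [measurable]: "chi_shift k \<in> borel_measurable borel"
  unfolding chi_shift_def[abs_def] by measurable

lemma chi_shift_nonneg [simp]: "0 \<le> chi_shift k v"
  by (simp add: chi_shift_def)

lemma chi_dens_shift:
  assumes k: "1 \<le> k"
  shows "chi_dens (Suc k) (sqrt k + v) = chi_peak k * chi_shift k v"
proof (cases "- sqrt k < v")
  case True
  define t where "t = v / sqrt k"
  have sk: "0 < sqrt k" using k by simp
  have t: "- 1 < t" using True sk by (simp add: t_def field_simps)
  have v: "v = sqrt k * t" using sk by (simp add: t_def)
  have "sqrt k + v = sqrt k * (1 + t)" by (simp add: v algebra_simps)
  moreover have "(1 + t) ^ k = exp (k * ln (1 + t))" using t by (simp add: exp_of_nat_mult)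
  moreover have "- (sqrt k * (1 + t))\<^sup>2 / 2 = - real k / 2 - k * t - v\<^sup>2 / 2"
    by (simp add: v power_mult_distrib power2_eq_square[of "1 + t"] algebra_simps) (simp add: power2_eq_square field_simps)
  ultimately have "chi_dens (Suc k) (sqrt k + v) = sqrt k ^ k * (exp (k * ln (1 + t)) * exp (- real k / 2 - k * t - v\<^sup>2 / 2))"
    using sk t by (simp add: chi_dens_def power_mult_distrib)
  also have "\<dots> = sqrt k ^ k * (exp (- real k / 2) * exp (k * (ln (1 + t) - t) - v\<^sup>2 / 2))"
    by (simp add: exp_add[symmetric] algebra_simps)
  finally show ?thesis using True by (simp add: chi_peak_def chi_shift_def t_def)
qed (auto simp: chi_dens_def chi_shift_def)

text \<open>By ln(1 + t) \<le> t the part of the exponent with factor k is not positive. The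
  resulting Gaussian majorant is the same for all k and dominates masses and moments.\<close>

lemma chi_shift_le: "chi_shift k v \<le> exp (- v\<^sup>2 / 2)"
proof (cases "- sqrt k < v \<and> 0 < k")
  case True
  then have "- 1 < v / sqrt k" by (simp add: field_simps)
  then have "ln (1 + v / sqrt k) \<le> v / sqrt k" by (intro ln_add_one_self_le_self2)
  then have "k * (ln (1 + v / sqrt k) - v / sqrt k) \<le> 0" by (intro mult_nonneg_nonpos) auto
  then show ?thesis by (auto simp: chi_shift_def)
qed (auto simp: chi_shift_def)

lemma exp_lipschitz_nonpos:
  fixes a b :: real
  assumes "a \<le> 0" "b \<le> 0"
  shows "\<bar>exp a - exp b\<bar> \<le> \<bar>a - b\<bar>"
proof -
  have *: "exp b - exp a \<le> b - a" if "a \<le> b" "b \<le> 0" for a b :: real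
  proof -
    have "exp b - exp a = exp b * (1 - exp (a - b))" by (simp add: exp_diff algebra_simps)
    also have "\<dots> \<le> 1 * (b - a)"
    proof (rule mult_mono)
      show "1 - exp (a - b) \<le> b - a" using exp_ge_add_one_self[of "a - b"] by linarith
    qed (use that in auto)
    finally show ?thesis by simp
  qed
  show ?thesis using *[of a b] *[of b a] assms by (cases "a \<le> b") (auto simp: abs_if)
qed

text \<open>With t = v/sqrt k, the cubic bound replaces k (ln(1 + t) - t) by -v^2/2 with error k
  |t|^3 = |v|^3/sqrt k as long as t \<ge> -1/2. Below -1/2 the crude bound exp(-v^2/2) is enough,
  because there (2|t|)^3 \<ge> 1; this accounts for the factor 8.\<close>

lemma chi_shift_gauss:
  assumes k: "1 \<le> k"
  shows "\<bar>chi_shift k v - exp (- v\<^sup>2)\<bar> \<le> 8 * \<bar>v\<bar> ^ 3 * exp (- v\<^sup>2 / 2) / sqrt k"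
proof -
  define t where "t = v / sqrt k"
  have sk: "0 < sqrt k" "1 \<le> sqrt k" using k by simp_all
  have v: "v = sqrt k * t" using sk by (simp add: t_def)
  have k3: "k * \<bar>t\<bar> ^ 3 = \<bar>v\<bar> ^ 3 / sqrt k"
  proof -
    have "\<bar>v\<bar> ^ 3 = sqrt k ^ 3 * \<bar>t\<bar> ^ 3" unfolding v by (simp add: abs_mult power_mult_distrib)
    moreover have "sqrt k ^ 3 = k * sqrt k" by (simp add: power3_eq_cube)
    ultimately show ?thesis using sk by (simp add: field_simps)
  qed
  have e: "exp (- v\<^sup>2) = exp (- v\<^sup>2 / 2) * exp (- v\<^sup>2 / 2)" by (simp add: exp_add[symmetric])
  show ?thesis
  proof (cases "- 1 / 2 \<le> t")
    case True
    then have v1: "- sqrt k < v" using mult_strict_left_mono[of "- 1" t "sqrt k"] sk by (simp add: v)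
    define A where "A = k * (ln (1 + t) - t)"
    have A0: "A \<le> 0" unfolding A_def
      using ln_add_one_self_le_self2[of t] True by (intro mult_nonneg_nonpos) auto
    have "chi_shift k v = exp (- v\<^sup>2 / 2) * exp A"
      using v1 by (simp add: chi_shift_def A_def t_def exp_add[symmetric])
    then have "\<bar>chi_shift k v - exp (- v\<^sup>2)\<bar> = exp (- v\<^sup>2 / 2) * \<bar>exp A - exp (- v\<^sup>2 / 2)\<bar>"
      by (simp add: e right_diff_distrib[symmetric] abs_mult)
    also have "\<dots> \<le> exp (- v\<^sup>2 / 2) * \<bar>A - (- v\<^sup>2 / 2)\<bar>"
      by (intro mult_left_mono exp_lipschitz_nonpos A0) auto
    also have "A - (- v\<^sup>2 / 2) = k * (ln (1 + t) - t + t\<^sup>2 / 2)"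
      by (simp add: A_def v power_mult_distrib algebra_simps)
    also have "\<bar>\<dots>\<bar> \<le> k * \<bar>t\<bar> ^ 3"
      unfolding abs_mult using ln_one_plus_cubic_bound[OF True] by (simp add: mult_left_mono)
    also have "\<dots> \<le> 8 * \<bar>v\<bar> ^ 3 / sqrt k" unfolding k3 by (intro divide_right_mono) auto
    finally show ?thesis by (simp add: algebra_simps mult_left_mono)
  next
    case False
    have le: "exp (- v\<^sup>2) \<le> exp (- v\<^sup>2 / 2)" by simp
    have "\<bar>chi_shift k v - exp (- v\<^sup>2)\<bar> \<le> exp (- v\<^sup>2 / 2) * 1"
      unfolding abs_le_iff using chi_shift_le[of k v] chi_shift_nonneg[of k v] le exp_ge_zero[of "- v\<^sup>2"] by linarith
    also have "1 \<le> (2 * \<bar>t\<bar>) ^ 3" using False by (intro one_le_power) auto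
    also have "\<dots> = 8 * (1 * \<bar>t\<bar> ^ 3)" by (simp add: power_mult_distrib)
    also have "\<dots> \<le> 8 * (k * \<bar>t\<bar> ^ 3)" using k by (intro mult_left_mono mult_right_mono) auto
    also have "\<dots> = 8 * \<bar>v\<bar> ^ 3 / sqrt k" unfolding k3 by simp
    finally show ?thesis by (simp add: algebra_simps mult_left_mono)
  qed
qed


declare measurable_gauss_vec_component [measurable del]

lemma integrable_abs_power_gauss: "integrable lborel (\<lambda>v::real. \<bar>v\<bar> ^ j * exp (- v\<^sup>2 / 2))"
proof -
  have "integrable lborel (\<lambda>v::real. sqrt (2 * pi) * (std_normal_density v * \<bar>v\<bar> ^ j))"
    by (intro integrable_mult_right integrable_std_normal_moment_abs)
  moreover have "sqrt (2 * pi) * (std_normal_density v * \<bar>v\<bar> ^ j) = \<bar>v\<bar> ^ j * exp (- v\<^sup>2 / 2)" for v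
    by (simp add: std_normal_density_def)
  ultimately show ?thesis by simp
qed

lemma integrable_exp_gauss: "integrable lborel (\<lambda>v::real. exp (- v\<^sup>2 / 2))"
  using integrable_abs_power_gauss[of 0] by simp

lemma integral_exp_gauss: "integral\<^sup>L lborel (\<lambda>v::real. exp (- v\<^sup>2 / 2)) = sqrt (2 * pi)"
proof -
  have "integral\<^sup>L lborel (\<lambda>v::real. exp (- v\<^sup>2 / 2)) = integral\<^sup>L lborel (\<lambda>v::real. sqrt (2 * pi) * std_normal_density v)"
    by (simp add: std_normal_density_def)
  then show ?thesis by simp
qed

lemma exp_sq_eq_normal_density: "exp (- v\<^sup>2) = sqrt pi * normal_density 0 (1 / sqrt 2) v"
  by (simp add: normal_density_def power_divide)

lemma integrable_exp_sq: "integrable lborel (\<lambda>v::real. exp (- v\<^sup>2))"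
  unfolding exp_sq_eq_normal_density by (intro integrable_mult_right integrable_normal_density) simp

lemma integral_exp_sq: "integral\<^sup>L lborel (\<lambda>v::real. exp (- v\<^sup>2)) = sqrt pi"
  unfolding exp_sq_eq_normal_density by simp

lemma integrable_chi_shift: "integrable lborel (chi_shift k)"
  by (rule Bochner_Integration.integrable_bound[OF integrable_exp_gauss]) (use chi_shift_le[of k] in auto)

text \<open>The normalising constant of the recentred density; it converges to sqrt pi at rate
  1/sqrt k (\<open>chi_mass_diff\<close>).\<close>

definition chi_mass :: "nat \<Rightarrow> real" where
  "chi_mass k = integral\<^sup>L lborel (chi_shift k)"

lemma chi_mass_le: "chi_mass k \<le> sqrt (2 * pi)"
  unfolding chi_mass_def integral_exp_gauss[symmetric]
  by (rule integral_mono[OF integrable_chi_shift integrable_exp_gauss]) (rule chi_shift_le)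

lemma nn_integral_chi_shift_eq: "(\<integral>\<^sup>+v. ennreal (chi_shift k v) \<partial>lborel) = ennreal (chi_mass k)"
  unfolding chi_mass_def by (rule nn_integral_eq_integral[OF integrable_chi_shift]) simp

lemma chi_mass_nonneg: "0 \<le> chi_mass k"
  unfolding chi_mass_def by simp

lemma chi_peak_pos: "1 \<le> k \<Longrightarrow> 0 < chi_peak k"
  by (simp add: chi_peak_def)

lemma nn_integral_chi_dens:
  assumes k: "1 \<le> k" and [measurable]: "h \<in> borel_measurable borel"
  shows "(\<integral>\<^sup>+r. ennreal (chi_dens (Suc k) r) * h r \<partial>lborel) =
    ennreal (chi_peak k) * (\<integral>\<^sup>+v. ennreal (chi_shift k v) * h (sqrt k + v) \<partial>lborel)"
proof -
  have "(\<integral>\<^sup>+r. ennreal (chi_dens (Suc k) r) * h r \<partial>lborel) =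
    ennreal \<bar>1\<bar> * (\<integral>\<^sup>+v. ennreal (chi_dens (Suc k) (sqrt k + 1 * v)) * h (sqrt k + 1 * v) \<partial>lborel)"
    by (rule nn_integral_real_affine) auto
  also have "\<dots> = (\<integral>\<^sup>+v. ennreal (chi_peak k) * (ennreal (chi_shift k v) * h (sqrt k + v)) \<partial>lborel)"
    using chi_peak_pos[OF k] by (simp add: chi_dens_shift[OF k] ennreal_mult mult.assoc)
  also have "\<dots> = ennreal (chi_peak k) * (\<integral>\<^sup>+v. ennreal (chi_shift k v) * h (sqrt k + v) \<partial>lborel)"
    by (rule nn_integral_cmult) measurable
  finally show ?thesis .
qed

lemma chi_const_eq: "1 \<le> k \<Longrightarrow> chi_const (Suc k) = ennreal (chi_peak k * chi_mass k)"
  using nn_integral_chi_dens[of k "\<lambda>_. 1"] chi_peak_pos[of k]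
  by (simp add: chi_const_def nn_integral_chi_shift_eq ennreal_mult chi_mass_nonneg)

lemma nn_integral_chi_shift:
  assumes k: "1 \<le> k" and z: "0 < chi_mass k" and [measurable]: "h \<in> borel_measurable borel"
  shows "(\<integral>\<^sup>+r. h r \<partial>chi (Suc k)) = (\<integral>\<^sup>+v. ennreal (chi_shift k v / chi_mass k) * h (sqrt k + v) \<partial>lborel)"
proof -
  let ?A = "\<integral>\<^sup>+v. ennreal (chi_shift k v) * h (sqrt k + v) \<partial>lborel"
  have p: "0 < chi_peak k" by (rule chi_peak_pos[OF k])
  have "(\<integral>\<^sup>+r. h r \<partial>chi (Suc k)) = ennreal (chi_peak k) * ?A / ennreal (chi_peak k * chi_mass k)"
    by (subst nn_integral_chi) (simp_all add: nn_integral_chi_dens[OF k] chi_const_eq[OF k])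
  also have "\<dots> = ?A * ennreal (1 / chi_mass k)"
  proof -
    have "ennreal (chi_peak k) * ?A / ennreal (chi_peak k * chi_mass k) = ?A * (ennreal (chi_peak k) * ennreal (inverse (chi_peak k * chi_mass k)))"
      using p z by (simp add: divide_ennreal_def inverse_ennreal mult_ac)
    also have "ennreal (chi_peak k) * ennreal (inverse (chi_peak k * chi_mass k)) = ennreal (1 / chi_mass k)"
      using p z by (subst ennreal_mult[symmetric]) (auto simp: field_simps)
    finally show ?thesis .
  qed
  also have "\<dots> = (\<integral>\<^sup>+v. (ennreal (chi_shift k v) * h (sqrt k + v)) * ennreal (1 / chi_mass k) \<partial>lborel)"
    by (rule nn_integral_multc[symmetric]) measurable
  also have "\<dots> = (\<integral>\<^sup>+v. ennreal (chi_shift k v / chi_mass k) * h (sqrt k + v) \<partial>lborel)"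
  proof (rule nn_integral_cong)
    fix v
    have "ennreal (chi_shift k v) * ennreal (1 / chi_mass k) = ennreal (chi_shift k v / chi_mass k)"
      using z by (subst ennreal_mult[symmetric]) auto
    then show "(ennreal (chi_shift k v) * h (sqrt k + v)) * ennreal (1 / chi_mass k) = ennreal (chi_shift k v / chi_mass k) * h (sqrt k + v)"
      by (metis mult.assoc mult.commute)
  qed
  finally show ?thesis .
qed

definition cubic_moment :: real where
  "cubic_moment = integral\<^sup>L lborel (\<lambda>v::real. 8 * (\<bar>v\<bar> ^ 3 * exp (- v\<^sup>2 / 2)))"

lemma cubic_moment_nonneg: "0 \<le> cubic_moment"
  unfolding cubic_moment_def by (intro integral_nonneg_AE) auto

lemma integrable_chi_shift_diff: "integrable lborel (\<lambda>v. \<bar>chi_shift k v - exp (- v\<^sup>2)\<bar>)"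
  by (intro integrable_abs Bochner_Integration.integrable_diff integrable_chi_shift integrable_exp_sq)

lemma integral_chi_shift_diff:
  assumes k: "1 \<le> k"
  shows "integral\<^sup>L lborel (\<lambda>v. \<bar>chi_shift k v - exp (- v\<^sup>2)\<bar>) \<le> cubic_moment / sqrt k"
proof -
  have "integral\<^sup>L lborel (\<lambda>v. \<bar>chi_shift k v - exp (- v\<^sup>2)\<bar>) \<le>
    integral\<^sup>L lborel (\<lambda>v::real. 8 * (\<bar>v\<bar> ^ 3 * exp (- v\<^sup>2 / 2)) / sqrt k)"
  proof (rule integral_mono[OF integrable_chi_shift_diff])
    show "integrable lborel (\<lambda>v::real. 8 * (\<bar>v\<bar> ^ 3 * exp (- v\<^sup>2 / 2)) / sqrt k)"
      by (intro integrable_divide integrable_mult_right integrable_abs_power_gauss)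
    show "\<bar>chi_shift k v - exp (- v\<^sup>2)\<bar> \<le> 8 * (\<bar>v\<bar> ^ 3 * exp (- v\<^sup>2 / 2)) / sqrt k" for v
      using chi_shift_gauss[OF k, of v] by (simp add: mult.assoc)
  qed
  also have "\<dots> = cubic_moment / sqrt k" unfolding cubic_moment_def
    by (rule integral_divide_zero)
  finally show ?thesis .
qed

lemma chi_mass_diff:
  assumes k: "1 \<le> k"
  shows "\<bar>chi_mass k - sqrt pi\<bar> \<le> cubic_moment / sqrt k"
proof -
  have "chi_mass k - sqrt pi = integral\<^sup>L lborel (\<lambda>v. chi_shift k v - exp (- v\<^sup>2))"
    by (simp add: chi_mass_def integral_exp_sq integrable_chi_shift integrable_exp_sq)
  then have "\<bar>chi_mass k - sqrt pi\<bar> \<le> integral\<^sup>L lborel (\<lambda>v. \<bar>chi_shift k v - exp (- v\<^sup>2)\<bar>)"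
    using integral_abs_bound[of lborel "\<lambda>v. chi_shift k v - exp (- v\<^sup>2)"] by simp
  then show ?thesis using integral_chi_shift_diff[OF k] by linarith
qed

text \<open>Since sqrt pi exceeds 3/2, an error of at most 1/2 in \<open>chi_mass_diff\<close>
  leaves mass at least 1; then dividing by the mass does not enlarge anything.\<close>

lemma chi_mass_ge:
  obtains k0 where "1 \<le> k0" "\<And>k. k0 \<le> k \<Longrightarrow> 1 \<le> chi_mass k"
proof -
  obtain j :: nat where j: "(2 * cubic_moment)\<^sup>2 \<le> j" using real_arch_simple by blast
  have "1 \<le> chi_mass k" if "max 1 j \<le> k" for k
  proof -
    have k: "1 \<le> k" using that by simp
    have "2 * cubic_moment = sqrt ((2 * cubic_moment)\<^sup>2)"
      unfolding real_sqrt_abs using cubic_moment_nonneg by simp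
    also have "\<dots> \<le> sqrt k" using j that by (intro real_sqrt_le_mono) auto
    finally have "cubic_moment / sqrt k \<le> 1 / 2" using k by (simp add: divide_le_eq)
    moreover have "sqrt ((3 / 2)\<^sup>2) \<le> sqrt pi" using pi_gt3 by (intro real_sqrt_le_mono) (simp add: power2_eq_square)
    then have "3 / 2 \<le> sqrt pi" by simp
    ultimately show ?thesis using chi_mass_diff[OF k] by linarith
  qed
  then show ?thesis by (intro that[of "max 1 j"]) auto
qed

lemma nn_integral_exp_sq_std_normal:
  assumes [measurable]: "h \<in> borel_measurable borel"
  shows "(\<integral>\<^sup>+v. ennreal (exp (- v\<^sup>2) / sqrt pi) * h v \<partial>lborel) = (\<integral>\<^sup>+x. h (x / sqrt 2) \<partial>std_normal)"
proof -
  have "(\<integral>\<^sup>+v. ennreal (exp (- v\<^sup>2) / sqrt pi) * h v \<partial>lborel) =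
    ennreal \<bar>1 / sqrt 2\<bar> * (\<integral>\<^sup>+x. ennreal (exp (- (0 + 1 / sqrt 2 * x)\<^sup>2) / sqrt pi) * h (0 + 1 / sqrt 2 * x) \<partial>lborel)"
    by (rule nn_integral_real_affine) auto
  also have "\<dots> = (\<integral>\<^sup>+x. ennreal (1 / sqrt 2) * (ennreal (exp (- (x / sqrt 2)\<^sup>2) / sqrt pi) * h (x / sqrt 2)) \<partial>lborel)"
    by (subst nn_integral_cmult[symmetric]) auto
  also have "\<dots> = (\<integral>\<^sup>+x. ennreal (std_normal_density x) * h (x / sqrt 2) \<partial>lborel)"
  proof (rule nn_integral_cong)
    fix x :: real
    have "ennreal (1 / sqrt 2) * ennreal (exp (- (x / sqrt 2)\<^sup>2) / sqrt pi) = ennreal (std_normal_density x)"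
      by (subst ennreal_mult[symmetric]) (auto simp: std_normal_density_def power_divide real_sqrt_mult)
    then show "ennreal (1 / sqrt 2) * (ennreal (exp (- (x / sqrt 2)\<^sup>2) / sqrt pi) * h (x / sqrt 2)) = ennreal (std_normal_density x) * h (x / sqrt 2)"
      by (metis mult.assoc)
  qed
  also have "\<dots> = (\<integral>\<^sup>+x. h (x / sqrt 2) \<partial>std_normal)"
    by (rule nn_integral_std_normal[symmetric]) measurable
  finally show ?thesis .
qed

lemma sqrt_half_le:
  assumes "1 \<le> k" "0 \<le> B"
  shows "B / sqrt (real k) \<le> 2 * B / sqrt (real (Suc k))"
proof -
  have "sqrt (real (Suc k)) \<le> sqrt (4 * real k)" using assms by (intro real_sqrt_le_mono) simp
  also have "\<dots> = 2 * sqrt (real k)" by (simp add: real_sqrt_mult)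
  finally have "B * sqrt (real (Suc k)) \<le> B * (2 * sqrt (real k))" using assms(2) by (rule mult_left_mono)
  then show ?thesis using assms(1) by (simp add: field_simps)
qed

text \<open>The chi law is compared with sqrt(m - 1) + N(0, 1/2): after recentring at the mode the
  densities are \<open>chi_shift k v / chi_mass k\<close> and exp(-v^2)/sqrt pi, and their L1
  distance is O(1/sqrt m). It is recorded as a one-sided inequality for all test functions bounded
  by 1.\<close>

lemma chi_total_variation:
  obtains C m0 where "0 \<le> C" "\<And>m h. m0 \<le> m \<Longrightarrow> h \<in> borel_measurable borel \<Longrightarrow> (\<And>x. h x \<le> 1) \<Longrightarrow>
    (\<integral>\<^sup>+r. h r \<partial>chi m) \<le> (\<integral>\<^sup>+x. h (sqrt (real (m - 1)) + x / sqrt 2) \<partial>std_normal) + ennreal (C / sqrt m)"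
proof -
  obtain k0 where k0: "1 \<le> k0" "\<And>k. k0 \<le> k \<Longrightarrow> 1 \<le> chi_mass k" using chi_mass_ge by blast
  have "(\<integral>\<^sup>+r. h r \<partial>chi m) \<le> (\<integral>\<^sup>+x. h (sqrt (real (m - 1)) + x / sqrt 2) \<partial>std_normal) + ennreal (2 * (2 * cubic_moment) / sqrt m)"
    if m: "Suc k0 \<le> m" and [measurable]: "h \<in> borel_measurable borel" and h1: "\<And>x. h x \<le> 1" for m and h :: "real \<Rightarrow> ennreal"
  proof -
    obtain k where mk: "m = Suc k" and "k0 \<le> k" using m by (cases m) auto
    then have k: "1 \<le> k" and z: "1 \<le> chi_mass k" using k0 by auto
    have sp: "1 \<le> sqrt pi" using pi_gt3 by (intro real_le_rsqrt) auto
    \<comment> \<open>Pointwise excess of the first density over the second: one summand for the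
      difference in shape, one for the difference of the normalising constants.\<close>
    define d where "d v = \<bar>chi_shift k v - exp (- v\<^sup>2)\<bar> + chi_shift k v * \<bar>1 / chi_mass k - 1 / sqrt pi\<bar>" for v
    have d0: "0 \<le> d v" for v by (simp add: d_def)
    have d_int: "integrable lborel d" unfolding d_def[abs_def]
      by (intro Bochner_Integration.integrable_add integrable_chi_shift_diff integrable_mult_left integrable_chi_shift)
    have "integral\<^sup>L lborel d = integral\<^sup>L lborel (\<lambda>v. \<bar>chi_shift k v - exp (- v\<^sup>2)\<bar>) + chi_mass k * \<bar>1 / chi_mass k - 1 / sqrt pi\<bar>"
      unfolding d_def[abs_def] chi_mass_def
      by (subst Bochner_Integration.integral_add) (auto simp: integrable_chi_shift_diff integrable_chi_shift)
    also have "chi_mass k * \<bar>1 / chi_mass k - 1 / sqrt pi\<bar> = \<bar>chi_mass k - sqrt pi\<bar> / sqrt pi"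
    proof -
      have "chi_mass k * \<bar>1 / chi_mass k - 1 / sqrt pi\<bar> = \<bar>chi_mass k * (1 / chi_mass k - 1 / sqrt pi)\<bar>"
        using z by (simp add: abs_mult)
      also have "chi_mass k * (1 / chi_mass k - 1 / sqrt pi) = - ((chi_mass k - sqrt pi) / sqrt pi)"
        using z by (simp add: field_simps)
      finally show ?thesis by simp
    qed
    also have "\<dots> \<le> cubic_moment / sqrt k"
    proof -
      have "\<bar>chi_mass k - sqrt pi\<bar> / sqrt pi \<le> \<bar>chi_mass k - sqrt pi\<bar> / 1" using sp by (intro divide_left_mono) auto
      then show ?thesis using chi_mass_diff[OF k] by simp
    qed
    finally have "integral\<^sup>L lborel d \<le> (2 * cubic_moment) / sqrt k" using integral_chi_shift_diff[OF k] by (simp add: add_divide_distrib)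
    also have "\<dots> \<le> 2 * (2 * cubic_moment) / sqrt m"
      unfolding mk by (rule sqrt_half_le[OF k]) (use cubic_moment_nonneg in simp)
    finally have d: "integral\<^sup>L lborel d \<le> 2 * (2 * cubic_moment) / sqrt m" .
    have pw: "chi_shift k v / chi_mass k \<le> exp (- v\<^sup>2) / sqrt pi + d v" for v
    proof -
      have eq: "chi_shift k v / chi_mass k = exp (- v\<^sup>2) / sqrt pi + (chi_shift k v - exp (- v\<^sup>2)) / sqrt pi + chi_shift k v * (1 / chi_mass k - 1 / sqrt pi)"
        using z by (simp add: field_simps)
      have i1: "(chi_shift k v - exp (- v\<^sup>2)) / sqrt pi \<le> \<bar>chi_shift k v - exp (- v\<^sup>2)\<bar> / 1"
        using sp by (intro frac_le) auto
      have i2: "chi_shift k v * (1 / chi_mass k - 1 / sqrt pi) \<le> chi_shift k v * \<bar>1 / chi_mass k - 1 / sqrt pi\<bar>"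
        by (intro mult_left_mono) auto
      show ?thesis unfolding eq d_def add.assoc using i1 i2 by (intro add_left_mono add_mono) simp_all
    qed
    have "(\<integral>\<^sup>+r. h r \<partial>chi m) = (\<integral>\<^sup>+v. ennreal (chi_shift k v / chi_mass k) * h (sqrt k + v) \<partial>lborel)"
      unfolding mk using k z by (intro nn_integral_chi_shift) auto
    also have "\<dots> \<le> (\<integral>\<^sup>+v. ennreal (exp (- v\<^sup>2) / sqrt pi) * h (sqrt k + v) + ennreal (d v) \<partial>lborel)"
    proof (rule nn_integral_mono)
      fix v
      have "ennreal (chi_shift k v / chi_mass k) * h (sqrt k + v) \<le> (ennreal (exp (- v\<^sup>2) / sqrt pi) + ennreal (d v)) * h (sqrt k + v)"
        using pw[of v] d0[of v] by (intro mult_right_mono) (auto simp: ennreal_plus[symmetric] simp del: ennreal_plus intro!: ennreal_leI)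
      also have "\<dots> \<le> ennreal (exp (- v\<^sup>2) / sqrt pi) * h (sqrt k + v) + ennreal (d v) * 1"
        unfolding distrib_right using h1 by (intro add_mono mult_left_mono order.refl) auto
      finally show "ennreal (chi_shift k v / chi_mass k) * h (sqrt k + v) \<le> ennreal (exp (- v\<^sup>2) / sqrt pi) * h (sqrt k + v) + ennreal (d v)"
        by simp
    qed
    also have "\<dots> = (\<integral>\<^sup>+v. ennreal (exp (- v\<^sup>2) / sqrt pi) * h (sqrt k + v) \<partial>lborel) + (\<integral>\<^sup>+v. ennreal (d v) \<partial>lborel)"
      using d_int by (intro nn_integral_add) (auto dest: borel_measurable_integrable)
    also have "(\<integral>\<^sup>+v. ennreal (d v) \<partial>lborel) = ennreal (integral\<^sup>L lborel d)"
      using d_int d0 by (intro nn_integral_eq_integral) auto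
    also have "(\<integral>\<^sup>+v. ennreal (exp (- v\<^sup>2) / sqrt pi) * h (sqrt k + v) \<partial>lborel) = (\<integral>\<^sup>+x. h (sqrt (real (m - 1)) + x / sqrt 2) \<partial>std_normal)"
      unfolding mk by (subst nn_integral_exp_sq_std_normal[of "\<lambda>v. h (sqrt k + v)"]) auto
    finally show ?thesis using d by (meson add_left_mono ennreal_leI order_trans)
  qed
  then show ?thesis using cubic_moment_nonneg by (intro that[of "2 * (2 * cubic_moment)" "Suc k0"]) auto
qed

text \<open>The majorant exp(-v^2/2) of the recentred density and a mass of at least 1 bound the
  second moment by a Gaussian one, uniformly in m.\<close>

lemma chi_second_moment:
  obtains C m0 where "0 \<le> C" "\<And>m. m0 \<le> m \<Longrightarrow> (\<integral>\<^sup>+r. ennreal ((r - sqrt (real (m - 1)))\<^sup>2) \<partial>chi m) \<le> ennreal C"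
proof -
  obtain k0 where k0: "1 \<le> k0" "\<And>k. k0 \<le> k \<Longrightarrow> 1 \<le> chi_mass k" using chi_mass_ge by blast
  define C where "C = integral\<^sup>L lborel (\<lambda>v::real. \<bar>v\<bar> ^ 2 * exp (- v\<^sup>2 / 2))"
  have "(\<integral>\<^sup>+r. ennreal ((r - sqrt (real (m - 1)))\<^sup>2) \<partial>chi m) \<le> ennreal C" if m: "Suc k0 \<le> m" for m
  proof -
    obtain k where mk: "m = Suc k" and "k0 \<le> k" using m by (cases m) auto
    then have k: "1 \<le> k" and z: "1 \<le> chi_mass k" using k0 by auto
    have "(\<integral>\<^sup>+r. ennreal ((r - sqrt (real (m - 1)))\<^sup>2) \<partial>chi m) = (\<integral>\<^sup>+v. ennreal (chi_shift k v / chi_mass k) * ennreal ((sqrt k + v - sqrt k)\<^sup>2) \<partial>lborel)"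
      unfolding mk using k z by (subst nn_integral_chi_shift) auto
    also have "\<dots> \<le> (\<integral>\<^sup>+v. ennreal (\<bar>v\<bar> ^ 2 * exp (- v\<^sup>2 / 2)) \<partial>lborel)"
    proof (rule nn_integral_mono)
      fix v
      have "chi_shift k v / chi_mass k \<le> exp (- v\<^sup>2 / 2) / 1"
        using z chi_shift_le by (intro frac_le) auto
      then have "chi_shift k v / chi_mass k * v\<^sup>2 \<le> exp (- v\<^sup>2 / 2) * v\<^sup>2"
        by (intro mult_right_mono) auto
      then have "ennreal (chi_shift k v / chi_mass k * v\<^sup>2) \<le> ennreal (v\<^sup>2 * exp (- v\<^sup>2 / 2))"
        by (intro ennreal_leI) (simp add: mult.commute)
      moreover have "ennreal (chi_shift k v / chi_mass k * v\<^sup>2) = ennreal (chi_shift k v / chi_mass k) * ennreal (v\<^sup>2)"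
        using z by (intro ennreal_mult) auto
      moreover have "(sqrt k + v - sqrt k)\<^sup>2 = v\<^sup>2" "\<bar>v\<bar>\<^sup>2 = v\<^sup>2" by simp_all
      ultimately show "ennreal (chi_shift k v / chi_mass k) * ennreal ((sqrt k + v - sqrt k)\<^sup>2) \<le> ennreal (\<bar>v\<bar> ^ 2 * exp (- v\<^sup>2 / 2))"
        by (simp only:)
    qed
    also have "\<dots> = ennreal C" unfolding C_def by (rule nn_integral_eq_integral[OF integrable_abs_power_gauss]) simp
    finally show ?thesis .
  qed
  moreover have "0 \<le> C" unfolding C_def by (intro integral_nonneg_AE) auto
  ultimately show ?thesis by (intro that[of C "Suc k0"]) auto
qed

text \<open>The ratio of consecutive chi constants is O(1/sqrt m). This is the source of the first
  factor n^(-1/2) in the probability that a competitor wins.\<close>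

lemma chi_const_ratio:
  obtains C m0 where "0 < C" "\<And>m. m0 \<le> m \<Longrightarrow> 2 \<le> m \<and> chi_const (m - 1) \<le> ennreal (C / sqrt m) * chi_const m"
    "\<And>m. m0 \<le> m \<Longrightarrow> 0 < chi_const m \<and> chi_const m < \<infinity>"
proof -
  obtain k0 where k0: "1 \<le> k0" "\<And>k. k0 \<le> k \<Longrightarrow> 1 \<le> chi_mass k" using chi_mass_ge by blast
  define C where "C = 2 * (exp (1 / 2) * sqrt (2 * pi))"
  have C0: "0 < C" by (simp add: C_def)
  have A: "2 \<le> m \<and> chi_const (m - 1) \<le> ennreal (C / sqrt m) * chi_const m" and B: "0 < chi_const m \<and> chi_const m < \<infinity>"
    if m: "Suc (Suc k0) \<le> m" for m
  proof -
    obtain j where mj: "m = Suc (Suc j)" and "k0 \<le> j" using m by (cases m; cases "m - 1") auto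
    then have j: "1 \<le> j" and z: "1 \<le> chi_mass (Suc j)" using k0 by auto
    have p: "0 < chi_peak (Suc j)" "0 < chi_peak j" using chi_peak_pos[of "Suc j"] chi_peak_pos[OF j] by auto
    have c1: "chi_const m = ennreal (chi_peak (Suc j) * chi_mass (Suc j))" unfolding mj by (rule chi_const_eq) simp
    have c2: "chi_const (m - 1) = ennreal (chi_peak j * chi_mass j)" unfolding mj using chi_const_eq[OF j] by simp
    show "0 < chi_const m \<and> chi_const m < \<infinity>" using c1 p z by simp
    \<comment> \<open>Enlarging the base from sqrt j to sqrt(j + 1) turns the peak into
      exp(1/2)/sqrt(j + 1) times the next peak.\<close>
    have "chi_peak j \<le> sqrt (real (Suc j)) ^ j * exp (- real j / 2)"
      unfolding chi_peak_def by (intro mult_right_mono power_mono) auto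
    also have "\<dots> = exp (1 / 2) / sqrt (real (Suc j)) * chi_peak (Suc j)"
    proof -
      have "exp (- real j / 2) = exp (1 / 2) * exp (- real (Suc j) / 2)" by (simp add: exp_add[symmetric] field_simps)
      then show ?thesis by (simp add: chi_peak_def)
    qed
    finally have "chi_peak j * chi_mass j \<le> (exp (1 / 2) / sqrt (real (Suc j)) * chi_peak (Suc j)) * sqrt (2 * pi)"
      using chi_mass_le[of j] chi_mass_nonneg[of j] p by (intro mult_mono) auto
    also have "\<dots> = (exp (1 / 2) * sqrt (2 * pi)) / sqrt (real (Suc j)) * (chi_peak (Suc j) * 1)" by simp
    also have "\<dots> \<le> C / sqrt m * (chi_peak (Suc j) * chi_mass (Suc j))"
    proof (rule mult_mono)
      show "(exp (1 / 2) * sqrt (2 * pi)) / sqrt (real (Suc j)) \<le> C / sqrt m"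
        unfolding mj C_def by (rule sqrt_half_le) auto
      show "chi_peak (Suc j) * 1 \<le> chi_peak (Suc j) * chi_mass (Suc j)"
        using p z by (intro mult_left_mono) auto
    qed (use C0 p in auto)
    finally have "chi_const (m - 1) \<le> ennreal (C / sqrt m * (chi_peak (Suc j) * chi_mass (Suc j)))"
      unfolding c2 by (rule ennreal_leI)
    also have "\<dots> = ennreal (C / sqrt m) * chi_const m" unfolding c1
      using C0 p z by (intro ennreal_mult) auto
    finally show "2 \<le> m \<and> chi_const (m - 1) \<le> ennreal (C / sqrt m) * chi_const m" using mj by simp
  qed
  show ?thesis by (rule that[OF C0, of "Suc (Suc k0)"]) (use A B in auto)
qed


section \<open>Gaussian probability of a cone\<close>

lemma sets_borel_prodI: "Measurable.pred (borel \<Otimes>\<^sub>M borel) P \<Longrightarrow> {w :: real \<times> real. P w} \<in> sets borel"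
  by (simp add: borel_prod pred_def)

text \<open>Mills ratio: on the range of integration x/t \<ge> 1, and x exp(-x^2/2) has an explicit
  primitive.\<close>

lemma std_normal_tail:
  assumes t: "0 < t"
  shows "(\<integral>\<^sup>+x. indicator {t..} x \<partial>std_normal) \<le> ennreal (exp (- t\<^sup>2 / 2) / (sqrt (2 * pi) * t))"
proof -
  have "(\<integral>\<^sup>+x. indicator {t..} x \<partial>std_normal) = (\<integral>\<^sup>+x. ennreal (std_normal_density x) * indicator {t..} x \<partial>lborel)"
    by (rule nn_integral_std_normal) simp
  also have "\<dots> \<le> (\<integral>\<^sup>+x. ennreal (x * exp (- x\<^sup>2 / 2) / (sqrt (2 * pi) * t)) * indicator {t..} x \<partial>lborel)"
  proof (rule nn_integral_mono)
    fix x :: real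
    show "ennreal (std_normal_density x) * indicator {t..} x \<le> ennreal (x * exp (- x\<^sup>2 / 2) / (sqrt (2 * pi) * t)) * indicator {t..} x"
    proof (cases "t \<le> x")
      case True
      have "std_normal_density x * 1 \<le> std_normal_density x * (x / t)"
        using True t by (intro mult_left_mono) auto
      also have "\<dots> = x * exp (- x\<^sup>2 / 2) / (sqrt (2 * pi) * t)" by (simp add: std_normal_density_def)
      finally show ?thesis using True by (auto intro!: ennreal_leI)
    qed auto
  qed
  also have "\<dots> = ennreal (0 - - exp (- t\<^sup>2 / 2) / (sqrt (2 * pi) * t))"
  proof (rule nn_integral_FTC_atLeast[where F = "\<lambda>x. - exp (- x\<^sup>2 / 2) / (sqrt (2 * pi) * t)"])
    show "((\<lambda>x. - exp (- x\<^sup>2 / 2) / (sqrt (2 * pi) * t)) has_real_derivative x * exp (- x\<^sup>2 / 2) / (sqrt (2 * pi) * t)) (at x)" for x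
      using t by (auto intro!: derivative_eq_intros)
    have "((\<lambda>x::real. - exp (- x\<^sup>2 / 2) / (sqrt (2 * pi) * t)) \<longlongrightarrow> - 0 / (sqrt (2 * pi) * t)) at_top"
    proof (intro tendsto_divide tendsto_minus tendsto_const)
      have "filterlim (\<lambda>x::real. x\<^sup>2 * (1 / 2)) at_top at_top"
        by (intro filterlim_at_top_mult_tendsto_pos[OF tendsto_const] filterlim_pow_at_top filterlim_ident) auto
      then have "filterlim (\<lambda>x::real. - (x\<^sup>2 * (1 / 2))) at_bot at_top"
        by (intro filterlim_compose[OF filterlim_uminus_at_bot_at_top])
      from filterlim_compose[OF exp_at_bot this] show "((\<lambda>x::real. exp (- x\<^sup>2 / 2)) \<longlongrightarrow> 0) at_top" by simp
    qed (use t in auto)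
    then show "((\<lambda>x::real. - exp (- x\<^sup>2 / 2) / (sqrt (2 * pi) * t)) \<longlongrightarrow> 0) at_top" by simp
  qed (use t in auto)
  finally show ?thesis by simp
qed

text \<open>The angle between x and v is acute and its sine is at most sqrt t. Written without
  quotients, so that zero vectors are simply outside the cone.\<close>

definition in_cone :: "nat \<Rightarrow> real \<Rightarrow> (nat \<Rightarrow> real) \<Rightarrow> (nat \<Rightarrow> real) \<Rightarrow> bool" where
  "in_cone n t x v \<longleftrightarrow> 0 < ip n x v \<and> (1 - t) * (ip n x x * ip n v v) \<le> (ip n x v)\<^sup>2"

lemma in_cone_commute: "in_cone n t x v = in_cone n t v x"
  by (simp add: in_cone_def ip_commute[of n x v] mult.commute[of "ip n x x"])

lemma ip_nonneg [simp]: "0 \<le> ip n x x"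
  by (simp add: ip_def sum_nonneg)

lemma ip_eq_0: "ip n x x = 0 \<Longrightarrow> ip n x y = 0"
proof -
  assume "ip n x x = 0"
  then have "\<forall>i\<in>{..<n}. x i * x i = 0"
    unfolding ip_def by (subst (asm) sum_nonneg_eq_0_iff) auto
  then show ?thesis by (simp add: ip_def)
qed

text \<open>Substituting r = s u merges the two Gaussian factors into exp(-u^2/2), and division by k
  r lowers the power of u by one, so the chi density with m - 1 degrees of freedom
  reappears.\<close>

lemma nn_integral_chi_dens_tilt:
  assumes m: "2 \<le> m" and k: "0 < k" and s: "0 < s" "s\<^sup>2 * (1 + k\<^sup>2) = 1"
  shows "(\<integral>\<^sup>+r. ennreal (chi_dens m r * (exp (- (k * r)\<^sup>2 / 2) / (k * r))) \<partial>lborel) = ennreal (s ^ (m - 1) / k) * chi_const (m - 1)"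
proof -
  obtain j where j: "m = Suc (Suc j)" using m by (metis add_2_eq_Suc le_Suc_ex)
  have pw: "s * (chi_dens m (s * u) * (exp (- (k * (s * u))\<^sup>2 / 2) / (k * (s * u)))) = s ^ (m - 1) / k * chi_dens (m - 1) u" for u
  proof (cases "0 < u")
    case True
    have su: "0 < s * u" using s True by simp
    have "(s * u)\<^sup>2 + (k * (s * u))\<^sup>2 = (s\<^sup>2 * (1 + k\<^sup>2)) * u\<^sup>2"
      by (simp only: power_mult_distrib) (simp add: algebra_simps)
    then have "(s * u)\<^sup>2 + (k * (s * u))\<^sup>2 = u\<^sup>2" unfolding s(2) by simp
    then have "- (s * u)\<^sup>2 / 2 + - (k * (s * u))\<^sup>2 / 2 = - u\<^sup>2 / 2" by linarith
    then have e: "exp (- (s * u)\<^sup>2 / 2) * exp (- (k * (s * u))\<^sup>2 / 2) = exp (- u\<^sup>2 / 2)"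
      unfolding exp_add[symmetric] by (rule arg_cong)
    have alg: "s * (X * A * (B / Y)) = s * (X / Y) * (A * B)" for X A B Y :: real by simp
    have "chi_dens m (s * u) = (s * u) ^ Suc j * exp (- (s * u)\<^sup>2 / 2)"
      unfolding chi_dens_def j using su by (simp only: if_True diff_Suc_1)
    then have 1: "s * (chi_dens m (s * u) * (exp (- (k * (s * u))\<^sup>2 / 2) / (k * (s * u)))) =
       s * ((s * u) ^ Suc j / (k * (s * u))) * exp (- u\<^sup>2 / 2)"
      by (simp only: alg e)
    have 2: "(s * u) ^ Suc j / (k * (s * u)) = (s ^ j * u ^ j) / k"
      using s True k by (simp add: power_mult_distrib)
    have 3: "chi_dens (m - 1) u = u ^ j * exp (- u\<^sup>2 / 2)"
      using True by (simp add: chi_dens_def j)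
    have 4: "s ^ (m - 1) = s * s ^ j" by (simp add: j)
    show ?thesis unfolding 1 2 3 4 by simp
  next
    case False
    then have "chi_dens m (s * u) = 0" "chi_dens (m - 1) u = 0"
      using s by (auto simp: chi_dens_def zero_less_mult_iff)
    then show ?thesis by simp
  qed
  have "(\<integral>\<^sup>+r. ennreal (chi_dens m r * (exp (- (k * r)\<^sup>2 / 2) / (k * r))) \<partial>lborel) =
    ennreal \<bar>s\<bar> * (\<integral>\<^sup>+u. ennreal (chi_dens m (0 + s * u) * (exp (- (k * (0 + s * u))\<^sup>2 / 2) / (k * (0 + s * u)))) \<partial>lborel)"
    by (rule nn_integral_real_affine) (measurable, use s in simp)
  also have "\<dots> = (\<integral>\<^sup>+u. ennreal s * ennreal (chi_dens m (s * u) * (exp (- (k * (s * u))\<^sup>2 / 2) / (k * (s * u)))) \<partial>lborel)"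
    by (subst nn_integral_cmult[symmetric], measurable) (use s in simp)
  also have "\<dots> = (\<integral>\<^sup>+u. ennreal (s ^ (m - 1) / k) * ennreal (chi_dens (m - 1) u) \<partial>lborel)"
  proof (rule nn_integral_cong)
    fix u
    have "ennreal s * ennreal (chi_dens m (s * u) * (exp (- (k * (s * u))\<^sup>2 / 2) / (k * (s * u)))) = ennreal (s ^ (m - 1) / k * chi_dens (m - 1) u)"
      using s by (simp only: ennreal_mult'[symmetric] pw order.strict_implies_order)
    also have "\<dots> = ennreal (s ^ (m - 1) / k) * ennreal (chi_dens (m - 1) u)"
      using s k by (intro ennreal_mult) auto
    finally show "ennreal s * ennreal (chi_dens m (s * u) * (exp (- (k * (s * u))\<^sup>2 / 2) / (k * (s * u)))) =
      ennreal (s ^ (m - 1) / k) * ennreal (chi_dens (m - 1) u)" .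
  qed
  also have "\<dots> = ennreal (s ^ (m - 1) / k) * chi_const (m - 1)"
    unfolding chi_const_def by (rule nn_integral_cmult) measurable
  finally show ?thesis .
qed

text \<open>For r > 0 the cone condition in the coordinates (a, r) is a \<ge> \<kappa> r with
  \<kappa>^2 = (1 - t)/t. The Mills ratio handles a, and the remaining integral over r is of the
  form in \<open>nn_integral_chi_dens_tilt\<close>.\<close>

lemma nn_integral_chi_tail:
  assumes m: "2 \<le> m" and t: "0 < t" "t < 1" and c: "0 < chi_const m" "chi_const m < \<infinity>"
  shows "(\<integral>\<^sup>+r. \<integral>\<^sup>+a. indicator {a. 0 < a \<and> (1 - t) * r\<^sup>2 \<le> t * a\<^sup>2} a \<partial>std_normal \<partial>chi m) \<le>
    ennreal (sqrt t ^ m / sqrt (1 - t)) * (chi_const (m - 1) / chi_const m)"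
proof -
  define \<kappa> where "\<kappa> = sqrt ((1 - t) / t)"
  have k0: "0 < \<kappa>" and k2: "\<kappa>\<^sup>2 = (1 - t) / t" using t by (simp_all add: \<kappa>_def)
  have inner: "(\<integral>\<^sup>+a. indicator {a. 0 < a \<and> (1 - t) * r\<^sup>2 \<le> t * a\<^sup>2} a \<partial>std_normal) \<le>
    ennreal (exp (- (\<kappa> * r)\<^sup>2 / 2) / (\<kappa> * r))" if r: "0 < r" for r
  proof -
    have "(\<integral>\<^sup>+a. indicator {a. 0 < a \<and> (1 - t) * r\<^sup>2 \<le> t * a\<^sup>2} a \<partial>std_normal) \<le> (\<integral>\<^sup>+a. indicator {\<kappa> * r..} a \<partial>std_normal)"
    proof (rule nn_integral_mono)
      fix a :: real
      have "\<kappa> * r \<le> a" if "0 < a" "(1 - t) * r\<^sup>2 \<le> t * a\<^sup>2"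
      proof (rule power2_le_imp_le)
        show "(\<kappa> * r)\<^sup>2 \<le> a\<^sup>2" using that t by (simp add: power_mult_distrib k2 field_simps)
      qed (use that in simp)
      then show "indicator {a. 0 < a \<and> (1 - t) * r\<^sup>2 \<le> t * a\<^sup>2} a \<le> (indicator {\<kappa> * r..} a :: ennreal)"
        by (auto simp: indicator_def)
    qed
    also have "\<dots> \<le> ennreal (exp (- (\<kappa> * r)\<^sup>2 / 2) / (sqrt (2 * pi) * (\<kappa> * r)))"
      using k0 r by (intro std_normal_tail) auto
    also have "\<dots> \<le> ennreal (exp (- (\<kappa> * r)\<^sup>2 / 2) / (\<kappa> * r))"
    proof (intro ennreal_leI divide_left_mono)
      have "1 \<le> sqrt (2 * pi)" using pi_gt3 by (intro real_le_rsqrt) auto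
      then have "1 * (\<kappa> * r) \<le> sqrt (2 * pi) * (\<kappa> * r)" using k0 r by (intro mult_right_mono) auto
      then show "\<kappa> * r \<le> sqrt (2 * pi) * (\<kappa> * r)" by simp
    qed (use k0 r in auto)
    finally show ?thesis .
  qed
  have chi_eq: "(\<integral>\<^sup>+r. \<integral>\<^sup>+a. indicator {a. 0 < a \<and> (1 - t) * r\<^sup>2 \<le> t * a\<^sup>2} a \<partial>std_normal \<partial>chi m) =
    (\<integral>\<^sup>+r. ennreal (chi_dens m r) * (\<integral>\<^sup>+a. indicator {a. 0 < a \<and> (1 - t) * r\<^sup>2 \<le> t * a\<^sup>2} a \<partial>std_normal) \<partial>lborel) / chi_const m"
  proof (rule nn_integral_chi)
    have "{w :: real \<times> real. 0 < snd w \<and> (1 - t) * (fst w)\<^sup>2 \<le> t * (snd w)\<^sup>2} \<in> sets borel"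
      by (rule sets_borel_prodI) measurable
    then have [measurable]: "(\<lambda>w :: real \<times> real. indicator {w. 0 < snd w \<and> (1 - t) * (fst w)\<^sup>2 \<le> t * (snd w)\<^sup>2} w :: ennreal) \<in> borel_measurable (borel \<Otimes>\<^sub>M borel)"
      by (simp add: borel_prod)
    have "(\<lambda>r. \<integral>\<^sup>+a. indicator {w :: real \<times> real. 0 < snd w \<and> (1 - t) * (fst w)\<^sup>2 \<le> t * (snd w)\<^sup>2} (r, a) \<partial>std_normal) \<in> borel_measurable borel"
      by measurable
    then show "(\<lambda>r. \<integral>\<^sup>+a. indicator {a. 0 < a \<and> (1 - t) * r\<^sup>2 \<le> t * a\<^sup>2} a \<partial>std_normal) \<in> borel_measurable borel"
      by (simp add: indicator_def)
  qed
  have s1: "(\<integral>\<^sup>+r. ennreal (chi_dens m r) * (\<integral>\<^sup>+a. indicator {a. 0 < a \<and> (1 - t) * r\<^sup>2 \<le> t * a\<^sup>2} a \<partial>std_normal) \<partial>lborel) \<le>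
    (\<integral>\<^sup>+r. ennreal (chi_dens m r * (exp (- (\<kappa> * r)\<^sup>2 / 2) / (\<kappa> * r))) \<partial>lborel)"
  proof (rule nn_integral_mono)
    fix r :: real
    show "ennreal (chi_dens m r) * (\<integral>\<^sup>+a. indicator {a. 0 < a \<and> (1 - t) * r\<^sup>2 \<le> t * a\<^sup>2} a \<partial>std_normal) \<le>
      ennreal (chi_dens m r * (exp (- (\<kappa> * r)\<^sup>2 / 2) / (\<kappa> * r)))"
    proof (cases "0 < r")
      case True
      have "ennreal (chi_dens m r) * (\<integral>\<^sup>+a. indicator {a. 0 < a \<and> (1 - t) * r\<^sup>2 \<le> t * a\<^sup>2} a \<partial>std_normal) \<le>
        ennreal (chi_dens m r) * ennreal (exp (- (\<kappa> * r)\<^sup>2 / 2) / (\<kappa> * r))"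
        by (rule mult_left_mono[OF inner[OF True]]) simp
      also have "\<dots> = ennreal (chi_dens m r * (exp (- (\<kappa> * r)\<^sup>2 / 2) / (\<kappa> * r)))"
        by (rule ennreal_mult[symmetric]) (use k0 True in \<open>auto intro!: divide_nonneg_pos\<close>)
      finally show ?thesis .
    next
      case False
      then have "chi_dens m r = 0" by (simp add: chi_dens_def)
      then show ?thesis by (simp only: ennreal_0 mult_zero_left order.refl)
    qed
  qed
  \<comment> \<open>The scale is s = sqrt t, since t (1 + \<kappa>^2) = 1; the power of s is what
    makes the bound exponentially small.\<close>
  have s2: "(\<integral>\<^sup>+r. ennreal (chi_dens m r * (exp (- (\<kappa> * r)\<^sup>2 / 2) / (\<kappa> * r))) \<partial>lborel) =
    ennreal (sqrt t ^ (m - 1) / \<kappa>) * chi_const (m - 1)"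
    by (rule nn_integral_chi_dens_tilt) (use m t k0 in \<open>auto simp: k2 field_simps\<close>)
  have s3: "sqrt t ^ (m - 1) / \<kappa> = sqrt t ^ m / sqrt (1 - t)"
  proof -
    obtain j where j: "m = Suc j" using m by (cases m) auto
    have "sqrt t ^ (m - 1) / \<kappa> = sqrt t ^ j * (sqrt t / sqrt (1 - t))" using t by (simp add: j \<kappa>_def real_sqrt_divide)
    then show ?thesis by (simp add: j mult.commute)
  qed
  show ?thesis unfolding chi_eq divide_ennreal_def mult.assoc[symmetric]
    by (rule mult_right_mono[OF s1[unfolded s2 s3]]) simp
qed

text \<open>The spherical cap estimate with its polynomial prefactor. With \<open>v\<close> on the
  first axis the cone becomes (1 - t) r^2 \<le> t a^2; \<open>nn_integral_chi_tail\<close> in n - 1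
  degrees of freedom gives the power of sqrt t and \<open>chi_const_ratio\<close> the factor 1/sqrt
  n.\<close>

lemma cone_bound:
  obtains C n0 where "0 < C" "3 \<le> n0" "\<And>n t v. n0 \<le> n \<Longrightarrow> 0 < t \<Longrightarrow> t < 1 \<Longrightarrow> 0 < ip n v v \<Longrightarrow>
    (\<integral>\<^sup>+x. indicator {x. in_cone n t x v} x \<partial>gauss_vec n) \<le> ennreal (C / sqrt n * (sqrt t ^ (n - 1) / sqrt (1 - t)))"
proof -
  obtain C m0 where C: "0 < C" "\<And>m. m0 \<le> m \<Longrightarrow> 2 \<le> m \<and> chi_const (m - 1) \<le> ennreal (C / sqrt m) * chi_const m"
    "\<And>m. m0 \<le> m \<Longrightarrow> 0 < chi_const m \<and> chi_const m < \<infinity>"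
    using chi_const_ratio by blast
  have "(\<integral>\<^sup>+x. indicator {x. in_cone n t x v} x \<partial>gauss_vec n) \<le> ennreal (2 * C / sqrt n * (sqrt t ^ (n - 1) / sqrt (1 - t)))"
    if n: "m0 + 3 \<le> n" and t: "0 < t" "t < 1" and v: "0 < ip n v v" for n t v
  proof -
    define m where "m = n - 1"
    have m: "m0 \<le> m" "2 \<le> m" "2 \<le> n" "n = Suc m" "1 \<le> m" using n by (auto simp: m_def)
    let ?q = "ip n v v"
    let ?f = "\<lambda>(p, q). indicator {w. 0 < fst w \<and> (1 - t) * (snd w * ?q) \<le> (fst w)\<^sup>2} (p, q) :: ennreal"
    have [measurable]: "{w :: real \<times> real. 0 < fst w \<and> (1 - t) * (snd w * ?q) \<le> (fst w)\<^sup>2} \<in> sets borel"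
      by (rule sets_borel_prodI) measurable
    have fm: "?f \<in> borel_measurable borel" by (simp add: split_beta') 
    have "(\<integral>\<^sup>+x. indicator {x. in_cone n t x v} x \<partial>gauss_vec n) = (\<integral>\<^sup>+x. ?f (ip n x v, ip n x x) \<partial>gauss_vec n)"
      by (intro nn_integral_cong) (auto simp: indicator_def in_cone_def)
    also have "\<dots> = (\<integral>\<^sup>+a. \<integral>\<^sup>+r. ?f (sqrt ?q * a, a\<^sup>2 + r\<^sup>2) \<partial>chi m \<partial>std_normal)"
      unfolding m_def by (rule nn_integral_gauss_vec_gram1[OF m(3) fm])
    also have "\<dots> = (\<integral>\<^sup>+a. \<integral>\<^sup>+r. indicator {a. 0 < a \<and> (1 - t) * r\<^sup>2 \<le> t * a\<^sup>2} a \<partial>chi m \<partial>std_normal)"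
    proof (intro nn_integral_cong)
      fix a r :: real
      have "(0 < sqrt ?q * a \<and> (1 - t) * ((a\<^sup>2 + r\<^sup>2) * ?q) \<le> (sqrt ?q * a)\<^sup>2) \<longleftrightarrow> (0 < a \<and> (1 - t) * r\<^sup>2 \<le> t * a\<^sup>2)"
      proof -
        have "(1 - t) * ((a\<^sup>2 + r\<^sup>2) * ?q) \<le> (sqrt ?q * a)\<^sup>2 \<longleftrightarrow> ((1 - t) * (a\<^sup>2 + r\<^sup>2)) * ?q \<le> a\<^sup>2 * ?q"
          using v by (simp add: power_mult_distrib mult_ac)
        also have "\<dots> \<longleftrightarrow> (1 - t) * (a\<^sup>2 + r\<^sup>2) \<le> a\<^sup>2" using v by (rule mult_le_cancel_right_pos)
        also have "\<dots> \<longleftrightarrow> (1 - t) * r\<^sup>2 \<le> t * a\<^sup>2" by (simp add: algebra_simps)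
        finally show ?thesis using v by (simp add: zero_less_mult_iff)
      qed
      then show "?f (sqrt ?q * a, a\<^sup>2 + r\<^sup>2) = indicator {a. 0 < a \<and> (1 - t) * r\<^sup>2 \<le> t * a\<^sup>2} a"
        by (simp add: indicator_def)
    qed
    also have "\<dots> = (\<integral>\<^sup>+r. \<integral>\<^sup>+a. indicator {a. 0 < a \<and> (1 - t) * r\<^sup>2 \<le> t * a\<^sup>2} a \<partial>std_normal \<partial>chi m)"
    proof -
      interpret P: pair_sigma_finite std_normal "chi m" ..
      have "{w :: real \<times> real. 0 < fst w \<and> (1 - t) * (snd w)\<^sup>2 \<le> t * (fst w)\<^sup>2} \<in> sets borel"
        by (rule sets_borel_prodI) measurable
      then have "(\<lambda>w :: real \<times> real. indicator {w. 0 < fst w \<and> (1 - t) * (snd w)\<^sup>2 \<le> t * (fst w)\<^sup>2} w :: ennreal) \<in> borel_measurable (std_normal \<Otimes>\<^sub>M chi m)"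
        by (simp add: borel_prod[symmetric] measurable_cong_sets[OF sets_pair_measure_cong[OF sets_std_normal sets_chi] refl])
      from P.Fubini[OF this] show ?thesis by (simp add: indicator_def)
    qed
    also have "\<dots> \<le> ennreal (sqrt t ^ m / sqrt (1 - t)) * (chi_const (m - 1) / chi_const m)"
      using C(3)[OF m(1)] by (intro nn_integral_chi_tail m t) auto
    also have "\<dots> \<le> ennreal (sqrt t ^ m / sqrt (1 - t)) * ennreal (2 * C / sqrt n)"
    proof (rule mult_left_mono)
    have "chi_const (m - 1) / chi_const m \<le> ennreal (C / sqrt m)"
    proof -
      have "chi_const (m - 1) / chi_const m \<le> ennreal (C / sqrt m) * chi_const m / chi_const m"
        using C(2)[OF m(1)] by (intro divide_right_mono_ennreal) auto
      also have "\<dots> = ennreal (C / sqrt m)" using C(3)[OF m(1)] by (intro ennreal_mult_divide_eq) auto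
      finally show ?thesis .
    qed
    also have "ennreal (C / sqrt m) \<le> ennreal (2 * C / sqrt n)"
      unfolding m(4) using m(5) C(1) by (intro ennreal_leI sqrt_half_le) auto
    finally show "chi_const (m - 1) / chi_const m \<le> ennreal (2 * C / sqrt n)" .
    qed simp
    also have "\<dots> = ennreal (2 * C / sqrt n * (sqrt t ^ (n - 1) / sqrt (1 - t)))"
      unfolding m_def using t C(1) by (subst ennreal_mult[symmetric]) (auto simp: mult.commute)
    finally show ?thesis .
  qed
  then show ?thesis using C(1) by (intro that[of "2 * C" "m0 + 3"]) auto
qed


section \<open>Codewords on the power spheres and the cones that contain competitors\<close>

text \<open>For Gaussian x this is a uniform point on the sphere of radius sqrt(n P). For x of norm
  0 division by zero gives the zero vector, which still satisfies the power constraint, so every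
  codebook is admissible.\<close>

definition sph :: "nat \<Rightarrow> real \<Rightarrow> (nat \<Rightarrow> real) \<Rightarrow> nat \<Rightarrow> real" where
  "sph n P x = (\<lambda>i. sqrt (real n * P) / sqrt (ip n x x) * x i)"

lemma ip_add_left: "ip n (\<lambda>i. x i + y i) z = ip n x z + ip n y z"
  by (simp add: ip_def distrib_right sum.distrib)

lemma ip_add_right: "ip n z (\<lambda>i. x i + y i) = ip n z x + ip n z y"
  by (simp add: ip_def distrib_left sum.distrib)

lemma ip_diff_left: "ip n (\<lambda>i. x i - y i) z = ip n x z - ip n y z"
  by (simp add: ip_def left_diff_distrib sum_subtractf)

lemma ip_diff_right: "ip n z (\<lambda>i. x i - y i) = ip n z x - ip n z y"
  by (simp add: ip_def right_diff_distrib sum_subtractf)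

lemma ip_scale_left: "ip n (\<lambda>i. c * x i) z = c * ip n x z"
  by (simp add: ip_def sum_distrib_left mult.assoc)

lemma ip_scale_right: "ip n z (\<lambda>i. c * x i) = c * ip n z x"
  by (simp add: ip_def sum_distrib_left mult_ac)

lemma ip_sph_left: "ip n (sph n P x) z = sqrt (real n * P) / sqrt (ip n x x) * ip n x z"
  unfolding sph_def by (rule ip_scale_left)

lemma ip_sph_right: "ip n z (sph n P x) = sqrt (real n * P) / sqrt (ip n x x) * ip n z x"
  unfolding sph_def by (rule ip_scale_right)

lemma ip_sph_sph: "0 \<le> P \<Longrightarrow> 0 < ip n x x \<Longrightarrow> ip n (sph n P x) (sph n P x) = real n * P"
  by (simp add: ip_sph_left ip_sph_right power2_eq_square[symmetric])

lemma ip_sph_sph_le: "0 \<le> P \<Longrightarrow> ip n (sph n P x) (sph n P x) \<le> real n * P"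
  using ip_sph_sph[of P n x] ip_nonneg[of n x] by (cases "ip n x x = 0") (auto simp: ip_sph_left)

text \<open>The ball of radius sqrt Z around v does not contain the origin and is seen from there
  under a half-angle of squared sine Z/|v|^2. Algebraically, with a = |v|^2 - Z, closeness says a +
  |s|^2 \<le> 2 (s, v), and 4 a |s|^2 \<le> (a + |s|^2)^2.\<close>

lemma in_cone_near:
  assumes z: "0 < Z" "Z < ip n v v" and near: "ip n (\<lambda>i. v i - s i) (\<lambda>i. v i - s i) \<le> Z"
  shows "in_cone n (Z / ip n v v) s v"
proof -
  define a where "a = ip n v v - Z"
  have a: "0 < a" using z by (simp add: a_def)
  have "ip n v v - ip n v s - ip n s v + ip n s s \<le> Z"
    using near by (simp add: ip_diff_left ip_diff_right algebra_simps)
  then have sv: "a + ip n s s \<le> 2 * ip n s v"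
    unfolding a_def by (simp add: ip_commute[of n v s])
  have pos: "0 < a + ip n s s" using a ip_nonneg[of n s] by linarith
  have "4 * (a * ip n s s) \<le> (a + ip n s s)\<^sup>2"
    using zero_le_power2[of "a - ip n s s"] by (simp add: power2_eq_square algebra_simps)
  also have "\<dots> \<le> (2 * ip n s v)\<^sup>2" using sv pos by (intro power_mono) auto
  finally have "a * ip n s s \<le> (ip n s v)\<^sup>2" by (simp add: power_mult_distrib)
  moreover have E: "(1 - Z / ip n v v) * (ip n s s * ip n v v) = a * ip n s s"
    using z by (simp add: a_def field_simps)
  moreover have "0 < ip n s v" using sv pos by linarith
  ultimately show ?thesis unfolding in_cone_def E by simp
qed

text \<open>A cone is invariant under positive scaling. Positivity of the factor is part of the
  hypothesis, through the positive inner product.\<close>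

lemma in_cone_sph:
  assumes "in_cone n t (sph n P x) v" "0 \<le> P"
  shows "in_cone n t x v"
proof -
  define c where "c = sqrt (real n * P) / sqrt (ip n x x)"
  have c: "0 < c * ip n x v" "(1 - t) * (c * (c * ip n x x) * ip n v v) \<le> (c * ip n x v)\<^sup>2"
    using assms by (auto simp: in_cone_def ip_sph_left ip_sph_right c_def)
  have "0 \<le> c" using assms by (simp add: c_def)
  then have c0: "0 < c" and p: "0 < ip n x v" using c(1) by (auto simp: zero_less_mult_iff)
  have "c\<^sup>2 * ((1 - t) * (ip n x x * ip n v v)) \<le> c\<^sup>2 * (ip n x v)\<^sup>2"
    using c(2) by (simp add: power_mult_distrib) (simp add: power2_eq_square mult_ac)
  then have "(1 - t) * (ip n x x * ip n v v) \<le> (ip n x v)\<^sup>2"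
    using c0 by (subst (asm) mult_le_cancel_left_pos) auto
  then show ?thesis using p by (simp add: in_cone_def)
qed

lemma AE_gauss_vec_nonzero:
  assumes "0 < n"
  shows "AE v in gauss_vec n. 0 < ip n v v"
proof -
  have [measurable]: "(\<lambda>v. ip n v v) \<in> borel_measurable (gauss_vec n)" by measurable
  have "(\<integral>\<^sup>+v. indicator {0} (sqrt (ip n v v)) \<partial>gauss_vec n) = (\<integral>\<^sup>+r. indicator {0} r \<partial>chi n)"
    by (rule nn_integral_gauss_vec_norm[OF assms]) simp
  also have "\<dots> = (\<integral>\<^sup>+r. ennreal (chi_dens n r) * indicator {0} r \<partial>lborel) / chi_const n"
    by (rule nn_integral_chi) simp
  also have "(\<integral>\<^sup>+r. ennreal (chi_dens n r) * indicator {0} r \<partial>lborel) = (\<integral>\<^sup>+r. 0 \<partial>(lborel :: real measure))"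
    by (rule nn_integral_cong) (auto simp: chi_dens_def indicator_def)
  finally have "(\<integral>\<^sup>+v. indicator {0} (sqrt (ip n v v)) \<partial>gauss_vec n) = (0 :: ennreal)" by simp
  then have "AE v in gauss_vec n. indicator {0} (sqrt (ip n v v)) = (0 :: ennreal)"
    by (subst (asm) nn_integral_0_iff_AE) auto
  then show ?thesis
  proof eventually_elim
    case (elim v)
    then have "ip n v v \<noteq> 0" by (auto simp: indicator_def)
    then show ?case using ip_nonneg[of n v] by linarith
  qed
qed

text \<open>The cone condition for a sum of two sphere codewords, as a function of q = |v|^2 and the
  products (x, v), (y, v), (x, y), |x|^2, |y|^2. In this form
  \<open>nn_integral_gauss_vec_gram2\<close> applies to it.\<close>

definition sum_cone :: "nat \<Rightarrow> real \<Rightarrow> real \<Rightarrow> real \<Rightarrow> real \<Rightarrow> real \<times> real \<times> real \<times> real \<times> real \<Rightarrow> bool" where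
  "sum_cone n t P1 P2 q w \<longleftrightarrow> (case w of (p1, p2, p3, p4, p5) \<Rightarrow>
     let \<alpha> = sqrt (real n * P1) / sqrt p4; \<beta> = sqrt (real n * P2) / sqrt p5
     in 0 < \<alpha> * p1 + \<beta> * p2 \<and> (1 - t) * ((\<alpha> * (\<alpha> * p4) + 2 * (\<alpha> * \<beta> * p3) + \<beta> * (\<beta> * p5)) * q) \<le> (\<alpha> * p1 + \<beta> * p2)\<^sup>2)"

lemma in_cone_sum_iff:
  "in_cone n t (\<lambda>i. sph n P1 x i + sph n P2 y i) v \<longleftrightarrow>
   sum_cone n t P1 P2 (ip n v v) (ip n x v, ip n y v, ip n x y, ip n x x, ip n y y)"
proof -
  define a where "a = sqrt (real n * P1) / sqrt (ip n x x)"
  define b where "b = sqrt (real n * P2) / sqrt (ip n y y)"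
  let ?s = "\<lambda>i. sph n P1 x i + sph n P2 y i"
  have 1: "ip n ?s v = a * ip n x v + b * ip n y v"
    by (simp only: ip_add_left ip_sph_left a_def b_def)
  have 2: "ip n ?s ?s = a * (a * ip n x x) + 2 * (a * b * ip n x y) + b * (b * ip n y y)"
    by (simp only: ip_add_left ip_add_right ip_sph_left ip_sph_right a_def[symmetric] b_def[symmetric] ip_commute[of n y x])
      (simp add: algebra_simps)
  show ?thesis unfolding in_cone_def sum_cone_def 1 2 split Let_def a_def[symmetric] b_def[symmetric] ..
qed

text \<open>Both inequalities are homogeneous in sqrt q, so the probability of the cone does not
  depend on the length of v.\<close>

lemma sum_cone_scale:
  assumes "0 < q"
  shows "sum_cone n t P1 P2 q (sqrt q * a, sqrt q * b, p3, p4, p5) \<longleftrightarrow> sum_cone n t P1 P2 1 (a, b, p3, p4, p5)"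
proof -
  define \<alpha> where "\<alpha> = sqrt (real n * P1) / sqrt p4"
  define \<beta> where "\<beta> = sqrt (real n * P2) / sqrt p5"
  define S where "S = \<alpha> * (\<alpha> * p4) + 2 * (\<alpha> * \<beta> * p3) + \<beta> * (\<beta> * p5)"
  have e: "\<alpha> * (sqrt q * a) + \<beta> * (sqrt q * b) = sqrt q * (\<alpha> * a + \<beta> * b)" by (simp add: algebra_simps)
  have "(1 - t) * (S * q) \<le> (sqrt q * (\<alpha> * a + \<beta> * b))\<^sup>2 \<longleftrightarrow> ((1 - t) * S) * q \<le> (\<alpha> * a + \<beta> * b)\<^sup>2 * q"
    using assms by (simp add: power_mult_distrib mult_ac)
  also have "\<dots> \<longleftrightarrow> (1 - t) * (S * 1) \<le> (\<alpha> * a + \<beta> * b)\<^sup>2"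
    using mult_le_cancel_right_pos[OF assms] by simp
  finally have "(1 - t) * (S * q) \<le> (sqrt q * (\<alpha> * a + \<beta> * b))\<^sup>2 \<longleftrightarrow> (1 - t) * (S * 1) \<le> (\<alpha> * a + \<beta> * b)\<^sup>2" .
  moreover have "0 < sqrt q * (\<alpha> * a + \<beta> * b) \<longleftrightarrow> 0 < \<alpha> * a + \<beta> * b"
    using assms by (simp add: zero_less_mult_iff)
  ultimately show ?thesis
    unfolding sum_cone_def split Let_def \<alpha>_def[symmetric] \<beta>_def[symmetric] S_def[symmetric] e by simp
qed

lemma pred_sum_cone:
  assumes [measurable]: "q \<in> borel_measurable M" "p1 \<in> borel_measurable M" "p2 \<in> borel_measurable M"
    "p3 \<in> borel_measurable M" "p4 \<in> borel_measurable M" "p5 \<in> borel_measurable M"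
  shows "Measurable.pred M (\<lambda>w. sum_cone n t P1 P2 (q w) (p1 w, p2 w, p3 w, p4 w, p5 w))"
proof -
  define A where "A w = sqrt (real n * P1) / sqrt (p4 w)" for w
  define B where "B w = sqrt (real n * P2) / sqrt (p5 w)" for w
  have [measurable]: "A \<in> borel_measurable M" "B \<in> borel_measurable M"
    unfolding A_def[abs_def] B_def[abs_def] by measurable
  define S where "S w = A w * p1 w + B w * p2 w" for w
  define U where "U w = (A w * (A w * p4 w) + 2 * (A w * B w * p3 w) + B w * (B w * p5 w)) * q w" for w
  have [measurable]: "S \<in> borel_measurable M" "U \<in> borel_measurable M"
    unfolding S_def[abs_def] U_def[abs_def] by measurable
  have "Measurable.pred M (\<lambda>w. 0 < S w \<and> (1 - t) * U w \<le> (S w)\<^sup>2)" by measurable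
  then show ?thesis by (simp only: sum_cone_def split Let_def A_def B_def S_def U_def)
qed

lemma sets_sum_cone: "Collect (sum_cone n t P1 P2 q) \<in> sets borel"
proof -
  have "Measurable.pred borel (\<lambda>w :: real \<times> real \<times> real \<times> real \<times> real.
    sum_cone n t P1 P2 q (fst w, fst (snd w), fst (snd (snd w)), fst (snd (snd (snd w))), snd (snd (snd (snd w)))))"
    by (intro pred_sum_cone borel_measurable_continuous_onI continuous_intros)
  then show ?thesis by (simp add: pred_def)
qed

lemma sum_cone_bound:
  obtains C n0 where "0 < C" "3 \<le> n0" "\<And>n t v P1 P2. n0 \<le> n \<Longrightarrow> 0 < t \<Longrightarrow> t < 1 \<Longrightarrow> 0 < ip n v v \<Longrightarrow>
    (\<integral>\<^sup>+x. \<integral>\<^sup>+y. indicator {w. in_cone n t (\<lambda>i. sph n P1 (fst w) i + sph n P2 (snd w) i) v} (x, y) \<partial>gauss_vec n \<partial>gauss_vec n)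
      \<le> ennreal (C / sqrt n * (sqrt t ^ (n - 1) / sqrt (1 - t)))"
proof -
  obtain C n0 where C: "0 < C" "3 \<le> n0" "\<And>n t v. n0 \<le> n \<Longrightarrow> 0 < t \<Longrightarrow> t < 1 \<Longrightarrow> 0 < ip n v v \<Longrightarrow>
    (\<integral>\<^sup>+x. indicator {x. in_cone n t x v} x \<partial>gauss_vec n) \<le> ennreal (C / sqrt n * (sqrt t ^ (n - 1) / sqrt (1 - t)))"
    using cone_bound by blast
  have "(\<integral>\<^sup>+x. \<integral>\<^sup>+y. indicator {w. in_cone n t (\<lambda>i. sph n P1 (fst w) i + sph n P2 (snd w) i) v} (x, y) \<partial>gauss_vec n \<partial>gauss_vec n)
      \<le> ennreal (C / sqrt n * (sqrt t ^ (n - 1) / sqrt (1 - t)))" (is "_ \<le> ?B")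
    if n: "n0 \<le> n" and t: "0 < t" "t < 1" and v: "0 < ip n v v" for n t v P1 P2
  proof -
    have n3: "3 \<le> n" "0 < n" using n C(2) by auto
    let ?K = "\<lambda>v x y. indicator (Collect (sum_cone n t P1 P2 (ip n v v))) (ip n x v, ip n y v, ip n x y, ip n x x, ip n y y) :: ennreal"
    define H where "H v = (\<integral>\<^sup>+x. \<integral>\<^sup>+y. ?K v x y \<partial>gauss_vec n \<partial>gauss_vec n)" for v
    define h0 where "h0 = (\<integral>\<^sup>+a. \<integral>\<^sup>+r. \<integral>\<^sup>+b. \<integral>\<^sup>+g. \<integral>\<^sup>+u. indicator (Collect (sum_cone n t P1 P2 1)) (a, b, a * b + r * g, a\<^sup>2 + r\<^sup>2, b\<^sup>2 + g\<^sup>2 + u\<^sup>2)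
       \<partial>chi (n - 2) \<partial>std_normal \<partial>std_normal \<partial>chi (n - 1) \<partial>std_normal :: ennreal)"
    have Hh: "H v = h0" if v: "0 < ip n v v" for v
    proof -
      have "H v = (\<integral>\<^sup>+a. \<integral>\<^sup>+r. \<integral>\<^sup>+b. \<integral>\<^sup>+g. \<integral>\<^sup>+u. indicator (Collect (sum_cone n t P1 P2 (ip n v v))) (sqrt (ip n v v) * a, sqrt (ip n v v) * b, a * b + r * g, a\<^sup>2 + r\<^sup>2, b\<^sup>2 + g\<^sup>2 + u\<^sup>2)
       \<partial>chi (n - 2) \<partial>std_normal \<partial>std_normal \<partial>chi (n - 1) \<partial>std_normal)"
        unfolding H_def by (rule nn_integral_gauss_vec_gram2[OF n3(1), of "indicator (Collect (sum_cone n t P1 P2 (ip n v v)))"])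
            (intro borel_measurable_indicator sets_sum_cone)
      also have "\<dots> = h0" unfolding h0_def
        by (simp only: indicator_def mem_Collect_eq sum_cone_scale[OF v])
      finally show ?thesis .
    qed
    have K_meas: "(\<lambda>w. ?K (fst w) (fst (snd w)) (snd (snd w))) \<in> borel_measurable (gauss_vec n \<Otimes>\<^sub>M gauss_vec n \<Otimes>\<^sub>M gauss_vec n)"
    proof -
      have "Measurable.pred (gauss_vec n \<Otimes>\<^sub>M gauss_vec n \<Otimes>\<^sub>M gauss_vec n) (\<lambda>w. sum_cone n t P1 P2 (ip n (fst w) (fst w))
         (ip n (fst (snd w)) (fst w), ip n (snd (snd w)) (fst w), ip n (fst (snd w)) (snd (snd w)), ip n (fst (snd w)) (fst (snd w)), ip n (snd (snd w)) (snd (snd w))))"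
        by (intro pred_sum_cone measurable_ip measurable_fst measurable_snd measurable_compose[OF measurable_snd measurable_fst]
            measurable_compose[OF measurable_snd measurable_snd])
      then show ?thesis by (simp add: indicator_def)
    qed
    interpret G: pair_sigma_finite "gauss_vec n" "gauss_vec n" ..
    \<comment> \<open>Averaging a constant over v is what allows v to be integrated first; the null
      vector v, where the formula may fail, has measure zero.\<close>
    have "h0 = (\<integral>\<^sup>+v. h0 \<partial>gauss_vec n)" by (simp only: nn_integral_const gauss_vec.emeasure_space_1 mult_1_right)
    also have "\<dots> = (\<integral>\<^sup>+v. H v \<partial>gauss_vec n)"
    proof (rule nn_integral_cong_AE)
      show "AE v in gauss_vec n. h0 = H v"
        using AE_gauss_vec_nonzero[OF n3(2)] by eventually_elim (rule Hh[symmetric])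
    qed
    also have "\<dots> = (\<integral>\<^sup>+x. \<integral>\<^sup>+v. \<integral>\<^sup>+y. ?K v x y \<partial>gauss_vec n \<partial>gauss_vec n \<partial>gauss_vec n)"
      unfolding H_def
    proof (rule G.Fubini')
      have "(\<lambda>p. ?K (snd (fst p)) (fst (fst p)) (snd p)) \<in> borel_measurable ((gauss_vec n \<Otimes>\<^sub>M gauss_vec n) \<Otimes>\<^sub>M gauss_vec n)"
      proof -
        have "(\<lambda>p. (snd (fst p), fst (fst p), snd p)) \<in> (gauss_vec n \<Otimes>\<^sub>M gauss_vec n) \<Otimes>\<^sub>M gauss_vec n \<rightarrow>\<^sub>M gauss_vec n \<Otimes>\<^sub>M gauss_vec n \<Otimes>\<^sub>M gauss_vec n"
          by measurable
        from measurable_compose[OF this K_meas] show ?thesis by (simp only: fst_conv snd_conv)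
      qed
      then have "(\<lambda>p. \<integral>\<^sup>+y. ?K (snd p) (fst p) y \<partial>gauss_vec n) \<in> borel_measurable (gauss_vec n \<Otimes>\<^sub>M gauss_vec n)"
        by (intro gauss_vec.borel_measurable_nn_integral) (simp only: split_beta')
      then show "(\<lambda>(x, v). \<integral>\<^sup>+y. ?K v x y \<partial>gauss_vec n) \<in> borel_measurable (gauss_vec n \<Otimes>\<^sub>M gauss_vec n)"
        by (simp only: split_beta')
    qed
    also have "\<dots> = (\<integral>\<^sup>+x. \<integral>\<^sup>+y. \<integral>\<^sup>+v. ?K v x y \<partial>gauss_vec n \<partial>gauss_vec n \<partial>gauss_vec n)"
    proof (rule nn_integral_cong)
      fix x assume x: "x \<in> space (gauss_vec n)"
      show "(\<integral>\<^sup>+v. \<integral>\<^sup>+y. ?K v x y \<partial>gauss_vec n \<partial>gauss_vec n) = (\<integral>\<^sup>+y. \<integral>\<^sup>+v. ?K v x y \<partial>gauss_vec n \<partial>gauss_vec n)"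
      proof (rule G.Fubini')
        have "(\<lambda>p. (snd p, x, fst p)) \<in> gauss_vec n \<Otimes>\<^sub>M gauss_vec n \<rightarrow>\<^sub>M gauss_vec n \<Otimes>\<^sub>M gauss_vec n \<Otimes>\<^sub>M gauss_vec n"
          using x by measurable
        from measurable_compose[OF this K_meas] show "(\<lambda>(y, v). ?K v x y) \<in> borel_measurable (gauss_vec n \<Otimes>\<^sub>M gauss_vec n)"
          by (simp only: split_beta' fst_conv snd_conv)
      qed
    qed
    also have "\<dots> \<le> (\<integral>\<^sup>+x. \<integral>\<^sup>+y. ?B \<partial>gauss_vec n \<partial>gauss_vec n)"
    proof (intro nn_integral_mono)
      fix x y :: "nat \<Rightarrow> real"
      let ?s = "\<lambda>i. sph n P1 x i + sph n P2 y i"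
      have "(\<integral>\<^sup>+v. ?K v x y \<partial>gauss_vec n) = (\<integral>\<^sup>+v. indicator {v. in_cone n t v ?s} v \<partial>gauss_vec n)"
        by (rule nn_integral_cong) (simp only: indicator_def mem_Collect_eq in_cone_sum_iff[symmetric] in_cone_commute[of n t ?s])
      also have "\<dots> \<le> ?B"
      proof (cases "ip n ?s ?s = 0")
        case True
        have "\<not> in_cone n t v ?s" for v
          unfolding in_cone_def ip_commute[of n v ?s] ip_eq_0[OF True, of v] by simp
        then have "(\<integral>\<^sup>+v. indicator {v. in_cone n t v ?s} v \<partial>gauss_vec n) = (\<integral>\<^sup>+v. 0 \<partial>gauss_vec n)"
          by (intro nn_integral_cong) (simp only: indicator_def mem_Collect_eq if_False of_bool_def)
        then show ?thesis by (simp only: nn_integral_const mult_zero_left zero_le)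
      next
        case False
        then have "0 < ip n ?s ?s" using ip_nonneg[of n ?s] by linarith
        then show ?thesis by (rule C(3)[OF n t])
      qed
      finally show "(\<integral>\<^sup>+v. ?K v x y \<partial>gauss_vec n) \<le> ?B" .
    qed
    also have "\<dots> = ?B" by (simp only: nn_integral_const gauss_vec.emeasure_space_1 mult_1_right)
    finally have "h0 \<le> ?B" .
    moreover have "(\<integral>\<^sup>+x. \<integral>\<^sup>+y. indicator {w. in_cone n t (\<lambda>i. sph n P1 (fst w) i + sph n P2 (snd w) i) v} (x, y) \<partial>gauss_vec n \<partial>gauss_vec n) = H v"
      unfolding H_def by (intro nn_integral_cong) (simp only: indicator_def mem_Collect_eq fst_conv snd_conv in_cone_sum_iff)
    ultimately show ?thesis unfolding Hh[OF v] by (simp only:)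
  qed
  then show ?thesis by (rule that[OF C(1,2)])
qed


section \<open>Taylor expansion of the deficit\<close>

lemma abs_sum3: "\<bar>x\<bar> \<le> a \<Longrightarrow> \<bar>y\<bar> \<le> b \<Longrightarrow> \<bar>z\<bar> \<le> c \<Longrightarrow> \<bar>x + y + z\<bar> \<le> a + b + (c :: real)"
  by linarith

lemma abs_diff3: "\<bar>- x - y - z\<bar> \<le> \<bar>x\<bar> + \<bar>y\<bar> + \<bar>z :: real\<bar>"
  by linarith

lemma abs_expansion: "\<bar>l - m / 2 - z\<bar> \<le> \<bar>l - v\<bar> + \<bar>m - h\<bar> / 2 + \<bar>v - h / 2 - z :: real\<bar>"
proof -
  have "l - m / 2 - z = (l - v) + - ((m - h) / 2) + (v - h / 2 - z)" by (simp add: diff_divide_distrib)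
  moreover have "\<bar>- ((m - h) / 2)\<bar> = \<bar>m - h\<bar> / 2" by simp
  ultimately show ?thesis
    using abs_sum3[OF order.refl order.refl order.refl, of "l - v" "- ((m - h) / 2)" "v - h / 2 - z"] by metis
qed

lemma norm_near_one:
  fixes a r :: real
  assumes "\<bar>r\<bar> \<le> 1"
  shows "\<bar>sqrt (a\<^sup>2 + (1 + r)\<^sup>2) - 1\<bar> \<le> \<bar>a\<bar> + \<bar>r\<bar>"
proof -
  have 1: "sqrt (a\<^sup>2 + (1 + r)\<^sup>2) \<le> \<bar>a\<bar> + \<bar>1 + r\<bar>"
    by (rule real_le_lsqrt) (auto simp: power2_eq_square algebra_simps abs_mult_self_eq)
  have 2: "sqrt ((1 + r)\<^sup>2) \<le> sqrt (a\<^sup>2 + (1 + r)\<^sup>2)" by (intro real_sqrt_le_mono) simp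
  show ?thesis using 1 2 assms unfolding real_sqrt_abs by linarith
qed

text \<open>All quantities are divided by n or sqrt n: W is the signal-to-noise ratio, 1 + V the
  norm of the noise, Q the correlation of signal and noise, E that of the two codewords, Y the
  squared norm of signal plus noise. Half the difference of logarithms is ln(1 + V) - ln(1 + h)/2
  with h of first order; its linear part is V - (V + Q + E)/(1 + W) = (W V - Q - E)/(1 + W). The
  bound 72 k T \<le> 1 keeps |h| \<le> 36 k T below 1/2, where the logarithm is quadratically close
  to its argument.\<close>

lemma dispersion_expansion_aux:
  fixes W k V Q E Q0 E0 T :: real
  assumes Pi: "0 \<le> W" and k: "1 \<le> k" and T: "0 \<le> T" "72 * k * T \<le> 1" and V: "\<bar>V\<bar> \<le> T"
    and Q: "\<bar>Q\<bar> \<le> 2 * k * T" and E: "\<bar>E\<bar> \<le> 12 * k * T"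
    and QE: "\<bar>(Q + E) - (Q0 + E0)\<bar> \<le> 40 * k * T\<^sup>2"
    and Y: "Y = W + (1 + V)\<^sup>2 + 2 * (1 + V) * Q + 2 * E"
  shows "\<bar>(ln (1 + W) - ln (Y / (1 + V)\<^sup>2)) / 2 - (W * V - Q0 - E0) / (1 + W)\<bar> \<le> 1400 * k\<^sup>2 * T\<^sup>2" "0 < Y"
proof -
  have kT: "T \<le> k * T" using k T by (simp add: mult_le_cancel_right1)
  have T1: "T \<le> 1 / 72" "k * T \<le> 1 / 72" using kT T by auto
  have V1: "\<bar>V\<bar> \<le> 1 / 72" using V T1 by linarith
  define H where "H = 2 * V + V\<^sup>2 + 2 * (1 + V) * Q + 2 * E"
  define h where "h = H / (1 + W)"
  have V2: "V\<^sup>2 \<le> T\<^sup>2" using V by (metis abs_ge_zero power_mono power2_abs)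
  have T2: "T\<^sup>2 \<le> T" using T T1 by (simp add: power2_eq_square mult_left_le)
  have VQ: "\<bar>(1 + V) * Q\<bar> \<le> 2 * (2 * k * T)"
    unfolding abs_mult using Q V1 by (intro mult_mono) auto
  have "\<bar>H\<bar> \<le> 2 * \<bar>V\<bar> + V\<^sup>2 + 2 * \<bar>(1 + V) * Q\<bar> + 2 * \<bar>E\<bar>"
    unfolding H_def mult.assoc using zero_le_power2[of V] by linarith
  also have "\<dots> \<le> 2 * T + T + 2 * (2 * (2 * k * T)) + 2 * (12 * k * T)"
    using V V2 T2 VQ E by linarith
  also have "\<dots> = 3 * T + 32 * (k * T)" by simp
  also have "\<dots> \<le> 36 * (k * T)" using kT T(1) by linarith
  finally have H36: "\<bar>H\<bar> \<le> 36 * (k * T)" .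
  have Hh: "\<bar>h\<bar> \<le> \<bar>H\<bar>" unfolding h_def abs_divide using Pi by (simp add: divide_le_eq mult_le_cancel_left1)
  then have h36: "\<bar>h\<bar> \<le> 36 * (k * T)" using H36 by linarith
  then have h1: "\<bar>h\<bar> \<le> 3 / 4" using T1 by linarith
  \<comment> \<open>Splitting off the typical value 1 + W of Y leaves the relative deviation h for
    the logarithm.\<close>
  have Yh: "Y = (1 + W) * (1 + h)"
    using Pi unfolding Y h_def H_def by (simp add: field_simps power2_eq_square)
  have pos: "0 < 1 + h" using h1 by linarith
  then show "0 < Y" unfolding Yh using Pi by simp
  have Vp: "0 < 1 + V" using V1 by linarith
  have "ln (Y / (1 + V)\<^sup>2) = ln Y - 2 * ln (1 + V)"
    using \<open>0 < Y\<close> Vp by (simp add: ln_div ln_realpow)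
  also have "ln Y = ln (1 + W) + ln (1 + h)" unfolding Yh using Pi pos by (simp add: ln_mult)
  finally have phi: "(ln (1 + W) - ln (Y / (1 + V)\<^sup>2)) / 2 = ln (1 + V) - ln (1 + h) / 2" by simp
  have lnV: "\<bar>ln (1 + V) - V\<bar> \<le> 2 * V\<^sup>2" using V1 by (intro abs_ln_one_plus_x_minus_x_bound) auto
  have lnh: "\<bar>ln (1 + h) - h\<bar> \<le> 2 * h\<^sup>2"
    using h36 T1 by (intro abs_ln_one_plus_x_minus_x_bound) auto
  have h2: "h\<^sup>2 \<le> (36 * (k * T))\<^sup>2" using h36 by (metis abs_ge_zero power_mono power2_abs)
  have "(36 * (k * T))\<^sup>2 = 1296 * (k\<^sup>2 * T\<^sup>2)" by (simp add: power_mult_distrib)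
  then have h2': "h\<^sup>2 \<le> 1296 * (k\<^sup>2 * T\<^sup>2)" using h2 by linarith
  have kk: "k \<le> k\<^sup>2" "1 \<le> k\<^sup>2" using k by (auto simp: power2_eq_square mult_le_cancel_right1 one_le_power[of k 2, unfolded power2_eq_square])
  have lin: "V - h / 2 - (W * V - Q0 - E0) / (1 + W) = (- (V\<^sup>2 / 2) - V * Q - (Q + E - (Q0 + E0))) / (1 + W)"
  proof -
    have "V - h / 2 - (W * V - Q0 - E0) / (1 + W) = (V * (1 + W) - H / 2 - (W * V - Q0 - E0)) / (1 + W)"
      using Pi by (simp add: h_def diff_divide_distrib)
    also have "V * (1 + W) - H / 2 - (W * V - Q0 - E0) = - (V\<^sup>2 / 2) - V * Q - (Q + E - (Q0 + E0))"
      by (simp add: H_def algebra_simps)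
    finally show ?thesis .
  qed
  have "\<bar>(- (V\<^sup>2 / 2) - V * Q - (Q + E - (Q0 + E0))) / (1 + W)\<bar> \<le> \<bar>- (V\<^sup>2 / 2) - V * Q - (Q + E - (Q0 + E0))\<bar> / 1"
    unfolding abs_divide using Pi by (intro frac_le) auto
  also have "\<dots> \<le> V\<^sup>2 / 2 + \<bar>V * Q\<bar> + \<bar>Q + E - (Q0 + E0)\<bar>"
    using abs_diff3[of "V\<^sup>2 / 2" "V * Q" "Q + E - (Q0 + E0)"] by simp
  also have "\<bar>V * Q\<bar> \<le> T * (2 * k * T)" unfolding abs_mult using V Q T by (intro mult_mono) auto
  finally have lin2: "\<bar>V - h / 2 - (W * V - Q0 - E0) / (1 + W)\<bar> \<le> T\<^sup>2 / 2 + 2 * (k * T\<^sup>2) + 40 * (k * T\<^sup>2)"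
    unfolding lin using V2 QE by (simp add: power2_eq_square mult_ac)
  have kT2: "k * T\<^sup>2 \<le> k\<^sup>2 * T\<^sup>2" "T\<^sup>2 \<le> k\<^sup>2 * T\<^sup>2"
    using kk by (auto intro: mult_right_mono simp: mult_le_cancel_right1)
  have "\<bar>(ln (1 + W) - ln (Y / (1 + V)\<^sup>2)) / 2 - (W * V - Q0 - E0) / (1 + W)\<bar> \<le>
    \<bar>ln (1 + V) - V\<bar> + \<bar>ln (1 + h) - h\<bar> / 2 + \<bar>V - h / 2 - (W * V - Q0 - E0) / (1 + W)\<bar>"
    unfolding phi by (rule abs_expansion)
  also have "\<dots> \<le> 2 * T\<^sup>2 + 1296 * (k\<^sup>2 * T\<^sup>2) + (T\<^sup>2 / 2 + 2 * (k * T\<^sup>2) + 40 * (k * T\<^sup>2))"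
  proof (intro add_mono lin2)
    show "\<bar>ln (1 + V) - V\<bar> \<le> 2 * T\<^sup>2" by (rule order_trans[OF lnV]) (use V2 in simp)
    show "\<bar>ln (1 + h) - h\<bar> / 2 \<le> 1296 * (k\<^sup>2 * T\<^sup>2)"
      by (rule order_trans[OF divide_right_mono[OF lnh, of 2]]) (use h2' in simp_all)
  qed
  also have "\<dots> \<le> 1400 * (k\<^sup>2 * T\<^sup>2)" using kT2 zero_le_power2[of T] by linarith
  finally show "\<bar>(ln (1 + W) - ln (Y / (1 + V)\<^sup>2)) / 2 - (W * V - Q0 - E0) / (1 + W)\<bar> \<le> 1400 * k\<^sup>2 * T\<^sup>2"
    by (simp add: mult.assoc)
qed

text \<open>Putting x and y on their spheres divides quantities of size T by norms that are 1 +
  O(T), so A, B and G change only by O(T^2). This is why the radial deviations R and U do not appear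
  in the linear term.\<close>

lemma sphere_coords_expansion:
  fixes A B G R U T :: real
  assumes T: "0 \<le> T" "72 * T \<le> 1" and b: "\<bar>A\<bar> \<le> T" "\<bar>B\<bar> \<le> T" "\<bar>G\<bar> \<le> T" "\<bar>R\<bar> \<le> T" "\<bar>U\<bar> \<le> T"
  defines "N1 \<equiv> sqrt (A\<^sup>2 + (1 + R)\<^sup>2)" and "N2 \<equiv> sqrt (B\<^sup>2 + G\<^sup>2 + (1 + U)\<^sup>2)"
  shows "\<bar>A / N1 - A\<bar> \<le> 4 * T\<^sup>2" "\<bar>B / N2 - B\<bar> \<le> 6 * T\<^sup>2"
    "\<bar>(A * B + (1 + R) * G) / (N1 * N2) - G\<bar> \<le> 40 * T\<^sup>2" "1 / 2 \<le> N1" "1 / 2 \<le> N2"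
proof -
  have T1: "T \<le> 1 / 72" using T by linarith
  have n1: "\<bar>N1 - 1\<bar> \<le> 2 * T"
    unfolding N1_def using norm_near_one[of R A] b T1 by linarith
  have n2: "\<bar>N2 - 1\<bar> \<le> 3 * T"
  proof -
    have "sqrt (B\<^sup>2 + G\<^sup>2) \<le> \<bar>B\<bar> + \<bar>G\<bar>"
      by (rule real_le_lsqrt) (auto simp: power2_eq_square algebra_simps abs_mult_self_eq)
    moreover have "\<bar>sqrt ((sqrt (B\<^sup>2 + G\<^sup>2))\<^sup>2 + (1 + U)\<^sup>2) - 1\<bar> \<le> \<bar>sqrt (B\<^sup>2 + G\<^sup>2)\<bar> + \<bar>U\<bar>"
      using b T1 by (intro norm_near_one) auto
    moreover have "(sqrt (B\<^sup>2 + G\<^sup>2))\<^sup>2 = B\<^sup>2 + G\<^sup>2" "\<bar>sqrt (B\<^sup>2 + G\<^sup>2)\<bar> = sqrt (B\<^sup>2 + G\<^sup>2)" by auto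
    ultimately show ?thesis unfolding N2_def using b by simp
  qed
  show h1: "1 / 2 \<le> N1" and h2: "1 / 2 \<le> N2" using n1 n2 T1 by (auto simp: abs_le_iff)
  have quot: "\<bar>X / N - X\<bar> \<le> 2 * (S * D)" if "1 / 2 \<le> N" "\<bar>X\<bar> \<le> S" "\<bar>N - 1\<bar> \<le> D" for X N S D :: real
  proof -
    have "X / N - X = - (X * (N - 1)) / N" using that by (simp add: field_simps)
    then have "\<bar>X / N - X\<bar> = \<bar>X\<bar> * \<bar>N - 1\<bar> / N" using that by (simp add: abs_mult)
    also have "\<dots> \<le> (S * D) / (1 / 2)"
      using that by (intro frac_le mult_mono) auto
    finally show ?thesis by simp
  qed
  show "\<bar>A / N1 - A\<bar> \<le> 4 * T\<^sup>2" using quot[OF h1 b(1) n1] by (simp add: power2_eq_square)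
  show "\<bar>B / N2 - B\<bar> \<le> 6 * T\<^sup>2" using quot[OF h2 b(2) n2] by (simp add: power2_eq_square)
  have n12: "\<bar>N1 * N2 - 1\<bar> \<le> 6 * T"
  proof -
    have "N1 * N2 - 1 = (N1 - 1) * (N2 - 1) + (N1 - 1) + (N2 - 1)" by (simp add: algebra_simps)
    moreover have "\<bar>(N1 - 1) * (N2 - 1)\<bar> \<le> (2 * T) * (3 * T)"
      unfolding abs_mult using n1 n2 T by (intro mult_mono) auto
    moreover have "(6 * T) * T \<le> 1 * T" using T by (intro mult_right_mono) auto
    then have "(2 * T) * (3 * T) \<le> T" by simp
    ultimately show ?thesis using abs_sum3[of "(N1 - 1) * (N2 - 1)" T "N1 - 1" "2 * T" "N2 - 1" "3 * T"] n1 n2 by simp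
  qed
  have d: "1 / 4 \<le> N1 * N2" using mult_mono[OF h1 h2] h1 by simp
  have "(A * B + (1 + R) * G) / (N1 * N2) - G = (A * B + G * (R - (N1 * N2 - 1))) / (N1 * N2)"
    using h1 h2 by (simp add: field_simps)
  then have "\<bar>(A * B + (1 + R) * G) / (N1 * N2) - G\<bar> = \<bar>A * B + G * (R - (N1 * N2 - 1))\<bar> / (N1 * N2)"
    using d by (simp add: abs_divide)
  also have "\<dots> \<le> (8 * T\<^sup>2) / (1 / 4)"
  proof (rule frac_le)
    have "\<bar>A * B\<bar> \<le> T * T" unfolding abs_mult using b T by (intro mult_mono) auto
    moreover have "\<bar>G * (R - (N1 * N2 - 1))\<bar> \<le> T * (7 * T)"
      unfolding abs_mult using b T n12 by (intro mult_mono) auto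
    ultimately show "\<bar>A * B + G * (R - (N1 * N2 - 1))\<bar> \<le> 8 * T\<^sup>2"
      unfolding power2_eq_square by linarith
  qed (use d in auto)
  also have "\<dots> \<le> 40 * T\<^sup>2" by simp
  finally show "\<bar>(A * B + (1 + R) * G) / (N1 * N2) - G\<bar> \<le> 40 * T\<^sup>2" .
qed

definition tot :: "real \<Rightarrow> real \<Rightarrow> nat \<Rightarrow> real" where
  "tot P1 P2 i = (if i = 0 then P1 else if i = 1 then P2 else P1 + P2)"

text \<open>The linear part of the deficit, with v for the deviation of the noise norm from sqrt n
  and a, b, g the three Gaussian coordinates of the codewords.\<close>

definition lin :: "real \<Rightarrow> real \<Rightarrow> nat \<Rightarrow> real \<Rightarrow> real \<Rightarrow> real \<Rightarrow> real \<Rightarrow> real" where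
  "lin P1 P2 i v a b g = (tot P1 P2 i * v -
     (if i = 0 then sqrt P1 * a else if i = 1 then sqrt P2 * b else sqrt P1 * a + sqrt P2 * b)
      - (if i = 0 \<or> i = 1 then 0 else sqrt (P1 * P2) * g)) / (1 + tot P1 P2 i)"

text \<open>The squared norm of noise plus signal of kind i, as a function of |z|^2, (x, z), (y, z),
  (x, y), |x|^2, |y|^2 for the Gaussian vectors x, y before normalisation
  (\<open>out_sq_gram_vec\<close>).\<close>

definition out_sq :: "nat \<Rightarrow> real \<Rightarrow> real \<Rightarrow> nat \<Rightarrow> real \<times> real \<times> real \<times> real \<times> real \<times> real \<Rightarrow> real" where
  "out_sq n P1 P2 i = (\<lambda>(zz, p1, p2, p3, p4, p5).
     let \<alpha> = sqrt (real n * P1) / sqrt p4; \<beta> = sqrt (real n * P2) / sqrt p5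
     in if i = 0 then zz + 2 * (\<alpha> * p1) + \<alpha> * (\<alpha> * p4)
        else if i = 1 then zz + 2 * (\<beta> * p2) + \<beta> * (\<beta> * p5)
        else zz + 2 * (\<alpha> * p1) + 2 * (\<beta> * p2) + \<alpha> * (\<alpha> * p4) + 2 * (\<alpha> * \<beta> * p3) + \<beta> * (\<beta> * p5))"

text \<open>The normalised deficit of the information density below capacity: its limit law is that of
  \<open>lin\<close> evaluated at independent Gaussians.\<close>
definition deficit :: "nat \<Rightarrow> real \<Rightarrow> real \<Rightarrow> nat \<Rightarrow> real \<times> real \<times> real \<times> real \<times> real \<times> real \<Rightarrow> real" where
  "deficit n P1 P2 i G = sqrt n * ((ln (1 + tot P1 P2 i) - ln (out_sq n P1 P2 i G / fst G)) / 2)"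

text \<open>These six inner products in triangular coordinates, that is for z = (\<rho>), x = (a, r)
  and y = (b, g, u).\<close>

definition gram :: "real \<Rightarrow> real \<Rightarrow> real \<Rightarrow> real \<Rightarrow> real \<Rightarrow> real \<Rightarrow> real \<times> real \<times> real \<times> real \<times> real \<times> real" where
  "gram \<rho> a r b g u = (\<rho>\<^sup>2, \<rho> * a, \<rho> * b, a * b + r * g, a\<^sup>2 + r\<^sup>2, b\<^sup>2 + g\<^sup>2 + u\<^sup>2)"

text \<open>Squared distance of the six coordinates from their typical values: sqrt n for the three
  norms, 0 for the three Gaussians.\<close>

definition spread :: "nat \<Rightarrow> real \<Rightarrow> real \<Rightarrow> real \<Rightarrow> real \<Rightarrow> real \<Rightarrow> real \<Rightarrow> real" where
  "spread n \<rho> a r b g u = (\<rho> - sqrt n)\<^sup>2 + a\<^sup>2 + (r - sqrt n)\<^sup>2 + b\<^sup>2 + g\<^sup>2 + (u - sqrt n)\<^sup>2"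

definition pow_const :: "real \<Rightarrow> real \<Rightarrow> real" where
  "pow_const P1 P2 = 1 + sqrt P1 + sqrt P2 + sqrt (P1 * P2)"

text \<open>After division by sqrt n every coordinate deviates from its typical value by at most T =
  sqrt(p/n), so \<open>sphere_coords_expansion\<close> and \<open>dispersion_expansion_aux\<close>
  bound the remainder by a multiple of sqrt n T^2 = p/sqrt n.\<close>

lemma deficit_expansion:
  fixes P1 P2 \<rho> a r b g u :: real and n i :: nat
  assumes P: "0 < P1" "0 < P2" and n: "1 \<le> n" and i: "i < 3"
  defines "k \<equiv> pow_const P1 P2" and "p \<equiv> spread n \<rho> a r b g u"
  assumes small: "(72 * k)\<^sup>2 * p \<le> n"
  shows "\<bar>deficit n P1 P2 i (gram \<rho> a r b g u) - lin P1 P2 i (\<rho> - sqrt n) a b g\<bar> \<le> 1400 * k\<^sup>2 * p / sqrt n"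
    and "\<bar>lin P1 P2 i (\<rho> - sqrt n) a b g\<bar> \<le> 2 * k * sqrt p"
proof -
  define s where "s = sqrt n"
  have s: "0 < s" "s\<^sup>2 = n" using n by (auto simp: s_def)
  define V where "V = \<rho> / s - 1"
  define A where "A = a / s"
  define R where "R = r / s - 1"
  define B where "B = b / s"
  define G where "G = g / s"
  define U where "U = u / s - 1"
  have vars: "\<rho> = s * (1 + V)" "a = s * A" "r = s * (1 + R)" "b = s * B" "g = s * G" "u = s * (1 + U)"
    using s by (simp_all add: V_def A_def R_def B_def G_def U_def)
  \<comment> \<open>The Euclidean norm of the six relative deviations, hence a bound for each of
    them.\<close>
  define T where "T = sqrt p / s"
  have p0: "0 \<le> p" unfolding p_def spread_def by (intro add_nonneg_nonneg) auto
  have T0: "0 \<le> T" using p0 s by (simp add: T_def)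
  have T2: "T\<^sup>2 = p / n" using p0 s by (simp add: T_def power_divide)
  have p_eq: "p = s\<^sup>2 * (V\<^sup>2 + A\<^sup>2 + R\<^sup>2 + B\<^sup>2 + G\<^sup>2 + U\<^sup>2)"
    unfolding p_def spread_def s_def[symmetric] vars by (simp add: power2_eq_square algebra_simps)
  have sumT: "V\<^sup>2 + A\<^sup>2 + R\<^sup>2 + B\<^sup>2 + G\<^sup>2 + U\<^sup>2 = T\<^sup>2"
    using s n unfolding T2 p_eq by simp
  have sq: "\<bar>X\<bar> \<le> T" if "X\<^sup>2 \<le> T\<^sup>2" for X using that T0 by (metis abs_le_square_iff abs_of_nonneg)
  have nn: "0 \<le> V\<^sup>2" "0 \<le> A\<^sup>2" "0 \<le> R\<^sup>2" "0 \<le> B\<^sup>2" "0 \<le> G\<^sup>2" "0 \<le> U\<^sup>2" by auto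
  have bV: "\<bar>V\<bar> \<le> T" and bA: "\<bar>A\<bar> \<le> T" and bR: "\<bar>R\<bar> \<le> T" and bB: "\<bar>B\<bar> \<le> T" and bG: "\<bar>G\<bar> \<le> T" and bU: "\<bar>U\<bar> \<le> T"
    by (rule sq, use sumT nn in linarith)+
  define c1 where "c1 = sqrt P1"
  define c2 where "c2 = sqrt P2"
  define c3 where "c3 = sqrt (P1 * P2)"
  have c: "0 \<le> c1" "0 \<le> c2" "0 \<le> c3" "c1\<^sup>2 = P1" "c2\<^sup>2 = P2" "c1 * c2 = c3"
    using P by (auto simp: c1_def c2_def c3_def real_sqrt_mult)
  have k: "k = 1 + c1 + c2 + c3" by (simp add: k_def pow_const_def c1_def c2_def c3_def)
  have k1: "1 \<le> k" using c by (simp add: k)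
  have kT: "72 * k * T \<le> 1"
  proof -
    have "(72 * k * T)\<^sup>2 \<le> 1" using small n by (simp add: power_mult_distrib T2 divide_le_eq)
    then show ?thesis by (metis abs_le_square_iff abs_of_nonneg abs_ge_self one_power2 abs_one order_trans)
  qed
  have "T \<le> k * T" using k1 T0 by (simp add: mult_le_cancel_right1)
  then have T72: "72 * T \<le> 1" using kT by linarith
  define N1 where "N1 = sqrt (A\<^sup>2 + (1 + R)\<^sup>2)"
  define N2 where "N2 = sqrt (B\<^sup>2 + G\<^sup>2 + (1 + U)\<^sup>2)"
  define \<Gamma> where "\<Gamma> = (A * B + (1 + R) * G) / (N1 * N2)"
  note sc = sphere_coords_expansion[OF T0 T72 bA bB bG bR bU, folded N1_def N2_def, folded \<Gamma>_def]
  have N: "0 < N1" "0 < N2" using sc(4,5) by auto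
  have TT: "40 * T\<^sup>2 \<le> T" using T72 T0 mult_right_mono[of "40 * T" 1 T] by (simp add: power2_eq_square)
  have AN: "\<bar>A / N1\<bar> \<le> 2 * T" using sc(1) bA TT T0 by linarith
  have BN: "\<bar>B / N2\<bar> \<le> 2 * T" using sc(2) bB TT T0 by linarith
  have GN: "\<bar>\<Gamma>\<bar> \<le> 2 * T" using sc(3) bG TT T0 by linarith
  have n1: "sqrt (a\<^sup>2 + r\<^sup>2) = s * N1"
  proof -
    have "a\<^sup>2 + r\<^sup>2 = s\<^sup>2 * (A\<^sup>2 + (1 + R)\<^sup>2)" unfolding vars by (simp only: power_mult_distrib distrib_left[of "s\<^sup>2"])
    then show ?thesis using s(1) by (simp add: N1_def real_sqrt_mult)
  qed
  have n2: "sqrt (b\<^sup>2 + g\<^sup>2 + u\<^sup>2) = s * N2"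
  proof -
    have "b\<^sup>2 + g\<^sup>2 + u\<^sup>2 = s\<^sup>2 * (B\<^sup>2 + G\<^sup>2 + (1 + U)\<^sup>2)" unfolding vars by (simp only: power_mult_distrib distrib_left[of "s\<^sup>2"])
    then show ?thesis using s(1) by (simp add: N2_def real_sqrt_mult)
  qed
  define \<alpha> where "\<alpha> = sqrt (real n * P1) / sqrt (a\<^sup>2 + r\<^sup>2)"
  define \<beta> where "\<beta> = sqrt (real n * P2) / sqrt (b\<^sup>2 + g\<^sup>2 + u\<^sup>2)"
  have al: "\<alpha> = c1 / N1" "\<beta> = c2 / N2"
    using s N by (simp_all add: \<alpha>_def \<beta>_def n1 n2 real_sqrt_mult s_def[symmetric] c1_def c2_def)
  have n1': "a\<^sup>2 + r\<^sup>2 = s\<^sup>2 * N1\<^sup>2" and n2': "b\<^sup>2 + g\<^sup>2 + u\<^sup>2 = s\<^sup>2 * N2\<^sup>2"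
    using n1 n2 real_sqrt_pow2[of "a\<^sup>2 + r\<^sup>2"] real_sqrt_pow2[of "b\<^sup>2 + g\<^sup>2 + u\<^sup>2"] by (simp_all add: power_mult_distrib)
  have e1: "\<alpha> * (\<rho> * a) = s\<^sup>2 * ((1 + V) * (c1 * (A / N1)))"
    unfolding al vars by (simp add: power2_eq_square)
  have e2: "\<beta> * (\<rho> * b) = s\<^sup>2 * ((1 + V) * (c2 * (B / N2)))"
    unfolding al vars by (simp add: power2_eq_square)
  have e3: "\<alpha> * \<beta> * (a * b + r * g) = s\<^sup>2 * (c3 * \<Gamma>)"
    unfolding al vars \<Gamma>_def c(6)[symmetric] by (simp add: power2_eq_square algebra_simps add_divide_distrib)
  have e4: "\<alpha> * (\<alpha> * (a\<^sup>2 + r\<^sup>2)) = s\<^sup>2 * P1"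
    unfolding al n1' c(4)[symmetric] using N by (simp add: power2_eq_square)
  have e5: "\<beta> * (\<beta> * (b\<^sup>2 + g\<^sup>2 + u\<^sup>2)) = s\<^sup>2 * P2"
    unfolding al n2' c(5)[symmetric] using N by (simp add: power2_eq_square)
  have e0: "\<rho>\<^sup>2 = s\<^sup>2 * (1 + V)\<^sup>2" unfolding vars by (simp add: power_mult_distrib)
  define Q where "Q = (if i = 0 then c1 * (A / N1) else if i = 1 then c2 * (B / N2) else c1 * (A / N1) + c2 * (B / N2))"
  define E where "E = (if i = 0 \<or> i = 1 then 0 else c3 * \<Gamma>)"
  define Q0 where "Q0 = (if i = 0 then c1 * A else if i = 1 then c2 * B else c1 * A + c2 * B)"
  define E0 where "E0 = (if i = 0 \<or> i = 1 then 0 else c3 * G)"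
  define Y where "Y = tot P1 P2 i + (1 + V)\<^sup>2 + 2 * (1 + V) * Q + 2 * E"
  have out: "out_sq n P1 P2 i (gram \<rho> a r b g u) = s\<^sup>2 * Y"
    unfolding out_sq_def gram_def split Let_def \<alpha>_def[symmetric] \<beta>_def[symmetric] e0 e1 e2 e3 e4 e5
    by (simp add: Y_def tot_def Q_def E_def algebra_simps add_divide_distrib)
  have mult_b: "\<bar>x * y\<bar> \<le> x * z" if "0 \<le> x" "\<bar>y\<bar> \<le> z" for x y z :: real
    using that by (simp add: abs_mult mult_left_mono)
  have q1: "\<bar>c1 * (A / N1)\<bar> \<le> c1 * (2 * T)" "\<bar>c2 * (B / N2)\<bar> \<le> c2 * (2 * T)" "\<bar>c3 * \<Gamma>\<bar> \<le> c3 * (2 * T)"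
    by (intro mult_b c AN BN GN)+
  have q2: "\<bar>c1 * (A / N1 - A)\<bar> \<le> c1 * (40 * T\<^sup>2)" "\<bar>c2 * (B / N2 - B)\<bar> \<le> c2 * (40 * T\<^sup>2)" "\<bar>c3 * (\<Gamma> - G)\<bar> \<le> c3 * (40 * T\<^sup>2)"
    by (intro mult_b c order_trans[OF sc(1)] order_trans[OF sc(2)] sc(3); simp)+
  have cT: "0 \<le> c1 * T" "0 \<le> c2 * T" "0 \<le> c3 * T" "0 \<le> c1 * T\<^sup>2" "0 \<le> c2 * T\<^sup>2" "0 \<le> c3 * T\<^sup>2" "0 \<le> T\<^sup>2" using c T0 by auto
  have kTe: "k * T = T + c1 * T + c2 * T + c3 * T" "k * T\<^sup>2 = T\<^sup>2 + c1 * T\<^sup>2 + c2 * T\<^sup>2 + c3 * T\<^sup>2" by (auto simp: k algebra_simps)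
  have bQ: "\<bar>Q\<bar> \<le> 2 * k * T"
  proof -
    have "\<bar>Q\<bar> \<le> c1 * (2 * T) + c2 * (2 * T)"
      using q1 cT abs_triangle_ineq[of "c1 * (A / N1)" "c2 * (B / N2)"] by (auto simp: Q_def)
    also have "\<dots> \<le> 2 * (k * T)" unfolding kTe using cT T0 by (simp add: algebra_simps)
    finally show ?thesis by simp
  qed
  have bE: "\<bar>E\<bar> \<le> 12 * k * T"
  proof -
    have "\<bar>E\<bar> \<le> c3 * (2 * T)" using q1(3) c(3) T0 by (auto simp: E_def)
    also have "\<dots> \<le> 12 * (k * T)" unfolding kTe using cT T0 by (simp add: algebra_simps)
    finally show ?thesis by simp
  qed
  have bQE: "\<bar>(Q + E) - (Q0 + E0)\<bar> \<le> 40 * k * T\<^sup>2"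
  proof -
    have "(Q + E) - (Q0 + E0) = (if i = 0 then c1 * (A / N1 - A) else if i = 1 then c2 * (B / N2 - B)
        else c1 * (A / N1 - A) + c2 * (B / N2 - B) + c3 * (\<Gamma> - G))"
      by (auto simp: Q_def E_def Q0_def E0_def algebra_simps)
    also have "\<bar>\<dots>\<bar> \<le> c1 * (40 * T\<^sup>2) + c2 * (40 * T\<^sup>2) + c3 * (40 * T\<^sup>2)"
      using q2 cT abs_sum3[OF q2] by auto
    also have "\<dots> \<le> 40 * (k * T\<^sup>2)" unfolding kTe using cT T0 by (simp add: algebra_simps)
    finally show ?thesis by simp
  qed
  have tot0: "0 \<le> tot P1 P2 i" using P by (simp add: tot_def)
  note exp = dispersion_expansion_aux[OF tot0 k1 T0 kT bV bQ bE bQE Y_def]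
  have ratio: "out_sq n P1 P2 i (gram \<rho> a r b g u) / fst (gram \<rho> a r b g u) = Y / (1 + V)\<^sup>2"
    unfolding out using s(1) by (simp add: gram_def e0)
  have lin_eq: "lin P1 P2 i (\<rho> - sqrt n) a b g = s * ((tot P1 P2 i * V - Q0 - E0) / (1 + tot P1 P2 i))"
  proof -
    have v: "\<rho> - sqrt n = s * V" unfolding s_def[symmetric] vars by (simp add: algebra_simps)
    show ?thesis unfolding lin_def v c1_def[symmetric] c2_def[symmetric] c3_def[symmetric] vars(2,4,5) times_divide_eq_right
      by (intro arg_cong2[where f="(/)"]) (auto simp: Q0_def E0_def algebra_simps)
  qed
  have "deficit n P1 P2 i (gram \<rho> a r b g u) - lin P1 P2 i (\<rho> - sqrt n) a b g =
      s * ((ln (1 + tot P1 P2 i) - ln (Y / (1 + V)\<^sup>2)) / 2 - (tot P1 P2 i * V - Q0 - E0) / (1 + tot P1 P2 i))"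
    unfolding deficit_def ratio lin_eq unfolding s_def[symmetric] by (simp only: right_diff_distrib)
  also have "\<bar>\<dots>\<bar> \<le> s * (1400 * k\<^sup>2 * T\<^sup>2)"
    using exp(1) s by (simp add: abs_mult mult_left_mono)
  also have "\<dots> = 1400 * k\<^sup>2 * p / sqrt n"
    unfolding T2 unfolding s(2)[symmetric] s_def[symmetric] using s(1) by (simp add: power2_eq_square)
  finally show "\<bar>deficit n P1 P2 i (gram \<rho> a r b g u) - lin P1 P2 i (\<rho> - sqrt n) a b g\<bar> \<le> 1400 * k\<^sup>2 * p / sqrt n" .
  have q3: "\<bar>c1 * A\<bar> \<le> c1 * T" "\<bar>c2 * B\<bar> \<le> c2 * T" "\<bar>c3 * G\<bar> \<le> c3 * T"
    by (intro mult_b c bA bB bG)+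
  have "\<bar>(tot P1 P2 i * V - Q0 - E0) / (1 + tot P1 P2 i)\<bar> \<le> \<bar>V\<bar> + \<bar>Q0 + E0\<bar>"
  proof -
    define w where "w = tot P1 P2 i"
    have "\<bar>(w * V - Q0 - E0) / (1 + w)\<bar> = \<bar>w * V - (Q0 + E0)\<bar> / (1 + w)" using tot0 by (simp add: w_def abs_divide)
    also have "\<dots> \<le> (w * \<bar>V\<bar> + \<bar>Q0 + E0\<bar>) / (1 + w)"
      using tot0 abs_triangle_ineq4[of "w * V" "Q0 + E0"] by (intro divide_right_mono) (auto simp: w_def abs_mult)
    also have "\<dots> \<le> ((1 + w) * (\<bar>V\<bar> + \<bar>Q0 + E0\<bar>)) / (1 + w)"
      using tot0 by (intro divide_right_mono) (auto simp: w_def algebra_simps)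
    also have "\<dots> = \<bar>V\<bar> + \<bar>Q0 + E0\<bar>" using tot0 by (simp add: w_def)
    finally show ?thesis by (simp add: w_def)
  qed
  also have "\<dots> \<le> T + (c1 * T + c2 * T + c3 * T)"
  proof (rule add_mono[OF bV])
    show "\<bar>Q0 + E0\<bar> \<le> c1 * T + c2 * T + c3 * T"
      using q3 cT abs_sum3[OF q3] by (auto simp: Q0_def E0_def)
  qed
  also have "\<dots> \<le> 2 * (k * T)" unfolding kTe using cT T0 by (simp add: algebra_simps)
  finally have "s * \<bar>(tot P1 P2 i * V - Q0 - E0) / (1 + tot P1 P2 i)\<bar> \<le> s * (2 * (k * T))"
    using s by (intro mult_left_mono) auto
  moreover have "s * (2 * (k * T)) = 2 * k * sqrt p" using s by (simp add: T_def)
  moreover have "\<bar>lin P1 P2 i (\<rho> - sqrt n) a b g\<bar> = s * \<bar>(tot P1 P2 i * V - Q0 - E0) / (1 + tot P1 P2 i)\<bar>"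
    unfolding lin_eq abs_mult using s by simp
  ultimately show "\<bar>lin P1 P2 i (\<rho> - sqrt n) a b g\<bar> \<le> 2 * k * sqrt p" by (simp only:)
qed


section \<open>Slabs of quadratic thickness and moment bounds\<close>

lemma nn_integral_add_const_le:
  assumes "prob_space M" and s: "0 \<le> s" "0 \<le> C" and f: "f \<in> borel_measurable M" "\<And>y. 0 \<le> f y"
    and le: "(\<integral>\<^sup>+y. ennreal (f y) \<partial>M) \<le> ennreal C"
  shows "(\<integral>\<^sup>+y. ennreal (s + f y) \<partial>M) \<le> ennreal (s + C)"
proof -
  interpret prob_space M by fact
  have "(\<integral>\<^sup>+y. ennreal (s + f y) \<partial>M) = (\<integral>\<^sup>+y. ennreal s + ennreal (f y) \<partial>M)"
    using s f by (simp add: ennreal_plus)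
  also have "\<dots> = (\<integral>\<^sup>+y. ennreal s \<partial>M) + (\<integral>\<^sup>+y. ennreal (f y) \<partial>M)"
    using f by (intro nn_integral_add) auto
  also have "\<dots> \<le> ennreal s + ennreal C" using le by (simp add: emeasure_space_1)
  also have "\<dots> = ennreal (s + C)" using s by simp
  finally show ?thesis .
qed

lemma nn_integral_std_normal_sq: "(\<integral>\<^sup>+x. ennreal (x\<^sup>2) \<partial>std_normal) \<le> ennreal 1"
proof -
  have "(\<integral>\<^sup>+x. ennreal (x\<^sup>2) \<partial>std_normal) = (\<integral>\<^sup>+x. ennreal (std_normal_density x) * ennreal (x\<^sup>2) \<partial>lborel)"
    by (rule nn_integral_std_normal) simp
  also have "\<dots> = (\<integral>\<^sup>+x. ennreal (std_normal_density x * x ^ 2) \<partial>lborel)"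
    by (simp add: ennreal_mult)
  also have "\<dots> = ennreal (integral\<^sup>L lborel (\<lambda>x. std_normal_density x * x ^ 2))"
    by (intro nn_integral_eq_integral integrable_std_normal_moment) auto
  also have "integral\<^sup>L lborel (\<lambda>x. std_normal_density x * x ^ 2) = 1"
    using integral_std_normal_moment_even[of 1] by simp
  finally show ?thesis by simp
qed

definition slab_const :: real where
  "slab_const = 66 * exp (1 / 4) / (1 - exp (- 1 / 4))"

lemma slab_const_pos: "0 < slab_const"
  by (simp add: slab_const_def)

text \<open>The Taylor remainder is quadratic and not bounded, so the thickness of the slab grows
  with a. The line is cut according to the integer part j of |a|: on each piece the thickness is at
  most \<open>\<eta> j\<close>, the slab is an interval of length 2 \<eta> j / |c|, and the density
  is at most exp(-j/2). The sum over j is geometric, with value \<open>slab_const\<close>.\<close>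

lemma std_normal_slab:
  fixes c w q \<delta> :: real
  assumes c: "c \<noteq> 0" and \<delta>: "0 \<le> \<delta>" and q: "1 \<le> q"
  shows "(\<integral>\<^sup>+a. indicator {a. \<bar>c * a + w\<bar> \<le> \<delta> * (q + a\<^sup>2)} a \<partial>std_normal) \<le> ennreal (slab_const / \<bar>c\<bar> * \<delta> * q)"
proof -
  let ?S = "{a. \<bar>c * a + w\<bar> \<le> \<delta> * (q + a\<^sup>2)}"
  define \<eta> where "\<eta> j = \<delta> * (q + (real j + 1)\<^sup>2)" for j :: nat
  have \<eta>0: "0 \<le> \<eta> j" for j using \<delta> q by (simp add: \<eta>_def)
  have "(\<integral>\<^sup>+a. indicator ?S a \<partial>std_normal) = (\<integral>\<^sup>+a. ennreal (std_normal_density a) * indicator ?S a \<partial>lborel)"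
    by (rule nn_integral_std_normal) measurable
  also have "\<dots> \<le> (\<integral>\<^sup>+a. (\<Sum>j. ennreal (exp (- real j / 2)) * indicator {a. \<bar>c * a + w\<bar> \<le> \<eta> j} a) \<partial>lborel)"
  proof (rule nn_integral_mono)
    fix a :: real
    define j where "j = nat \<lfloor>\<bar>a\<bar>\<rfloor>"
    have j: "real j \<le> \<bar>a\<bar>" "\<bar>a\<bar> \<le> real j + 1" unfolding j_def by linarith+
    have "ennreal (std_normal_density a) * indicator ?S a \<le> ennreal (exp (- real j / 2)) * indicator {a. \<bar>c * a + w\<bar> \<le> \<eta> j} a"
    proof (cases "a \<in> ?S")
      case True
      have a2: "a\<^sup>2 \<le> (real j + 1)\<^sup>2" using j(2) by (metis abs_ge_zero power_mono power2_abs)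
      have "\<bar>c * a + w\<bar> \<le> \<delta> * (q + a\<^sup>2)" using True by simp
      also have "\<dots> \<le> \<eta> j" unfolding \<eta>_def using \<delta> a2 by (intro mult_left_mono) auto
      finally have 1: "\<bar>c * a + w\<bar> \<le> \<eta> j" .
      have "std_normal_density a \<le> 1 * exp (- a\<^sup>2 / 2)"
        unfolding std_normal_density_def
      proof (intro mult_right_mono)
        have "1 \<le> sqrt (2 * pi)" using pi_gt3 by (intro real_le_rsqrt) auto
        then show "1 / sqrt (2 * pi) \<le> 1" by simp
      qed auto
      also have "\<dots> \<le> exp (- real j / 2)"
      proof -
        have "real j \<le> (real j)\<^sup>2" by (cases j) (auto simp: power2_eq_square)
        also have "\<dots> \<le> a\<^sup>2" using j(1) by (metis of_nat_0_le_iff power_mono power2_abs)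
        finally show ?thesis by simp
      qed
      finally show ?thesis using True 1 by (simp add: ennreal_leI)
    qed auto
    also have "\<dots> \<le> (\<Sum>j. ennreal (exp (- real j / 2)) * indicator {a. \<bar>c * a + w\<bar> \<le> \<eta> j} a)"
    proof -
      define F where "F i = ennreal (exp (- real i / 2)) * indicator {a. \<bar>c * a + w\<bar> \<le> \<eta> i} a" for i
      have "sum F {j} \<le> (\<Sum>i. F i)" by (rule sum_le_suminf) auto
      then have "F j \<le> (\<Sum>i. F i)" by simp
      then show ?thesis unfolding F_def .
    qed
    finally show "ennreal (std_normal_density a) * indicator ?S a \<le> (\<Sum>j. ennreal (exp (- real j / 2)) * indicator {a. \<bar>c * a + w\<bar> \<le> \<eta> j} a)" .
  qed
  also have "\<dots> = (\<Sum>j. \<integral>\<^sup>+a. ennreal (exp (- real j / 2)) * indicator {a. \<bar>c * a + w\<bar> \<le> \<eta> j} a \<partial>lborel)"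
    by (rule nn_integral_suminf) measurable
  also have "\<dots> \<le> (\<Sum>j. ennreal (66 * exp (1 / 4) / \<bar>c\<bar> * \<delta> * q * exp (- 1 / 4) ^ j))"
  proof (rule suminf_le)
    fix j
    have "(\<integral>\<^sup>+a. indicator {a. \<bar>c * a + w\<bar> \<le> \<eta> j} a \<partial>lborel) \<le> ennreal (2 * \<eta> j / \<bar>c\<bar>)"
    proof -
      have "(\<integral>\<^sup>+a. indicator {a. \<bar>c * a + w\<bar> \<le> \<eta> j} a \<partial>lborel) =
        ennreal \<bar>1 / c\<bar> * (\<integral>\<^sup>+y. indicator {a. \<bar>c * a + w\<bar> \<le> \<eta> j} (- w / c + 1 / c * y) \<partial>lborel)"
        using c by (intro nn_integral_real_affine) auto
      also have "(\<lambda>y. indicator {a. \<bar>c * a + w\<bar> \<le> \<eta> j} (- w / c + 1 / c * y)) = (indicator {- \<eta> j..\<eta> j} :: real \<Rightarrow> ennreal)"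
        using c by (auto simp: fun_eq_iff indicator_def algebra_simps abs_le_iff)
      also have "(\<integral>\<^sup>+y. indicator {- \<eta> j..\<eta> j} y \<partial>lborel) = ennreal (2 * \<eta> j)"
        using \<eta>0[of j] by simp
      also have "ennreal \<bar>1 / c\<bar> * ennreal (2 * \<eta> j) = ennreal (2 * \<eta> j / \<bar>c\<bar>)"
        using \<eta>0[of j] by (subst ennreal_mult[symmetric]) auto
      finally show ?thesis by simp
    qed
    then have "(\<integral>\<^sup>+a. ennreal (exp (- real j / 2)) * indicator {a. \<bar>c * a + w\<bar> \<le> \<eta> j} a \<partial>lborel) \<le> ennreal (exp (- real j / 2)) * ennreal (2 * \<eta> j / \<bar>c\<bar>)"
      by (subst nn_integral_cmult) (auto intro!: mult_left_mono)
    also have "\<dots> = ennreal (exp (- real j / 2) * (2 * \<eta> j / \<bar>c\<bar>))"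
      using \<eta>0[of j] by (subst ennreal_mult[symmetric]) auto
    also have "\<dots> \<le> ennreal (66 * exp (1 / 4) / \<bar>c\<bar> * \<delta> * q * exp (- 1 / 4) ^ j)"
    proof (rule ennreal_leI)
      \<comment> \<open>The Taylor bound for exp gives 1 + (j + 1)^2 = 1 + 32 (t^2/2) \<le> 33 exp
        t, and exp(-j/2) exp t = exp(1/4) exp(-1/4)^j leaves a convergent series.\<close>
      define t where "t = (real j + 1) / 4"
      have "1 + t + t\<^sup>2 / 2 \<le> exp t" by (rule exp_lower_Taylor_quadratic) (simp add: t_def)
      moreover have "0 \<le> t" by (simp add: t_def)
      ultimately have "t\<^sup>2 / 2 \<le> exp t" "1 \<le> exp t" using zero_le_power2[of t] by linarith+
      moreover have "1 + (real j + 1)\<^sup>2 = 1 + 32 * (t\<^sup>2 / 2)" by (simp add: t_def power_divide)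
      ultimately have "1 + (real j + 1)\<^sup>2 \<le> 33 * exp t" by linarith
      moreover have "q + (real j + 1)\<^sup>2 \<le> q * (1 + (real j + 1)\<^sup>2)"
        using q mult_right_mono[of 1 q "(real j + 1)\<^sup>2"] by (simp add: algebra_simps)
      ultimately have "q + (real j + 1)\<^sup>2 \<le> q * (33 * exp t)" using q by (meson mult_left_mono order_trans zero_le_one)
      then have "\<eta> j \<le> \<delta> * (q * (33 * exp t))" unfolding \<eta>_def using \<delta> by (rule mult_left_mono)
      then have "exp (- real j / 2) * (2 * \<eta> j / \<bar>c\<bar>) \<le> exp (- real j / 2) * (2 * (\<delta> * (q * (33 * exp t))) / \<bar>c\<bar>)"
        by (intro mult_left_mono divide_right_mono) auto
      also have "\<dots> = 66 / \<bar>c\<bar> * \<delta> * q * (exp (- real j / 2) * exp t)" by simp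
      also have "exp (- real j / 2) * exp t = exp (1 / 4) * exp (- 1 / 4) ^ j"
        by (simp add: t_def exp_add[symmetric] exp_of_nat_mult[symmetric] field_simps)
      finally show "exp (- real j / 2) * (2 * \<eta> j / \<bar>c\<bar>) \<le> 66 * exp (1 / 4) / \<bar>c\<bar> * \<delta> * q * exp (- 1 / 4) ^ j"
        by (simp add: mult_ac)
    qed
    finally show "(\<integral>\<^sup>+a. ennreal (exp (- real j / 2)) * indicator {a. \<bar>c * a + w\<bar> \<le> \<eta> j} a \<partial>lborel) \<le> ennreal (66 * exp (1 / 4) / \<bar>c\<bar> * \<delta> * q * exp (- 1 / 4) ^ j)" .
  qed auto
  also have "\<dots> = ennreal (\<Sum>j. 66 * exp (1 / 4) / \<bar>c\<bar> * \<delta> * q * exp (- 1 / 4) ^ j)"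
    using \<delta> q by (intro suminf_ennreal2 summable_mult summable_geometric) auto
  also have "(\<Sum>j. 66 * exp (1 / 4) / \<bar>c\<bar> * \<delta> * q * exp (- 1 / 4) ^ j) = slab_const / \<bar>c\<bar> * \<delta> * q"
    by (subst suminf_mult) (auto simp: summable_geometric suminf_geometric slab_const_def)
  finally show ?thesis .
qed

text \<open>Law of the coordinates (a, r, b, g, u) of the two codeword vectors. The noise norm
  \<rho> is kept apart because it alone is replaced by a Gaussian.\<close>

definition mac5 :: "nat \<Rightarrow> (real \<times> real \<times> real \<times> real \<times> real) measure" where
  "mac5 n = std_normal \<Otimes>\<^sub>M chi (n - 1) \<Otimes>\<^sub>M std_normal \<Otimes>\<^sub>M std_normal \<Otimes>\<^sub>M chi (n - 2)"

lemma prob_space_mac5: "prob_space (mac5 n)"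
  unfolding mac5_def by (intro prob_space_pair prob_space_std_normal prob_space_chi)

interpretation mac5: prob_space "mac5 n" for n
  by (rule prob_space_mac5)

lemma sets_mac5 [measurable_cong]: "sets (mac5 n) = sets (borel \<Otimes>\<^sub>M borel \<Otimes>\<^sub>M borel \<Otimes>\<^sub>M borel \<Otimes>\<^sub>M borel)"
  unfolding mac5_def by (intro sets_pair_measure_cong sets_std_normal sets_chi)

lemma nn_integral_mac5:
  assumes f: "f \<in> borel_measurable (mac5 n)"
  shows "(\<integral>\<^sup>+\<omega>. f \<omega> \<partial>mac5 n) = (\<integral>\<^sup>+a. \<integral>\<^sup>+r. \<integral>\<^sup>+b. \<integral>\<^sup>+g. \<integral>\<^sup>+u. f (a, r, b, g, u) \<partial>chi (n - 2) \<partial>std_normal \<partial>std_normal \<partial>chi (n - 1) \<partial>std_normal)"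
proof -
  let ?M2 = "std_normal \<Otimes>\<^sub>M chi (n - 2)"
  let ?M3 = "std_normal \<Otimes>\<^sub>M ?M2"
  let ?M4 = "chi (n - 1) \<Otimes>\<^sub>M ?M3"
  interpret p2: prob_space ?M2 by (intro prob_space_pair prob_space_std_normal prob_space_chi)
  interpret p3: prob_space ?M3 by (intro prob_space_pair prob_space_std_normal prob_space_chi)
  interpret p4: prob_space ?M4 by (intro prob_space_pair prob_space_std_normal prob_space_chi)
  have f5: "f \<in> borel_measurable (std_normal \<Otimes>\<^sub>M ?M4)" using f by (simp add: mac5_def)
  have f4: "(\<lambda>y. f (a, y)) \<in> borel_measurable ?M4" for a
    using measurable_compose[OF measurable_Pair1' f5] by simp
  have f3: "(\<lambda>y. f (a, r, y)) \<in> borel_measurable ?M3" for a r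
    using measurable_compose[OF measurable_Pair1' f4] by simp
  have f2: "(\<lambda>y. f (a, r, b, y)) \<in> borel_measurable ?M2" for a r b
    using measurable_compose[OF measurable_Pair1' f3] by simp
  have "(\<integral>\<^sup>+\<omega>. f \<omega> \<partial>mac5 n) = (\<integral>\<^sup>+a. \<integral>\<^sup>+y. f (a, y) \<partial>?M4 \<partial>std_normal)"
    unfolding mac5_def by (rule p4.nn_integral_fst[symmetric, OF f5])
  also have "\<dots> = (\<integral>\<^sup>+a. \<integral>\<^sup>+r. \<integral>\<^sup>+y. f (a, r, y) \<partial>?M3 \<partial>chi (n - 1) \<partial>std_normal)"
    by (intro nn_integral_cong) (rule p3.nn_integral_fst[symmetric, OF f4])
  also have "\<dots> = (\<integral>\<^sup>+a. \<integral>\<^sup>+r. \<integral>\<^sup>+b. \<integral>\<^sup>+y. f (a, r, b, y) \<partial>?M2 \<partial>std_normal \<partial>chi (n - 1) \<partial>std_normal)"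
    by (intro nn_integral_cong) (rule p2.nn_integral_fst[symmetric, OF f3])
  also have "\<dots> = (\<integral>\<^sup>+a. \<integral>\<^sup>+r. \<integral>\<^sup>+b. \<integral>\<^sup>+g. \<integral>\<^sup>+u. f (a, r, b, g, u) \<partial>chi (n - 2) \<partial>std_normal \<partial>std_normal \<partial>chi (n - 1) \<partial>std_normal)"
    by (intro nn_integral_cong) (rule chi.nn_integral_fst[symmetric, OF f2])
  finally show ?thesis .
qed

lemma sqrt_nat_diff_le:
  assumes "j \<le> n"
  shows "0 \<le> sqrt (real n) - sqrt (real (n - j))" "sqrt (real n) - sqrt (real (n - j)) \<le> real j / sqrt (real n)"
proof -
  show "0 \<le> sqrt (real n) - sqrt (real (n - j))" by simp
  show "sqrt (real n) - sqrt (real (n - j)) \<le> real j / sqrt (real n)"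
  proof (cases "n = 0")
    case False
    then have n: "0 < sqrt (real n)" by simp
    have "sqrt (real (n - j)) * sqrt (real (n - j)) \<le> sqrt (real (n - j)) * sqrt (real n)"
      by (intro mult_left_mono) auto
    then have "(sqrt (real n) - sqrt (real (n - j))) * sqrt (real n) \<le> real j"
      using assms by (simp add: algebra_simps of_nat_diff)
    then show ?thesis using n by (simp add: le_divide_eq)
  qed (use assms in simp)
qed

text \<open>The centre sqrt(n - j - 1) of \<open>chi_second_moment\<close> differs from sqrt n by at
  most 3, which costs the 18 = 2 times 3^2 and a factor 2.\<close>

lemma chi_moment_sqrt_n:
  obtains C n0 where "0 \<le> C" "3 \<le> n0" "\<And>n j. n0 \<le> n \<Longrightarrow> j \<le> 2 \<Longrightarrow> (\<integral>\<^sup>+r. ennreal ((r - sqrt (real n))\<^sup>2) \<partial>chi (n - j)) \<le> ennreal C"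
proof -
  obtain C m0 where C: "0 \<le> C" "\<And>m. m0 \<le> m \<Longrightarrow> (\<integral>\<^sup>+r. ennreal ((r - sqrt (real (m - 1)))\<^sup>2) \<partial>chi m) \<le> ennreal C"
    using chi_second_moment by blast
  have "(\<integral>\<^sup>+r. ennreal ((r - sqrt (real n))\<^sup>2) \<partial>chi (n - j)) \<le> ennreal (18 + 2 * C)" if n: "m0 + 3 \<le> n" and j: "j \<le> 2" for n j
  proof -
    define e where "e = sqrt (real n) - sqrt (real (n - j - 1))"
    have e: "0 \<le> e" "e \<le> 3"
    proof -
      have jn: "j + 1 \<le> n" "n - j - 1 = n - (j + 1)" using n j by auto
      show "0 \<le> e" unfolding e_def jn by simp
      have "1 \<le> sqrt (real n)" using n by simp
      then have "real (j + 1) / sqrt (real n) \<le> real (j + 1) / 1" by (intro divide_left_mono) auto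
      also have "real (j + 1) / 1 \<le> 3" using j by simp
      finally show "e \<le> 3" unfolding e_def jn using sqrt_nat_diff_le(2)[OF jn(1)] by linarith
    qed
    have "(\<integral>\<^sup>+r. ennreal ((r - sqrt (real n))\<^sup>2) \<partial>chi (n - j)) \<le> (\<integral>\<^sup>+r. ennreal (18 + 2 * (r - sqrt (real (n - j - 1)))\<^sup>2) \<partial>chi (n - j))"
    proof (intro nn_integral_mono ennreal_leI)
      fix r
      define x where "x = r - sqrt (real (n - j - 1))"
      have 1: "r - sqrt (real n) = x - e" by (simp add: e_def x_def)
      have 2: "(x - e)\<^sup>2 \<le> 2 * e\<^sup>2 + 2 * x\<^sup>2"
        using zero_le_power2[of "x + e"] by (simp add: power2_eq_square algebra_simps)
      have 3: "e\<^sup>2 \<le> 3\<^sup>2" using e by (intro power_mono)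
      have "3\<^sup>2 = (9 :: real)" by simp
      then show "(r - sqrt (real n))\<^sup>2 \<le> 18 + 2 * (r - sqrt (real (n - j - 1)))\<^sup>2"
        unfolding 1 x_def[symmetric] using 2 3 by linarith
    qed
    also have "\<dots> \<le> ennreal (18 + 2 * C)"
    proof (rule nn_integral_add_const_le[OF prob_space_chi])
      have "(\<integral>\<^sup>+r. ennreal (2 * (r - sqrt (real (n - j - 1)))\<^sup>2) \<partial>chi (n - j)) = ennreal 2 * (\<integral>\<^sup>+r. ennreal ((r - sqrt (real (n - j - 1)))\<^sup>2) \<partial>chi (n - j))"
        by (subst nn_integral_cmult[symmetric]) (auto simp: ennreal_mult)
      also have "\<dots> \<le> ennreal 2 * ennreal C" using C(2)[of "n - j"] n j by (intro mult_left_mono) auto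
      also have "\<dots> = ennreal (2 * C)" using C(1) by (simp add: ennreal_mult)
      finally show "(\<integral>\<^sup>+r. ennreal (2 * (r - sqrt (real (n - j - 1)))\<^sup>2) \<partial>chi (n - j)) \<le> ennreal (2 * C)" .
    qed (use C(1) in auto)
    finally show ?thesis .
  qed
  then show ?thesis using C(1) by (intro that[of "18 + 2 * C" "m0 + 3"]) auto
qed


section \<open>Comparison of the deficit with its Gaussian linearisation\<close>

text \<open>Quadratic majorant of \<open>spread\<close> once \<rho> is replaced by sqrt(n - 1) +
  x/sqrt 2. The constant 3 absorbs the shift from sqrt(n - 1) to sqrt n and keeps the majorant above
  1 even when the square of one coordinate is removed.\<close>

definition env :: "nat \<Rightarrow> real \<Rightarrow> real \<times> real \<times> real \<times> real \<times> real \<Rightarrow> real" where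
  "env n x = (\<lambda>(a, r, b, g, u). 3 + x\<^sup>2 + a\<^sup>2 + (r - sqrt n)\<^sup>2 + b\<^sup>2 + g\<^sup>2 + (u - sqrt n)\<^sup>2)"

text \<open>The limit variable: x/sqrt 2 stands for the deviation of the noise norm, which has
  asymptotic variance 1/2.\<close>

definition lin5 :: "real \<Rightarrow> real \<Rightarrow> nat \<Rightarrow> real \<Rightarrow> real \<times> real \<times> real \<times> real \<times> real \<Rightarrow> real" where
  "lin5 P1 P2 i x = (\<lambda>(a, r, b, g, u). lin P1 P2 i (x / sqrt 2) a b g)"

definition deficit5 :: "nat \<Rightarrow> real \<Rightarrow> real \<Rightarrow> nat \<Rightarrow> real \<Rightarrow> real \<times> real \<times> real \<times> real \<times> real \<Rightarrow> real" where
  "deficit5 n P1 P2 i \<rho> = (\<lambda>(a, r, b, g, u). deficit n P1 P2 i (gram \<rho> a r b g u))"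

lemma env_ge: "3 \<le> env n x \<omega>"
  by (cases \<omega>) (auto simp: env_def intro!: add_increasing2)

lemma measurable_coords5 [measurable]:
  "(\<lambda>\<omega>. fst \<omega>) \<in> borel_measurable (mac5 n)" "(\<lambda>\<omega>. fst (snd \<omega>)) \<in> borel_measurable (mac5 n)"
  "(\<lambda>\<omega>. fst (snd (snd \<omega>))) \<in> borel_measurable (mac5 n)" "(\<lambda>\<omega>. fst (snd (snd (snd \<omega>)))) \<in> borel_measurable (mac5 n)"
  "(\<lambda>\<omega>. snd (snd (snd (snd \<omega>)))) \<in> borel_measurable (mac5 n)"
  by measurable

lemma borel_measurable_out_sq:
  assumes [measurable]: "zz \<in> borel_measurable M" "p1 \<in> borel_measurable M" "p2 \<in> borel_measurable M"
    "p3 \<in> borel_measurable M" "p4 \<in> borel_measurable M" "p5 \<in> borel_measurable M"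
  shows "(\<lambda>w. out_sq n P1 P2 i (zz w, p1 w, p2 w, p3 w, p4 w, p5 w)) \<in> borel_measurable M"
proof -
  define A where "A w = sqrt (real n * P1) / sqrt (p4 w)" for w
  define B where "B w = sqrt (real n * P2) / sqrt (p5 w)" for w
  have [measurable]: "A \<in> borel_measurable M" "B \<in> borel_measurable M"
    unfolding A_def[abs_def] B_def[abs_def] by measurable
  have 0: "(\<lambda>w. zz w + 2 * (A w * p1 w) + A w * (A w * p4 w)) \<in> borel_measurable M" by measurable
  have 1: "(\<lambda>w. zz w + 2 * (B w * p2 w) + B w * (B w * p5 w)) \<in> borel_measurable M" by measurable
  have 2: "(\<lambda>w. zz w + 2 * (A w * p1 w) + 2 * (B w * p2 w) + A w * (A w * p4 w) + 2 * (A w * B w * p3 w) + B w * (B w * p5 w)) \<in> borel_measurable M"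
    by measurable
  show ?thesis using 0 1 2 unfolding A_def B_def by (simp add: out_sq_def Let_def)
qed

lemma borel_measurable_deficit:
  assumes [measurable]: "zz \<in> borel_measurable M" "p1 \<in> borel_measurable M" "p2 \<in> borel_measurable M"
    "p3 \<in> borel_measurable M" "p4 \<in> borel_measurable M" "p5 \<in> borel_measurable M"
  shows "(\<lambda>w. deficit n P1 P2 i (zz w, p1 w, p2 w, p3 w, p4 w, p5 w)) \<in> borel_measurable M"
proof -
  define Y where "Y w = out_sq n P1 P2 i (zz w, p1 w, p2 w, p3 w, p4 w, p5 w)" for w
  have [measurable]: "Y \<in> borel_measurable M" unfolding Y_def[abs_def] by (rule borel_measurable_out_sq) measurable
  have "(\<lambda>w. sqrt n * ((ln (1 + tot P1 P2 i) - ln (Y w / zz w)) / 2)) \<in> borel_measurable M" by measurable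
  then show ?thesis unfolding Y_def by (simp add: deficit_def)
qed

lemma borel_measurable_deficit5:
  assumes [measurable]: "\<rho> \<in> borel_measurable M" "a \<in> borel_measurable M" "r \<in> borel_measurable M"
    "b \<in> borel_measurable M" "g \<in> borel_measurable M" "u \<in> borel_measurable M"
  shows "(\<lambda>w. deficit5 n P1 P2 i (\<rho> w) (a w, r w, b w, g w, u w)) \<in> borel_measurable M"
  unfolding deficit5_def gram_def split by (rule borel_measurable_deficit) measurable

lemma measurable_deficit5 [measurable]: "(\<lambda>w. deficit5 n P1 P2 i (fst w) (snd w)) \<in> borel_measurable (borel \<Otimes>\<^sub>M mac5 m)"
proof -
  have "(\<lambda>w. deficit5 n P1 P2 i (fst w) (fst (snd w), fst (snd (snd w)), fst (snd (snd (snd w))), fst (snd (snd (snd (snd w)))), snd (snd (snd (snd (snd w))))))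
     \<in> borel_measurable (borel \<Otimes>\<^sub>M mac5 m)"
    by (intro borel_measurable_deficit5 measurable_fst measurable_compose[OF measurable_snd measurable_coords5(1)]
      measurable_compose[OF measurable_snd measurable_coords5(2)] measurable_compose[OF measurable_snd measurable_coords5(3)]
      measurable_compose[OF measurable_snd measurable_coords5(4)] measurable_compose[OF measurable_snd measurable_coords5(5)])
  then show ?thesis by simp
qed

lemma measurable_deficit5' [measurable]: "deficit5 n P1 P2 i \<rho> \<in> borel_measurable (mac5 m)"
proof -
  have "(\<lambda>\<omega>. deficit5 n P1 P2 i \<rho> (fst \<omega>, fst (snd \<omega>), fst (snd (snd \<omega>)), fst (snd (snd (snd \<omega>))), snd (snd (snd (snd \<omega>))))) \<in> borel_measurable (mac5 m)"
    by (intro borel_measurable_deficit5 measurable_coords5 borel_measurable_const)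
  then show ?thesis by simp
qed

lemma measurable_lin5 [measurable]: "lin5 P1 P2 i x \<in> borel_measurable (mac5 n)"
proof -
  have "(\<lambda>\<omega>. lin P1 P2 i (x / sqrt 2) (fst \<omega>) (fst (snd (snd \<omega>))) (fst (snd (snd (snd \<omega>))))) \<in> borel_measurable (mac5 n)"
    unfolding lin_def by measurable
  then show ?thesis by (simp add: lin5_def split_beta')
qed

lemma measurable_env [measurable]: "env n x \<in> borel_measurable (mac5 m)"
proof -
  have "(\<lambda>\<omega>. 3 + x\<^sup>2 + (fst \<omega>)\<^sup>2 + (fst (snd \<omega>) - sqrt n)\<^sup>2 + (fst (snd (snd \<omega>)))\<^sup>2 + (fst (snd (snd (snd \<omega>))))\<^sup>2 + (snd (snd (snd (snd \<omega>))) - sqrt n)\<^sup>2) \<in> borel_measurable (mac5 m)"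
    by measurable
  then show ?thesis by (simp add: env_def split_beta')
qed

text \<open>\<open>deficit_expansion\<close> on the likely event that the envelope is small compared
  with n. The second conclusion shows that there a truncation of thresholds at \<kappa> sqrt n has
  no effect.\<close>

lemma deficit5_approx:
  assumes P: "0 < P1" "0 < P2" and \<kappa>: "0 < \<kappa>"
  obtains C c where "0 < C" "0 < c"
    "\<And>n i x \<omega>. 1 \<le> n \<Longrightarrow> i < 3 \<Longrightarrow> env n x \<omega> \<le> c * real n \<Longrightarrow>
      \<bar>deficit5 n P1 P2 i (sqrt (real (n - 1)) + x / sqrt 2) \<omega> - lin5 P1 P2 i x \<omega>\<bar> \<le> C / sqrt n * env n x \<omega> \<and>
      deficit5 n P1 P2 i (sqrt (real (n - 1)) + x / sqrt 2) \<omega> < \<kappa> * sqrt n"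
proof -
  define k where "k = pow_const P1 P2"
  have k1: "1 \<le> k" using P by (simp add: k_def pow_const_def)
  \<comment> \<open>The first bound makes the expansion applicable, as 72 k e \<le> 1; the second
    keeps 2 k e + 1400 (k e)^2 below \<kappa>.\<close>
  define e where "e = min (1 / (72 * k)) (\<kappa> / (80 * k))"
  have e0: "0 < e" using k1 \<kappa> by (simp add: e_def)
  have "e \<le> 1 / (72 * k)" "e \<le> \<kappa> / (80 * k)" by (auto simp: e_def)
  then have e72: "72 * (k * e) \<le> 1" and e80: "80 * (k * e) \<le> \<kappa>" using k1 by (simp_all add: field_simps)
  have "\<bar>deficit5 n P1 P2 i (sqrt (real (n - 1)) + x / sqrt 2) \<omega> - lin5 P1 P2 i x \<omega>\<bar> \<le> (1400 * k\<^sup>2 + 1) / sqrt n * env n x \<omega> \<and>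
      deficit5 n P1 P2 i (sqrt (real (n - 1)) + x / sqrt 2) \<omega> < \<kappa> * sqrt n"
    if n: "1 \<le> n" and i: "i < 3" and small: "env n x \<omega> \<le> e\<^sup>2 * n" for n i x \<omega>
  proof -
    obtain a r b g u where \<omega>: "\<omega> = (a, r, b, g, u)" by (cases \<omega>)
    define \<rho> where "\<rho> = sqrt (real (n - 1)) + x / sqrt 2"
    \<comment> \<open>The chi law is centred at sqrt(n - 1), the expansion at sqrt n; the
      discrepancy is at most 1/sqrt n and joins the error term.\<close>
    define d where "d = sqrt n - sqrt (real (n - 1))"
    have s0: "0 < sqrt n" "1 \<le> sqrt n" using n by auto
    have d: "0 \<le> d" "d \<le> 1 / sqrt n" using sqrt_nat_diff_le[OF n] by (auto simp: d_def)
    have d1: "d \<le> 1" using d(2) s0 by (smt (verit) divide_le_eq_1)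
    have v: "\<rho> - sqrt n = x / sqrt 2 - d" by (simp add: \<rho>_def d_def)
    define p where "p = spread n \<rho> a r b g u"
    define E where "E = env n x \<omega>"
    have E3: "3 \<le> E" unfolding E_def by (rule env_ge)
    have p0: "0 \<le> p" unfolding p_def spread_def by (intro add_nonneg_nonneg) auto
    have pE: "p \<le> E"
    proof -
      have "(y - d)\<^sup>2 \<le> 2 * y\<^sup>2 + 2 * d\<^sup>2" for y
        using zero_le_power2[of "y + d"] by (simp add: power2_eq_square algebra_simps)
      from this[of "x / sqrt 2"] have "(x / sqrt 2 - d)\<^sup>2 \<le> x\<^sup>2 + 2 * d\<^sup>2" by (simp add: power_divide)
      moreover have "d\<^sup>2 \<le> 1" using d d1 by (simp add: power_le_one)
      ultimately show ?thesis unfolding p_def spread_def v E_def \<omega> env_def split by linarith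
    qed
    have small': "(72 * k)\<^sup>2 * p \<le> n"
    proof -
      have "(72 * k)\<^sup>2 * p \<le> (72 * k)\<^sup>2 * (e\<^sup>2 * n)" using pE small unfolding E_def by (intro mult_left_mono) auto
      also have "\<dots> = (72 * (k * e))\<^sup>2 * n" by (simp add: power_mult_distrib)
      also have "\<dots> \<le> 1 * real n" using e72 e0 k1 by (intro mult_right_mono power_le_one) auto
      finally show ?thesis by simp
    qed
    note exp = deficit_expansion[OF P n i small'[unfolded k_def p_def], folded k_def, folded p_def]
    have t0: "0 \<le> tot P1 P2 i" using P by (simp add: tot_def)
    have lind: "\<bar>lin P1 P2 i (\<rho> - sqrt n) a b g - lin P1 P2 i (x / sqrt 2) a b g\<bar> \<le> 1 / sqrt n"
    proof -
      define t where "t = tot P1 P2 i"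
      have "lin P1 P2 i (\<rho> - sqrt n) a b g - lin P1 P2 i (x / sqrt 2) a b g = - (t * d / (1 + t))"
        unfolding v lin_def t_def[symmetric] diff_divide_distrib[symmetric] by (simp add: algebra_simps)
      then have "\<bar>lin P1 P2 i (\<rho> - sqrt n) a b g - lin P1 P2 i (x / sqrt 2) a b g\<bar> = t * d / (1 + t)"
        using t0 d unfolding t_def by simp
      also have "\<dots> \<le> d" using t0 d unfolding t_def by (simp add: divide_le_eq algebra_simps)
      finally show ?thesis using d by simp
    qed
    have D: "deficit5 n P1 P2 i \<rho> \<omega> = deficit n P1 P2 i (gram \<rho> a r b g u)" by (simp add: deficit5_def \<omega>)
    have L: "lin5 P1 P2 i x \<omega> = lin P1 P2 i (x / sqrt 2) a b g" by (simp add: lin5_def \<omega>)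
    have "\<bar>deficit5 n P1 P2 i \<rho> \<omega> - lin5 P1 P2 i x \<omega>\<bar> \<le> 1400 * k\<^sup>2 * p / sqrt n + 1 / sqrt n"
      unfolding D L using exp(1) lind by linarith
    also have "\<dots> \<le> 1400 * k\<^sup>2 * E / sqrt n + E / sqrt n"
      using pE E3 s0 by (intro add_mono divide_right_mono mult_left_mono) auto
    also have "\<dots> = (1400 * k\<^sup>2 + 1) / sqrt n * E" by (simp add: add_divide_distrib[symmetric] algebra_simps)
    finally have 1: "\<bar>deficit5 n P1 P2 i \<rho> \<omega> - lin5 P1 P2 i x \<omega>\<bar> \<le> (1400 * k\<^sup>2 + 1) / sqrt n * E" .
    have pe: "p \<le> e\<^sup>2 * n" using pE small unfolding E_def by linarith
    have sp: "sqrt p \<le> e * sqrt n"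
    proof -
      have "sqrt p \<le> sqrt (e\<^sup>2 * n)" using pe by simp
      then show ?thesis using e0 by (simp add: real_sqrt_mult)
    qed
    have ps: "p / sqrt n \<le> e\<^sup>2 * sqrt n"
    proof -
      have "p / sqrt n \<le> e\<^sup>2 * n / sqrt n" using pe s0 by (intro divide_right_mono) auto
      also have "\<dots> = e\<^sup>2 * (n / sqrt n)" by simp
      also have "n / sqrt n = sqrt n" by (rule real_div_sqrt) simp
      finally show ?thesis .
    qed
    have "deficit5 n P1 P2 i \<rho> \<omega> \<le> 2 * k * sqrt p + 1400 * k\<^sup>2 * (p / sqrt n)"
      unfolding D using exp by (simp add: abs_le_iff)
    also have "\<dots> \<le> 2 * k * (e * sqrt n) + 1400 * k\<^sup>2 * (e\<^sup>2 * sqrt n)"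
      using sp ps k1 by (intro add_mono mult_left_mono) auto
    also have "\<dots> = (2 * (k * e) + 1400 * ((k * e) * (k * e))) * sqrt n" by (simp add: power2_eq_square algebra_simps)
    also have "\<dots> < \<kappa> * sqrt n"
    proof (rule mult_strict_right_mono)
      have "(k * e) * (k * e) \<le> (1 / 72) * (\<kappa> / 80)" using e72 e80 k1 e0 by (intro mult_mono) auto
      then show "2 * (k * e) + 1400 * ((k * e) * (k * e)) < \<kappa>" using e80 \<kappa> by linarith
    qed (use s0 in simp)
    finally show ?thesis using 1 unfolding \<rho>_def[symmetric] E_def by blast
  qed
  then show ?thesis using e0 by (intro that[of "1400 * k\<^sup>2 + 1" "e\<^sup>2"]) (auto intro: add_nonneg_pos)
qed


text \<open>\<open>std_normal_slab\<close> is applied to the first coordinate with all others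
  frozen, where the linear form is c a + l(y) and the envelope q(y) + a^2.\<close>

lemma slab_pair:
  assumes "prob_space M" and c: "c \<noteq> 0" and \<delta>: "0 \<le> \<delta>"
    and l [measurable]: "l \<in> borel_measurable M" and q [measurable]: "q \<in> borel_measurable M" and q1: "\<And>y. 1 \<le> q y"
  shows "(\<integral>\<^sup>+w. indicator {w. \<bar>c * fst w + l (snd w)\<bar> \<le> \<delta> * (q (snd w) + (fst w)\<^sup>2)} w \<partial>(std_normal \<Otimes>\<^sub>M M)) \<le>
    (\<integral>\<^sup>+w. ennreal (slab_const / \<bar>c\<bar> * \<delta> * (q (snd w) + (fst w)\<^sup>2)) \<partial>(std_normal \<Otimes>\<^sub>M M))"
proof -
  interpret M: prob_space M by fact
  interpret P: pair_sigma_finite std_normal M ..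
  let ?f = "\<lambda>w. indicator {w. \<bar>c * fst w + l (snd w)\<bar> \<le> \<delta> * (q (snd w) + (fst w)\<^sup>2)} w :: ennreal"
  let ?g = "\<lambda>w. ennreal (slab_const / \<bar>c\<bar> * \<delta> * (q (snd w) + (fst w)\<^sup>2))"
  have f: "?f \<in> borel_measurable (std_normal \<Otimes>\<^sub>M M)"
  proof -
    have "Measurable.pred (std_normal \<Otimes>\<^sub>M M) (\<lambda>w. \<bar>c * fst w + l (snd w)\<bar> \<le> \<delta> * (q (snd w) + (fst w)\<^sup>2))" by measurable
    then show ?thesis by (simp add: indicator_def)
  qed
  have g: "?g \<in> borel_measurable (std_normal \<Otimes>\<^sub>M M)" by measurable
  have "(\<integral>\<^sup>+w. ?f w \<partial>(std_normal \<Otimes>\<^sub>M M)) = (\<integral>\<^sup>+y. \<integral>\<^sup>+a. ?f (a, y) \<partial>std_normal \<partial>M)"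
    by (rule P.nn_integral_snd[symmetric, OF f])
  also have "\<dots> \<le> (\<integral>\<^sup>+y. \<integral>\<^sup>+a. ?g (a, y) \<partial>std_normal \<partial>M)"
  proof (rule nn_integral_mono)
    fix y
    have "(\<integral>\<^sup>+a. ?f (a, y) \<partial>std_normal) = (\<integral>\<^sup>+a. indicator {a. \<bar>c * a + l y\<bar> \<le> \<delta> * (q y + a\<^sup>2)} a \<partial>std_normal)"
      by (simp add: indicator_def)
    also have "\<dots> \<le> ennreal (slab_const / \<bar>c\<bar> * \<delta> * q y)"
      by (rule std_normal_slab[OF c \<delta> q1])
    also have "\<dots> = (\<integral>\<^sup>+a. ennreal (slab_const / \<bar>c\<bar> * \<delta> * q y) \<partial>std_normal)"
      by (simp add: std_normal.emeasure_space_1[simplified])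
    also have "\<dots> \<le> (\<integral>\<^sup>+a. ?g (a, y) \<partial>std_normal)"
    proof (intro nn_integral_mono ennreal_leI)
      fix a
      show "slab_const / \<bar>c\<bar> * \<delta> * q y \<le> slab_const / \<bar>c\<bar> * \<delta> * (q (snd (a, y)) + (fst (a, y))\<^sup>2)"
        using slab_const_pos \<delta> by (intro mult_left_mono) auto
    qed
    finally show "(\<integral>\<^sup>+a. ?f (a, y) \<partial>std_normal) \<le> (\<integral>\<^sup>+a. ?g (a, y) \<partial>std_normal)" .
  qed
  also have "\<dots> = (\<integral>\<^sup>+w. ?g w \<partial>(std_normal \<Otimes>\<^sub>M M))" by (rule P.nn_integral_snd[OF g])
  finally show ?thesis .
qed

lemma nn_integral_mac5_split2:
  assumes f: "f \<in> borel_measurable (mac5 n)"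
  shows "(\<integral>\<^sup>+\<omega>. f \<omega> \<partial>mac5 n) = (\<integral>\<^sup>+a. \<integral>\<^sup>+r. \<integral>\<^sup>+y. f (a, r, y) \<partial>(std_normal \<Otimes>\<^sub>M std_normal \<Otimes>\<^sub>M chi (n - 2)) \<partial>chi (n - 1) \<partial>std_normal)"
proof -
  let ?M3 = "std_normal \<Otimes>\<^sub>M std_normal \<Otimes>\<^sub>M chi (n - 2)"
  interpret p3: prob_space ?M3 by (intro prob_space_pair prob_space_std_normal prob_space_chi)
  interpret p4: prob_space "chi (n - 1) \<Otimes>\<^sub>M ?M3" by (intro prob_space_pair prob_space_std_normal prob_space_chi)
  have f5: "f \<in> borel_measurable (std_normal \<Otimes>\<^sub>M (chi (n - 1) \<Otimes>\<^sub>M ?M3))" using f by (simp add: mac5_def)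
  have f4: "(\<lambda>y. f (a, y)) \<in> borel_measurable (chi (n - 1) \<Otimes>\<^sub>M ?M3)" for a
    using measurable_compose[OF measurable_Pair1' f5] by simp
  have "(\<integral>\<^sup>+\<omega>. f \<omega> \<partial>mac5 n) = (\<integral>\<^sup>+a. \<integral>\<^sup>+y. f (a, y) \<partial>(chi (n - 1) \<Otimes>\<^sub>M ?M3) \<partial>std_normal)"
    unfolding mac5_def by (rule p4.nn_integral_fst[symmetric, OF f5])
  also have "\<dots> = (\<integral>\<^sup>+a. \<integral>\<^sup>+r. \<integral>\<^sup>+y. f (a, r, y) \<partial>?M3 \<partial>chi (n - 1) \<partial>std_normal)"
    by (intro nn_integral_cong) (rule p3.nn_integral_fst[symmetric, OF f4])
  finally show ?thesis .
qed

text \<open>Each linear form contains some standard Gaussian with a nonzero coefficient: a for the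
  kinds 0 and 2, b for kind 1. Conditioning on the other coordinates reduces the claim to one
  dimension.\<close>

lemma slab5_pointwise:
  assumes P: "0 < P1" "0 < P2" and i: "i < 3"
  obtains K where "0 \<le> K" "\<And>n x \<delta> w. 0 \<le> \<delta> \<Longrightarrow>
    (\<integral>\<^sup>+\<omega>. indicator {\<omega>. \<bar>lin5 P1 P2 i x \<omega> - w\<bar> \<le> \<delta> * env n x \<omega>} \<omega> \<partial>mac5 n) \<le> (\<integral>\<^sup>+\<omega>. ennreal (K * \<delta> * env n x \<omega>) \<partial>mac5 n)"
proof -
  define t where "t = tot P1 P2 i"
  have t0: "0 < 1 + t" using P by (simp add: t_def tot_def)
  show ?thesis
  proof (cases "i = 1")
    case False
    define c where "c = - sqrt P1 / (1 + t)"
    have c0: "c \<noteq> 0" using P t0 by (simp add: c_def)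
    have "(\<integral>\<^sup>+\<omega>. indicator {\<omega>. \<bar>lin5 P1 P2 i x \<omega> - w\<bar> \<le> \<delta> * env n x \<omega>} \<omega> \<partial>mac5 n) \<le> (\<integral>\<^sup>+\<omega>. ennreal (slab_const / \<bar>c\<bar> * \<delta> * env n x \<omega>) \<partial>mac5 n)"
      if \<delta>: "0 \<le> \<delta>" for n x \<delta> w
    proof -
      let ?M = "chi (n - 1) \<Otimes>\<^sub>M std_normal \<Otimes>\<^sub>M std_normal \<Otimes>\<^sub>M chi (n - 2)"
      define l where "l y = lin5 P1 P2 i x (0, y) - w" for y
      define q where "q y = env n x (0, y)" for y
      have sec: "(\<lambda>y. (0, y)) \<in> ?M \<rightarrow>\<^sub>M mac5 n" unfolding mac5_def by (rule measurable_Pair1') simp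
      have l_meas: "l \<in> borel_measurable ?M" unfolding l_def[abs_def]
        by (intro borel_measurable_diff measurable_compose[OF sec measurable_lin5] borel_measurable_const)
      have q_meas: "q \<in> borel_measurable ?M" unfolding q_def[abs_def] by (rule measurable_compose[OF sec measurable_env])
      have lin: "lin5 P1 P2 i x \<omega> - w = c * fst \<omega> + l (snd \<omega>)" for \<omega>
        unfolding l_def lin5_def lin_def c_def t_def using False
        by (cases \<omega>) (simp add: diff_divide_distrib add_divide_distrib split: if_splits)
      have env: "env n x \<omega> = q (snd \<omega>) + (fst \<omega>)\<^sup>2" for \<omega>
        unfolding q_def env_def by (cases \<omega>) simp
      have "1 \<le> q y" for y unfolding q_def using env_ge[of n x "(0, y)"] by simp
      from slab_pair[OF _ c0 \<delta> l_meas q_meas this] show ?thesis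
        unfolding lin env mac5_def by (simp add: prob_space_pair prob_space_std_normal prob_space_chi)
    qed
    then show ?thesis using slab_const_pos by (intro that[of "slab_const / \<bar>c\<bar>"]) auto
  next
    case True
    \<comment> \<open>In kind 1 the form does not contain a, so a and r are frozen and the slab is
      taken in b.\<close>
    define c where "c = - sqrt P2 / (1 + t)"
    have c0: "c \<noteq> 0" using P t0 by (simp add: c_def)
    have "(\<integral>\<^sup>+\<omega>. indicator {\<omega>. \<bar>lin5 P1 P2 i x \<omega> - w\<bar> \<le> \<delta> * env n x \<omega>} \<omega> \<partial>mac5 n) \<le> (\<integral>\<^sup>+\<omega>. ennreal (slab_const / \<bar>c\<bar> * \<delta> * env n x \<omega>) \<partial>mac5 n)"
      if \<delta>: "0 \<le> \<delta>" for n x \<delta> w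
    proof -
      let ?M2 = "std_normal \<Otimes>\<^sub>M chi (n - 2)"
      let ?f = "\<lambda>\<omega>. indicator {\<omega>. \<bar>lin5 P1 P2 i x \<omega> - w\<bar> \<le> \<delta> * env n x \<omega>} \<omega> :: ennreal"
      let ?g = "\<lambda>\<omega>. ennreal (slab_const / \<bar>c\<bar> * \<delta> * env n x \<omega>)"
      have f: "?f \<in> borel_measurable (mac5 n)"
      proof -
        have "Measurable.pred (mac5 n) (\<lambda>\<omega>. \<bar>lin5 P1 P2 i x \<omega> - w\<bar> \<le> \<delta> * env n x \<omega>)" by measurable
        then show ?thesis by (simp add: indicator_def)
      qed
      have g: "?g \<in> borel_measurable (mac5 n)" by measurable
      have sect: "(\<integral>\<^sup>+y. ?f (a, r, y) \<partial>(std_normal \<Otimes>\<^sub>M ?M2)) \<le> (\<integral>\<^sup>+y. ?g (a, r, y) \<partial>(std_normal \<Otimes>\<^sub>M ?M2))" for a r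
      proof -
        define l where "l y = lin5 P1 P2 i x (a, r, 0, y) - w" for y
        define q where "q y = env n x (a, r, 0, y)" for y
        have sec: "(\<lambda>y. (a, r, 0, y)) \<in> ?M2 \<rightarrow>\<^sub>M mac5 n"
          unfolding mac5_def by (intro measurable_Pair measurable_const measurable_ident_sets refl) auto
        have l_meas: "l \<in> borel_measurable ?M2" unfolding l_def[abs_def]
          by (intro borel_measurable_diff measurable_compose[OF sec measurable_lin5] borel_measurable_const)
        have q_meas: "q \<in> borel_measurable ?M2" unfolding q_def[abs_def] by (rule measurable_compose[OF sec measurable_env])
        have lin: "lin5 P1 P2 i x (a, r, y) - w = c * fst y + l (snd y)" for y
          unfolding l_def lin5_def lin_def c_def t_def using True
          by (cases y) (simp add: diff_divide_distrib add_divide_distrib)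
        have env: "env n x (a, r, y) = q (snd y) + (fst y)\<^sup>2" for y
          unfolding q_def env_def by (cases y) simp
        have "1 \<le> q y" for y unfolding q_def using env_ge[of n x "(a, r, 0, y)"] by simp
        from slab_pair[OF _ c0 \<delta> l_meas q_meas this] show ?thesis
          unfolding lin[symmetric] env[symmetric] by (simp add: prob_space_pair prob_space_std_normal prob_space_chi indicator_def)
      qed
      show ?thesis unfolding nn_integral_mac5_split2[OF f] nn_integral_mac5_split2[OF g]
        by (rule nn_integral_mono, rule nn_integral_mono) (rule sect)
    qed
    then show ?thesis using slab_const_pos by (intro that[of "slab_const / \<bar>c\<bar>"]) auto
  qed
qed

lemma env_moment:
  obtains C n0 where "0 \<le> C" "3 \<le> n0" "\<And>n. n0 \<le> n \<Longrightarrow> (\<integral>\<^sup>+x. \<integral>\<^sup>+\<omega>. ennreal (env n x \<omega>) \<partial>mac5 n \<partial>std_normal) \<le> ennreal C"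
proof -
  obtain C n0 where C: "0 \<le> C" "3 \<le> n0" "\<And>n j. n0 \<le> n \<Longrightarrow> j \<le> 2 \<Longrightarrow> (\<integral>\<^sup>+r. ennreal ((r - sqrt (real n))\<^sup>2) \<partial>chi (n - j)) \<le> ennreal C"
    using chi_moment_sqrt_n by blast
  have "(\<integral>\<^sup>+x. \<integral>\<^sup>+\<omega>. ennreal (env n x \<omega>) \<partial>mac5 n \<partial>std_normal) \<le> ennreal (7 + 2 * C)" if n: "n0 \<le> n" for n
  proof -
    note N = nn_integral_add_const_le[OF prob_space_std_normal _ _ _ _ nn_integral_std_normal_sq]
    have u: "(\<integral>\<^sup>+u. ennreal (s + (u - sqrt n)\<^sup>2) \<partial>chi (n - 2)) \<le> ennreal (s + C)" if "0 \<le> s" for s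
      using that C by (intro nn_integral_add_const_le prob_space_chi C(3) n) auto
    have r: "(\<integral>\<^sup>+u. ennreal (s + (u - sqrt n)\<^sup>2) \<partial>chi (n - 1)) \<le> ennreal (s + C)" if "0 \<le> s" for s
      using that C by (intro nn_integral_add_const_le prob_space_chi C(3) n) auto
    have z: "(\<integral>\<^sup>+u. ennreal (s + u\<^sup>2) \<partial>std_normal) \<le> ennreal (s + 1)" if "0 \<le> s" for s
      using that by (intro N) auto
    have inner: "(\<integral>\<^sup>+\<omega>. ennreal (env n x \<omega>) \<partial>mac5 n) \<le> ennreal ((6 + 2 * C) + x\<^sup>2)" for x
    proof -
      have "(\<integral>\<^sup>+\<omega>. ennreal (env n x \<omega>) \<partial>mac5 n) = (\<integral>\<^sup>+a. \<integral>\<^sup>+r. \<integral>\<^sup>+b. \<integral>\<^sup>+g. \<integral>\<^sup>+u. ennreal ((3 + x\<^sup>2 + a\<^sup>2 + (r - sqrt n)\<^sup>2 + b\<^sup>2 + g\<^sup>2) + (u - sqrt n)\<^sup>2)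
         \<partial>chi (n - 2) \<partial>std_normal \<partial>std_normal \<partial>chi (n - 1) \<partial>std_normal)"
        by (subst nn_integral_mac5) (measurable, simp add: env_def)
      also have "\<dots> \<le> (\<integral>\<^sup>+a. \<integral>\<^sup>+r. \<integral>\<^sup>+b. \<integral>\<^sup>+g. ennreal ((3 + x\<^sup>2 + a\<^sup>2 + (r - sqrt n)\<^sup>2 + b\<^sup>2 + g\<^sup>2) + C) \<partial>std_normal \<partial>std_normal \<partial>chi (n - 1) \<partial>std_normal)"
        by (intro nn_integral_mono u) auto
      also have "\<dots> = (\<integral>\<^sup>+a. \<integral>\<^sup>+r. \<integral>\<^sup>+b. \<integral>\<^sup>+g. ennreal ((3 + x\<^sup>2 + a\<^sup>2 + (r - sqrt n)\<^sup>2 + b\<^sup>2 + C) + g\<^sup>2) \<partial>std_normal \<partial>std_normal \<partial>chi (n - 1) \<partial>std_normal)"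
        by (simp only: add_ac)
      also have "\<dots> \<le> (\<integral>\<^sup>+a. \<integral>\<^sup>+r. \<integral>\<^sup>+b. ennreal ((3 + x\<^sup>2 + a\<^sup>2 + (r - sqrt n)\<^sup>2 + b\<^sup>2 + C) + 1) \<partial>std_normal \<partial>chi (n - 1) \<partial>std_normal)"
        using C by (intro nn_integral_mono z) auto
      also have "\<dots> = (\<integral>\<^sup>+a. \<integral>\<^sup>+r. \<integral>\<^sup>+b. ennreal ((3 + x\<^sup>2 + a\<^sup>2 + (r - sqrt n)\<^sup>2 + C + 1) + b\<^sup>2) \<partial>std_normal \<partial>chi (n - 1) \<partial>std_normal)"
        by (simp only: add_ac)
      also have "\<dots> \<le> (\<integral>\<^sup>+a. \<integral>\<^sup>+r. ennreal ((3 + x\<^sup>2 + a\<^sup>2 + (r - sqrt n)\<^sup>2 + C + 1) + 1) \<partial>chi (n - 1) \<partial>std_normal)"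
        using C by (intro nn_integral_mono z) auto
      also have "\<dots> = (\<integral>\<^sup>+a. \<integral>\<^sup>+r. ennreal ((3 + x\<^sup>2 + a\<^sup>2 + C + 1 + 1) + (r - sqrt n)\<^sup>2) \<partial>chi (n - 1) \<partial>std_normal)"
        by (simp only: add_ac)
      also have "\<dots> \<le> (\<integral>\<^sup>+a. ennreal ((3 + x\<^sup>2 + a\<^sup>2 + C + 1 + 1) + C) \<partial>std_normal)"
        using C by (intro nn_integral_mono r) auto
      also have "\<dots> = (\<integral>\<^sup>+a. ennreal ((3 + x\<^sup>2 + C + 1 + 1 + C) + a\<^sup>2) \<partial>std_normal)"
        by (simp only: add_ac)
      also have "\<dots> \<le> ennreal ((3 + x\<^sup>2 + C + 1 + 1 + C) + 1)"
        using C by (intro z) auto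
      also have "(3 + x\<^sup>2 + C + 1 + 1 + C) + 1 = (6 + 2 * C) + x\<^sup>2" by simp
      finally show ?thesis .
    qed
    have "(\<integral>\<^sup>+x. \<integral>\<^sup>+\<omega>. ennreal (env n x \<omega>) \<partial>mac5 n \<partial>std_normal) \<le> (\<integral>\<^sup>+x. ennreal ((6 + 2 * C) + x\<^sup>2) \<partial>std_normal)"
      by (intro nn_integral_mono inner)
    also have "\<dots> \<le> ennreal ((6 + 2 * C) + 1)" using C by (intro z) auto
    finally show ?thesis by (simp add: add.commute)
  qed
  then show ?thesis using C by (intro that[of "7 + 2 * C" n0]) auto
qed


lemma pred_indicator: "Measurable.pred M P \<Longrightarrow> (\<lambda>w. indicator {w. P w} w :: ennreal) \<in> borel_measurable M"
  by (simp add: indicator_def)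

lemma measurable_lin5_pair [measurable]: "(\<lambda>w. lin5 P1 P2 i (fst w) (snd w)) \<in> borel_measurable (std_normal \<Otimes>\<^sub>M mac5 n)"
proof -
  have [measurable]: "(\<lambda>w. fst (snd w)) \<in> borel_measurable (std_normal \<Otimes>\<^sub>M mac5 n)"
    "(\<lambda>w. fst (snd (snd (snd w)))) \<in> borel_measurable (std_normal \<Otimes>\<^sub>M mac5 n)"
    "(\<lambda>w. fst (snd (snd (snd (snd w))))) \<in> borel_measurable (std_normal \<Otimes>\<^sub>M mac5 n)"
    by (rule measurable_compose[OF measurable_snd measurable_coords5(1)]
        measurable_compose[OF measurable_snd measurable_coords5(3)] measurable_compose[OF measurable_snd measurable_coords5(4)])+
  have "(\<lambda>w. lin P1 P2 i (fst w / sqrt 2) (fst (snd w)) (fst (snd (snd (snd w)))) (fst (snd (snd (snd (snd w)))))) \<in> borel_measurable (std_normal \<Otimes>\<^sub>M mac5 n)"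
    unfolding lin_def by measurable
  then show ?thesis by (simp add: lin5_def split_beta')
qed

lemma measurable_env_pair [measurable]: "(\<lambda>w. env m (fst w) (snd w)) \<in> borel_measurable (std_normal \<Otimes>\<^sub>M mac5 n)"
proof -
  have [measurable]: "(\<lambda>w. fst (snd w)) \<in> borel_measurable (std_normal \<Otimes>\<^sub>M mac5 n)"
    "(\<lambda>w. fst (snd (snd w))) \<in> borel_measurable (std_normal \<Otimes>\<^sub>M mac5 n)"
    "(\<lambda>w. fst (snd (snd (snd w)))) \<in> borel_measurable (std_normal \<Otimes>\<^sub>M mac5 n)"
    "(\<lambda>w. fst (snd (snd (snd (snd w))))) \<in> borel_measurable (std_normal \<Otimes>\<^sub>M mac5 n)"
    "(\<lambda>w. snd (snd (snd (snd (snd w))))) \<in> borel_measurable (std_normal \<Otimes>\<^sub>M mac5 n)"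
    by (rule measurable_compose[OF measurable_snd measurable_coords5(1)] measurable_compose[OF measurable_snd measurable_coords5(2)]
        measurable_compose[OF measurable_snd measurable_coords5(3)] measurable_compose[OF measurable_snd measurable_coords5(4)]
        measurable_compose[OF measurable_snd measurable_coords5(5)])+
  have "(\<lambda>w. 3 + (fst w)\<^sup>2 + (fst (snd w))\<^sup>2 + (fst (snd (snd w)) - sqrt m)\<^sup>2 + (fst (snd (snd (snd w))))\<^sup>2
     + (fst (snd (snd (snd (snd w)))))\<^sup>2 + (snd (snd (snd (snd (snd w)))) - sqrt m)\<^sup>2) \<in> borel_measurable (std_normal \<Otimes>\<^sub>M mac5 n)"
    by measurable
  then show ?thesis by (simp add: env_def split_beta')
qed

lemma nn_integral_std_normal_mac5:
  "f \<in> borel_measurable (std_normal \<Otimes>\<^sub>M mac5 n) \<Longrightarrow> (\<integral>\<^sup>+w. f w \<partial>(std_normal \<Otimes>\<^sub>M mac5 n)) = (\<integral>\<^sup>+x. \<integral>\<^sup>+\<omega>. f (x, \<omega>) \<partial>mac5 n \<partial>std_normal)"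
  by (rule mac5.nn_integral_fst[symmetric])

lemma ennreal_indicator_le_1: "(indicator A x :: ennreal) \<le> 1"
  by (simp add: indicator_def)

lemma ennreal_indicator_0: "\<not> P x \<Longrightarrow> (indicator {x. P x} x :: ennreal) = 0"
  by simp

lemma nat_lt_3_disj: "P i \<Longrightarrow> i = 0 \<or> i = 1 \<or> i = 2 \<Longrightarrow> P 0 \<or> P 1 \<or> P (2 :: nat)"
  by auto

lemma one_le_add5:
  fixes a b c d e :: ennreal
  shows "a = 1 \<Longrightarrow> 1 \<le> a + (b + (c + (d + e)))"
    and "b = 1 \<or> c = 1 \<or> d = 1 \<Longrightarrow> 1 \<le> a + (b + (c + (d + e)))"
    and "e = 1 \<Longrightarrow> 1 \<le> a + (b + (c + (d + e)))"
  by (auto simp: add_increasing add_increasing2)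

lemma nn_integral_add5:
  assumes "f0 \<in> borel_measurable M" "f1 \<in> borel_measurable M" "f2 \<in> borel_measurable M" "f3 \<in> borel_measurable M" "f4 \<in> borel_measurable M"
  shows "(\<integral>\<^sup>+v. f0 v + (f1 v + (f2 v + (f3 v + f4 v))) \<partial>M) =
    (\<integral>\<^sup>+v. f0 v \<partial>M) + ((\<integral>\<^sup>+v. f1 v \<partial>M) + ((\<integral>\<^sup>+v. f2 v \<partial>M) + ((\<integral>\<^sup>+v. f3 v \<partial>M) + (\<integral>\<^sup>+v. f4 v \<partial>M))))"
  using assms by (simp add: nn_integral_add)

text \<open>The probability over the other coordinates, as a function of \<rho>, is a test function
  bounded by 1, so \<open>chi_total_variation\<close> replaces \<rho> by its Gaussian
  approximation.\<close>

lemma chi_mac5_transfer: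
  obtains C n0 where "0 \<le> C" "1 \<le> n0"
    "\<And>n E. n0 \<le> n \<Longrightarrow> Measurable.pred (borel \<Otimes>\<^sub>M mac5 n) (\<lambda>w. E (fst w) (snd w)) \<Longrightarrow>
      (\<integral>\<^sup>+\<rho>. \<integral>\<^sup>+\<omega>. indicator {\<omega>. E \<rho> \<omega>} \<omega> \<partial>mac5 n \<partial>chi n) \<le>
      (\<integral>\<^sup>+x. \<integral>\<^sup>+\<omega>. indicator {\<omega>. E (sqrt (real (n - 1)) + x / sqrt 2) \<omega>} \<omega> \<partial>mac5 n \<partial>std_normal) + ennreal (C / sqrt n)"
proof -
  obtain C m0 where C: "0 \<le> C" "\<And>m h. m0 \<le> m \<Longrightarrow> h \<in> borel_measurable borel \<Longrightarrow> (\<And>x. h x \<le> 1) \<Longrightarrow>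
    (\<integral>\<^sup>+r. h r \<partial>chi m) \<le> (\<integral>\<^sup>+x. h (sqrt (real (m - 1)) + x / sqrt 2) \<partial>std_normal) + ennreal (C / sqrt m)"
    using chi_total_variation by blast
  show ?thesis
  proof (rule that[of C "max 1 m0"])
    fix n :: nat and E :: "real \<Rightarrow> real \<times> real \<times> real \<times> real \<times> real \<Rightarrow> bool"
    assume n: "max 1 m0 \<le> n" and E: "Measurable.pred (borel \<Otimes>\<^sub>M mac5 n) (\<lambda>w. E (fst w) (snd w))"
    show "(\<integral>\<^sup>+\<rho>. \<integral>\<^sup>+\<omega>. indicator {\<omega>. E \<rho> \<omega>} \<omega> \<partial>mac5 n \<partial>chi n) \<le>
      (\<integral>\<^sup>+x. \<integral>\<^sup>+\<omega>. indicator {\<omega>. E (sqrt (real (n - 1)) + x / sqrt 2) \<omega>} \<omega> \<partial>mac5 n \<partial>std_normal) + ennreal (C / sqrt n)"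
    proof (rule C(2))
      have "(\<lambda>w. indicator {\<omega>. E (fst w) \<omega>} (snd w) :: ennreal) \<in> borel_measurable (borel \<Otimes>\<^sub>M mac5 n)"
        using E by (simp add: indicator_def)
      from mac5.borel_measurable_nn_integral_fst[OF this]
      show "(\<lambda>\<rho>. \<integral>\<^sup>+\<omega>. indicator {\<omega>. E \<rho> \<omega>} \<omega> \<partial>mac5 n) \<in> borel_measurable borel" by simp
      show "(\<integral>\<^sup>+\<omega>. indicator {\<omega>. E \<rho> \<omega>} \<omega> \<partial>mac5 n) \<le> 1" for \<rho>
      proof -
        have "(\<integral>\<^sup>+\<omega>. indicator {\<omega>. E \<rho> \<omega>} \<omega> \<partial>mac5 n) \<le> (\<integral>\<^sup>+\<omega>. 1 \<partial>mac5 n)"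
          by (intro nn_integral_mono) (simp add: indicator_def)
        then show ?thesis by (simp add: mac5.emeasure_space_1)
      qed
    qed (use n in simp)
  qed (use C in auto)
qed

text \<open>Markov's inequality for the envelope, whose mean is bounded, gives O(1/n), more than
  enough.\<close>

lemma env_tail:
  assumes c: "0 < c"
  obtains C n0 where "0 \<le> C" "3 \<le> n0" "\<And>n. n0 \<le> n \<Longrightarrow>
    (\<integral>\<^sup>+w. indicator {w. c * real n < env n (fst w) (snd w)} w \<partial>(std_normal \<Otimes>\<^sub>M mac5 n)) \<le> ennreal (C / sqrt n)"
proof -
  obtain C n0 where C: "0 \<le> C" "3 \<le> n0" "\<And>n. n0 \<le> n \<Longrightarrow> (\<integral>\<^sup>+x. \<integral>\<^sup>+\<omega>. ennreal (env n x \<omega>) \<partial>mac5 n \<partial>std_normal) \<le> ennreal C"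
    using env_moment by blast
  have "(\<integral>\<^sup>+w. indicator {w. c * real n < env n (fst w) (snd w)} w \<partial>(std_normal \<Otimes>\<^sub>M mac5 n)) \<le> ennreal (C / c / sqrt n)" if n: "n0 \<le> n" for n
  proof -
    have n0: "1 \<le> n" using n C by simp
    have "(\<integral>\<^sup>+w. indicator {w. c * real n < env n (fst w) (snd w)} w \<partial>(std_normal \<Otimes>\<^sub>M mac5 n)) \<le>
      (\<integral>\<^sup>+w. ennreal (1 / (c * n)) * ennreal (env n (fst w) (snd w)) \<partial>(std_normal \<Otimes>\<^sub>M mac5 n))"
    proof (rule nn_integral_mono)
      fix w :: "real \<times> real \<times> real \<times> real \<times> real \<times> real"
      show "indicator {w. c * real n < env n (fst w) (snd w)} w \<le> ennreal (1 / (c * n)) * ennreal (env n (fst w) (snd w))"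
      proof (cases "c * real n < env n (fst w) (snd w)")
        case True
        have cn: "0 < c * real n" using c n0 by simp
        have "1 \<le> 1 / (c * n) * env n (fst w) (snd w)" using True cn by simp
        then have "ennreal 1 \<le> ennreal (1 / (c * n) * env n (fst w) (snd w))" by (rule ennreal_leI)
        then show ?thesis using True cn by (simp add: ennreal_mult'[symmetric])
      qed auto
    qed
    also have "\<dots> = ennreal (1 / (c * n)) * (\<integral>\<^sup>+x. \<integral>\<^sup>+\<omega>. ennreal (env n x \<omega>) \<partial>mac5 n \<partial>std_normal)"
    proof -
      have m: "(\<lambda>w. ennreal (env n (fst w) (snd w))) \<in> borel_measurable (std_normal \<Otimes>\<^sub>M mac5 n)" by measurable
      show ?thesis unfolding nn_integral_cmult[OF m] nn_integral_std_normal_mac5[OF m] by simp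
    qed
    also have "\<dots> \<le> ennreal (1 / (c * n)) * ennreal C" by (intro mult_left_mono C(3) n) auto
    also have "\<dots> = ennreal (C / c / n)" using c C(1) by (subst ennreal_mult[symmetric]) auto
    also have "\<dots> \<le> ennreal (C / c / sqrt n)"
    proof (intro ennreal_leI divide_left_mono)
      have "sqrt n * 1 \<le> sqrt n * sqrt n" using n0 by (intro mult_left_mono) auto
      then show "sqrt n \<le> n" by simp
    qed (use n0 c C in auto)
    finally show ?thesis .
  qed
  then show ?thesis using C c by (intro that[of "C / c" n0]) auto
qed

lemma slab5:
  assumes P: "0 < P1" "0 < P2" and i: "i < 3" and B: "0 \<le> B"
  obtains C n0 where "0 \<le> C" "3 \<le> n0" "\<And>n w. n0 \<le> n \<Longrightarrow>
    (\<integral>\<^sup>+v. indicator {v. \<bar>lin5 P1 P2 i (fst v) (snd v) - w\<bar> \<le> B / sqrt n * env n (fst v) (snd v)} v \<partial>(std_normal \<Otimes>\<^sub>M mac5 n)) \<le> ennreal (C / sqrt n)"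
proof -
  obtain C n0 where C: "0 \<le> C" "3 \<le> n0" "\<And>n. n0 \<le> n \<Longrightarrow> (\<integral>\<^sup>+x. \<integral>\<^sup>+\<omega>. ennreal (env n x \<omega>) \<partial>mac5 n \<partial>std_normal) \<le> ennreal C"
    using env_moment by blast
  obtain K where K: "0 \<le> K" "\<And>n x \<delta> w. 0 \<le> \<delta> \<Longrightarrow>
    (\<integral>\<^sup>+\<omega>. indicator {\<omega>. \<bar>lin5 P1 P2 i x \<omega> - w\<bar> \<le> \<delta> * env n x \<omega>} \<omega> \<partial>mac5 n) \<le> (\<integral>\<^sup>+\<omega>. ennreal (K * \<delta> * env n x \<omega>) \<partial>mac5 n)"
    using slab5_pointwise[OF P i] by blast
  have "(\<integral>\<^sup>+v. indicator {v. \<bar>lin5 P1 P2 i (fst v) (snd v) - w\<bar> \<le> B / sqrt n * env n (fst v) (snd v)} v \<partial>(std_normal \<Otimes>\<^sub>M mac5 n)) \<le> ennreal (K * B * C / sqrt n)"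
    if n: "n0 \<le> n" for n w
  proof -
    define \<delta> where "\<delta> = B / sqrt n"
    have \<delta>: "0 \<le> \<delta>" using B by (simp add: \<delta>_def)
    have "(\<integral>\<^sup>+v. indicator {v. \<bar>lin5 P1 P2 i (fst v) (snd v) - w\<bar> \<le> \<delta> * env n (fst v) (snd v)} v \<partial>(std_normal \<Otimes>\<^sub>M mac5 n)) =
      (\<integral>\<^sup>+x. \<integral>\<^sup>+\<omega>. indicator {\<omega>. \<bar>lin5 P1 P2 i x \<omega> - w\<bar> \<le> \<delta> * env n x \<omega>} \<omega> \<partial>mac5 n \<partial>std_normal)"
    proof (subst nn_integral_std_normal_mac5)
      show "(indicator {v. \<bar>lin5 P1 P2 i (fst v) (snd v) - w\<bar> \<le> \<delta> * env n (fst v) (snd v)} :: _ \<Rightarrow> ennreal) \<in> borel_measurable (std_normal \<Otimes>\<^sub>M mac5 n)"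
        by (rule pred_indicator) measurable
    qed (intro nn_integral_cong, simp add: indicator_def)
    also have "\<dots> \<le> (\<integral>\<^sup>+x. \<integral>\<^sup>+\<omega>. ennreal (K * \<delta> * env n x \<omega>) \<partial>mac5 n \<partial>std_normal)"
      by (rule nn_integral_mono) (rule K(2)[OF \<delta>])
    also have "\<dots> = (\<integral>\<^sup>+x. \<integral>\<^sup>+\<omega>. ennreal (K * \<delta>) * ennreal (env n x \<omega>) \<partial>mac5 n \<partial>std_normal)"
      using K(1) \<delta> by (simp add: ennreal_mult')
    also have "\<dots> = ennreal (K * \<delta>) * (\<integral>\<^sup>+x. \<integral>\<^sup>+\<omega>. ennreal (env n x \<omega>) \<partial>mac5 n \<partial>std_normal)"
    proof -
      have m: "(\<lambda>x. \<integral>\<^sup>+\<omega>. ennreal (env n x \<omega>) \<partial>mac5 n) \<in> borel_measurable std_normal"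
        using mac5.borel_measurable_nn_integral_fst[of "\<lambda>w. ennreal (env n (fst w) (snd w))" std_normal n] by simp
      have "(\<integral>\<^sup>+x. \<integral>\<^sup>+\<omega>. ennreal (K * \<delta>) * ennreal (env n x \<omega>) \<partial>mac5 n \<partial>std_normal) = (\<integral>\<^sup>+x. ennreal (K * \<delta>) * (\<integral>\<^sup>+\<omega>. ennreal (env n x \<omega>) \<partial>mac5 n) \<partial>std_normal)"
        by (intro nn_integral_cong nn_integral_cmult) measurable
      then show ?thesis using nn_integral_cmult[OF m] by simp
    qed
    also have "\<dots> \<le> ennreal (K * \<delta>) * ennreal C" by (intro mult_left_mono C(3) n) auto
    also have "\<dots> = ennreal (K * B * C / sqrt n)" unfolding \<delta>_def using K(1) B C(1) by (subst ennreal_mult[symmetric]) auto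
    finally show ?thesis unfolding \<delta>_def .
  qed
  then show ?thesis using K C B by (intro that[of "K * B * C" n0]) auto
qed

text \<open>A one-sided Berry-Esseen bound, uniform in the thresholds. After passing to Gaussian
  \<rho>, if some deficit reaches its threshold then its linear form exceeds it, or some form is
  within the Taylor error of its threshold, or the envelope is large; the last two events have
  probability O(1/sqrt n). Thresholds are truncated at \<kappa> sqrt n because the competitor
  estimate only works below that level.\<close>

lemma deficit_bad_event:
  assumes P: "0 < P1" "0 < P2" and \<kappa>: "0 < \<kappa>"
  obtains C n0 where "0 \<le> C" "3 \<le> n0" "\<And>n w. n0 \<le> n \<Longrightarrow>
    (\<integral>\<^sup>+\<rho>. \<integral>\<^sup>+\<omega>. indicator {\<omega>. \<exists>i<3. min (w i) (\<kappa> * sqrt n) \<le> deficit5 n P1 P2 i \<rho> \<omega>} \<omega> \<partial>mac5 n \<partial>chi n) \<le>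
    (\<integral>\<^sup>+v. indicator {v. \<exists>i<3. w i < lin5 P1 P2 i (fst v) (snd v)} v \<partial>(std_normal \<Otimes>\<^sub>M mac5 n)) + ennreal (C / sqrt n)"
proof -
  obtain B c where B: "0 < B" "0 < c"
    "\<And>n i x \<omega>. 1 \<le> n \<Longrightarrow> i < 3 \<Longrightarrow> env n x \<omega> \<le> c * real n \<Longrightarrow>
      \<bar>deficit5 n P1 P2 i (sqrt (real (n - 1)) + x / sqrt 2) \<omega> - lin5 P1 P2 i x \<omega>\<bar> \<le> B / sqrt n * env n x \<omega> \<and>
      deficit5 n P1 P2 i (sqrt (real (n - 1)) + x / sqrt 2) \<omega> < \<kappa> * sqrt n"
    using deficit5_approx[OF P \<kappa>] by metis
  obtain C0 n0 where C0: "0 \<le> C0" "1 \<le> n0"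
    "\<And>n E. n0 \<le> n \<Longrightarrow> Measurable.pred (borel \<Otimes>\<^sub>M mac5 n) (\<lambda>w. E (fst w) (snd w)) \<Longrightarrow>
      (\<integral>\<^sup>+\<rho>. \<integral>\<^sup>+\<omega>. indicator {\<omega>. E \<rho> \<omega>} \<omega> \<partial>mac5 n \<partial>chi n) \<le>
      (\<integral>\<^sup>+x. \<integral>\<^sup>+\<omega>. indicator {\<omega>. E (sqrt (real (n - 1)) + x / sqrt 2) \<omega>} \<omega> \<partial>mac5 n \<partial>std_normal) + ennreal (C0 / sqrt n)"
    apply (rule chi_mac5_transfer)
    subgoal premises prems for C n0 by (rule prems(1)[OF prems(2-4)])
    done
  obtain C1 n1 where C1: "0 \<le> C1" "3 \<le> n1" "\<And>n. n1 \<le> n \<Longrightarrow>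
    (\<integral>\<^sup>+w. indicator {w. c * real n < env n (fst w) (snd w)} w \<partial>(std_normal \<Otimes>\<^sub>M mac5 n)) \<le> ennreal (C1 / sqrt n)"
    apply (rule env_tail[OF B(2)])
    subgoal premises prems for C n0 by (rule prems(1)[OF prems(2-4)])
    done
  \<comment> \<open>The slab constants for the three kinds, to be collected by choice.\<close>
  have "\<forall>i. \<exists>C n0. i < 3 \<longrightarrow> 0 \<le> C \<and> 3 \<le> n0 \<and> (\<forall>n w. n0 \<le> n \<longrightarrow>
    (\<integral>\<^sup>+v. indicator {v. \<bar>lin5 P1 P2 i (fst v) (snd v) - w\<bar> \<le> B / sqrt n * env n (fst v) (snd v)} v \<partial>(std_normal \<Otimes>\<^sub>M mac5 n)) \<le> ennreal (C / sqrt n))"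
  proof (intro allI)
    fix i
    show "\<exists>C n0. i < 3 \<longrightarrow> 0 \<le> C \<and> 3 \<le> n0 \<and> (\<forall>n w. n0 \<le> n \<longrightarrow>
      (\<integral>\<^sup>+v. indicator {v. \<bar>lin5 P1 P2 i (fst v) (snd v) - w\<bar> \<le> B / sqrt n * env n (fst v) (snd v)} v \<partial>(std_normal \<Otimes>\<^sub>M mac5 n)) \<le> ennreal (C / sqrt n))"
    proof (cases "i < 3")
      case True
      show ?thesis by (rule slab5[OF P True less_imp_le[OF B(1)]]) blast
    qed blast
  qed
  from choice[OF this] obtain S where "\<forall>i. \<exists>n0. i < 3 \<longrightarrow> 0 \<le> S i \<and> 3 \<le> n0 \<and> (\<forall>n w. n0 \<le> n \<longrightarrow>
    (\<integral>\<^sup>+v. indicator {v. \<bar>lin5 P1 P2 i (fst v) (snd v) - w\<bar> \<le> B / sqrt n * env n (fst v) (snd v)} v \<partial>(std_normal \<Otimes>\<^sub>M mac5 n)) \<le> ennreal (S i / sqrt n))"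
    by blast
  from choice[OF this] obtain m where S: "\<And>i. i < 3 \<Longrightarrow> 0 \<le> S i \<and> 3 \<le> m i \<and> (\<forall>n w. m i \<le> n \<longrightarrow>
    (\<integral>\<^sup>+v. indicator {v. \<bar>lin5 P1 P2 i (fst v) (snd v) - w\<bar> \<le> B / sqrt n * env n (fst v) (snd v)} v \<partial>(std_normal \<Otimes>\<^sub>M mac5 n)) \<le> ennreal (S i / sqrt n))"
    by blast
  define N where "N = max (max n0 n1) (max (m 0) (max (m 1) (m 2)))"
  define Ctot where "Ctot = S 0 + S 1 + S 2 + C1 + C0"
  have S0: "0 \<le> S 0" "0 \<le> S 1" "0 \<le> S 2" using S by auto
  show ?thesis
  proof (rule that[of Ctot N])
    show "0 \<le> Ctot" using S0 C0 C1 by (simp add: Ctot_def)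
    show "3 \<le> N" using C1(2) by (simp add: N_def)
    fix n w assume "N \<le> n"
    then have n: "n0 \<le> n" "n1 \<le> n" "m 0 \<le> n" "m 1 \<le> n" "m 2 \<le> n" by (auto simp: N_def)
    have n1: "1 \<le> n" using n C0(2) by simp
    let ?M = "std_normal \<Otimes>\<^sub>M mac5 n"
    let ?D = "\<lambda>i x. deficit5 n P1 P2 i (sqrt (real (n - 1)) + x / sqrt 2)"
    let ?L = "\<lambda>i v. lin5 P1 P2 i (fst v) (snd v)"
    let ?e = "\<lambda>v. env n (fst v) (snd v)"
    let ?bad = "\<lambda>v. \<exists>i<3. min (w i) (\<kappa> * sqrt n) \<le> ?D i (fst v) (snd v)"
    let ?lim = "indicator {v. \<exists>i<3. w i < ?L i v} :: _ \<Rightarrow> ennreal"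
    let ?sl = "\<lambda>i. indicator {v. \<bar>?L i v - w i\<bar> \<le> B / sqrt n * ?e v} :: _ \<Rightarrow> ennreal"
    let ?tail = "indicator {v. c * real n < ?e v} :: _ \<Rightarrow> ennreal"
    have [measurable]: "?lim \<in> borel_measurable ?M" by (rule pred_indicator) measurable
    have [measurable]: "?sl i \<in> borel_measurable ?M" for i by (rule pred_indicator) measurable
    have [measurable]: "?tail \<in> borel_measurable ?M" by (rule pred_indicator) measurable
    have D_meas [measurable]: "(\<lambda>v. ?D i (fst v) (snd v)) \<in> borel_measurable ?M" for i
    proof -
      have "(\<lambda>v. (sqrt (real (n - 1)) + fst v / sqrt 2, snd v)) \<in> ?M \<rightarrow>\<^sub>M borel \<Otimes>\<^sub>M mac5 n" by measurable
      from measurable_compose[OF this measurable_deficit5] show ?thesis by simp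
    qed
    have 1: "(\<integral>\<^sup>+\<rho>. \<integral>\<^sup>+\<omega>. indicator {\<omega>. \<exists>i<3. min (w i) (\<kappa> * sqrt n) \<le> deficit5 n P1 P2 i \<rho> \<omega>} \<omega> \<partial>mac5 n \<partial>chi n) \<le>
      (\<integral>\<^sup>+x. \<integral>\<^sup>+\<omega>. indicator {\<omega>. \<exists>i<3. min (w i) (\<kappa> * sqrt n) \<le> ?D i x \<omega>} \<omega> \<partial>mac5 n \<partial>std_normal) + ennreal (C0 / sqrt n)"
    proof (rule C0(3)[OF n(1)])
      show "Measurable.pred (borel \<Otimes>\<^sub>M mac5 n) (\<lambda>v. \<exists>i<3. min (w i) (\<kappa> * sqrt n) \<le> deficit5 n P1 P2 i (fst v) (snd v))"
        by measurable
    qed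
    have 3: "(\<integral>\<^sup>+x. \<integral>\<^sup>+\<omega>. indicator {\<omega>. \<exists>i<3. min (w i) (\<kappa> * sqrt n) \<le> ?D i x \<omega>} \<omega> \<partial>mac5 n \<partial>std_normal) = (\<integral>\<^sup>+v. indicator {v. ?bad v} v \<partial>?M)"
    proof (subst nn_integral_std_normal_mac5)
      show "(indicator {v. ?bad v} :: _ \<Rightarrow> ennreal) \<in> borel_measurable ?M" by (rule pred_indicator) measurable
    qed (intro nn_integral_cong, simp add: indicator_def)
    have "(\<integral>\<^sup>+v. indicator {v. ?bad v} v \<partial>?M) \<le> (\<integral>\<^sup>+v. ?lim v + (?sl 0 v + (?sl 1 v + (?sl 2 v + ?tail v))) \<partial>?M)"
    proof (rule nn_integral_mono)
      fix v :: "real \<times> real \<times> real \<times> real \<times> real \<times> real"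
      show "indicator {v. ?bad v} v \<le> ?lim v + (?sl 0 v + (?sl 1 v + (?sl 2 v + ?tail v)))"
      proof (cases "?bad v \<and> \<not> c * real n < ?e v")
        case True
        then obtain i where i: "i < 3" "min (w i) (\<kappa> * sqrt n) \<le> ?D i (fst v) (snd v)" and small: "?e v \<le> c * real n" by auto
        have ap: "\<bar>?D i (fst v) (snd v) - ?L i v\<bar> \<le> B / sqrt n * ?e v" "?D i (fst v) (snd v) < \<kappa> * sqrt n"
          using B(3)[OF n1 i(1) small] by auto
        \<comment> \<open>The deficit stays below \<kappa> sqrt n, so the minimum it reaches must be
          \<open>w i\<close>.\<close>
        then have "w i \<le> ?D i (fst v) (snd v)" using i(2) by (auto simp: min_le_iff_disj)
        then have "w i < ?L i v \<or> \<bar>?L i v - w i\<bar> \<le> B / sqrt n * ?e v" using ap(1) by linarith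
        then show ?thesis
        proof
          assume "w i < ?L i v"
          then have "?lim v = 1" using i(1) by (auto simp: indicator_def)
          then have "1 \<le> ?lim v + (?sl 0 v + (?sl 1 v + (?sl 2 v + ?tail v)))" by (rule one_le_add5(1))
          then show ?thesis by (rule order_trans[OF ennreal_indicator_le_1])
        next
          assume "\<bar>?L i v - w i\<bar> \<le> B / sqrt n * ?e v"
          then have "?sl i v = 1" by (simp add: indicator_def)
          moreover have "i = 0 \<or> i = 1 \<or> i = 2" using i(1) by linarith
          ultimately have "?sl 0 v = 1 \<or> ?sl 1 v = 1 \<or> ?sl 2 v = 1" by (rule nat_lt_3_disj[of "\<lambda>i. ?sl i v = 1"])
          then have "1 \<le> ?lim v + (?sl 0 v + (?sl 1 v + (?sl 2 v + ?tail v)))" by (rule one_le_add5(2))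
          then show ?thesis by (rule order_trans[OF ennreal_indicator_le_1])
        qed
      next
        case False
        show ?thesis
        proof (cases "?bad v")
          case True
          have "c * real n < ?e v"
          proof (rule ccontr)
            assume "\<not> c * real n < ?e v"
            from conjI[OF True this] show False by (rule notE[OF False])
          qed
          then have "?tail v = 1" by (simp add: indicator_def)
          then have "1 \<le> ?lim v + (?sl 0 v + (?sl 1 v + (?sl 2 v + ?tail v)))" by (rule one_le_add5(3))
          then show ?thesis by (rule order_trans[OF ennreal_indicator_le_1])
        next
          case F: False
          have z: "indicator {v. ?bad v} v = (0 :: ennreal)" by (rule ennreal_indicator_0) (rule F)
          show ?thesis unfolding z by (rule zero_le)
        qed
      qed
    qed
    also have "\<dots> = (\<integral>\<^sup>+v. ?lim v \<partial>?M) + ((\<integral>\<^sup>+v. ?sl 0 v \<partial>?M) + ((\<integral>\<^sup>+v. ?sl 1 v \<partial>?M) + ((\<integral>\<^sup>+v. ?sl 2 v \<partial>?M) + (\<integral>\<^sup>+v. ?tail v \<partial>?M))))"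
      by (rule nn_integral_add5) measurable
    also have "\<dots> \<le> (\<integral>\<^sup>+v. ?lim v \<partial>?M) + (ennreal (S 0 / sqrt n) + (ennreal (S 1 / sqrt n) + (ennreal (S 2 / sqrt n) + ennreal (C1 / sqrt n))))"
      using S[of 0] S[of 1] S[of 2] n by (intro add_mono order.refl C1(3)) auto
    also have "ennreal (S 0 / sqrt n) + (ennreal (S 1 / sqrt n) + (ennreal (S 2 / sqrt n) + ennreal (C1 / sqrt n))) = ennreal ((S 0 + S 1 + S 2 + C1) / sqrt n)"
      using S0 C1(1) by (simp add: ennreal_plus[symmetric] add_divide_distrib add_ac del: ennreal_plus)
    finally have 2: "(\<integral>\<^sup>+v. indicator {v. ?bad v} v \<partial>?M) \<le> (\<integral>\<^sup>+v. ?lim v \<partial>?M) + ennreal ((S 0 + S 1 + S 2 + C1) / sqrt n)" .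
    have "(\<integral>\<^sup>+\<rho>. \<integral>\<^sup>+\<omega>. indicator {\<omega>. \<exists>i<3. min (w i) (\<kappa> * sqrt n) \<le> deficit5 n P1 P2 i \<rho> \<omega>} \<omega> \<partial>mac5 n \<partial>chi n) \<le>
      (\<integral>\<^sup>+v. ?lim v \<partial>?M) + ennreal ((S 0 + S 1 + S 2 + C1) / sqrt n) + ennreal (C0 / sqrt n)"
      using 1 unfolding 3 using add_right_mono[OF 2] by (rule order_trans)
    also have "\<dots> = (\<integral>\<^sup>+v. ?lim v \<partial>?M) + ennreal (Ctot / sqrt n)"
      using S0 C1(1) C0(1) unfolding Ctot_def
      by (subst add.assoc, subst ennreal_plus[symmetric]) (auto simp: add_divide_distrib)
    finally show "(\<integral>\<^sup>+\<rho>. \<integral>\<^sup>+\<omega>. indicator {\<omega>. \<exists>i<3. min (w i) (\<kappa> * sqrt n) \<le> deficit5 n P1 P2 i \<rho> \<omega>} \<omega> \<partial>mac5 n \<partial>chi n) \<le>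
      (\<integral>\<^sup>+v. ?lim v \<partial>?M) + ennreal (Ctot / sqrt n)" .
  qed
qed

text \<open>A local estimate on the scale 1/sqrt n: up to total variation and tails, the slice lies
  in a slab around \<open>w\<close> whose thickness covers both the Taylor error and the length of
  the slice.\<close>

lemma deficit_slice:
  assumes P: "0 < P1" "0 < P2" and i: "i < 3"
  obtains C n0 where "0 \<le> C" "3 \<le> n0" "\<And>n w. n0 \<le> n \<Longrightarrow>
    (\<integral>\<^sup>+\<rho>. \<integral>\<^sup>+\<omega>. indicator {\<omega>. w \<le> deficit5 n P1 P2 i \<rho> \<omega> \<and> deficit5 n P1 P2 i \<rho> \<omega> \<le> w + 1 / sqrt n} \<omega> \<partial>mac5 n \<partial>chi n) \<le> ennreal (C / sqrt n)"
proof -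
  obtain B c where B: "0 < B" "0 < c"
    "\<And>n i x \<omega>. 1 \<le> n \<Longrightarrow> i < 3 \<Longrightarrow> env n x \<omega> \<le> c * real n \<Longrightarrow>
      \<bar>deficit5 n P1 P2 i (sqrt (real (n - 1)) + x / sqrt 2) \<omega> - lin5 P1 P2 i x \<omega>\<bar> \<le> B / sqrt n * env n x \<omega> \<and>
      deficit5 n P1 P2 i (sqrt (real (n - 1)) + x / sqrt 2) \<omega> < 1 * sqrt n"
    using deficit5_approx[OF P zero_less_one] by metis
  obtain C0 n0 where C0: "0 \<le> C0" "1 \<le> n0"
    "\<And>n E. n0 \<le> n \<Longrightarrow> Measurable.pred (borel \<Otimes>\<^sub>M mac5 n) (\<lambda>w. E (fst w) (snd w)) \<Longrightarrow>
      (\<integral>\<^sup>+\<rho>. \<integral>\<^sup>+\<omega>. indicator {\<omega>. E \<rho> \<omega>} \<omega> \<partial>mac5 n \<partial>chi n) \<le>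
      (\<integral>\<^sup>+x. \<integral>\<^sup>+\<omega>. indicator {\<omega>. E (sqrt (real (n - 1)) + x / sqrt 2) \<omega>} \<omega> \<partial>mac5 n \<partial>std_normal) + ennreal (C0 / sqrt n)"
    apply (rule chi_mac5_transfer)
    subgoal premises prems for C n0 by (rule prems(1)[OF prems(2-4)])
    done
  obtain C1 n1 where C1: "0 \<le> C1" "3 \<le> n1" "\<And>n. n1 \<le> n \<Longrightarrow>
    (\<integral>\<^sup>+w. indicator {w. c * real n < env n (fst w) (snd w)} w \<partial>(std_normal \<Otimes>\<^sub>M mac5 n)) \<le> ennreal (C1 / sqrt n)"
    apply (rule env_tail[OF B(2)])
    subgoal premises prems for C n0 by (rule prems(1)[OF prems(2-4)])
    done
  have B1: "0 \<le> B + 1" using B(1) by simp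
  obtain S m where S: "0 \<le> S" "3 \<le> m" "\<And>n w. m \<le> n \<Longrightarrow>
    (\<integral>\<^sup>+v. indicator {v. \<bar>lin5 P1 P2 i (fst v) (snd v) - w\<bar> \<le> (B + 1) / sqrt n * env n (fst v) (snd v)} v \<partial>(std_normal \<Otimes>\<^sub>M mac5 n)) \<le> ennreal (S / sqrt n)"
    apply (rule slab5[OF P i B1])
    subgoal premises prems for C n0 by (rule prems(1)[OF prems(2-4)])
    done
  define N where "N = max (max n0 n1) m"
  show ?thesis
  proof (rule that[of "S + C1 + C0" N])
    show "0 \<le> S + C1 + C0" using S C0 C1 by simp
    show "3 \<le> N" using C1(2) by (simp add: N_def)
    fix n w assume "N \<le> n"
    then have n: "n0 \<le> n" "n1 \<le> n" "m \<le> n" by (auto simp: N_def)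
    have n1: "1 \<le> n" using n C0(2) by simp
    let ?M = "std_normal \<Otimes>\<^sub>M mac5 n"
    let ?D = "\<lambda>x. deficit5 n P1 P2 i (sqrt (real (n - 1)) + x / sqrt 2)"
    let ?L = "\<lambda>v. lin5 P1 P2 i (fst v) (snd v)"
    let ?e = "\<lambda>v. env n (fst v) (snd v)"
    let ?bad = "\<lambda>v. w \<le> ?D (fst v) (snd v) \<and> ?D (fst v) (snd v) \<le> w + 1 / sqrt n"
    let ?sl = "indicator {v. \<bar>?L v - w\<bar> \<le> (B + 1) / sqrt n * ?e v} :: _ \<Rightarrow> ennreal"
    let ?tail = "indicator {v. c * real n < ?e v} :: _ \<Rightarrow> ennreal"
    have sl_m: "?sl \<in> borel_measurable ?M" by (rule pred_indicator) measurable
    have tail_m: "?tail \<in> borel_measurable ?M" by (rule pred_indicator) measurable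
    have D_meas [measurable]: "(\<lambda>v. ?D (fst v) (snd v)) \<in> borel_measurable ?M"
    proof -
      have "(\<lambda>v. (sqrt (real (n - 1)) + fst v / sqrt 2, snd v)) \<in> ?M \<rightarrow>\<^sub>M borel \<Otimes>\<^sub>M mac5 n" by measurable
      from measurable_compose[OF this measurable_deficit5] show ?thesis by simp
    qed
    have 1: "(\<integral>\<^sup>+\<rho>. \<integral>\<^sup>+\<omega>. indicator {\<omega>. w \<le> deficit5 n P1 P2 i \<rho> \<omega> \<and> deficit5 n P1 P2 i \<rho> \<omega> \<le> w + 1 / sqrt n} \<omega> \<partial>mac5 n \<partial>chi n) \<le>
      (\<integral>\<^sup>+x. \<integral>\<^sup>+\<omega>. indicator {\<omega>. w \<le> ?D x \<omega> \<and> ?D x \<omega> \<le> w + 1 / sqrt n} \<omega> \<partial>mac5 n \<partial>std_normal) + ennreal (C0 / sqrt n)"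
    proof (rule C0(3)[OF n(1)])
      show "Measurable.pred (borel \<Otimes>\<^sub>M mac5 n) (\<lambda>v. w \<le> deficit5 n P1 P2 i (fst v) (snd v) \<and> deficit5 n P1 P2 i (fst v) (snd v) \<le> w + 1 / sqrt n)"
        by measurable
    qed
    have 3: "(\<integral>\<^sup>+x. \<integral>\<^sup>+\<omega>. indicator {\<omega>. w \<le> ?D x \<omega> \<and> ?D x \<omega> \<le> w + 1 / sqrt n} \<omega> \<partial>mac5 n \<partial>std_normal) = (\<integral>\<^sup>+v. indicator {v. ?bad v} v \<partial>?M)"
    proof (subst nn_integral_std_normal_mac5)
      show "(indicator {v. ?bad v} :: _ \<Rightarrow> ennreal) \<in> borel_measurable ?M" by (rule pred_indicator) measurable
    qed (intro nn_integral_cong, simp add: indicator_def)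
    have "(\<integral>\<^sup>+v. indicator {v. ?bad v} v \<partial>?M) \<le> (\<integral>\<^sup>+v. ?sl v + ?tail v \<partial>?M)"
    proof (rule nn_integral_mono)
      fix v :: "real \<times> real \<times> real \<times> real \<times> real \<times> real"
      show "indicator {v. ?bad v} v \<le> ?sl v + ?tail v"
      proof (cases "?bad v")
        case bad: True
        show ?thesis
        proof (cases "c * real n < ?e v")
          case True
          then have "?tail v = 1" by (simp add: indicator_def)
          then have "1 \<le> ?sl v + ?tail v" by (simp add: add_increasing)
          then show ?thesis by (rule order_trans[OF ennreal_indicator_le_1])
        next
          case False
          then have small: "?e v \<le> c * real n" by simp
          have ap: "\<bar>?D (fst v) (snd v) - ?L v\<bar> \<le> B / sqrt n * ?e v"
            using B(3)[OF n1 i small] by (rule conjunct1)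
          \<comment> \<open>As the envelope is at least 1, raising the slab constant from B to B + 1
            pays for the length of the slice.\<close>
          have "1 / sqrt n * 1 \<le> 1 / sqrt n * ?e v"
            using env_ge[of n "fst v" "snd v"] by (intro mult_left_mono) auto
          moreover have "(B + 1) / sqrt n * ?e v = B / sqrt n * ?e v + 1 / sqrt n * ?e v"
            by (simp add: add_divide_distrib distrib_right)
          ultimately have "\<bar>?L v - w\<bar> \<le> (B + 1) / sqrt n * ?e v" using bad ap by linarith
          then have "?sl v = 1" by (simp add: indicator_def)
          then have "1 \<le> ?sl v + ?tail v" by (simp add: add_increasing2)
          then show ?thesis by (rule order_trans[OF ennreal_indicator_le_1])
        qed
      next
        case False
        have z: "indicator {v. ?bad v} v = (0 :: ennreal)" by (rule ennreal_indicator_0) (rule False)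
        show ?thesis unfolding z by (rule zero_le)
      qed
    qed
    also have "\<dots> = (\<integral>\<^sup>+v. ?sl v \<partial>?M) + (\<integral>\<^sup>+v. ?tail v \<partial>?M)"
      by (rule nn_integral_add[OF sl_m tail_m])
    also have "\<dots> \<le> ennreal (S / sqrt n) + ennreal (C1 / sqrt n)"
      by (intro add_mono S(3) C1(3) n)
    finally have 2: "(\<integral>\<^sup>+v. indicator {v. ?bad v} v \<partial>?M) \<le> ennreal (S / sqrt n) + ennreal (C1 / sqrt n)" .
    have "(\<integral>\<^sup>+\<rho>. \<integral>\<^sup>+\<omega>. indicator {\<omega>. w \<le> deficit5 n P1 P2 i \<rho> \<omega> \<and> deficit5 n P1 P2 i \<rho> \<omega> \<le> w + 1 / sqrt n} \<omega> \<partial>mac5 n \<partial>chi n) \<le>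
      ennreal (S / sqrt n) + ennreal (C1 / sqrt n) + ennreal (C0 / sqrt n)"
      using 1 unfolding 3 using add_right_mono[OF 2] by (rule order_trans)
    also have "\<dots> = ennreal ((S + C1 + C0) / sqrt n)"
      using S(1) C1(1) C0(1) by (simp add: ennreal_plus[symmetric] add_divide_distrib del: ennreal_plus)
    finally show "(\<integral>\<^sup>+\<rho>. \<integral>\<^sup>+\<omega>. indicator {\<omega>. w \<le> deficit5 n P1 P2 i \<rho> \<omega> \<and> deficit5 n P1 P2 i \<rho> \<omega> \<le> w + 1 / sqrt n} \<omega> \<partial>mac5 n \<partial>chi n) \<le>
      ennreal ((S + C1 + C0) / sqrt n)" .
  qed
qed


section \<open>The limit law and the dispersion matrix\<close>

definition normal4 :: "(real \<times> real \<times> real \<times> real) measure" where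
  "normal4 = std_normal \<Otimes>\<^sub>M std_normal \<Otimes>\<^sub>M std_normal \<Otimes>\<^sub>M std_normal"

definition lin4 :: "real \<Rightarrow> real \<Rightarrow> nat \<Rightarrow> real \<times> real \<times> real \<times> real \<Rightarrow> real" where
  "lin4 P1 P2 i = (\<lambda>(x, a, b, g). lin P1 P2 i (x / sqrt 2) a b g)"

lemma prob_space_normal4: "prob_space normal4"
  unfolding normal4_def by (intro prob_space_pair prob_space_std_normal)

interpretation normal4: prob_space normal4
  by (rule prob_space_normal4)

lemma sets_normal4 [measurable_cong]: "sets normal4 = sets (borel \<Otimes>\<^sub>M borel \<Otimes>\<^sub>M borel \<Otimes>\<^sub>M borel)"
  unfolding normal4_def by (intro sets_pair_measure_cong sets_std_normal)

lemma space_normal4 [simp]: "space normal4 = UNIV"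
  by (simp add: normal4_def space_pair_measure)

lemma measurable_lin4 [measurable]: "lin4 P1 P2 i \<in> borel_measurable normal4"
proof -
  have "(\<lambda>v. lin P1 P2 i (fst v / sqrt 2) (fst (snd v)) (fst (snd (snd v))) (snd (snd (snd v)))) \<in> borel_measurable normal4"
    unfolding lin_def by measurable
  then show ?thesis by (simp add: lin4_def split_beta')
qed

lemma nn_integral_normal4:
  assumes f: "f \<in> borel_measurable normal4"
  shows "(\<integral>\<^sup>+v. f v \<partial>normal4) = (\<integral>\<^sup>+x. \<integral>\<^sup>+a. \<integral>\<^sup>+b. \<integral>\<^sup>+g. f (x, a, b, g) \<partial>std_normal \<partial>std_normal \<partial>std_normal \<partial>std_normal)"
proof -
  let ?M2 = "std_normal \<Otimes>\<^sub>M std_normal"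
  let ?M3 = "std_normal \<Otimes>\<^sub>M ?M2"
  interpret p2: prob_space ?M2 by (intro prob_space_pair prob_space_std_normal)
  interpret p3: prob_space ?M3 by (intro prob_space_pair prob_space_std_normal)
  have f5: "f \<in> borel_measurable (std_normal \<Otimes>\<^sub>M ?M3)" using f by (simp add: normal4_def)
  have f4: "(\<lambda>y. f (a, y)) \<in> borel_measurable ?M3" for a
    using measurable_compose[OF measurable_Pair1' f5] by simp
  have f3: "(\<lambda>y. f (a, r, y)) \<in> borel_measurable ?M2" for a r
    using measurable_compose[OF measurable_Pair1' f4] by simp
  have "(\<integral>\<^sup>+v. f v \<partial>normal4) = (\<integral>\<^sup>+a. \<integral>\<^sup>+y. f (a, y) \<partial>?M3 \<partial>std_normal)"
    unfolding normal4_def by (rule p3.nn_integral_fst[symmetric, OF f5])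
  also have "\<dots> = (\<integral>\<^sup>+a. \<integral>\<^sup>+r. \<integral>\<^sup>+y. f (a, r, y) \<partial>?M2 \<partial>std_normal \<partial>std_normal)"
    by (intro nn_integral_cong) (rule p2.nn_integral_fst[symmetric, OF f4])
  also have "\<dots> = (\<integral>\<^sup>+x. \<integral>\<^sup>+a. \<integral>\<^sup>+b. \<integral>\<^sup>+g. f (x, a, b, g) \<partial>std_normal \<partial>std_normal \<partial>std_normal \<partial>std_normal)"
    by (intro nn_integral_cong) (rule std_normal.nn_integral_fst[symmetric, OF f3])
  finally show ?thesis .
qed

text \<open>Stated for an arbitrary factor because it serves twice: for four scalar Gaussians, and
  for four codewords of the random codebook.\<close>

lemma nn_integral_PiM_4:
  assumes M: "prob_space M" and f: "f \<in> borel_measurable (M \<Otimes>\<^sub>M M \<Otimes>\<^sub>M M \<Otimes>\<^sub>M M)"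
  shows "(\<integral>\<^sup>+v. f (v 0, v 1, v 2, v 3) \<partial>PiM {..<4::nat} (\<lambda>_. M)) = (\<integral>\<^sup>+x. \<integral>\<^sup>+a. \<integral>\<^sup>+b. \<integral>\<^sup>+g. f (x, a, b, g) \<partial>M \<partial>M \<partial>M \<partial>M)"
proof -
  interpret M: prob_space M by (rule M)
  interpret product_sigma_finite "\<lambda>_::nat. M" ..
  let ?P = "\<lambda>n. PiM {..<n::nat} (\<lambda>_. M)"
  have m: "(\<lambda>v. (v 0, v 1, v 2, v 3)) \<in> ?P 4 \<rightarrow>\<^sub>M M \<Otimes>\<^sub>M M \<Otimes>\<^sub>M M \<Otimes>\<^sub>M M"
    by (intro measurable_Pair measurable_component_singleton) auto
  have meas: "(\<lambda>x. \<integral>\<^sup>+y. h (x(n := y)) \<partial>M) \<in> borel_measurable (?P n)"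
    if h: "h \<in> borel_measurable (?P (Suc n))" for h :: "_ \<Rightarrow> ennreal" and n
  proof -
    have "(\<lambda>(f, y). f(n := y)) \<in> ?P n \<Otimes>\<^sub>M M \<rightarrow>\<^sub>M ?P (Suc n)"
      using measurable_add_dim[of n "{..<n}" "\<lambda>_. M"] by (simp add: lessThan_Suc)
    from measurable_compose[OF this h]
    have "(\<lambda>w. h ((fst w)(n := snd w))) \<in> borel_measurable (?P n \<Otimes>\<^sub>M M)" by (simp add: split_beta')
    from M.borel_measurable_nn_integral_fst[OF this] show ?thesis by simp
  qed
  have step: "(\<integral>\<^sup>+v. h v \<partial>?P (Suc n)) = (\<integral>\<^sup>+x. \<integral>\<^sup>+y. h (x(n := y)) \<partial>M \<partial>?P n)"
    if h: "h \<in> borel_measurable (?P (Suc n))" for h :: "_ \<Rightarrow> ennreal" and n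
    using product_nn_integral_insert[of "{..<n}" n h] h by (simp add: lessThan_Suc)
  define h4 where "h4 y = f (y 0, y 1, y 2, y 3)" for y :: "nat \<Rightarrow> _"
  define h3 where "h3 x = (\<integral>\<^sup>+y. h4 (x(3 := y)) \<partial>M)" for x
  define h2 where "h2 x = (\<integral>\<^sup>+y. h3 (x(2 := y)) \<partial>M)" for x
  define h1 where "h1 x = (\<integral>\<^sup>+y. h2 (x(1 := y)) \<partial>M)" for x
  have e: "?P 4 = ?P (Suc 3)" "?P 3 = ?P (Suc 2)" "?P 2 = ?P (Suc 1)" "?P 1 = ?P (Suc 0)"
    by (simp_all add: eval_nat_numeral)
  have h4: "h4 \<in> borel_measurable (?P (Suc 3))"
    unfolding h4_def[abs_def] e(1)[symmetric] by (rule measurable_compose[OF m f])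
  have h3: "h3 \<in> borel_measurable (?P (Suc 2))" unfolding h3_def[abs_def] e(2)[symmetric] by (rule meas[OF h4])
  have h2: "h2 \<in> borel_measurable (?P (Suc 1))" unfolding h2_def[abs_def] e(3)[symmetric] by (rule meas[OF h3])
  have h1: "h1 \<in> borel_measurable (?P (Suc 0))" unfolding h1_def[abs_def] e(4)[symmetric] by (rule meas[OF h2])
  have s4: "(\<integral>\<^sup>+y. h4 y \<partial>?P (Suc 3)) = (\<integral>\<^sup>+x. h3 x \<partial>?P (Suc 2))"
    unfolding h3_def e(2)[symmetric] by (rule step[OF h4])
  have s3: "(\<integral>\<^sup>+y. h3 y \<partial>?P (Suc 2)) = (\<integral>\<^sup>+x. h2 x \<partial>?P (Suc 1))"
    unfolding h2_def e(3)[symmetric] by (rule step[OF h3])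
  have s2: "(\<integral>\<^sup>+y. h2 y \<partial>?P (Suc 1)) = (\<integral>\<^sup>+x. h1 x \<partial>?P (Suc 0))"
    unfolding h1_def e(4)[symmetric] by (rule step[OF h2])
  have s1: "(\<integral>\<^sup>+y. h1 y \<partial>?P (Suc 0)) = (\<integral>\<^sup>+y. h1 ((\<lambda>_. undefined)(0 := y)) \<partial>M)"
    unfolding step[OF h1] by (simp add: nn_integral_empty)
  have "(\<integral>\<^sup>+y. f (y 0, y 1, y 2, y 3) \<partial>?P 4) = (\<integral>\<^sup>+y. h4 y \<partial>?P (Suc 3))" unfolding h4_def e(1) ..
  then show ?thesis
    unfolding s4 s3 s2 s1 unfolding h1_def h2_def h3_def h4_def by simp
qed

lemma nn_integral_gauss_vec_4:
  assumes f: "f \<in> borel_measurable normal4"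
  shows "(\<integral>\<^sup>+y. f (y 0, y 1, y 2, y 3) \<partial>gauss_vec 4) = (\<integral>\<^sup>+v. f v \<partial>normal4)"
  unfolding nn_integral_normal4[OF f] gauss_vec_def
  by (rule nn_integral_PiM_4[OF prob_space_std_normal]) (use f in \<open>simp add: normal4_def\<close>)

text \<open>Coefficients of the linear form \<open>lin4\<close> in the four independent Gaussians
  (x, a, b, g).\<close>

definition row :: "real \<Rightarrow> real \<Rightarrow> nat \<Rightarrow> nat \<Rightarrow> real" where
  "row P1 P2 i k = (if k = 0 then tot P1 P2 i / sqrt 2
     else if k = 1 then (if i = 1 then 0 else - sqrt P1)
     else if k = 2 then (if i = 0 then 0 else - sqrt P2)
     else (if i = 0 \<or> i = 1 then 0 else - sqrt (P1 * P2))) / (1 + tot P1 P2 i)"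

lemma ip4: "ip 4 x y = x 0 * y 0 + x 1 * y 1 + x 2 * y 2 + x 3 * y 3"
  by (simp add: ip_def eval_nat_numeral)

lemma ip_row: "ip 4 (row P1 P2 i) y = lin4 P1 P2 i (y 0, y 1, y 2, y 3)"
  unfolding ip4 row_def lin4_def lin_def by (simp add: diff_divide_distrib add_divide_distrib)

text \<open>This is where the dispersion matrix arises: covariances of linear forms in independent
  standard Gaussians are the inner products of their coefficient rows. In entry (2, 2) the
  contribution P1 P2 of the coordinate g produces the additional summand V_12.\<close>

lemma row_gram:
  assumes P: "0 < P1" "0 < P2" and ij: "i < 3" "j < 3"
  shows "ip 4 (row P1 P2 i) (row P1 P2 j) = disp_mat P1 P2 i j"
proof -
  have nz: "1 + P1 \<noteq> 0" "1 + P2 \<noteq> 0" "1 + (P1 + P2) \<noteq> 0" using P by auto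
  have i: "i = 0 \<or> i = 1 \<or> i = 2" and j: "j = 0 \<or> j = 1 \<or> j = 2" using ij by linarith+
  have sq: "sqrt P1 * sqrt P1 = P1" "sqrt P2 * sqrt P2 = P2" "sqrt (P1 * P2) * sqrt (P1 * P2) = P1 * P2" using P by auto
  have m: "(a / u) * (b / w) = (a * b) / (u * w)" for a b u w :: real by simp
  have e: "ip 4 (row P1 P2 i) (row P1 P2 j) = (tot P1 P2 i * tot P1 P2 j / 2
    + (if i = 1 \<or> j = 1 then 0 else P1) + (if i = 0 \<or> j = 0 then 0 else P2)
    + (if i = 0 \<or> i = 1 \<or> j = 0 \<or> j = 1 then 0 else P1 * P2)) / ((1 + tot P1 P2 i) * (1 + tot P1 P2 j))"
    unfolding ip4 row_def m using sq by (simp add: add_divide_distrib)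
  show ?thesis
  proof (cases "i = 2 \<and> j = 2")
    case True
    define w where "w = 1 + (P1 + P2)"
    have "((P1 + P2) * (P1 + P2) / 2 + P1 + P2 + P1 * P2) / (w * w) = (P1 + P2) * (P1 + P2 + 2) / (2 * (w * w)) + P1 * P2 / (w * w)"
      using nz(3) unfolding w_def[symmetric] by (simp add: field_simps)
    with True show ?thesis unfolding e by (simp add: disp_mat_def tot_def Disp_def Let_def doubleton_eq_iff w_def power2_eq_square add.assoc)
  next
    case False
    with i j nz P show ?thesis unfolding e
      by (elim disjE) (simp_all add: disp_mat_def tot_def Disp_def Let_def doubleton_eq_iff, simp_all add: field_simps power2_eq_square)
  qed
qed

text \<open>The choice in \<open>sqrt_factor\<close> is meaningful once some factor exists.
  Triangular reduction turns the three rows in four dimensions into vectors supported on three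
  coordinates with the same Gram matrix.\<close>

lemma sqrt_factor_disp_mat:
  assumes P: "0 < P1" "0 < P2"
  shows "\<forall>i<3. \<forall>j<3. (\<Sum>k<3. sqrt_factor (disp_mat P1 P2) i k * sqrt_factor (disp_mat P1 P2) j k) = disp_mat P1 P2 i j"
proof -
  obtain T where T: "gauss_isometry 4 0 T" "\<And>j i. j < 3 \<Longrightarrow> j < i \<Longrightarrow> i < 4 \<Longrightarrow> T (row P1 P2 j) i = 0"
    using gauss_isometry_triangular[of 4 "row P1 P2"] by auto
  have "(\<Sum>k<3. T (row P1 P2 i) k * T (row P1 P2 j) k) = disp_mat P1 P2 i j" if "i < 3" "j < 3" for i j
  proof -
    have "T (row P1 P2 i) 3 = 0" using T(2)[of i 3] that by simp
    then have "(\<Sum>k<3. T (row P1 P2 i) k * T (row P1 P2 j) k) = ip 4 (T (row P1 P2 i)) (T (row P1 P2 j))"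
      unfolding ip4 by (simp add: eval_nat_numeral)
    also have "\<dots> = disp_mat P1 P2 i j" using gauss_isometryD(3)[OF T(1)] row_gram[OF P that] by simp
    finally show ?thesis .
  qed
  then have "\<exists>A :: nat \<Rightarrow> nat \<Rightarrow> real. \<forall>i<3. \<forall>j<3. (\<Sum>k<3. A i k * A j k) = disp_mat P1 P2 i j"
    by (intro exI[of _ "\<lambda>i. T (row P1 P2 i)"]) simp
  from someI_ex[OF this] show ?thesis unfolding sqrt_factor_def .
qed

text \<open>The chosen factor and the matrix of rows have the same Gram matrix, so by
  \<open>emeasure_gauss_vec_gram\<close> they define the same Gaussian law.\<close>

lemma gauss_cdf3_disp_mat:
  assumes P: "0 < P1" "0 < P2"
  shows "gauss_cdf3 (disp_mat P1 P2) z = measure normal4 {v. \<forall>i<3. lin4 P1 P2 i v \<le> z i}"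
proof -
  \<comment> \<open>The 3 x 3 factor is padded with a zero column so that both families live in four
    dimensions.\<close>
  define A where "A i k = (if k < 3 then sqrt_factor (disp_mat P1 P2) i k else 0)" for i k :: nat
  have A3: "ip 4 (A i) g = (\<Sum>k<3. sqrt_factor (disp_mat P1 P2) i k * g k)" for i g
    unfolding ip4 A_def by (simp add: eval_nat_numeral)
  have AA: "ip 4 (A i) (A j) = disp_mat P1 P2 i j" if "i < 3" "j < 3" for i j
    using sqrt_factor_disp_mat[OF P] that unfolding A3 by (simp add: A_def)
  have ipm: "(\<lambda>g. ip n x g) \<in> borel_measurable (gauss_vec n)" for n x by (rule measurable_ip_right)
  have S3: "{g \<in> space (gauss_vec 3). \<forall>i<3. (\<Sum>k<3. sqrt_factor (disp_mat P1 P2) i k * g k) \<le> z i} \<in> sets (gauss_vec 3)"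
  proof -
    have "{g \<in> space (gauss_vec 3). \<forall>i<3. ip 3 (sqrt_factor (disp_mat P1 P2) i) g \<le> z i} \<in> sets (gauss_vec 3)"
      by measurable
    then show ?thesis by (simp add: ip_def)
  qed
  have S4: "{g \<in> space (gauss_vec 4). \<forall>i<3. ip 4 (r i) g \<le> z i} \<in> sets (gauss_vec 4)" for r :: "nat \<Rightarrow> nat \<Rightarrow> real"
    by measurable
  let ?I3 = "indicator {g \<in> space (gauss_vec 3). \<forall>i<3. (\<Sum>k<3. sqrt_factor (disp_mat P1 P2) i k * g k) \<le> z i} :: _ \<Rightarrow> ennreal"
  let ?I4 = "indicator {g \<in> space (gauss_vec 4). \<forall>i<3. ip 4 (A i) g \<le> z i} :: _ \<Rightarrow> ennreal"
  have n4: "(4::nat) = Suc 3" by simp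
  have "emeasure (gauss_vec 4) {g \<in> space (gauss_vec 4). \<forall>i<3. ip 4 (A i) g \<le> z i} = (\<integral>\<^sup>+g. ?I4 g \<partial>gauss_vec 4)"
    using S4 by simp
  also have "\<dots> = (\<integral>\<^sup>+g. \<integral>\<^sup>+y. ?I4 (g(3 := y)) \<partial>std_normal \<partial>gauss_vec 3)"
    unfolding n4 by (rule nn_integral_gauss_vec_Suc) (use S4 in simp)
  also have "\<dots> = (\<integral>\<^sup>+g. \<integral>\<^sup>+y. ?I3 g \<partial>std_normal \<partial>gauss_vec 3)"
  proof (intro nn_integral_cong)
    fix g y assume g: "g \<in> space (gauss_vec 3)"
    have "g(3 := y) \<in> space (gauss_vec 4)" using g by (auto simp: space_gauss_vec PiE_def extensional_def)
    moreover have "ip 4 (A i) (g(3 := y)) = (\<Sum>k<3. sqrt_factor (disp_mat P1 P2) i k * g k)" for i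
      unfolding A3 by (intro sum.cong) auto
    ultimately show "?I4 (g(3 := y)) = ?I3 g" using g by (simp add: indicator_def)
  qed
  also have "\<dots> = emeasure (gauss_vec 3) {g \<in> space (gauss_vec 3). \<forall>i<3. (\<Sum>k<3. sqrt_factor (disp_mat P1 P2) i k * g k) \<le> z i}"
    using S3 by (simp add: std_normal.emeasure_space_1[simplified])
  finally have 1: "emeasure (gauss_vec 3) {g \<in> space (gauss_vec 3). \<forall>i<3. (\<Sum>k<3. sqrt_factor (disp_mat P1 P2) i k * g k) \<le> z i} =
    emeasure (gauss_vec 4) {g \<in> space (gauss_vec 4). \<forall>i<3. ip 4 (A i) g \<le> z i}" by simp
  have d00: "disp_mat P1 P2 0 0 = Disp P1" and d11: "disp_mat P1 P2 1 1 = Disp P2"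
    and d01: "disp_mat P1 P2 0 1 = (1/2) * (P1 * P2) / ((1 + P1) * (1 + P2))"
    by (simp_all add: disp_mat_def Let_def)
  have pos: "0 < Disp P1" using P by (simp add: Disp_def)
  \<comment> \<open>The leading 2 x 2 minor is positive because P1 P2 < (P1 + 2)(P2 + 2).\<close>
  have pd: "(disp_mat P1 P2 0 1)\<^sup>2 < disp_mat P1 P2 0 0 * disp_mat P1 P2 1 1"
  proof -
    have "disp_mat P1 P2 0 0 * disp_mat P1 P2 1 1 = (P1 * P2 * ((P1 + 2) * (P2 + 2))) / (4 * ((1 + P1)\<^sup>2 * (1 + P2)\<^sup>2))"
      unfolding d00 d11 Disp_def by simp
    moreover have "(disp_mat P1 P2 0 1)\<^sup>2 = (P1 * P2 * (P1 * P2)) / (4 * ((1 + P1)\<^sup>2 * (1 + P2)\<^sup>2))"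
      unfolding d01 by (simp add: power2_eq_square)
    moreover have "P1 * P2 * (P1 * P2) < P1 * P2 * ((P1 + 2) * (P2 + 2))"
      using P by (intro mult_strict_left_mono mult_strict_mono) auto
    ultimately show ?thesis using P by (simp add: divide_strict_right_mono)
  qed
  have 2: "emeasure (gauss_vec 4) {g \<in> space (gauss_vec 4). \<forall>i<3. ip 4 (A i) g \<le> z i} =
    emeasure (gauss_vec 4) {g \<in> space (gauss_vec 4). \<forall>i<3. ip 4 (row P1 P2 i) g \<le> z i}"
    by (rule emeasure_gauss_vec_gram) (use AA row_gram[OF P] pos d00 pd in auto)
  have 3: "emeasure (gauss_vec 4) {g \<in> space (gauss_vec 4). \<forall>i<3. ip 4 (row P1 P2 i) g \<le> z i} = emeasure normal4 {v. \<forall>i<3. lin4 P1 P2 i v \<le> z i}"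
  proof -
    let ?S = "{v. \<forall>i<3. lin4 P1 P2 i v \<le> z i}"
    have S: "?S \<in> sets normal4"
    proof -
      have "{v \<in> space normal4. \<forall>i<3. lin4 P1 P2 i v \<le> z i} \<in> sets normal4" by measurable
      then show ?thesis by simp
    qed
    have "emeasure (gauss_vec 4) {g \<in> space (gauss_vec 4). \<forall>i<3. ip 4 (row P1 P2 i) g \<le> z i} =
      (\<integral>\<^sup>+g. indicator {g \<in> space (gauss_vec 4). \<forall>i<3. ip 4 (row P1 P2 i) g \<le> z i} g \<partial>gauss_vec 4)"
      using S4 by simp
    also have "\<dots> = (\<integral>\<^sup>+g. indicator ?S (g 0, g 1, g 2, g 3) \<partial>gauss_vec 4)"
      by (intro nn_integral_cong) (simp add: indicator_def ip_row)
    also have "\<dots> = (\<integral>\<^sup>+v. indicator ?S v \<partial>normal4)" using S by (intro nn_integral_gauss_vec_4) simp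
    also have "\<dots> = emeasure normal4 ?S" using S by simp
    finally show ?thesis .
  qed
  show ?thesis unfolding gauss_cdf3_def measure_def 1 2 3 ..
qed

text \<open>The linear forms do not involve r and u, so the chi coordinates integrate out and the
  limit probability is independent of n.\<close>

lemma nn_integral_lin5_exceed:
  assumes P: "0 < P1" "0 < P2"
  shows "(\<integral>\<^sup>+v. indicator {v. \<exists>i<3. w i < lin5 P1 P2 i (fst v) (snd v)} v \<partial>(std_normal \<Otimes>\<^sub>M mac5 n)) = ennreal (1 - gauss_cdf3 (disp_mat P1 P2) w)"
proof -
  let ?S = "{v. \<forall>i<3. lin4 P1 P2 i v \<le> w i}"
  have S: "?S \<in> sets normal4"
  proof -
    have "{v \<in> space normal4. \<forall>i<3. lin4 P1 P2 i v \<le> w i} \<in> sets normal4" by measurable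
    then show ?thesis by simp
  qed
  have cS: "- ?S \<in> sets normal4" using sets.compl_sets[OF S] by (simp add: Compl_eq_Diff_UNIV)
  have m: "(indicator {v. \<exists>i<3. w i < lin5 P1 P2 i (fst v) (snd v)} :: _ \<Rightarrow> ennreal) \<in> borel_measurable (std_normal \<Otimes>\<^sub>M mac5 n)"
    by (rule pred_indicator) measurable
  have mx: "(\<lambda>\<omega>. indicator {v. \<exists>i<3. w i < lin5 P1 P2 i (fst v) (snd v)} (x, \<omega>) :: ennreal) \<in> borel_measurable (mac5 n)" for x
    using measurable_compose[OF measurable_Pair1' m, of x] by simp
  have "(\<integral>\<^sup>+v. indicator {v. \<exists>i<3. w i < lin5 P1 P2 i (fst v) (snd v)} v \<partial>(std_normal \<Otimes>\<^sub>M mac5 n)) =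
    (\<integral>\<^sup>+x. \<integral>\<^sup>+a. \<integral>\<^sup>+r. \<integral>\<^sup>+b. \<integral>\<^sup>+g. \<integral>\<^sup>+u. indicator (- ?S) (x, a, b, g)
       \<partial>chi (n - 2) \<partial>std_normal \<partial>std_normal \<partial>chi (n - 1) \<partial>std_normal \<partial>std_normal)"
    unfolding nn_integral_std_normal_mac5[OF m] nn_integral_mac5[OF mx]
    by (intro nn_integral_cong) (simp add: indicator_def lin5_def lin4_def not_le)
  also have "\<dots> = (\<integral>\<^sup>+x. \<integral>\<^sup>+a. \<integral>\<^sup>+b. \<integral>\<^sup>+g. indicator (- ?S) (x, a, b, g) \<partial>std_normal \<partial>std_normal \<partial>std_normal \<partial>std_normal)"
    by (simp add: chi.emeasure_space_1[simplified])
  also have "\<dots> = (\<integral>\<^sup>+v. indicator (- ?S) v \<partial>normal4)"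
    by (rule nn_integral_normal4[symmetric], rule borel_measurable_indicator, rule cS)
  also have "\<dots> = emeasure normal4 (- ?S)" by (rule nn_integral_indicator[OF cS])
  also have "- ?S = space normal4 - ?S" by (simp add: Compl_eq_Diff_UNIV)
  also have "emeasure normal4 (space normal4 - ?S) = ennreal (measure normal4 (space normal4 - ?S))" by (rule normal4.emeasure_eq_measure)
  also have "measure normal4 (space normal4 - ?S) = 1 - gauss_cdf3 (disp_mat P1 P2) w"
    unfolding gauss_cdf3_disp_mat[OF P] by (rule normal4.prob_compl[OF S])
  finally show ?thesis .
qed


section \<open>Growth of the limiting distribution function\<close>

lemma nn_integral_std_normal_interval_ge:
  fixes f :: "real \<Rightarrow> ennreal"
  assumes l: "0 \<le> l" and R: "- R \<le> u" "u + l \<le> R" and c: "0 \<le> c"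
    and f: "\<And>x. u \<le> x \<Longrightarrow> x \<le> u + l \<Longrightarrow> ennreal c \<le> f x"
  shows "ennreal (l * std_normal_density R * c) \<le> (\<integral>\<^sup>+x. f x \<partial>std_normal)"
proof -
  let ?I = "indicator {u..u + l} :: real \<Rightarrow> ennreal"
  have d: "std_normal_density R \<le> std_normal_density x" if "u \<le> x" "x \<le> u + l" for x
  proof -
    have "\<bar>x\<bar> \<le> \<bar>R\<bar>" using that R by auto
    then have "x\<^sup>2 \<le> R\<^sup>2" by (simp add: abs_le_square_iff)
    then show ?thesis by (simp add: std_normal_density_def divide_right_mono)
  qed
  have "ennreal (l * std_normal_density R * c) = ennreal (std_normal_density R * c) * ennreal l"
    using l c by (simp add: ennreal_mult[symmetric] mult_ac)
  also have "\<dots> = ennreal (std_normal_density R * c) * emeasure lborel {u..u + l}" using l by simp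
  also have "\<dots> = (\<integral>\<^sup>+x. ennreal (std_normal_density R * c) * ?I x \<partial>lborel)"
    by (rule nn_integral_cmult_indicator[symmetric]) simp
  also have "\<dots> \<le> (\<integral>\<^sup>+x. ennreal (std_normal_density x) * (ennreal c * ?I x) \<partial>lborel)"
  proof (rule nn_integral_mono)
    fix x
    show "ennreal (std_normal_density R * c) * ?I x \<le> ennreal (std_normal_density x) * (ennreal c * ?I x)"
      using d[of x] c by (cases "x \<in> {u..u + l}") (auto simp: ennreal_mult[symmetric] intro!: mult_right_mono)
  qed
  also have "\<dots> = (\<integral>\<^sup>+x. ennreal c * ?I x \<partial>std_normal)"
    by (rule nn_integral_std_normal[symmetric]) simp
  also have "\<dots> \<le> (\<integral>\<^sup>+x. f x \<partial>std_normal)"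
  proof (rule nn_integral_mono)
    fix x show "ennreal c * ?I x \<le> f x" using f[of x] by (cases "x \<in> {u..u + l}") auto
  qed
  finally show ?thesis .
qed

text \<open>A volume bound for a skewed box: each edge may start at a point depending on the earlier
  coordinates, while all of it stays in the cube of radius R, where the Gaussian density is bounded
  below.\<close>

lemma normal4_box_le:
  assumes S: "S \<in> sets normal4" and l: "0 \<le> la" "0 \<le> lb" "0 \<le> lg" and R: "1 \<le> R"
    and box: "\<And>x. 0 \<le> x \<Longrightarrow> x \<le> 1 \<Longrightarrow> - R \<le> ua x \<and> ua x + la \<le> R \<and>
      (\<forall>a. ua x \<le> a \<longrightarrow> a \<le> ua x + la \<longrightarrow> - R \<le> ub x a \<and> ub x a + lb \<le> R \<and>
      (\<forall>b. ub x a \<le> b \<longrightarrow> b \<le> ub x a + lb \<longrightarrow> - R \<le> ug x a b \<and> ug x a b + lg \<le> R \<and>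
      (\<forall>g. ug x a b \<le> g \<longrightarrow> g \<le> ug x a b + lg \<longrightarrow> (x, a, b, g) \<in> S)))"
  shows "la * lb * lg * std_normal_density R ^ 4 \<le> measure normal4 S"
proof -
  define d where "d = std_normal_density R"
  have d: "0 \<le> d" by (simp add: d_def)
  have "ennreal (1 * d * (la * d * (lb * d * (lg * d * 1)))) \<le>
    (\<integral>\<^sup>+x. \<integral>\<^sup>+a. \<integral>\<^sup>+b. \<integral>\<^sup>+g. indicator S (x, a, b, g) \<partial>std_normal \<partial>std_normal \<partial>std_normal \<partial>std_normal)"
    unfolding d_def
  proof (rule nn_integral_std_normal_interval_ge[where u = 0])
    fix x :: real assume x: "0 \<le> x" "x \<le> 0 + 1"
    note bx = box[of x, OF x(1)]
    show "ennreal (la * std_normal_density R * (lb * std_normal_density R * (lg * std_normal_density R * 1))) \<le>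
      (\<integral>\<^sup>+a. \<integral>\<^sup>+b. \<integral>\<^sup>+g. indicator S (x, a, b, g) \<partial>std_normal \<partial>std_normal \<partial>std_normal)"
    proof (rule nn_integral_std_normal_interval_ge[where u = "ua x"])
      fix a :: real assume a: "ua x \<le> a" "a \<le> ua x + la"
      have ba: "- R \<le> ub x a \<and> ub x a + lb \<le> R \<and>
        (\<forall>b. ub x a \<le> b \<longrightarrow> b \<le> ub x a + lb \<longrightarrow> - R \<le> ug x a b \<and> ug x a b + lg \<le> R \<and>
        (\<forall>g. ug x a b \<le> g \<longrightarrow> g \<le> ug x a b + lg \<longrightarrow> (x, a, b, g) \<in> S))" using bx x a by simp
      show "ennreal (lb * std_normal_density R * (lg * std_normal_density R * 1)) \<le>
        (\<integral>\<^sup>+b. \<integral>\<^sup>+g. indicator S (x, a, b, g) \<partial>std_normal \<partial>std_normal)"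
      proof (rule nn_integral_std_normal_interval_ge[where u = "ub x a"])
        fix b :: real assume b: "ub x a \<le> b" "b \<le> ub x a + lb"
        have bb: "- R \<le> ug x a b \<and> ug x a b + lg \<le> R \<and>
          (\<forall>g. ug x a b \<le> g \<longrightarrow> g \<le> ug x a b + lg \<longrightarrow> (x, a, b, g) \<in> S)" using ba b by simp
        show "ennreal (lg * std_normal_density R * 1) \<le> (\<integral>\<^sup>+g. indicator S (x, a, b, g) \<partial>std_normal)"
          by (rule nn_integral_std_normal_interval_ge[where u = "ug x a b"]) (use bb l in auto)
      qed (use ba l in auto)
    qed (use bx x l in auto)
  qed (use R l in auto)
  also have "\<dots> = (\<integral>\<^sup>+v. indicator S v \<partial>normal4)"
    by (rule nn_integral_normal4[symmetric], rule borel_measurable_indicator, rule S)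
  also have "\<dots> = ennreal (measure normal4 S)" using S by (simp add: normal4.emeasure_eq_measure)
  finally have "1 * d * (la * d * (lb * d * (lg * d * 1))) \<le> measure normal4 S" by (simp add: ennreal_le_iff)
  then show ?thesis unfolding d_def[symmetric] by (simp add: eval_nat_numeral mult_ac)
qed

definition lin_cdf :: "real \<Rightarrow> real \<Rightarrow> (nat \<Rightarrow> real) \<Rightarrow> real" where
  "lin_cdf P1 P2 z = measure normal4 {v. \<forall>i<3. lin4 P1 P2 i v \<le> z i}"

lemma sets_lin4_le: "{v. \<forall>i<3. lin4 P1 P2 i v \<le> z i} \<in> sets normal4"
proof -
  have "{v \<in> space normal4. \<forall>i<3. lin4 P1 P2 i v \<le> z i} \<in> sets normal4" by measurable
  then show ?thesis by simp
qed

lemma lin_cdf_shift: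
  assumes \<delta>: "0 < (\<delta>::real)"
  shows "lin_cdf P1 P2 (\<lambda>i. z i + \<delta>) = lin_cdf P1 P2 z +
    measure normal4 ({v. \<forall>i<3. lin4 P1 P2 i v \<le> z i + \<delta>} - {v. \<forall>i<3. lin4 P1 P2 i v \<le> z i})"
proof -
  have s: "{v. \<forall>i<3. lin4 P1 P2 i v \<le> z i} \<subseteq> {v. \<forall>i<3. lin4 P1 P2 i v \<le> z i + \<delta>}"
  proof (rule subsetI, rule CollectI, intro allI impI)
    fix v and i :: nat assume "v \<in> {v. \<forall>i<3. lin4 P1 P2 i v \<le> z i}" and "i < 3"
    then have "lin4 P1 P2 i v \<le> z i" by simp
    then show "lin4 P1 P2 i v \<le> z i + \<delta>" using \<delta> by simp
  qed
  show ?thesis unfolding lin_cdf_def normal4.finite_measure_Diff[OF sets_lin4_le sets_lin4_le s] by simp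
qed

lemma all_less_3: "(\<forall>i<(3::nat). Q i) \<longleftrightarrow> Q 0 \<and> Q 1 \<and> Q 2"
proof -
  have "i < (3::nat) \<longleftrightarrow> i = 0 \<or> i = 1 \<or> i = 2" for i by linarith
  then show ?thesis by auto
qed

lemma lin4_simps:
  "lin4 P1 P2 0 (x, a, b, g) = (P1 * (x / sqrt 2) - sqrt P1 * a) / (1 + P1)"
  "lin4 P1 P2 1 (x, a, b, g) = (P2 * (x / sqrt 2) - sqrt P2 * b) / (1 + P2)"
  "lin4 P1 P2 2 (x, a, b, g) = ((P1 + P2) * (x / sqrt 2) - (sqrt P1 * a + sqrt P2 * b) - sqrt (P1 * P2) * g) / (1 + (P1 + P2))"
  by (simp_all add: lin4_def lin_def tot_def)

lemma scaled_unit_interval: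
  assumes "0 \<le> x" "x \<le> 1" "0 \<le> (c::real)"
  shows "0 \<le> c * (x / sqrt 2)" "c * (x / sqrt 2) \<le> c"
proof -
  have "x / sqrt 2 \<le> 1" using assms by (simp add: divide_le_eq_1) (meson order_trans real_sqrt_ge_one one_le_numeral)
  then show "0 \<le> c * (x / sqrt 2)" "c * (x / sqrt 2) \<le> c" using assms mult_left_mono[of "x / sqrt 2" 1 c] by auto
qed

text \<open>The increment contains the event that the first form lies in (z 0, z 0 + \<delta>] while
  the other two are at most -B. It is forced by letting a range over an interval of length
  proportional to \<delta> and taking b and g large; a appears in the first and third form, b in the
  second and third, g in the third only, so they can be chosen in this order.\<close>

lemma gain_first:
  fixes P1 P2 B :: real
  assumes P: "0 < P1" "0 < P2" and B: "0 \<le> B"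
  obtains c where "0 < c" "\<And>z \<delta>. 0 < \<delta> \<Longrightarrow> \<delta> \<le> 1 \<Longrightarrow> (\<forall>i<3. - B \<le> z i) \<Longrightarrow> z 0 \<le> B \<Longrightarrow>
    lin_cdf P1 P2 z + c * \<delta> \<le> lin_cdf P1 P2 (\<lambda>i. z i + \<delta>)"
proof -
  define s1 s2 s3 where "s1 = sqrt P1" and "s2 = sqrt P2" and "s3 = sqrt (P1 * P2)"
  have s: "0 < s1" "0 < s2" "0 < s3" using P by (auto simp: s1_def s2_def s3_def)
  \<comment> \<open>\<open>Ra\<close> bounds the possible starting points of a; \<beta> then pushes
    the second form below -B and \<gamma> the third, whatever the value of a.\<close>
  define Ra where "Ra = (P1 + (1 + P1) * (B + 1)) / s1"
  define \<beta> where "\<beta> = (P2 + (1 + P2) * B) / s2"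
  define \<gamma> where "\<gamma> = ((P1 + P2) + s1 * Ra + (1 + (P1 + P2)) * B) / s3"
  have Ra: "0 \<le> Ra" using s P B by (simp add: Ra_def)
  have \<beta>: "0 \<le> \<beta>" using s P B by (simp add: \<beta>_def)
  have \<gamma>: "0 \<le> \<gamma>" using s P B Ra by (simp add: \<gamma>_def)
  have sRa: "s1 * Ra = P1 + (1 + P1) * (B + 1)" using s by (simp add: Ra_def)
  have s\<beta>: "s2 * \<beta> = P2 + (1 + P2) * B" using s by (simp add: \<beta>_def)
  have s\<gamma>: "s3 * \<gamma> = (P1 + P2) + s1 * Ra + (1 + (P1 + P2)) * B" using s by (simp add: \<gamma>_def)
  \<comment> \<open>Along an a-interval of length l \<delta> the first form drops by only
    \<delta>/2, so it stays strictly above \<open>z 0\<close>.\<close>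
  define l where "l = (1 + P1) / (2 * s1)"
  have l: "0 < l" using s P by (simp add: l_def)
  define R where "R = 1 + Ra + l + \<beta> + \<gamma>"
  show ?thesis
  proof (rule that[of "l * std_normal_density R ^ 4"])
    show "0 < l * std_normal_density R ^ 4" using l by (intro mult_pos_pos zero_less_power normal_density_pos) simp_all
    fix z :: "nat \<Rightarrow> real" and \<delta> :: real
    assume \<delta>: "0 < \<delta>" "\<delta> \<le> 1" and zB: "\<forall>i<3. - B \<le> z i" and z0: "z 0 \<le> B"
    have z: "- B \<le> z 0" "- B \<le> z 1" "- B \<le> z 2" using zB by auto
    \<comment> \<open>The value of a at which the first form equals z 0 + \<delta>.\<close>
    define ua where "ua x = (P1 * (x / sqrt 2) - (1 + P1) * (z 0 + \<delta>)) / s1" for x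
    have sua: "s1 * ua x = P1 * (x / sqrt 2) - (1 + P1) * (z 0 + \<delta>)" for x using s by (simp add: ua_def)
    let ?S = "{v. \<forall>i<3. lin4 P1 P2 i v \<le> z i + \<delta>} - {v. \<forall>i<3. lin4 P1 P2 i v \<le> z i}"
    have "l * \<delta> * 1 * 1 * std_normal_density R ^ 4 \<le> measure normal4 ?S"
    proof (rule normal4_box_le[where ua = ua and ub = "\<lambda>_ _. \<beta>" and ug = "\<lambda>_ _ _. \<gamma>"])
      fix x :: real assume x: "0 \<le> x" "x \<le> 1"
      note px = scaled_unit_interval[OF x]
      have p1: "0 \<le> P1 * (x / sqrt 2)" "P1 * (x / sqrt 2) \<le> P1" using px[of P1] P by auto
      have p2: "0 \<le> P2 * (x / sqrt 2)" "P2 * (x / sqrt 2) \<le> P2" using px[of P2] P by auto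
      have z1: "(1 + P1) * (z 0 + \<delta>) \<le> (1 + P1) * (B + 1)" "- ((1 + P1) * (B + 1)) \<le> (1 + P1) * (z 0 + \<delta>)"
        using z0 z \<delta> P by (auto simp del: distrib_left_numeral simp: mult_minus_right[symmetric] simp del: mult_minus_right intro!: mult_left_mono)
      have "s1 * ua x \<le> s1 * Ra" "s1 * - Ra \<le> s1 * ua x" using p1 z1 unfolding sua mult_minus_right sRa by linarith+
      then have u: "ua x \<le> Ra" "- Ra \<le> ua x" using s mult_le_cancel_left_pos by blast+
      have l\<delta>: "0 \<le> l * \<delta>" "l * \<delta> \<le> l" using l \<delta> by auto
      have uR: "ua x + l * \<delta> \<le> R" using u l\<delta> \<beta> \<gamma> unfolding R_def by linarith
      show "- R \<le> ua x \<and> ua x + l * \<delta> \<le> R \<and>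
        (\<forall>a. ua x \<le> a \<longrightarrow> a \<le> ua x + l * \<delta> \<longrightarrow> - R \<le> \<beta> \<and> \<beta> + 1 \<le> R \<and>
        (\<forall>b. \<beta> \<le> b \<longrightarrow> b \<le> \<beta> + 1 \<longrightarrow> - R \<le> \<gamma> \<and> \<gamma> + 1 \<le> R \<and>
        (\<forall>g. \<gamma> \<le> g \<longrightarrow> g \<le> \<gamma> + 1 \<longrightarrow> (x, a, b, g) \<in> ?S)))"
      proof (intro conjI allI impI)
        fix a b g assume a: "ua x \<le> a" "a \<le> ua x + l * \<delta>" and b: "\<beta> \<le> b" and g: "\<gamma> \<le> g"
        have sa: "s1 * ua x \<le> s1 * a" "s1 * a \<le> s1 * ua x + s1 * (l * \<delta>)"
          using a s by (auto simp: distrib_left[symmetric])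
        have sl: "s1 * (l * \<delta>) = (1 + P1) * \<delta> / 2" using s by (simp add: l_def)
        have sb: "s2 * \<beta> \<le> s2 * b" and sg: "s3 * \<gamma> \<le> s3 * g" using b g s by auto
        have sb0: "0 \<le> s2 * b" using s \<beta> b by simp
        have sRu: "- (s1 * Ra) \<le> s1 * ua x" using \<open>s1 * - Ra \<le> s1 * ua x\<close> by simp
        have \<delta>1: "0 < (1 + P1) * \<delta>" using P \<delta> by simp
        have e0: "lin4 P1 P2 0 (x, a, b, g) \<le> z 0 + \<delta>"
          unfolding lin4_simps s1_def[symmetric] using P sa sua[of x] by (simp add: divide_le_eq mult.commute)
        have e0': "z 0 < lin4 P1 P2 0 (x, a, b, g)"
        proof -
          have "(1 + P1) * z 0 + (1 + P1) * \<delta> / 2 \<le> P1 * (x / sqrt 2) - s1 * a"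
            using sa sl sua[of x] unfolding distrib_left[of "1 + P1" "z 0"] by linarith
          then show ?thesis unfolding lin4_simps s1_def[symmetric] using P \<delta>1 by (simp add: less_divide_eq mult.commute)
        qed
        have e1: "lin4 P1 P2 1 (x, a, b, g) \<le> - B"
        proof -
          have "P2 * (x / sqrt 2) - s2 * b \<le> - ((1 + P2) * B)" using p2 sb s\<beta> by linarith
          then show ?thesis unfolding lin4_simps s2_def[symmetric] using P by (simp add: divide_le_eq mult.commute)
        qed
        have e2: "lin4 P1 P2 2 (x, a, b, g) \<le> - B"
        proof -
          have "(P1 + P2) * (x / sqrt 2) - (s1 * a + s2 * b) - s3 * g \<le> - ((1 + (P1 + P2)) * B)"
            using p1 p2 sa sb0 sg s\<gamma> sRu unfolding distrib_right[of P1 P2 "x / sqrt 2"] by linarith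
          then show ?thesis unfolding lin4_simps s1_def[symmetric] s2_def[symmetric] s3_def[symmetric]
            using P by (simp add: divide_le_eq mult.commute)
        qed
        show "(x, a, b, g) \<in> ?S"
          unfolding Diff_iff mem_Collect_eq all_less_3 using e0 e0' e1 e2 z \<delta> by auto
      qed (use uR u \<beta> \<gamma> Ra R_def l in auto)
    next
      show "?S \<in> sets normal4" by (intro sets.Diff sets_lin4_le)
    qed (use l \<delta> Ra \<beta> \<gamma> R_def in auto)
    then show "lin_cdf P1 P2 z + l * std_normal_density R ^ 4 * \<delta> \<le> lin_cdf P1 P2 (\<lambda>i. z i + \<delta>)"
      unfolding lin_cdf_shift[OF \<delta>(1)] by (simp add: mult_ac)
  qed
qed

text \<open>Exchanging the two users amounts to exchanging the independent coordinates a and b; this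
  makes \<open>gain_second\<close> a consequence of \<open>gain_first\<close>.\<close>

lemma lin_cdf_swap: "lin_cdf P1 P2 z = lin_cdf P2 P1 (z \<circ> (\<lambda>i. if i = 0 then 1 else if i = 1 then 0 else i))"
proof -
  let ?\<sigma> = "\<lambda>i. if i = 0 then 1 else if i = 1 then 0 else i :: nat"
  let ?S = "{v. \<forall>i<3. lin4 P1 P2 i v \<le> z i}" and ?T = "{v. \<forall>i<3. lin4 P2 P1 i v \<le> (z \<circ> ?\<sigma>) i}"
  interpret pair_sigma_finite std_normal std_normal ..
  have mem: "(x, a, b, g) \<in> ?S \<longleftrightarrow> (x, b, a, g) \<in> ?T" for x a b g
    unfolding mem_Collect_eq all_less_3 lin4_simps by (auto simp: mult.commute[of P2 P1] add.commute[of P2 P1] add.commute[of "sqrt P2 * b" "sqrt P1 * a"])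
  have meas: "(\<lambda>(a, b). \<integral>\<^sup>+g. indicator ?T (x, a, b, g) \<partial>std_normal) \<in> borel_measurable (std_normal \<Otimes>\<^sub>M std_normal)" for x
  proof -
    have "(\<lambda>w. (x, fst (fst w), snd (fst w), snd w)) \<in> (std_normal \<Otimes>\<^sub>M std_normal) \<Otimes>\<^sub>M std_normal \<rightarrow>\<^sub>M normal4"
      unfolding normal4_def by measurable
    from measurable_compose[OF this, of "indicator ?T :: _ \<Rightarrow> ennreal"]
    have "(\<lambda>w. indicator ?T (x, fst (fst w), snd (fst w), snd w) :: ennreal) \<in> borel_measurable ((std_normal \<Otimes>\<^sub>M std_normal) \<Otimes>\<^sub>M std_normal)"
      using sets_lin4_le by simp
    from std_normal.borel_measurable_nn_integral_fst[OF this] show ?thesis by (simp add: split_beta')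
  qed
  have "emeasure normal4 ?S = (\<integral>\<^sup>+v. indicator ?S v \<partial>normal4)" by (rule nn_integral_indicator[symmetric, OF sets_lin4_le])
  also have "\<dots> = (\<integral>\<^sup>+x. \<integral>\<^sup>+a. \<integral>\<^sup>+b. \<integral>\<^sup>+g. indicator ?S (x, a, b, g) \<partial>std_normal \<partial>std_normal \<partial>std_normal \<partial>std_normal)"
    by (rule nn_integral_normal4, rule borel_measurable_indicator, rule sets_lin4_le)
  also have "\<dots> = (\<integral>\<^sup>+x. \<integral>\<^sup>+a. \<integral>\<^sup>+b. \<integral>\<^sup>+g. indicator ?T (x, b, a, g) \<partial>std_normal \<partial>std_normal \<partial>std_normal \<partial>std_normal)"
    by (intro nn_integral_cong) (simp only: indicator_def mem)
  also have "\<dots> = (\<integral>\<^sup>+x. \<integral>\<^sup>+b. \<integral>\<^sup>+a. \<integral>\<^sup>+g. indicator ?T (x, b, a, g) \<partial>std_normal \<partial>std_normal \<partial>std_normal \<partial>std_normal)"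
    by (rule nn_integral_cong) (rule Fubini'[OF meas])
  also have "\<dots> = (\<integral>\<^sup>+v. indicator ?T v \<partial>normal4)"
    by (rule nn_integral_normal4[symmetric], rule borel_measurable_indicator, rule sets_lin4_le)
  also have "\<dots> = emeasure normal4 ?T" by (rule nn_integral_indicator[OF sets_lin4_le])
  finally show ?thesis unfolding lin_cdf_def measure_def by simp
qed

lemma gain_second:
  fixes P1 P2 B :: real
  assumes P: "0 < P1" "0 < P2" and B: "0 \<le> B"
  obtains c where "0 < c" "\<And>z \<delta>. 0 < \<delta> \<Longrightarrow> \<delta> \<le> 1 \<Longrightarrow> (\<forall>i<3. - B \<le> z i) \<Longrightarrow> z 1 \<le> B \<Longrightarrow>
    lin_cdf P1 P2 z + c * \<delta> \<le> lin_cdf P1 P2 (\<lambda>i. z i + \<delta>)"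
proof -
  obtain c where c: "0 < c" "\<And>z \<delta>. 0 < \<delta> \<Longrightarrow> \<delta> \<le> 1 \<Longrightarrow> (\<forall>i<3. - B \<le> z i) \<Longrightarrow> z 0 \<le> B \<Longrightarrow>
    lin_cdf P2 P1 z + c * \<delta> \<le> lin_cdf P2 P1 (\<lambda>i. z i + \<delta>)"
    apply (rule gain_first[OF P(2,1) B])
    subgoal premises prems for c by (rule prems(1)[OF prems(2,3)])
    done
  show ?thesis
  proof (rule that[OF c(1)])
    fix z :: "nat \<Rightarrow> real" and \<delta> :: real
    assume \<delta>: "0 < \<delta>" "\<delta> \<le> 1" and z: "\<forall>i<3. - B \<le> z i" "z 1 \<le> B"
    let ?y = "z \<circ> (\<lambda>i. if i = 0 then 1 else if i = 1 then 0 else i)"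
    have "(\<lambda>i. z i + \<delta>) \<circ> (\<lambda>i. if i = 0 then 1 else if i = 1 then 0 else i) = (\<lambda>i. ?y i + \<delta>)" by auto
    moreover have "lin_cdf P2 P1 ?y + c * \<delta> \<le> lin_cdf P2 P1 (\<lambda>i. ?y i + \<delta>)"
      by (rule c(2)[OF \<delta>]) (use z in \<open>auto simp: all_less_3\<close>)
    ultimately show "lin_cdf P1 P2 z + c * \<delta> \<le> lin_cdf P1 P2 (\<lambda>i. z i + \<delta>)"
      unfolding lin_cdf_swap[of P1 P2] by simp
  qed
qed

text \<open>The coordinate g occurs only in the third form. So a and b are taken large enough to
  push the first two forms below -B, and then g is tuned in an interval of length proportional to
  \<delta>.\<close>

lemma gain_third:
  fixes P1 P2 B :: real
  assumes P: "0 < P1" "0 < P2" and B: "0 \<le> B"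
  obtains c where "0 < c" "\<And>z \<delta>. 0 < \<delta> \<Longrightarrow> \<delta> \<le> 1 \<Longrightarrow> (\<forall>i<3. - B \<le> z i) \<Longrightarrow> z 2 \<le> B \<Longrightarrow>
    lin_cdf P1 P2 z + c * \<delta> \<le> lin_cdf P1 P2 (\<lambda>i. z i + \<delta>)"
proof -
  define s1 s2 s3 where "s1 = sqrt P1" and "s2 = sqrt P2" and "s3 = sqrt (P1 * P2)"
  have s: "0 < s1" "0 < s2" "0 < s3" using P by (auto simp: s1_def s2_def s3_def)
  define w where "w = 1 + (P1 + P2)"
  have w: "0 < w" "1 < w" using P by (auto simp: w_def)
  define \<alpha> where "\<alpha> = (P1 + (1 + P1) * B) / s1"
  define \<beta> where "\<beta> = (P2 + (1 + P2) * B) / s2"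
  define Rg where "Rg = (w + s1 * (\<alpha> + 1) + s2 * (\<beta> + 1) + w * (B + 1)) / s3"
  have \<alpha>: "0 \<le> \<alpha>" using s P B by (simp add: \<alpha>_def)
  have \<beta>: "0 \<le> \<beta>" using s P B by (simp add: \<beta>_def)
  have Rg: "0 \<le> Rg" using s w B \<alpha> \<beta> by (simp add: Rg_def)
  have s\<alpha>: "s1 * \<alpha> = P1 + (1 + P1) * B" using s by (simp add: \<alpha>_def)
  have s\<beta>: "s2 * \<beta> = P2 + (1 + P2) * B" using s by (simp add: \<beta>_def)
  have sRg: "s3 * Rg = w + s1 * (\<alpha> + 1) + s2 * (\<beta> + 1) + w * (B + 1)" using s by (simp add: Rg_def)
  define l where "l = w / (2 * s3)"
  have l: "0 < l" using s w by (simp add: l_def)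
  define R where "R = 1 + Rg + l + \<alpha> + \<beta>"
  show ?thesis
  proof (rule that[of "l * std_normal_density R ^ 4"])
    show "0 < l * std_normal_density R ^ 4" using l by (intro mult_pos_pos zero_less_power normal_density_pos) simp_all
    fix z :: "nat \<Rightarrow> real" and \<delta> :: real
    assume \<delta>: "0 < \<delta>" "\<delta> \<le> 1" and zB: "\<forall>i<3. - B \<le> z i" and z2: "z 2 \<le> B"
    have z: "- B \<le> z 0" "- B \<le> z 1" "- B \<le> z 2" using zB by auto
    define ug where "ug x a b = ((P1 + P2) * (x / sqrt 2) - (s1 * a + s2 * b) - w * (z 2 + \<delta>)) / s3" for x a b
    have sug: "s3 * ug x a b = (P1 + P2) * (x / sqrt 2) - (s1 * a + s2 * b) - w * (z 2 + \<delta>)" for x a b using s by (simp add: ug_def)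
    let ?S = "{v. \<forall>i<3. lin4 P1 P2 i v \<le> z i + \<delta>} - {v. \<forall>i<3. lin4 P1 P2 i v \<le> z i}"
    have l\<delta>: "0 \<le> l * \<delta>" "l * \<delta> \<le> l" using l \<delta> by auto
    have z1: "w * (z 2 + \<delta>) \<le> w * (B + 1)" "- (w * (B + 1)) \<le> w * (z 2 + \<delta>)"
      using z2 z \<delta> w by (auto simp: mult_minus_right[symmetric] simp del: mult_minus_right intro!: mult_left_mono)
    have "1 * 1 * (l * \<delta>) * std_normal_density R ^ 4 \<le> measure normal4 ?S"
    proof (rule normal4_box_le[where ua = "\<lambda>_. \<alpha>" and ub = "\<lambda>_ _. \<beta>" and ug = ug])
      fix x :: real assume x: "0 \<le> x" "x \<le> 1"
      note px = scaled_unit_interval[OF x]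
      have p1: "0 \<le> P1 * (x / sqrt 2)" "P1 * (x / sqrt 2) \<le> P1" using px[of P1] P by auto
      have p2: "0 \<le> P2 * (x / sqrt 2)" "P2 * (x / sqrt 2) \<le> P2" using px[of P2] P by auto
      have p3: "0 \<le> (P1 + P2) * (x / sqrt 2)" "(P1 + P2) * (x / sqrt 2) \<le> w" using px[of "P1 + P2"] P by (auto simp: w_def)
      have u: "- Rg \<le> ug x a b \<and> ug x a b \<le> Rg" if a: "\<alpha> \<le> a" "a \<le> \<alpha> + 1" and b: "\<beta> \<le> b" "b \<le> \<beta> + 1" for a b
      proof -
        have sa: "s1 * a \<le> s1 * (\<alpha> + 1)" "0 \<le> s1 * a" and sb: "s2 * b \<le> s2 * (\<beta> + 1)" "0 \<le> s2 * b"
          using a b s \<alpha> \<beta> by (auto intro!: mult_left_mono)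
        have "s3 * ug x a b \<le> s3 * Rg" "s3 * - Rg \<le> s3 * ug x a b"
          using p3 z1 sa sb w unfolding sug mult_minus_right sRg by linarith+
        then show ?thesis using s mult_le_cancel_left_pos by blast
      qed
      show "- R \<le> \<alpha> \<and> \<alpha> + 1 \<le> R \<and>
        (\<forall>a. \<alpha> \<le> a \<longrightarrow> a \<le> \<alpha> + 1 \<longrightarrow> - R \<le> \<beta> \<and> \<beta> + 1 \<le> R \<and>
        (\<forall>b. \<beta> \<le> b \<longrightarrow> b \<le> \<beta> + 1 \<longrightarrow> - R \<le> ug x a b \<and> ug x a b + l * \<delta> \<le> R \<and>
        (\<forall>g. ug x a b \<le> g \<longrightarrow> g \<le> ug x a b + l * \<delta> \<longrightarrow> (x, a, b, g) \<in> ?S)))"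
      proof (intro conjI allI impI)
        fix a b assume "\<alpha> \<le> a" "a \<le> \<alpha> + 1" "\<beta> \<le> b" "b \<le> \<beta> + 1"
        from u[OF this] show "- R \<le> ug x a b" "ug x a b + l * \<delta> \<le> R" using l\<delta> \<alpha> \<beta> l Rg unfolding R_def by linarith+
      next
        fix a b g assume a: "\<alpha> \<le> a" and b: "\<beta> \<le> b" and g: "ug x a b \<le> g" "g \<le> ug x a b + l * \<delta>"
        have sg: "s3 * ug x a b \<le> s3 * g" "s3 * g \<le> s3 * ug x a b + s3 * (l * \<delta>)"
          using g s by (auto simp: distrib_left[symmetric])
        have sl: "s3 * (l * \<delta>) = w * \<delta> / 2" using s by (simp add: l_def)
        have sa: "s1 * \<alpha> \<le> s1 * a" and sb: "s2 * \<beta> \<le> s2 * b" using a b s by auto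
        have \<delta>1: "0 < w * \<delta>" using w \<delta> by simp
        have e0: "lin4 P1 P2 0 (x, a, b, g) \<le> - B"
        proof -
          have "P1 * (x / sqrt 2) - s1 * a \<le> - ((1 + P1) * B)" using p1 sa s\<alpha> by linarith
          then show ?thesis unfolding lin4_simps s1_def[symmetric] using P by (simp add: divide_le_eq mult.commute)
        qed
        have e1: "lin4 P1 P2 1 (x, a, b, g) \<le> - B"
        proof -
          have "P2 * (x / sqrt 2) - s2 * b \<le> - ((1 + P2) * B)" using p2 sb s\<beta> by linarith
          then show ?thesis unfolding lin4_simps s2_def[symmetric] using P by (simp add: divide_le_eq mult.commute)
        qed
        have e2: "lin4 P1 P2 2 (x, a, b, g) \<le> z 2 + \<delta>"
        proof -
          have "(P1 + P2) * (x / sqrt 2) - (s1 * a + s2 * b) - s3 * g \<le> (z 2 + \<delta>) * w" using sg(1) sug[of x a b] by (simp add: mult.commute)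
          then show ?thesis unfolding lin4_simps s1_def[symmetric] s2_def[symmetric] s3_def[symmetric] w_def[symmetric]
            using w by (simp only: divide_le_eq if_True)
        qed
        have e2': "z 2 < lin4 P1 P2 2 (x, a, b, g)"
        proof -
          have "z 2 * w + w * \<delta> / 2 \<le> (P1 + P2) * (x / sqrt 2) - (s1 * a + s2 * b) - s3 * g"
            using sg sl sug[of x a b] unfolding distrib_left[of w "z 2"] mult.commute[of "z 2" w] by linarith
          then have "z 2 * w < (P1 + P2) * (x / sqrt 2) - (s1 * a + s2 * b) - s3 * g" using \<delta>1 by linarith
          then show ?thesis unfolding lin4_simps s1_def[symmetric] s2_def[symmetric] s3_def[symmetric] w_def[symmetric]
            using w by (simp only: less_divide_eq if_True)
        qed
        show "(x, a, b, g) \<in> ?S"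
          unfolding Diff_iff mem_Collect_eq all_less_3 using e0 e1 e2 e2' z \<delta> by auto
      qed (use \<alpha> \<beta> Rg l R_def in auto)
    next
      show "?S \<in> sets normal4" by (intro sets.Diff sets_lin4_le)
    qed (use l \<delta> Rg \<alpha> \<beta> R_def in auto)
    then show "lin_cdf P1 P2 z + l * std_normal_density R ^ 4 * \<delta> \<le> lin_cdf P1 P2 (\<lambda>i. z i + \<delta>)"
      unfolding lin_cdf_shift[OF \<delta>(1)] by (simp add: mult_ac)
  qed
qed

lemma lin4_concentration:
  assumes \<eta>: "0 < \<eta>"
  obtains B :: real where "0 \<le> B" "1 - \<eta> < measure normal4 {v. \<forall>i<3. \<bar>lin4 P1 P2 i v\<bar> \<le> B}"
proof -
  define A where "A k = {v. \<forall>i<3. \<bar>lin4 P1 P2 i v\<bar> \<le> real k}" for k :: nat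
  have s: "A k \<in> sets normal4" for k
  proof -
    have "{v \<in> space normal4. \<forall>i<3. \<bar>lin4 P1 P2 i v\<bar> \<le> real k} \<in> sets normal4" by measurable
    then show ?thesis by (simp add: A_def)
  qed
  have "incseq A"
  proof (rule incseq_SucI, rule subsetI)
    fix k v assume v: "v \<in> A k"
    have "\<bar>lin4 P1 P2 i v\<bar> \<le> real (Suc k)" if "i < 3" for i
    proof -
      have "\<bar>lin4 P1 P2 i v\<bar> \<le> real k" using v that by (simp add: A_def)
      then show ?thesis by simp
    qed
    then show "v \<in> A (Suc k)" by (simp add: A_def)
  qed
  moreover have "(\<Union>k. A k) = UNIV"
  proof (rule UNIV_eq_I[symmetric])
    fix v
    obtain k :: nat where "\<bar>lin4 P1 P2 0 v\<bar> + \<bar>lin4 P1 P2 1 v\<bar> + \<bar>lin4 P1 P2 2 v\<bar> \<le> real k"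
      using real_arch_simple by blast
    then have "v \<in> A k" unfolding A_def mem_Collect_eq all_less_3 by linarith
    then show "v \<in> (\<Union>k. A k)" by blast
  qed
  ultimately have "(\<lambda>k. measure normal4 (A k)) \<longlonglongrightarrow> measure normal4 UNIV"
    using normal4.finite_Lim_measure_incseq[of A] s by auto
  moreover have "measure normal4 UNIV = 1" using normal4.prob_space by simp
  ultimately have "\<forall>\<^sub>F k in sequentially. 1 - \<eta> < measure normal4 (A k)"
    using \<eta> by (intro order_tendstoD(1)) auto
  then obtain k where "1 - \<eta> < measure normal4 (A k)" by (auto dest: eventually_happens)
  then show ?thesis by (intro that[of "real k"]) (simp_all add: A_def)
qed

text \<open>Coordinates of z are bounded below, since otherwise the distribution function would be
  too small. If some coordinate is also at most B, the matching gain lemma yields a linear increase;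
  if all are at least B, the function already exceeds 1 - \<epsilon>/2. The constants depend on z in
  neither case, although the points of \<open>Qinv\<close> form an unbounded set.\<close>

lemma lin_cdf_gain:
  assumes P: "0 < P1" "0 < P2" and \<epsilon>: "0 < \<epsilon>" "\<epsilon> < 1"
  obtains B c where "0 \<le> B" "0 < c"
    "\<And>z. 1 - \<epsilon> \<le> lin_cdf P1 P2 z \<Longrightarrow> \<forall>i<3. - B \<le> z i"
    "\<And>z \<delta>. 1 - \<epsilon> \<le> lin_cdf P1 P2 z \<Longrightarrow> 0 < \<delta> \<Longrightarrow> \<delta> \<le> 1 \<Longrightarrow>
       1 - \<epsilon> / 2 \<le> lin_cdf P1 P2 (\<lambda>i. z i + \<delta>) \<or> lin_cdf P1 P2 z + c * \<delta> \<le> lin_cdf P1 P2 (\<lambda>i. z i + \<delta>)"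
proof -
  \<comment> \<open>Below 1 - \<epsilon> for the lower bound on z, at most \<epsilon>/2 for the
    alternative with large coordinates.\<close>
  define \<eta> where "\<eta> = min (\<epsilon> / 2) ((1 - \<epsilon>) / 2)"
  have \<eta>: "0 < \<eta>" "\<eta> \<le> \<epsilon> / 2" "\<eta> < 1 - \<epsilon>" using \<epsilon> by (auto simp: \<eta>_def min_def)
  obtain B :: real where B: "0 \<le> B" "1 - \<eta> < measure normal4 {v. \<forall>i<3. \<bar>lin4 P1 P2 i v\<bar> \<le> B}"
    by (rule lin4_concentration[OF \<eta>(1)])
  let ?A = "{v. \<forall>i<3. \<bar>lin4 P1 P2 i v\<bar> \<le> B}"
  have sA: "?A \<in> sets normal4"
  proof -
    have "{v \<in> space normal4. \<forall>i<3. \<bar>lin4 P1 P2 i v\<bar> \<le> B} \<in> sets normal4" by measurable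
    then show ?thesis by simp
  qed
  have lower: "\<forall>i<3. - B \<le> z i" if z: "1 - \<epsilon> \<le> lin_cdf P1 P2 z" for z
  proof (intro allI impI)
    fix i :: nat assume i: "i < 3"
    show "- B \<le> z i"
    proof (rule ccontr)
      assume n: "\<not> - B \<le> z i"
      have "{v. \<forall>i<3. lin4 P1 P2 i v \<le> z i} \<subseteq> space normal4 - ?A"
      proof (rule subsetI)
        fix v assume "v \<in> {v. \<forall>i<3. lin4 P1 P2 i v \<le> z i}"
        then have "lin4 P1 P2 i v \<le> z i" using i by simp
        then have "\<not> \<bar>lin4 P1 P2 i v\<bar> \<le> B" using n by linarith
        then have "v \<notin> ?A" using i by auto
        then show "v \<in> space normal4 - ?A" by simp
      qed
      then have "lin_cdf P1 P2 z \<le> measure normal4 (space normal4 - ?A)"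
        unfolding lin_cdf_def by (rule normal4.finite_measure_mono[OF _ sets.compl_sets[OF sA]])
      also have "\<dots> = 1 - measure normal4 ?A" by (rule normal4.prob_compl[OF sA])
      finally show False using z B \<eta> by linarith
    qed
  qed
  have upper: "1 - \<epsilon> / 2 \<le> lin_cdf P1 P2 y" if y: "\<forall>i<3. B \<le> y i" for y
  proof -
    have "?A \<subseteq> {v. \<forall>i<3. lin4 P1 P2 i v \<le> y i}"
    proof (rule subsetI, rule CollectI, intro allI impI)
      fix v and i :: nat assume "v \<in> ?A" and i: "i < 3"
      then have "\<bar>lin4 P1 P2 i v\<bar> \<le> B" by simp
      moreover have "B \<le> y i" using y i by simp
      ultimately show "lin4 P1 P2 i v \<le> y i" by linarith
    qed
    then have "measure normal4 ?A \<le> lin_cdf P1 P2 y"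
      unfolding lin_cdf_def by (rule normal4.finite_measure_mono[OF _ sets_lin4_le])
    then show ?thesis using B \<eta> by linarith
  qed
  obtain c0 where c0: "0 < c0" "\<And>z \<delta>. 0 < \<delta> \<Longrightarrow> \<delta> \<le> 1 \<Longrightarrow> (\<forall>i<3. - B \<le> z i) \<Longrightarrow> z 0 \<le> B \<Longrightarrow>
    lin_cdf P1 P2 z + c0 * \<delta> \<le> lin_cdf P1 P2 (\<lambda>i. z i + \<delta>)"
    apply (rule gain_first[OF P B(1)])
    subgoal premises prems for c by (rule prems(1)[OF prems(2,3)])
    done
  obtain c1 where c1: "0 < c1" "\<And>z \<delta>. 0 < \<delta> \<Longrightarrow> \<delta> \<le> 1 \<Longrightarrow> (\<forall>i<3. - B \<le> z i) \<Longrightarrow> z 1 \<le> B \<Longrightarrow>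
    lin_cdf P1 P2 z + c1 * \<delta> \<le> lin_cdf P1 P2 (\<lambda>i. z i + \<delta>)"
    apply (rule gain_second[OF P B(1)])
    subgoal premises prems for c by (rule prems(1)[OF prems(2,3)])
    done
  obtain c2 where c2: "0 < c2" "\<And>z \<delta>. 0 < \<delta> \<Longrightarrow> \<delta> \<le> 1 \<Longrightarrow> (\<forall>i<3. - B \<le> z i) \<Longrightarrow> z 2 \<le> B \<Longrightarrow>
    lin_cdf P1 P2 z + c2 * \<delta> \<le> lin_cdf P1 P2 (\<lambda>i. z i + \<delta>)"
    apply (rule gain_third[OF P B(1)])
    subgoal premises prems for c by (rule prems(1)[OF prems(2,3)])
    done
  define c where "c = min c0 (min c1 c2)"
  have c: "0 < c" "c \<le> c0" "c \<le> c1" "c \<le> c2" using c0(1) c1(1) c2(1) by (auto simp: c_def)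
  show ?thesis
  proof (rule that[OF B(1) c(1) lower])
    fix z \<delta> assume z: "1 - \<epsilon> \<le> lin_cdf P1 P2 z" and \<delta>: "0 < \<delta>" "\<delta> \<le> (1::real)"
    have c\<delta>: "c * \<delta> \<le> c0 * \<delta>" "c * \<delta> \<le> c1 * \<delta>" "c * \<delta> \<le> c2 * \<delta>" using c \<delta> by auto
    consider "z 0 \<le> B" | "z 1 \<le> B" | "z 2 \<le> B" | "B \<le> z 0" "B \<le> z 1" "B \<le> z 2" by linarith
    then show "1 - \<epsilon> / 2 \<le> lin_cdf P1 P2 (\<lambda>i. z i + \<delta>) \<or> lin_cdf P1 P2 z + c * \<delta> \<le> lin_cdf P1 P2 (\<lambda>i. z i + \<delta>)"
    proof cases
      case 1 from c0(2)[OF \<delta> lower[OF z] this] c\<delta> show ?thesis by linarith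
    next
      case 2 from c1(2)[OF \<delta> lower[OF z] this] c\<delta> show ?thesis by linarith
    next
      case 3 from c2(2)[OF \<delta> lower[OF z] this] c\<delta> show ?thesis by linarith
    next
      case 4
      have "1 - \<epsilon> / 2 \<le> lin_cdf P1 P2 (\<lambda>i. z i + \<delta>)"
        by (rule upper, unfold all_less_3) (use 4 \<delta> in auto)
      then show ?thesis ..
    qed
  qed
qed


section \<open>Probability that a random competitor wins\<close>

text \<open>The part of the channel input in which a competitor of kind i differs from the sent
  pair; a codeword shared by both cancels from the comparison of distances.\<close>

definition signal :: "nat \<Rightarrow> real \<Rightarrow> real \<Rightarrow> nat \<Rightarrow> (nat \<Rightarrow> real) \<Rightarrow> (nat \<Rightarrow> real) \<Rightarrow> nat \<Rightarrow> real" where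
  "signal n P1 P2 i x y = (if i = 0 then sph n P1 x else if i = 1 then sph n P2 y else (\<lambda>j. sph n P1 x j + sph n P2 y j))"

definition gram_vec :: "nat \<Rightarrow> (nat \<Rightarrow> real) \<Rightarrow> (nat \<Rightarrow> real) \<Rightarrow> (nat \<Rightarrow> real) \<Rightarrow> real \<times> real \<times> real \<times> real \<times> real \<times> real" where
  "gram_vec n z x y = (ip n z z, ip n x z, ip n y z, ip n x y, ip n x x, ip n y y)"

lemma out_sq_gram_vec:
  assumes "i < 3"
  shows "out_sq n P1 P2 i (gram_vec n z x y) = ip n (\<lambda>j. signal n P1 P2 i x y j + z j) (\<lambda>j. signal n P1 P2 i x y j + z j)"
proof -
  define \<alpha> where "\<alpha> = sqrt (real n * P1) / sqrt (ip n x x)"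
  define \<beta> where "\<beta> = sqrt (real n * P2) / sqrt (ip n y y)"
  have l: "ip n (sph n P1 x) v = \<alpha> * ip n x v" "ip n (sph n P2 y) v = \<beta> * ip n y v"
    and r: "ip n v (sph n P1 x) = \<alpha> * ip n v x" "ip n v (sph n P2 y) = \<beta> * ip n v y" for v
    by (simp_all add: \<alpha>_def \<beta>_def ip_sph_left ip_sph_right)
  note c = ip_commute[of n z x] ip_commute[of n z y] ip_commute[of n y x]
  note o = out_sq_def gram_vec_def split Let_def \<alpha>_def[symmetric] \<beta>_def[symmetric] signal_def
  consider "i = 0" | "i = 1" | "i = 2" using assms by linarith
  then show ?thesis
  proof cases
    case 1
    show ?thesis unfolding o 1 by (simp only: ip_add_left ip_add_right l r c simp_thms if_True)
  next
    case 2
    show ?thesis unfolding o 2 by (simp only: ip_add_left ip_add_right l r c if_True one_neq_zero if_False) (simp add: l r c algebra_simps)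
  next
    case 3
    have n: "(2::nat) \<noteq> 0" "(2::nat) \<noteq> 1" by auto
    show ?thesis unfolding o 3 by (simp only: ip_add_left ip_add_right l r c n if_False) (simp add: algebra_simps)
  qed
qed

lemma borel_measurable_deficit_borel [measurable]: "deficit n P1 P2 i \<in> borel_measurable borel"
proof -
  have "(\<lambda>G. deficit n P1 P2 i (fst G, fst (snd G), fst (snd (snd G)), fst (snd (snd (snd G))), fst (snd (snd (snd (snd G)))), snd (snd (snd (snd (snd G)))))) \<in> borel_measurable borel"
    unfolding borel_prod[symmetric] by (rule borel_measurable_deficit) measurable
  then show ?thesis by simp
qed

text \<open>For fixed z the products depend on z only through |z|
  (\<open>nn_integral_gauss_vec_gram2\<close>), and |z| has the chi law.\<close>

lemma nn_integral_gram_vec: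
  fixes f :: "real \<times> real \<times> real \<times> real \<times> real \<times> real \<Rightarrow> ennreal"
  assumes n: "3 \<le> n" and f: "f \<in> borel_measurable borel"
  shows "(\<integral>\<^sup>+z. \<integral>\<^sup>+x. \<integral>\<^sup>+y. f (gram_vec n z x y) \<partial>gauss_vec n \<partial>gauss_vec n \<partial>gauss_vec n) =
    (\<integral>\<^sup>+\<rho>. \<integral>\<^sup>+\<omega>. f (case \<omega> of (a, r, b, g, u) \<Rightarrow> gram \<rho> a r b g u) \<partial>mac5 n \<partial>chi n)"
proof -
  have f6: "f \<in> borel_measurable (borel \<Otimes>\<^sub>M borel \<Otimes>\<^sub>M borel \<Otimes>\<^sub>M borel \<Otimes>\<^sub>M borel \<Otimes>\<^sub>M borel)"
    using f by (simp add: borel_prod)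
  have gm: "(\<lambda>w. gram (fst w) (fst (snd w)) (fst (snd (snd w))) (fst (snd (snd (snd w)))) (fst (snd (snd (snd (snd w))))) (snd (snd (snd (snd (snd w))))))
    \<in> borel \<Otimes>\<^sub>M mac5 n \<rightarrow>\<^sub>M borel \<Otimes>\<^sub>M borel \<Otimes>\<^sub>M borel \<Otimes>\<^sub>M borel \<Otimes>\<^sub>M borel \<Otimes>\<^sub>M borel"
  proof -
    have [measurable]: "(\<lambda>w. fst (snd w)) \<in> borel_measurable (borel \<Otimes>\<^sub>M mac5 n)"
      "(\<lambda>w. fst (snd (snd w))) \<in> borel_measurable (borel \<Otimes>\<^sub>M mac5 n)"
      "(\<lambda>w. fst (snd (snd (snd w)))) \<in> borel_measurable (borel \<Otimes>\<^sub>M mac5 n)"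
      "(\<lambda>w. fst (snd (snd (snd (snd w))))) \<in> borel_measurable (borel \<Otimes>\<^sub>M mac5 n)"
      "(\<lambda>w. snd (snd (snd (snd (snd w))))) \<in> borel_measurable (borel \<Otimes>\<^sub>M mac5 n)"
      by (rule measurable_compose[OF measurable_snd measurable_coords5(1)] measurable_compose[OF measurable_snd measurable_coords5(2)]
        measurable_compose[OF measurable_snd measurable_coords5(3)] measurable_compose[OF measurable_snd measurable_coords5(4)]
        measurable_compose[OF measurable_snd measurable_coords5(5)])+
    show ?thesis unfolding gram_def by measurable
  qed
  have fg: "(\<lambda>w. f (case snd w of (a, r, b, g, u) \<Rightarrow> gram (fst w) a r b g u)) \<in> borel_measurable (borel \<Otimes>\<^sub>M mac5 n)"
    using measurable_compose[OF gm f6] by (simp add: split_beta')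
  have fg1: "(\<lambda>\<omega>. f (case \<omega> of (a, r, b, g, u) \<Rightarrow> gram \<rho> a r b g u)) \<in> borel_measurable (mac5 n)" for \<rho>
    using measurable_compose[OF measurable_Pair1' fg, of \<rho>] by simp
  define H where "H \<rho> = (\<integral>\<^sup>+\<omega>. f (case \<omega> of (a, r, b, g, u) \<Rightarrow> gram \<rho> a r b g u) \<partial>mac5 n)" for \<rho>
  have H: "H \<in> borel_measurable borel"
    unfolding H_def[abs_def] using mac5.borel_measurable_nn_integral_fst[OF fg] by simp
  have "(\<integral>\<^sup>+x. \<integral>\<^sup>+y. f (gram_vec n z x y) \<partial>gauss_vec n \<partial>gauss_vec n) = H (sqrt (ip n z z))" for z
  proof -
    define f' where "f' p = f (ip n z z, p)" for p
    have f2: "f \<in> borel_measurable (borel \<Otimes>\<^sub>M borel)" using f by (simp add: borel_prod)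
    have f': "f' \<in> borel_measurable borel"
      unfolding f'_def[abs_def] by (rule measurable_compose[OF measurable_Pair1' f2]) simp
    have "(\<integral>\<^sup>+x. \<integral>\<^sup>+y. f (gram_vec n z x y) \<partial>gauss_vec n \<partial>gauss_vec n) =
      (\<integral>\<^sup>+x. \<integral>\<^sup>+y. f' (ip n x z, ip n y z, ip n x y, ip n x x, ip n y y) \<partial>gauss_vec n \<partial>gauss_vec n)"
      unfolding gram_vec_def f'_def ..
    also note nn_integral_gauss_vec_gram2[OF n f', of z]
    finally show ?thesis unfolding H_def nn_integral_mac5[OF fg1] f'_def gram_def by simp
  qed
  then have "(\<integral>\<^sup>+z. \<integral>\<^sup>+x. \<integral>\<^sup>+y. f (gram_vec n z x y) \<partial>gauss_vec n \<partial>gauss_vec n \<partial>gauss_vec n) = (\<integral>\<^sup>+z. H (sqrt (ip n z z)) \<partial>gauss_vec n)"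
    by simp
  also have "\<dots> = (\<integral>\<^sup>+\<rho>. H \<rho> \<partial>chi n)" by (rule nn_integral_gauss_vec_norm) (use n H in auto)
  finally show ?thesis unfolding H_def .
qed

lemma deficit_gram5: "deficit n P1 P2 i (case \<omega> of (a, r, b, g, u) \<Rightarrow> gram \<rho> a r b g u) = deficit5 n P1 P2 i \<rho> \<omega>"
  by (cases \<omega>) (simp add: deficit5_def)

text \<open>Cutting the range of the deficit below \<open>w\<close> into slices of length \<open>1 / sqrt n\<close> gains the
  factor \<open>1 / sqrt n\<close> over the trivial bound, and with it the term \<open>(ln n) / 2\<close> of the theorem.\<close>
lemma deficit_exp_moment:
  assumes P: "0 < P1" "0 < P2" and i: "i < 3"
  obtains C n0 where "0 \<le> C" "3 \<le> n0" "\<And>n w c. n0 \<le> n \<Longrightarrow> 0 \<le> c \<Longrightarrow>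
    (\<integral>\<^sup>+z. \<integral>\<^sup>+x. \<integral>\<^sup>+y. ennreal (c * exp ((real n - 1) * (deficit n P1 P2 i (gram_vec n z x y) / sqrt n))) *
       of_bool (deficit n P1 P2 i (gram_vec n z x y) < w) \<partial>gauss_vec n \<partial>gauss_vec n \<partial>gauss_vec n)
     \<le> ennreal (C / sqrt n * (c * exp ((real n - 1) * (w / sqrt n))))"
proof -
  obtain C n0 where C: "0 \<le> C" "3 \<le> n0" "\<And>n w. n0 \<le> n \<Longrightarrow>
    (\<integral>\<^sup>+\<rho>. \<integral>\<^sup>+\<omega>. indicator {\<omega>. w \<le> deficit5 n P1 P2 i \<rho> \<omega> \<and> deficit5 n P1 P2 i \<rho> \<omega> \<le> w + 1 / sqrt n} \<omega> \<partial>mac5 n \<partial>chi n) \<le> ennreal (C / sqrt n)"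
    apply (rule deficit_slice[OF P i])
    subgoal premises prems for C n0 by (rule prems(1)[OF prems(2-4)])
    done
  \<comment> \<open>Going down by one slice multiplies the exponential by at most exp(-(n - 1)/n),
    which is at most exp(-1/2).\<close>
  define q where "q = exp (- (1/2) :: real)"
  have q: "0 < q" "q < 1" by (auto simp: q_def)
  show ?thesis
  proof (rule that[of "C * (1 / (1 - q))", OF _ C(2)])
    show "0 \<le> C * (1 / (1 - q))" using C(1) q by simp
    fix n :: nat and w c :: real assume n: "n0 \<le> n" and c: "0 \<le> c"
    have n3: "3 \<le> n" using n C(2) by simp
    define s where "s = sqrt n"
    have s: "0 < s" "s * s = n" using n3 by (auto simp: s_def)
    define A where "A = c * exp ((real n - 1) * (w / s))"
    have A: "0 \<le> A" using c by (simp add: A_def)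
    define J where "J j D = (indicator {D. w - real (Suc j) / s \<le> D \<and> D \<le> w - real (Suc j) / s + 1 / s} D :: ennreal)" for j :: nat and D :: real
    define F where "F D = (ennreal (c * exp ((real n - 1) * (D / s))) * of_bool (D < w) :: ennreal)" for D
    have "F \<in> borel_measurable borel" unfolding F_def[abs_def] of_bool_def by measurable
    then have f: "(\<lambda>G. F (deficit n P1 P2 i G)) \<in> borel_measurable borel"
      by (rule measurable_compose[OF borel_measurable_deficit_borel])
    have ptw: "F D \<le> (\<Sum>j. ennreal (A * q ^ j) * J j D)" for D
    proof (cases "D < w")
      case True
      \<comment> \<open>The index of the slice, counted downwards from w, that contains D.\<close>
      define j where "j = nat \<lfloor>(w - D) * s\<rfloor>"
      have "0 \<le> (w - D) * s" using True s by simp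
      then have "real j = of_int \<lfloor>(w - D) * s\<rfloor>" by (simp add: j_def)
      then have j: "real j \<le> (w - D) * s" "(w - D) * s < real j + 1" by linarith+
      have dj: "real j / s \<le> w - D" "w - D < (real j + 1) / s" using j s by (auto simp: divide_le_eq less_divide_eq mult.commute)
      have J1: "J j D = 1" using dj by (simp add: J_def add_divide_distrib)
      have "(real n - 1) * (D / s) \<le> (real n - 1) * (w / s) - real j / 2"
      proof -
        have "real j / s / s \<le> (w - D) / s" using dj s by (intro divide_right_mono) auto
        then have "real j / real n \<le> w / s - D / s" using s by (simp add: diff_divide_distrib)
        then have "(real n - 1) * (real j / real n) \<le> (real n - 1) * (w / s - D / s)" using n3 by (intro mult_left_mono) auto
        moreover have "real j / 2 \<le> (real n - 1) * (real j / real n)"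
        proof -
          have "1 / 2 * real j \<le> (real n - 1) / real n * real j"
            using n3 by (intro mult_right_mono) (auto simp: field_simps)
          then show ?thesis by simp
        qed
        ultimately show ?thesis unfolding right_diff_distrib by linarith
      qed
      then have "c * exp ((real n - 1) * (D / s)) \<le> c * exp ((real n - 1) * (w / s) - real j / 2)" using c by (intro mult_left_mono) auto
      also have "\<dots> = A * exp (- (real j / 2))" unfolding A_def mult.assoc exp_add[symmetric] by simp
      also have "exp (- (real j / 2)) = q ^ j" unfolding q_def exp_of_nat_mult[symmetric] by simp
      finally have "F D \<le> ennreal (A * q ^ j) * J j D"
        unfolding F_def using True J1 by (simp add: ennreal_leI)
      also have "\<dots> = sum (\<lambda>j. ennreal (A * q ^ j) * J j D) {j}" by simp
      also have "\<dots> \<le> (\<Sum>j. ennreal (A * q ^ j) * J j D)" by (rule sum_le_suminf) auto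
      finally show ?thesis .
    qed (simp add: F_def)
    have J_bm: "J j \<in> borel_measurable borel" for j
    proof -
      have "{w - real (Suc j) / s..w - real (Suc j) / s + 1 / s} \<in> sets borel" by simp
      then show ?thesis unfolding J_def[abs_def] by (simp add: atLeastAtMost_def atLeast_def atMost_def Collect_conj_eq)
    qed
    have J_meas: "(\<lambda>w. ennreal c * J j (deficit5 n P1 P2 i (fst w) (snd w))) \<in> borel_measurable (borel \<Otimes>\<^sub>M mac5 n)" for c j
      by (rule borel_measurable_times_ennreal[OF borel_measurable_const measurable_compose[OF measurable_deficit5 J_bm]])
    have J_meas1: "(\<lambda>\<omega>. ennreal c * J j (deficit5 n P1 P2 i \<rho> \<omega>)) \<in> borel_measurable (mac5 n)" for c j \<rho>
      by (rule borel_measurable_times_ennreal[OF borel_measurable_const measurable_compose[OF measurable_deficit5' J_bm]])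
    have J_meas2: "(\<lambda>\<rho>. \<integral>\<^sup>+\<omega>. ennreal c * J j (deficit5 n P1 P2 i \<rho> \<omega>) \<partial>mac5 n) \<in> borel_measurable (chi n)" for c j
      using mac5.borel_measurable_nn_integral_fst[OF J_meas[of c j]] by simp
    have J_meas3: "(\<lambda>\<rho>. \<integral>\<^sup>+\<omega>. J j (deficit5 n P1 P2 i \<rho> \<omega>) \<partial>mac5 n) \<in> borel_measurable (chi n)" for j
      using J_meas2[of 1 j] by simp
    have J_meas4: "(\<lambda>\<omega>. J j (deficit5 n P1 P2 i \<rho> \<omega>)) \<in> borel_measurable (mac5 n)" for j \<rho>
      using J_meas1[of 1 j \<rho>] by simp
    have bJ: "(\<integral>\<^sup>+\<rho>. \<integral>\<^sup>+\<omega>. J j (deficit5 n P1 P2 i \<rho> \<omega>) \<partial>mac5 n \<partial>chi n) \<le> ennreal (C / s)" for j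
      using C(3)[OF n, of "w - real (Suc j) / s"] unfolding s_def J_def by (simp only: indicator_def mem_Collect_eq)
    have e1: "(\<integral>\<^sup>+z. \<integral>\<^sup>+x. \<integral>\<^sup>+y. F (deficit n P1 P2 i (gram_vec n z x y)) \<partial>gauss_vec n \<partial>gauss_vec n \<partial>gauss_vec n) =
      (\<integral>\<^sup>+\<rho>. \<integral>\<^sup>+\<omega>. F (deficit5 n P1 P2 i \<rho> \<omega>) \<partial>mac5 n \<partial>chi n)"
      unfolding nn_integral_gram_vec[OF n3 f] deficit_gram5 ..
    have e2: "(\<integral>\<^sup>+\<rho>. \<integral>\<^sup>+\<omega>. F (deficit5 n P1 P2 i \<rho> \<omega>) \<partial>mac5 n \<partial>chi n) \<le>
      (\<integral>\<^sup>+\<rho>. \<integral>\<^sup>+\<omega>. (\<Sum>j. ennreal (A * q ^ j) * J j (deficit5 n P1 P2 i \<rho> \<omega>)) \<partial>mac5 n \<partial>chi n)"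
      by (rule nn_integral_mono, rule nn_integral_mono, rule ptw)
    have e3: "(\<integral>\<^sup>+\<rho>. \<integral>\<^sup>+\<omega>. (\<Sum>j. ennreal (A * q ^ j) * J j (deficit5 n P1 P2 i \<rho> \<omega>)) \<partial>mac5 n \<partial>chi n) =
      (\<integral>\<^sup>+\<rho>. (\<Sum>j. \<integral>\<^sup>+\<omega>. ennreal (A * q ^ j) * J j (deficit5 n P1 P2 i \<rho> \<omega>) \<partial>mac5 n) \<partial>chi n)"
      by (rule nn_integral_cong, rule nn_integral_suminf, rule J_meas1)
    have e4: "(\<integral>\<^sup>+\<rho>. (\<Sum>j. \<integral>\<^sup>+\<omega>. ennreal (A * q ^ j) * J j (deficit5 n P1 P2 i \<rho> \<omega>) \<partial>mac5 n) \<partial>chi n) =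
      (\<Sum>j. \<integral>\<^sup>+\<rho>. \<integral>\<^sup>+\<omega>. ennreal (A * q ^ j) * J j (deficit5 n P1 P2 i \<rho> \<omega>) \<partial>mac5 n \<partial>chi n)"
      by (rule nn_integral_suminf, rule J_meas2)
    have e5: "(\<integral>\<^sup>+\<rho>. \<integral>\<^sup>+\<omega>. ennreal (A * q ^ j) * J j (deficit5 n P1 P2 i \<rho> \<omega>) \<partial>mac5 n \<partial>chi n) \<le> ennreal (A * (C / s) * q ^ j)" for j
    proof -
      have "(\<integral>\<^sup>+\<rho>. \<integral>\<^sup>+\<omega>. ennreal (A * q ^ j) * J j (deficit5 n P1 P2 i \<rho> \<omega>) \<partial>mac5 n \<partial>chi n) =
        ennreal (A * q ^ j) * (\<integral>\<^sup>+\<rho>. \<integral>\<^sup>+\<omega>. J j (deficit5 n P1 P2 i \<rho> \<omega>) \<partial>mac5 n \<partial>chi n)"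
        unfolding nn_integral_cmult[OF J_meas4] nn_integral_cmult[OF J_meas3] ..
      moreover have "\<dots> \<le> ennreal (A * q ^ j) * ennreal (C / s)" by (rule mult_left_mono[OF bJ]) simp
      moreover have "\<dots> = ennreal (A * (C / s) * q ^ j)"
        using q C(1) s A by (simp add: ennreal_mult[symmetric] mult_ac)
      ultimately show ?thesis by simp
    qed
    have e6: "(\<Sum>j. ennreal (A * (C / s) * q ^ j)) = ennreal (A * (C / s) * (1 / (1 - q)))"
    proof (rule suminf_ennreal_eq)
      show "0 \<le> A * (C / s) * q ^ j" for j using q C(1) s A by simp
      show "(\<lambda>j. A * (C / s) * q ^ j) sums (A * (C / s) * (1 / (1 - q)))"
        by (rule sums_mult, rule geometric_sums) (use q in simp)
    qed
    have "(\<Sum>j. \<integral>\<^sup>+\<rho>. \<integral>\<^sup>+\<omega>. ennreal (A * q ^ j) * J j (deficit5 n P1 P2 i \<rho> \<omega>) \<partial>mac5 n \<partial>chi n) \<le> (\<Sum>j. ennreal (A * (C / s) * q ^ j))"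
      by (rule suminf_le[OF e5 summableI summableI])
    with e1 e2 e3 e4 e6 have "(\<integral>\<^sup>+z. \<integral>\<^sup>+x. \<integral>\<^sup>+y. F (deficit n P1 P2 i (gram_vec n z x y)) \<partial>gauss_vec n \<partial>gauss_vec n \<partial>gauss_vec n) \<le> ennreal (A * (C / s) * (1 / (1 - q)))"
      by (simp only:)
    moreover have "A * (C / s) * (1 / (1 - q)) = C * (1 / (1 - q)) / s * A" by (simp add: mult.commute)
    ultimately show "(\<integral>\<^sup>+z. \<integral>\<^sup>+x. \<integral>\<^sup>+y. ennreal (c * exp ((real n - 1) * (deficit n P1 P2 i (gram_vec n z x y) / sqrt n))) *
       of_bool (deficit n P1 P2 i (gram_vec n z x y) < w) \<partial>gauss_vec n \<partial>gauss_vec n \<partial>gauss_vec n)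
     \<le> ennreal (C * (1 / (1 - q)) / sqrt n * (c * exp ((real n - 1) * (w / sqrt n))))"
      unfolding A_def s_def F_def by (simp only:)
  qed
qed


text \<open>Kinds 0 and 1 involve a single sphere codeword, for which normalisation can be undone
  because cones are scale invariant; kind 2 is the sum treated in
  \<open>sum_cone_bound\<close>.\<close>

lemma signal_cone_bound:
  assumes P: "0 \<le> P1" "0 \<le> P2" and i: "i < 3"
  obtains C n0 where "0 < C" "3 \<le> n0" "\<And>n t v. n0 \<le> n \<Longrightarrow> 0 < t \<Longrightarrow> t < 1 \<Longrightarrow> 0 < ip n v v \<Longrightarrow>
    (\<integral>\<^sup>+x. \<integral>\<^sup>+y. of_bool (in_cone n t (signal n P1 P2 i x y) v) \<partial>gauss_vec n \<partial>gauss_vec n) \<le> ennreal (C / sqrt n * (sqrt t ^ (n - 1) / sqrt (1 - t)))"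
proof -
  consider "i = 0" | "i = 1" | "i = 2" using i by linarith
  then show ?thesis
  proof cases
    case 3
    show ?thesis
      apply (rule sum_cone_bound)
      subgoal premises prems for C n0
        apply (rule that[OF prems(1,2)])
        subgoal premises p for n t v
          using prems(3)[OF p, of P1 P2] 3 by (simp add: signal_def indicator_def)
        done
      done
  next
    case 1
    show ?thesis
      apply (rule cone_bound)
      subgoal premises prems for C n0
        apply (rule that[OF prems(1,2)])
        subgoal premises p for n t v
        proof -
          have "(\<integral>\<^sup>+x. \<integral>\<^sup>+y. of_bool (in_cone n t (signal n P1 P2 i x y) v) \<partial>gauss_vec n \<partial>gauss_vec n) =
            (\<integral>\<^sup>+x. of_bool (in_cone n t (sph n P1 x) v) \<partial>gauss_vec n)"
            using 1 by (simp add: signal_def gauss_vec.emeasure_space_1)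
          also have "\<dots> \<le> (\<integral>\<^sup>+x. indicator {x. in_cone n t x v} x \<partial>gauss_vec n)"
            using in_cone_sph[OF _ P(1)] by (intro nn_integral_mono) (simp add: indicator_def)
          finally show ?thesis using prems(3)[OF p] by (rule order_trans)
        qed
        done
      done
  next
    case 2
    show ?thesis
      apply (rule cone_bound)
      subgoal premises prems for C n0
        apply (rule that[OF prems(1,2)])
        subgoal premises p for n t v
        proof -
          have "(\<integral>\<^sup>+x. \<integral>\<^sup>+y. of_bool (in_cone n t (signal n P1 P2 i x y) v) \<partial>gauss_vec n \<partial>gauss_vec n) =
            (\<integral>\<^sup>+y. of_bool (in_cone n t (sph n P2 y) v) \<partial>gauss_vec n)"
            using 2 by (simp add: signal_def gauss_vec.emeasure_space_1)
          also have "\<dots> \<le> (\<integral>\<^sup>+x. indicator {x. in_cone n t x v} x \<partial>gauss_vec n)"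
            using in_cone_sph[OF _ P(2)] by (intro nn_integral_mono) (simp add: indicator_def)
          finally show ?thesis using prems(3)[OF p] by (rule order_trans)
        qed
        done
      done
  qed
qed

lemma cap_vec_tot: "i < 3 \<Longrightarrow> cap_vec P1 P2 i = ln (1 + tot P1 P2 i) / 2"
  by (auto simp: cap_vec_def tot_def Cap_def)

text \<open>For fixed z, x, y a winning competitor lies in the cone with t = |z|^2/|v|^2, where sqrt
  t = exp(D/sqrt n - C_i). \<open>signal_cone_bound\<close> gives one factor n^(-1/2), and the
  average over D < w in \<open>deficit_exp_moment\<close> the other. The hypotheses on \<kappa> and
  w keep t away from 1, so that 1/sqrt(1 - t) is bounded.\<close>

lemma competitor_bound:
  assumes P: "0 < P1" "0 < P2" and i: "i < 3" and \<kappa>: "4 * \<kappa> \<le> ln (1 + tot P1 P2 i)"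
  obtains C n0 where "0 \<le> C" "3 \<le> n0" "\<And>n w. n0 \<le> n \<Longrightarrow> w \<le> \<kappa> * sqrt n \<Longrightarrow>
    (\<integral>\<^sup>+z. \<integral>\<^sup>+x. \<integral>\<^sup>+y. \<integral>\<^sup>+x'. \<integral>\<^sup>+y'. of_bool (deficit n P1 P2 i (gram_vec n z x y) < w \<and>
        ip n (\<lambda>j. signal n P1 P2 i x y j + z j - signal n P1 P2 i x' y' j)
             (\<lambda>j. signal n P1 P2 i x y j + z j - signal n P1 P2 i x' y' j) \<le> ip n z z)
      \<partial>gauss_vec n \<partial>gauss_vec n \<partial>gauss_vec n \<partial>gauss_vec n \<partial>gauss_vec n)
    \<le> ennreal (C / n * exp ((real n - 1) * (w / sqrt n - cap_vec P1 P2 i)))"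
proof -
  obtain C1 n1 where C1: "0 < C1" "3 \<le> n1" "\<And>n t v. n1 \<le> n \<Longrightarrow> 0 < t \<Longrightarrow> t < 1 \<Longrightarrow> 0 < ip n v v \<Longrightarrow>
    (\<integral>\<^sup>+x. \<integral>\<^sup>+y. of_bool (in_cone n t (signal n P1 P2 i x y) v) \<partial>gauss_vec n \<partial>gauss_vec n) \<le> ennreal (C1 / sqrt n * (sqrt t ^ (n - 1) / sqrt (1 - t)))"
    apply (rule signal_cone_bound[OF less_imp_le[OF P(1)] less_imp_le[OF P(2)] i])
    subgoal premises prems for C n0 by (rule prems(1)[OF prems(2-4)])
    done
  obtain C2 n2 where C2: "0 \<le> C2" "3 \<le> n2" "\<And>n w c. n2 \<le> n \<Longrightarrow> 0 \<le> c \<Longrightarrow>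
    (\<integral>\<^sup>+z. \<integral>\<^sup>+x. \<integral>\<^sup>+y. ennreal (c * exp ((real n - 1) * (deficit n P1 P2 i (gram_vec n z x y) / sqrt n))) *
       of_bool (deficit n P1 P2 i (gram_vec n z x y) < w) \<partial>gauss_vec n \<partial>gauss_vec n \<partial>gauss_vec n)
     \<le> ennreal (C2 / sqrt n * (c * exp ((real n - 1) * (w / sqrt n))))"
    apply (rule deficit_exp_moment[OF P i])
    subgoal premises prems for C n0 by (rule prems(1)[OF prems(2-4)])
    done
  define L where "L = ln (1 + tot P1 P2 i)"
  have tot: "0 < tot P1 P2 i" using P by (simp add: tot_def)
  have L: "0 < L" using tot by (simp add: L_def)
  \<comment> \<open>The uniform upper bound for t: on D < w the ratio |v|^2/|z|^2 exceeds
    exp(L/2).\<close>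
  define t0 where "t0 = exp (- (L / 2))"
  have t0: "0 < t0" "t0 < 1" using L by (auto simp: t0_def)
  have cap: "cap_vec P1 P2 i = L / 2" using cap_vec_tot[OF i] by (simp add: L_def)
  show ?thesis
  proof (rule that[of "C1 / sqrt (1 - t0) * C2" "max n1 n2"])
    show "0 \<le> C1 / sqrt (1 - t0) * C2" using C1(1) C2(1) t0 by simp
    show "3 \<le> max n1 n2" using C1(2) by simp
    fix n :: nat and w :: real assume n: "max n1 n2 \<le> n" and w: "w \<le> \<kappa> * sqrt n"
    have n1: "n1 \<le> n" and n2: "n2 \<le> n" and n3: "3 \<le> n" using n C1(2) by auto
    define s where "s = sqrt n"
    have s: "0 < s" "s * s = n" using n3 by (auto simp: s_def)
    define c where "c = C1 / s * (exp (- ((real n - 1) * (L / 2))) / sqrt (1 - t0))"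
    have c: "0 \<le> c" using C1(1) s t0 by (simp add: c_def)
    define near where "near z x y x' y' \<longleftrightarrow>
        ip n (\<lambda>j. signal n P1 P2 i x y j + z j - signal n P1 P2 i x' y' j)
             (\<lambda>j. signal n P1 P2 i x y j + z j - signal n P1 P2 i x' y' j) \<le> ip n z z" for z x y x' y'
    define D where "D z x y = deficit n P1 P2 i (gram_vec n z x y)" for z x y
    have ptw: "(\<integral>\<^sup>+x'. \<integral>\<^sup>+y'. of_bool (D z x y < w \<and> near z x y x' y') \<partial>gauss_vec n \<partial>gauss_vec n) \<le>
      ennreal (c * exp ((real n - 1) * (D z x y / s))) * of_bool (D z x y < w)" if z: "0 < ip n z z" for z x y
    proof (cases "D z x y < w")
      case True
      define v where "v = (\<lambda>j. signal n P1 P2 i x y j + z j)"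
      define r where "r = ip n v v / ip n z z"
      have r0: "0 \<le> r" using z by (simp add: r_def)
      have Dr: "D z x y = s * ((L - ln r) / 2)"
        unfolding D_def deficit_def out_sq_gram_vec[OF i] v_def[symmetric] s_def L_def r_def by (simp add: gram_vec_def)
      have "s * ((L - ln r) / 2) < s * \<kappa>" using True w Dr by (simp add: s_def mult.commute)
      then have "(L - ln r) / 2 < \<kappa>" using s by simp
      \<comment> \<open>From (L - ln r)/2 < \<kappa> \<le> L/4; in particular r > 1, so the ball of
        radius |z| around v misses the origin.\<close>
      then have lnr: "L / 2 < ln r" using \<kappa> unfolding L_def[symmetric] by simp
      have "1 < r"
      proof (rule ccontr)
        assume "\<not> 1 < r"
        then have "ln r \<le> 0" using r0 by (cases "r = 0") auto
        then show False using lnr L by simp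
      qed
      define t where "t = ip n z z / ip n v v"
      have tr: "t = 1 / r" by (simp add: t_def r_def)
      have t: "0 < t" "t < 1" using \<open>1 < r\<close> by (auto simp: tr)
      have vv: "ip n z z < ip n v v" using \<open>1 < r\<close> z by (simp add: r_def less_divide_eq)
      have lnt: "ln t = - ln r" using \<open>1 < r\<close> by (simp add: tr ln_div)
      have te: "t = exp (- ln r)" using t lnt by (metis exp_ln)
      have "t \<le> t0" unfolding te t0_def using lnr by simp
      then have q: "1 / sqrt (1 - t) \<le> 1 / sqrt (1 - t0)" using t t0 by (intro divide_left_mono) auto
      \<comment> \<open>The dictionary between the angle of the cone and the deficit.\<close>
      have st: "sqrt t = exp (D z x y / s - L / 2)"
      proof -
        have "D z x y / s - L / 2 = - ln r / 2" unfolding Dr using s by (simp add: field_simps)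
        moreover have "(exp (- ln r / 2))\<^sup>2 = t" unfolding te by (simp add: power2_eq_square exp_add[symmetric])
        ultimately show ?thesis by (simp add: real_sqrt_unique)
      qed
      have n1r: "real (n - 1) = real n - 1" using n3 by simp
      have st2: "sqrt t ^ (n - 1) = exp ((real n - 1) * (D z x y / s)) * exp (- ((real n - 1) * (L / 2)))"
        unfolding st exp_of_nat_mult[symmetric] n1r exp_add[symmetric] by (simp add: right_diff_distrib)
      have "(\<integral>\<^sup>+x'. \<integral>\<^sup>+y'. of_bool (D z x y < w \<and> near z x y x' y') \<partial>gauss_vec n \<partial>gauss_vec n) \<le>
        (\<integral>\<^sup>+x'. \<integral>\<^sup>+y'. of_bool (in_cone n t (signal n P1 P2 i x' y') v) \<partial>gauss_vec n \<partial>gauss_vec n)"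
      proof (rule nn_integral_mono, rule nn_integral_mono)
        fix x' y'
        show "(of_bool (D z x y < w \<and> near z x y x' y') :: ennreal) \<le> of_bool (in_cone n t (signal n P1 P2 i x' y') v)"
          using in_cone_near[OF z vv, of "signal n P1 P2 i x' y'"] unfolding near_def t_def v_def by auto
      qed
      also have "\<dots> \<le> ennreal (C1 / sqrt n * (sqrt t ^ (n - 1) / sqrt (1 - t)))"
        by (rule C1(3)[OF n1 t]) (use vv z in simp)
      also have "\<dots> \<le> ennreal (c * exp ((real n - 1) * (D z x y / s)))"
      proof (rule ennreal_leI)
        have "C1 / s * (sqrt t ^ (n - 1) * (1 / sqrt (1 - t))) \<le> C1 / s * (sqrt t ^ (n - 1) * (1 / sqrt (1 - t0)))"
          using q C1(1) s t by (intro mult_left_mono) auto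
        also have "\<dots> = c * exp ((real n - 1) * (D z x y / s))" unfolding st2 c_def by simp
        finally show "C1 / sqrt n * (sqrt t ^ (n - 1) / sqrt (1 - t)) \<le> c * exp ((real n - 1) * (D z x y / s))"
          by (simp add: s_def)
      qed
      finally show ?thesis using True by simp
    qed simp
    have "(\<integral>\<^sup>+z. \<integral>\<^sup>+x. \<integral>\<^sup>+y. \<integral>\<^sup>+x'. \<integral>\<^sup>+y'. of_bool (D z x y < w \<and> near z x y x' y')
        \<partial>gauss_vec n \<partial>gauss_vec n \<partial>gauss_vec n \<partial>gauss_vec n \<partial>gauss_vec n)
      \<le> (\<integral>\<^sup>+z. \<integral>\<^sup>+x. \<integral>\<^sup>+y. ennreal (c * exp ((real n - 1) * (D z x y / s))) * of_bool (D z x y < w) \<partial>gauss_vec n \<partial>gauss_vec n \<partial>gauss_vec n)"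
    proof (rule nn_integral_mono_AE)
      have "AE z in gauss_vec n. 0 < ip n z z" by (rule AE_gauss_vec_nonzero) (use n3 in simp)
      then show "AE z in gauss_vec n. (\<integral>\<^sup>+x. \<integral>\<^sup>+y. \<integral>\<^sup>+x'. \<integral>\<^sup>+y'. of_bool (D z x y < w \<and> near z x y x' y')
          \<partial>gauss_vec n \<partial>gauss_vec n \<partial>gauss_vec n \<partial>gauss_vec n) \<le>
        (\<integral>\<^sup>+x. \<integral>\<^sup>+y. ennreal (c * exp ((real n - 1) * (D z x y / s))) * of_bool (D z x y < w) \<partial>gauss_vec n \<partial>gauss_vec n)"
      proof eventually_elim
        case (elim z)
        show ?case by (rule nn_integral_mono, rule nn_integral_mono, rule ptw[OF elim])
      qed
    qed
    also have "\<dots> \<le> ennreal (C2 / sqrt n * (c * exp ((real n - 1) * (w / sqrt n))))"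
      unfolding D_def s_def by (rule C2(3)[OF n2 c])
    also have "C2 / sqrt n * (c * exp ((real n - 1) * (w / sqrt n))) =
      C1 / sqrt (1 - t0) * C2 / n * exp ((real n - 1) * (w / sqrt n - cap_vec P1 P2 i))"
    proof -
      have "exp ((real n - 1) * (w / s - L / 2)) = exp ((real n - 1) * (w / s)) * exp (- ((real n - 1) * (L / 2)))"
        unfolding exp_add[symmetric] by (simp add: right_diff_distrib)
      moreover have "C2 / s * (C1 / s * (u / q) * e) = C1 / q * C2 / (s * s) * (e * u)" for u q e by (simp add: mult_ac)
      ultimately have "C2 / s * (c * exp ((real n - 1) * (w / s))) = C1 / sqrt (1 - t0) * C2 / (s * s) * exp ((real n - 1) * (w / s - L / 2))"
        unfolding c_def by (simp only:)
      then show ?thesis unfolding s(2) cap unfolding s_def .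
    qed
    finally show "(\<integral>\<^sup>+z. \<integral>\<^sup>+x. \<integral>\<^sup>+y. \<integral>\<^sup>+x'. \<integral>\<^sup>+y'. of_bool (deficit n P1 P2 i (gram_vec n z x y) < w \<and>
        ip n (\<lambda>j. signal n P1 P2 i x y j + z j - signal n P1 P2 i x' y' j)
             (\<lambda>j. signal n P1 P2 i x y j + z j - signal n P1 P2 i x' y' j) \<le> ip n z z)
      \<partial>gauss_vec n \<partial>gauss_vec n \<partial>gauss_vec n \<partial>gauss_vec n \<partial>gauss_vec n)
      \<le> ennreal (C1 / sqrt (1 - t0) * C2 / n * exp ((real n - 1) * (w / sqrt n - cap_vec P1 P2 i)))"
      unfolding near_def D_def .
  qed
qed


section \<open>Minimum-distance decoding and the random codebook\<close>

text \<open>A measurable minimiser: pairs of messages are numbered by k = m1 M2 + m2, and ties are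
  broken by taking the least k.\<close>

lemma min_index_decoder:
  fixes e :: "nat \<Rightarrow> nat \<Rightarrow> 'a \<Rightarrow> real"
  assumes M: "1 \<le> M1" "1 \<le> M2" and e: "\<And>m1 m2. e m1 m2 \<in> borel_measurable M"
  obtains g where "g \<in> M \<rightarrow>\<^sub>M count_space UNIV" "\<And>y. g y \<in> {..<M1} \<times> {..<M2}"
    "\<And>y m1 m2. m1 < M1 \<Longrightarrow> m2 < M2 \<Longrightarrow> g y \<noteq> (m1, m2) \<Longrightarrow>
      \<exists>m1' m2'. m1' < M1 \<and> m2' < M2 \<and> (m1', m2') \<noteq> (m1, m2) \<and> e m1' m2' y \<le> e m1 m2 y"
proof -
  define c where "c k y = e (k div M2) (k mod M2) y" for k y
  have [measurable]: "c k \<in> borel_measurable M" for k unfolding c_def[abs_def] by (rule e)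
  define K where "K y = (LEAST k. k < M1 * M2 \<and> (\<forall>k'\<in>{..<M1 * M2}. c k y \<le> c k' y))" for y
  have K: "K y < M1 * M2 \<and> (\<forall>k'\<in>{..<M1 * M2}. c (K y) y \<le> c k' y)" for y
  proof -
    have ne: "{..<M1 * M2} \<noteq> {}" using M by (auto simp: lessThan_empty_iff)
    obtain k where "k \<in> {..<M1 * M2}" "\<forall>k'\<in>{..<M1 * M2}. c k y \<le> c k' y"
      using ex_min_if_finite[of "(\<lambda>k. c k y) ` {..<M1 * M2}"] ne by (auto simp: not_less)
    then have "k < M1 * M2 \<and> (\<forall>k'\<in>{..<M1 * M2}. c k y \<le> c k' y)" by simp
    then show ?thesis unfolding K_def by (rule LeastI)
  qed
  have K_meas [measurable]: "K \<in> M \<rightarrow>\<^sub>M count_space UNIV"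
    unfolding K_def[abs_def] by measurable
  define g where "g y = (K y div M2, K y mod M2)" for y
  show ?thesis
  proof (rule that[of g])
    have "(\<lambda>k. (k div M2, k mod M2)) \<circ> K \<in> M \<rightarrow>\<^sub>M count_space UNIV"
      by (rule measurable_comp[OF K_meas]) simp
    then show "g \<in> M \<rightarrow>\<^sub>M count_space UNIV" by (simp add: g_def[abs_def] comp_def)
    show "g y \<in> {..<M1} \<times> {..<M2}" for y
      using K[of y] M by (auto simp: g_def less_mult_imp_div_less)
    fix y m1 m2 assume m: "m1 < M1" "m2 < M2" and ne: "g y \<noteq> (m1, m2)"
    have "m1 * M2 + m2 < M1 * M2"
    proof -
      have "m1 * M2 + m2 < m1 * M2 + M2" using m by simp
      also have "\<dots> = Suc m1 * M2" by simp
      also have "\<dots> \<le> M1 * M2" using m by (intro mult_right_mono) auto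
      finally show ?thesis .
    qed
    then have "c (K y) y \<le> c (m1 * M2 + m2) y" using K[of y] by simp
    then have "e (K y div M2) (K y mod M2) y \<le> e m1 m2 y" using m by (simp add: c_def)
    moreover have "(K y div M2, K y mod M2) \<noteq> (m1, m2)" using ne by (simp add: g_def)
    moreover have "K y div M2 < M1" "K y mod M2 < M2" using K[of y] M by (auto simp: less_mult_imp_div_less)
    ultimately show "\<exists>m1' m2'. m1' < M1 \<and> m2' < M2 \<and> (m1', m2') \<noteq> (m1, m2) \<and> e m1' m2' y \<le> e m1 m2 y"
      by (intro exI[of _ "K y div M2"] exI[of _ "K y mod M2"]) simp
  qed
qed

text \<open>One infinite sequence of independent Gaussian vectors serves both users: even indices 2
  m carry the messages of the first, odd indices 2 m + 1 those of the second.\<close>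

abbreviation codebook :: "nat \<Rightarrow> (nat \<Rightarrow> nat \<Rightarrow> real) measure" where
  "codebook n \<equiv> PiM UNIV (\<lambda>_. gauss_vec n)"

interpretation codebook: prob_space "codebook n" for n
  by (rule prob_space_PiM) (rule prob_space_gauss_vec)

lemma measurable_codebook:
  assumes f: "f \<in> borel_measurable (gauss_vec n \<Otimes>\<^sub>M gauss_vec n \<Otimes>\<^sub>M gauss_vec n \<Otimes>\<^sub>M gauss_vec n \<Otimes>\<^sub>M gauss_vec n)"
  shows "(\<lambda>(\<omega>, z). f (z, \<omega> a, \<omega> b, \<omega> c, \<omega> d)) \<in> borel_measurable (codebook n \<Otimes>\<^sub>M gauss_vec n)"
proof -
  have "(\<lambda>w. (snd w, fst w a, fst w b, fst w c, fst w d)) \<in> codebook n \<Otimes>\<^sub>M gauss_vec n \<rightarrow>\<^sub>M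
    gauss_vec n \<Otimes>\<^sub>M gauss_vec n \<Otimes>\<^sub>M gauss_vec n \<Otimes>\<^sub>M gauss_vec n \<Otimes>\<^sub>M gauss_vec n"
    by (intro measurable_Pair measurable_snd measurable_compose[OF measurable_fst measurable_component_singleton]) auto
  from measurable_compose[OF this f] show ?thesis by (simp add: split_beta')
qed

text \<open>Four entries at distinct indices are independent with law \<open>gauss_vec n\<close>, so
  an average over codebooks becomes an iterated integral over sent and competing vectors.\<close>

lemma nn_integral_codebook:
  fixes f :: "_ \<Rightarrow> ennreal"
  assumes f: "f \<in> borel_measurable (gauss_vec n \<Otimes>\<^sub>M gauss_vec n \<Otimes>\<^sub>M gauss_vec n \<Otimes>\<^sub>M gauss_vec n \<Otimes>\<^sub>M gauss_vec n)"
    and d: "distinct [a, b, c, d]"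
  shows "(\<integral>\<^sup>+\<omega>. \<integral>\<^sup>+z. f (z, \<omega> a, \<omega> b, \<omega> c, \<omega> d) \<partial>gauss_vec n \<partial>codebook n) =
    (\<integral>\<^sup>+z. \<integral>\<^sup>+x. \<integral>\<^sup>+y. \<integral>\<^sup>+x'. \<integral>\<^sup>+y'. f (z, x, y, x', y') \<partial>gauss_vec n \<partial>gauss_vec n \<partial>gauss_vec n \<partial>gauss_vec n \<partial>gauss_vec n)"
proof -
  interpret pair_sigma_finite "codebook n" "gauss_vec n" ..
  define t where "t i = [a, b, c, d] ! i" for i
  have t: "t 0 = a" "t 1 = b" "t 2 = c" "t 3 = d" by (simp_all add: t_def)
  have inj: "inj_on t {..<4}"
    unfolding t_def using d by (intro inj_onI) (simp add: nth_eq_iff_index_eq)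
  have "(\<integral>\<^sup>+\<omega>. \<integral>\<^sup>+z. f (z, \<omega> a, \<omega> b, \<omega> c, \<omega> d) \<partial>gauss_vec n \<partial>codebook n) =
    (\<integral>\<^sup>+z. \<integral>\<^sup>+\<omega>. f (z, \<omega> a, \<omega> b, \<omega> c, \<omega> d) \<partial>codebook n \<partial>gauss_vec n)"
    using Fubini'[OF measurable_codebook[OF f, of a b c d]] by simp
  also have "\<dots> = (\<integral>\<^sup>+z. \<integral>\<^sup>+x. \<integral>\<^sup>+y. \<integral>\<^sup>+x'. \<integral>\<^sup>+y'. f (z, x, y, x', y') \<partial>gauss_vec n \<partial>gauss_vec n \<partial>gauss_vec n \<partial>gauss_vec n \<partial>gauss_vec n)"
  proof (rule nn_integral_cong)
    fix z assume z: "z \<in> space (gauss_vec n)"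
    define h where "h p = f (z, p)" for p
    have h: "h \<in> borel_measurable (gauss_vec n \<Otimes>\<^sub>M gauss_vec n \<Otimes>\<^sub>M gauss_vec n \<Otimes>\<^sub>M gauss_vec n)"
      unfolding h_def[abs_def] by (rule measurable_compose[OF measurable_Pair1'[OF z] f])
    have hm: "(\<lambda>v. h (v 0, v 1, v 2, v 3)) \<in> borel_measurable (PiM {..<4::nat} (\<lambda>_. gauss_vec n))"
      by (rule measurable_compose[OF _ h]) (intro measurable_Pair measurable_component_singleton, auto)
    have rm: "(\<lambda>\<omega>. \<lambda>i\<in>{..<4}. \<omega> (t i)) \<in> codebook n \<rightarrow>\<^sub>M PiM {..<4::nat} (\<lambda>_. gauss_vec n)"
      by (rule measurable_restrict) (rule measurable_component_singleton, simp)
    have "(\<integral>\<^sup>+\<omega>. f (z, \<omega> a, \<omega> b, \<omega> c, \<omega> d) \<partial>codebook n) = (\<integral>\<^sup>+\<omega>. (\<lambda>v. h (v 0, v 1, v 2, v 3)) (\<lambda>i\<in>{..<4}. \<omega> (t i)) \<partial>codebook n)"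
      by (simp add: h_def t[simplified])
    also have "\<dots> = (\<integral>\<^sup>+v. h (v 0, v 1, v 2, v 3) \<partial>distr (codebook n) (PiM {..<4::nat} (\<lambda>_. gauss_vec n)) (\<lambda>\<omega>. \<lambda>i\<in>{..<4}. \<omega> (t i)))"
      by (rule nn_integral_distr[OF rm, symmetric]) (subst measurable_distr_eq1, rule hm)
    also have "distr (codebook n) (PiM {..<4::nat} (\<lambda>_. gauss_vec n)) (\<lambda>\<omega>. \<lambda>i\<in>{..<4}. \<omega> (t i)) = PiM {..<4::nat} (\<lambda>_. gauss_vec n)"
      by (rule distr_PiM_reindex[OF _ inj]) (auto intro: prob_space_gauss_vec)
    also have "(\<integral>\<^sup>+v. h (v 0, v 1, v 2, v 3) \<partial>PiM {..<4::nat} (\<lambda>_. gauss_vec n)) =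
      (\<integral>\<^sup>+x. \<integral>\<^sup>+y. \<integral>\<^sup>+x'. \<integral>\<^sup>+y'. h (x, y, x', y') \<partial>gauss_vec n \<partial>gauss_vec n \<partial>gauss_vec n \<partial>gauss_vec n)"
      by (rule nn_integral_PiM_4[OF prob_space_gauss_vec h])
    finally show "(\<integral>\<^sup>+\<omega>. f (z, \<omega> a, \<omega> b, \<omega> c, \<omega> d) \<partial>codebook n) =
      (\<integral>\<^sup>+x. \<integral>\<^sup>+y. \<integral>\<^sup>+x'. \<integral>\<^sup>+y'. f (z, x, y, x', y') \<partial>gauss_vec n \<partial>gauss_vec n \<partial>gauss_vec n \<partial>gauss_vec n)"
      unfolding h_def .
  qed
  finally show ?thesis .
qed


text \<open>The competitor (x', y') is at least as close to the channel output as the sent pair,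
  whose squared distance is that of the noise.\<close>

definition near :: "nat \<Rightarrow> real \<Rightarrow> real \<Rightarrow> nat \<Rightarrow> (nat \<Rightarrow> real) \<Rightarrow> (nat \<Rightarrow> real) \<Rightarrow> (nat \<Rightarrow> real) \<Rightarrow> (nat \<Rightarrow> real) \<Rightarrow> (nat \<Rightarrow> real) \<Rightarrow> bool" where
  "near n P1 P2 i z x y x' y' \<longleftrightarrow>
     ip n (\<lambda>j. signal n P1 P2 i x y j + z j - signal n P1 P2 i x' y' j)
          (\<lambda>j. signal n P1 P2 i x y j + z j - signal n P1 P2 i x' y' j) \<le> ip n z z"

lemma measurable_gauss_vec_apply:
  "f \<in> M \<rightarrow>\<^sub>M gauss_vec n \<Longrightarrow> j < n \<Longrightarrow> (\<lambda>w. f w j) \<in> borel_measurable M"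
  by (rule measurable_compose[OF _ measurable_gauss_vec_component])

lemma borel_measurable_signal:
  assumes f: "f \<in> M \<rightarrow>\<^sub>M gauss_vec n" "g \<in> M \<rightarrow>\<^sub>M gauss_vec n" and j: "j < n"
  shows "(\<lambda>w. signal n P1 P2 i (f w) (g w) j) \<in> borel_measurable M"
proof -
  have s: "(\<lambda>w. sph n P (h w) j) \<in> borel_measurable M" if h: "h \<in> M \<rightarrow>\<^sub>M gauss_vec n" for h P
  proof -
    have [measurable]: "(\<lambda>w. ip n (h w) (h w)) \<in> borel_measurable M" "(\<lambda>w. h w j) \<in> borel_measurable M"
      using measurable_ip[OF h h] measurable_gauss_vec_apply[OF h j] by auto
    show ?thesis unfolding sph_def by measurable
  qed
  have "(\<lambda>w. sph n P1 (f w) j + sph n P2 (g w) j) \<in> borel_measurable M"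
    by (rule borel_measurable_add[OF s[OF f(1)] s[OF f(2)]])
  then show ?thesis unfolding signal_def using s[OF f(1)] s[OF f(2)]
    by (cases "i = 0"; cases "i = 1") simp_all
qed

lemma pred_near:
  assumes z: "fz \<in> M \<rightarrow>\<^sub>M gauss_vec n" and x: "fx \<in> M \<rightarrow>\<^sub>M gauss_vec n" "fy \<in> M \<rightarrow>\<^sub>M gauss_vec n"
    and x': "fx' \<in> M \<rightarrow>\<^sub>M gauss_vec n" "fy' \<in> M \<rightarrow>\<^sub>M gauss_vec n"
  shows "Measurable.pred M (\<lambda>w. near n P1 P2 i (fz w) (fx w) (fy w) (fx' w) (fy' w))"
proof -
  define Q where "Q w = (\<Sum>j<n. (signal n P1 P2 i (fx w) (fy w) j + fz w j - signal n P1 P2 i (fx' w) (fy' w) j) *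
    (signal n P1 P2 i (fx w) (fy w) j + fz w j - signal n P1 P2 i (fx' w) (fy' w) j))" for w
  have [measurable]: "Q \<in> borel_measurable M"
    unfolding Q_def[abs_def]
  proof (rule borel_measurable_sum)
    fix j assume "j \<in> {..<n}"
    then have j: "j < n" by simp
    have d: "(\<lambda>w. signal n P1 P2 i (fx w) (fy w) j + fz w j - signal n P1 P2 i (fx' w) (fy' w) j) \<in> borel_measurable M"
      by (rule borel_measurable_diff[OF borel_measurable_add[OF borel_measurable_signal[OF x j] measurable_gauss_vec_apply[OF z j]]
        borel_measurable_signal[OF x' j]])
    show "(\<lambda>w. (signal n P1 P2 i (fx w) (fy w) j + fz w j - signal n P1 P2 i (fx' w) (fy' w) j) *
      (signal n P1 P2 i (fx w) (fy w) j + fz w j - signal n P1 P2 i (fx' w) (fy' w) j)) \<in> borel_measurable M"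
      by (rule borel_measurable_times[OF d d])
  qed
  have [measurable]: "(\<lambda>w. ip n (fz w) (fz w)) \<in> borel_measurable M" by (rule measurable_ip[OF z z])
  have "Measurable.pred M (\<lambda>w. Q w \<le> ip n (fz w) (fz w))" by measurable
  then show ?thesis unfolding near_def Q_def ip_def[of n "\<lambda>j. _ j + _ j - _ j"] .
qed

lemma borel_measurable_deficit_gram_vec:
  assumes z: "fz \<in> M \<rightarrow>\<^sub>M gauss_vec n" and x: "fx \<in> M \<rightarrow>\<^sub>M gauss_vec n" "fy \<in> M \<rightarrow>\<^sub>M gauss_vec n"
  shows "(\<lambda>w. deficit n P1 P2 i (gram_vec n (fz w) (fx w) (fy w))) \<in> borel_measurable M"
  unfolding gram_vec_def by (intro borel_measurable_deficit measurable_ip z x)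

text \<open>The index \<open>i\<close> tells which messages of the competing pair are wrong (0: the first, 1: the second,
  2: both); the union bound over competitors is paid only while the deficit \<open>i\<close> stays below \<open>w i\<close>.\<close>
lemma random_coding:
  fixes w :: "nat \<Rightarrow> real" and \<beta> :: real and \<tau> :: "nat \<Rightarrow> real"
  assumes M: "1 \<le> M1" "1 \<le> M2" and P: "0 \<le> P1" "0 \<le> P2" and nonneg: "0 \<le> \<beta>" "\<And>i. i < 3 \<Longrightarrow> 0 \<le> \<tau> i"
    and bad: "(\<integral>\<^sup>+z. \<integral>\<^sup>+x. \<integral>\<^sup>+y. of_bool (\<exists>i<3. w i \<le> deficit n P1 P2 i (gram_vec n z x y))
      \<partial>gauss_vec n \<partial>gauss_vec n \<partial>gauss_vec n) \<le> ennreal \<beta>"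
    and comp: "\<And>i. i < 3 \<Longrightarrow> (\<integral>\<^sup>+z. \<integral>\<^sup>+x. \<integral>\<^sup>+y. \<integral>\<^sup>+x'. \<integral>\<^sup>+y'.
      of_bool (deficit n P1 P2 i (gram_vec n z x y) < w i \<and> near n P1 P2 i z x y x' y')
      \<partial>gauss_vec n \<partial>gauss_vec n \<partial>gauss_vec n \<partial>gauss_vec n \<partial>gauss_vec n) \<le> ennreal (\<tau> i)"
    and total: "\<beta> + M1 * \<tau> 0 + M2 * \<tau> 1 + real M1 * real M2 * \<tau> 2 < \<epsilon>"
  shows "exists_mac_code n M1 M2 \<epsilon> P1 P2"
proof -
  define N where "N i = (if i = 0 then M1 else if i = 1 then M2 else M1 * M2)" for i :: nat
  define \<Psi> where "\<Psi> = (\<lambda>(z, x, y, x' :: nat \<Rightarrow> real, y' :: nat \<Rightarrow> real). of_bool (\<exists>i<3. w i \<le> deficit n P1 P2 i (gram_vec n z x y)) :: ennreal)"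
  define \<Phi> where "\<Phi> i = (\<lambda>(z, x, y, x', y'). of_bool (deficit n P1 P2 i (gram_vec n z x y) < w i \<and> near n P1 P2 i z x y x' y') :: ennreal)" for i
  let ?G5 = "gauss_vec n \<Otimes>\<^sub>M gauss_vec n \<Otimes>\<^sub>M gauss_vec n \<Otimes>\<^sub>M gauss_vec n \<Otimes>\<^sub>M gauss_vec n"
  have proj: "(\<lambda>p. fst p) \<in> ?G5 \<rightarrow>\<^sub>M gauss_vec n" "(\<lambda>p. fst (snd p)) \<in> ?G5 \<rightarrow>\<^sub>M gauss_vec n"
    "(\<lambda>p. fst (snd (snd p))) \<in> ?G5 \<rightarrow>\<^sub>M gauss_vec n" "(\<lambda>p. fst (snd (snd (snd p)))) \<in> ?G5 \<rightarrow>\<^sub>M gauss_vec n"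
    "(\<lambda>p. snd (snd (snd (snd p)))) \<in> ?G5 \<rightarrow>\<^sub>M gauss_vec n" by measurable
  have ob: "(\<lambda>p. of_bool (Q p) :: ennreal) \<in> borel_measurable ?G5" if [measurable]: "Measurable.pred ?G5 Q" for Q
    unfolding of_bool_def by measurable
  define D where "D i p = deficit n P1 P2 i (gram_vec n (fst p) (fst (snd p)) (fst (snd (snd p))))"
    for i and p :: "(nat \<Rightarrow> real) \<times> (nat \<Rightarrow> real) \<times> (nat \<Rightarrow> real) \<times> (nat \<Rightarrow> real) \<times> (nat \<Rightarrow> real)"
  have D [measurable]: "D i \<in> borel_measurable ?G5" for i
    unfolding D_def[abs_def] by (rule borel_measurable_deficit_gram_vec[OF proj(1,2,3)])
  have \<Psi>_meas: "\<Psi> \<in> borel_measurable ?G5"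
  proof -
    have "Measurable.pred ?G5 (\<lambda>p. \<exists>i<3. w i \<le> D i p)" by measurable
    moreover have "\<Psi> = (\<lambda>p. of_bool (\<exists>i<3. w i \<le> D i p))"
      by (rule ext) (simp only: \<Psi>_def D_def split_beta')
    ultimately show ?thesis using ob by (simp only:)
  qed
  have \<Phi>_meas: "\<Phi> i \<in> borel_measurable ?G5" for i
  proof -
    define R where "R p = near n P1 P2 i (fst p) (fst (snd p)) (fst (snd (snd p))) (fst (snd (snd (snd p)))) (snd (snd (snd (snd p))))" for p
    have [measurable]: "Measurable.pred ?G5 R" unfolding R_def[abs_def] by (rule pred_near[OF proj])
    have "Measurable.pred ?G5 (\<lambda>p. D i p < w i \<and> R p)" by measurable
    moreover have "\<Phi> i = (\<lambda>p. of_bool (D i p < w i \<and> R p))"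
      by (rule ext) (simp only: \<Phi>_def D_def R_def split_beta')
    ultimately show ?thesis using ob by (simp only:)
  qed
  \<comment> \<open>The event function evaluated at the codewords of the sent pair (m1, m2) and the
    competing pair q.\<close>
  define ev where "ev f m1 m2 q \<omega> z = (f (z, \<omega> (2 * m1), \<omega> (2 * m2 + 1), \<omega> (2 * fst q), \<omega> (2 * snd q + 1)) :: ennreal)"
    for f and m1 m2 :: nat and q :: "nat \<times> nat" and \<omega> :: "nat \<Rightarrow> nat \<Rightarrow> real" and z :: "nat \<Rightarrow> real"
  have ev_meas: "(\<lambda>(\<omega>, z). ev f m1 m2 q \<omega> z) \<in> borel_measurable (codebook n \<Otimes>\<^sub>M gauss_vec n)"
    if f: "f \<in> borel_measurable ?G5" for f m1 m2 q
    unfolding ev_def by (rule measurable_codebook[OF f])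
  have ev_meas1: "(\<lambda>z. ev f m1 m2 q \<omega> z) \<in> borel_measurable (gauss_vec n)"
    if f: "f \<in> borel_measurable ?G5" and \<omega>: "\<omega> \<in> space (codebook n)" for f m1 m2 q \<omega>
    using measurable_compose[OF measurable_Pair1'[OF \<omega>] ev_meas[OF f]] by simp
  have ev_meas2: "(\<lambda>\<omega>. \<integral>\<^sup>+z. ev f m1 m2 q \<omega> z \<partial>gauss_vec n) \<in> borel_measurable (codebook n)"
    if f: "f \<in> borel_measurable ?G5" for f m1 m2 q
    using gauss_vec.borel_measurable_nn_integral_fst[OF ev_meas[OF f]] by simp
  have ev_int: "(\<integral>\<^sup>+\<omega>. \<integral>\<^sup>+z. ev f m1 m2 q \<omega> z \<partial>gauss_vec n \<partial>codebook n) =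
    (\<integral>\<^sup>+z. \<integral>\<^sup>+x. \<integral>\<^sup>+y. \<integral>\<^sup>+x'. \<integral>\<^sup>+y'. f (z, x, y, x', y') \<partial>gauss_vec n \<partial>gauss_vec n \<partial>gauss_vec n \<partial>gauss_vec n \<partial>gauss_vec n)"
    if f: "f \<in> borel_measurable ?G5" and q: "fst q \<noteq> m1" "snd q \<noteq> m2" for f m1 m2 q
  proof -
    have "distinct [2 * m1, 2 * m2 + 1, 2 * fst q, 2 * snd q + 1]" using q by simp presburger
    then show ?thesis unfolding ev_def by (rule nn_integral_codebook[OF f])
  qed
  \<comment> \<open>Competitors of each kind. In kinds 0 and 1 only one message is wrong and the
    other slot is ignored by \<open>signal\<close>; it is filled with a dummy index Suc m, so that
    the four codebook entries are always distinct and \<open>nn_integral_codebook\<close>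
    applies.\<close>
  define S where "S i m1 m2 = (if i = 0 then ({..<M1} - {m1}) \<times> {Suc m2} else if i = 1 then {Suc m1} \<times> ({..<M2} - {m2})
    else ({..<M1} - {m1}) \<times> ({..<M2} - {m2}))" for i m1 m2 :: nat
  have S_fin: "finite (S i m1 m2)" for i m1 m2 by (simp add: S_def)
  have S_card: "card (S i m1 m2) \<le> N i" for i m1 m2
  proof -
    have c: "card ({..<M1} - {m1}) \<le> M1" "card ({..<M2} - {m2}) \<le> M2"
      using card_mono[of "{..<M1}" "{..<M1} - {m1}"] card_mono[of "{..<M2}" "{..<M2} - {m2}"] by auto
    show ?thesis using c by (simp add: S_def N_def card_cartesian_product mult_le_mono)
  qed
  have S_ne: "fst q \<noteq> m1" "snd q \<noteq> m2" if "q \<in> S i m1 m2" for q i m1 m2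
    using that by (auto simp: S_def split: if_splits)
  \<comment> \<open>Union bound: it is at least 1 whenever decoding fails, and its mean is at most
    \<theta> < \<epsilon>. The dummy pair in the first summand only serves to bring it into the same
    form.\<close>
  define U where "U m1 m2 \<omega> z = ev \<Psi> m1 m2 (Suc m1, Suc m2) \<omega> z + (\<Sum>i<3. \<Sum>q\<in>S i m1 m2. ev (\<Phi> i) m1 m2 q \<omega> z)" for m1 m2 \<omega> z
  define \<theta> where "\<theta> = \<beta> + (\<Sum>i<3. real (N i) * \<tau> i)"
  have \<theta>0: "0 \<le> \<theta>" unfolding \<theta>_def using nonneg by (intro add_nonneg_nonneg sum_nonneg mult_nonneg_nonneg) auto
  have \<theta>: "\<theta> < \<epsilon>" using total by (simp add: \<theta>_def N_def eval_nat_numeral)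
  have U_z: "(\<integral>\<^sup>+z. U m1 m2 \<omega> z \<partial>gauss_vec n) = (\<integral>\<^sup>+z. ev \<Psi> m1 m2 (Suc m1, Suc m2) \<omega> z \<partial>gauss_vec n) +
      (\<Sum>i<3. \<Sum>q\<in>S i m1 m2. \<integral>\<^sup>+z. ev (\<Phi> i) m1 m2 q \<omega> z \<partial>gauss_vec n)" if \<omega>: "\<omega> \<in> space (codebook n)" for m1 m2 \<omega>
  proof -
    note m = ev_meas1[OF \<Psi>_meas \<omega>] ev_meas1[OF \<Phi>_meas \<omega>]
    have "(\<integral>\<^sup>+z. U m1 m2 \<omega> z \<partial>gauss_vec n) = (\<integral>\<^sup>+z. ev \<Psi> m1 m2 (Suc m1, Suc m2) \<omega> z \<partial>gauss_vec n) +
      (\<integral>\<^sup>+z. (\<Sum>i<3. \<Sum>q\<in>S i m1 m2. ev (\<Phi> i) m1 m2 q \<omega> z) \<partial>gauss_vec n)"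
      unfolding U_def by (rule nn_integral_add[OF m(1)]) (intro borel_measurable_sum m(2))
    also have "(\<integral>\<^sup>+z. (\<Sum>i<3. \<Sum>q\<in>S i m1 m2. ev (\<Phi> i) m1 m2 q \<omega> z) \<partial>gauss_vec n) = (\<Sum>i<3. \<integral>\<^sup>+z. (\<Sum>q\<in>S i m1 m2. ev (\<Phi> i) m1 m2 q \<omega> z) \<partial>gauss_vec n)"
      by (rule nn_integral_sum) (intro borel_measurable_sum m(2))
    also have "\<dots> = (\<Sum>i<3. \<Sum>q\<in>S i m1 m2. \<integral>\<^sup>+z. ev (\<Phi> i) m1 m2 q \<omega> z \<partial>gauss_vec n)"
      by (rule sum.cong[OF refl]) (rule nn_integral_sum[OF m(2)])
    finally show ?thesis .
  qed
  have U_meas: "(\<lambda>\<omega>. \<integral>\<^sup>+z. U m1 m2 \<omega> z \<partial>gauss_vec n) \<in> borel_measurable (codebook n)" for m1 m2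
  proof -
    have "(\<lambda>\<omega>. (\<integral>\<^sup>+z. ev \<Psi> m1 m2 (Suc m1, Suc m2) \<omega> z \<partial>gauss_vec n) +
      (\<Sum>i<3. \<Sum>q\<in>S i m1 m2. \<integral>\<^sup>+z. ev (\<Phi> i) m1 m2 q \<omega> z \<partial>gauss_vec n)) \<in> borel_measurable (codebook n)"
      by (intro borel_measurable_add borel_measurable_sum ev_meas2 \<Psi>_meas \<Phi>_meas)
    then show ?thesis by (rule measurable_cong[THEN iffD1, rotated]) (rule U_z[symmetric])
  qed
  have U_int: "(\<integral>\<^sup>+\<omega>. \<integral>\<^sup>+z. U m1 m2 \<omega> z \<partial>gauss_vec n \<partial>codebook n) \<le> ennreal \<theta>" for m1 m2
  proof -
    have t1: "(\<integral>\<^sup>+\<omega>. \<integral>\<^sup>+z. ev \<Psi> m1 m2 (Suc m1, Suc m2) \<omega> z \<partial>gauss_vec n \<partial>codebook n) \<le> ennreal \<beta>"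
    proof -
      have "(\<integral>\<^sup>+\<omega>. \<integral>\<^sup>+z. ev \<Psi> m1 m2 (Suc m1, Suc m2) \<omega> z \<partial>gauss_vec n \<partial>codebook n) =
        (\<integral>\<^sup>+z. \<integral>\<^sup>+x. \<integral>\<^sup>+y. \<integral>\<^sup>+x'. \<integral>\<^sup>+y'. \<Psi> (z, x, y, x', y') \<partial>gauss_vec n \<partial>gauss_vec n \<partial>gauss_vec n \<partial>gauss_vec n \<partial>gauss_vec n)"
        by (rule ev_int[OF \<Psi>_meas]) auto
      also have "\<dots> = (\<integral>\<^sup>+z. \<integral>\<^sup>+x. \<integral>\<^sup>+y. of_bool (\<exists>i<3. w i \<le> deficit n P1 P2 i (gram_vec n z x y))
        \<partial>gauss_vec n \<partial>gauss_vec n \<partial>gauss_vec n)"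
        unfolding \<Psi>_def split nn_integral_const gauss_vec.emeasure_space_1 mult_1_right ..
      finally show ?thesis using bad by simp
    qed
    have t2: "(\<integral>\<^sup>+\<omega>. \<integral>\<^sup>+z. ev (\<Phi> i) m1 m2 q \<omega> z \<partial>gauss_vec n \<partial>codebook n) \<le> ennreal (\<tau> i)"
      if i: "i < 3" and q: "q \<in> S i m1 m2" for i q
      unfolding ev_int[OF \<Phi>_meas S_ne[OF q]] using comp[OF i] unfolding \<Phi>_def split .
    have t3: "(\<Sum>q\<in>S i m1 m2. \<integral>\<^sup>+\<omega>. \<integral>\<^sup>+z. ev (\<Phi> i) m1 m2 q \<omega> z \<partial>gauss_vec n \<partial>codebook n) \<le> ennreal (real (N i) * \<tau> i)" if i: "i < 3" for i
    proof -
      have "(\<Sum>q\<in>S i m1 m2. \<integral>\<^sup>+\<omega>. \<integral>\<^sup>+z. ev (\<Phi> i) m1 m2 q \<omega> z \<partial>gauss_vec n \<partial>codebook n) \<le> (\<Sum>q\<in>S i m1 m2. ennreal (\<tau> i))"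
        by (rule sum_mono) (rule t2[OF i])
      also have "\<dots> = ennreal (real (card (S i m1 m2)) * \<tau> i)" using nonneg(2)[OF i] by (simp add: ennreal_mult ennreal_of_nat_eq_real_of_nat)
      also have "\<dots> \<le> ennreal (real (N i) * \<tau> i)" using S_card nonneg(2)[OF i] by (intro ennreal_leI mult_right_mono) auto
      finally show ?thesis .
    qed
    have "(\<integral>\<^sup>+\<omega>. \<integral>\<^sup>+z. U m1 m2 \<omega> z \<partial>gauss_vec n \<partial>codebook n) = (\<integral>\<^sup>+\<omega>. (\<integral>\<^sup>+z. ev \<Psi> m1 m2 (Suc m1, Suc m2) \<omega> z \<partial>gauss_vec n) +
      (\<Sum>i<3. \<Sum>q\<in>S i m1 m2. \<integral>\<^sup>+z. ev (\<Phi> i) m1 m2 q \<omega> z \<partial>gauss_vec n) \<partial>codebook n)"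
      by (rule nn_integral_cong) (rule U_z)
    also have "\<dots> = (\<integral>\<^sup>+\<omega>. \<integral>\<^sup>+z. ev \<Psi> m1 m2 (Suc m1, Suc m2) \<omega> z \<partial>gauss_vec n \<partial>codebook n) +
      (\<integral>\<^sup>+\<omega>. (\<Sum>i<3. \<Sum>q\<in>S i m1 m2. \<integral>\<^sup>+z. ev (\<Phi> i) m1 m2 q \<omega> z \<partial>gauss_vec n) \<partial>codebook n)"
      by (rule nn_integral_add[OF ev_meas2[OF \<Psi>_meas]]) (intro borel_measurable_sum ev_meas2[OF \<Phi>_meas])
    also have "(\<integral>\<^sup>+\<omega>. (\<Sum>i<3. \<Sum>q\<in>S i m1 m2. \<integral>\<^sup>+z. ev (\<Phi> i) m1 m2 q \<omega> z \<partial>gauss_vec n) \<partial>codebook n) =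
      (\<Sum>i<3. \<integral>\<^sup>+\<omega>. (\<Sum>q\<in>S i m1 m2. \<integral>\<^sup>+z. ev (\<Phi> i) m1 m2 q \<omega> z \<partial>gauss_vec n) \<partial>codebook n)"
      by (rule nn_integral_sum) (intro borel_measurable_sum ev_meas2[OF \<Phi>_meas])
    also have "\<dots> = (\<Sum>i<3. \<Sum>q\<in>S i m1 m2. \<integral>\<^sup>+\<omega>. \<integral>\<^sup>+z. ev (\<Phi> i) m1 m2 q \<omega> z \<partial>gauss_vec n \<partial>codebook n)"
      by (rule sum.cong[OF refl]) (rule nn_integral_sum[OF ev_meas2[OF \<Phi>_meas]])
    finally have e: "(\<integral>\<^sup>+\<omega>. \<integral>\<^sup>+z. U m1 m2 \<omega> z \<partial>gauss_vec n \<partial>codebook n) =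
      (\<integral>\<^sup>+\<omega>. \<integral>\<^sup>+z. ev \<Psi> m1 m2 (Suc m1, Suc m2) \<omega> z \<partial>gauss_vec n \<partial>codebook n) +
      (\<Sum>i<3. \<Sum>q\<in>S i m1 m2. \<integral>\<^sup>+\<omega>. \<integral>\<^sup>+z. ev (\<Phi> i) m1 m2 q \<omega> z \<partial>gauss_vec n \<partial>codebook n)" .
    have "\<dots> \<le> ennreal \<beta> + (\<Sum>i<3. ennreal (real (N i) * \<tau> i))"
      by (rule add_mono[OF t1], rule sum_mono, rule t3) simp
    also have "(\<Sum>i<3. ennreal (real (N i) * \<tau> i)) = ennreal (\<Sum>i<3. real (N i) * \<tau> i)"
      by (rule sum_ennreal) (use nonneg in auto)
    also have "ennreal \<beta> + \<dots> = ennreal \<theta>" unfolding \<theta>_def using nonneg by (intro ennreal_plus[symmetric] sum_nonneg) auto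
    finally show ?thesis unfolding e .
  qed
  have MM: "0 < real M1 * real M2" using M by simp
  \<comment> \<open>Some codebook is as good as the average one: otherwise the mean of the sum would
    be at least M1 M2 \<epsilon>, against the bound \<theta>.\<close>
  have "\<exists>\<omega>\<in>space (codebook n). (\<Sum>m1<M1. \<Sum>m2<M2. \<integral>\<^sup>+z. U m1 m2 \<omega> z \<partial>gauss_vec n) \<le> ennreal (real M1 * real M2 * \<epsilon>)"
  proof (rule ccontr)
    assume neg: "\<not> ?thesis"
    let ?ex = "\<exists>\<omega>\<in>space (codebook n). (\<Sum>m1<M1. \<Sum>m2<M2. \<integral>\<^sup>+z. U m1 m2 \<omega> z \<partial>gauss_vec n) \<le> ennreal (real M1 * real M2 * \<epsilon>)"
    have big: "ennreal (real M1 * real M2 * \<epsilon>) \<le> (\<Sum>m1<M1. \<Sum>m2<M2. \<integral>\<^sup>+z. U m1 m2 \<omega> z \<partial>gauss_vec n)" if "\<omega> \<in> space (codebook n)" for \<omega>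
    proof (rule ccontr)
      assume "\<not> ennreal (real M1 * real M2 * \<epsilon>) \<le> (\<Sum>m1<M1. \<Sum>m2<M2. \<integral>\<^sup>+z. U m1 m2 \<omega> z \<partial>gauss_vec n)"
      then have "(\<Sum>m1<M1. \<Sum>m2<M2. \<integral>\<^sup>+z. U m1 m2 \<omega> z \<partial>gauss_vec n) \<le> ennreal (real M1 * real M2 * \<epsilon>)" by simp
      with that have ?ex by (intro bexI[of _ \<omega>])
      with neg show False by (rule notE)
    qed
    have "ennreal (real M1 * real M2 * \<epsilon>) = (\<integral>\<^sup>+\<omega>. ennreal (real M1 * real M2 * \<epsilon>) \<partial>codebook n)"
      by (simp add: codebook.emeasure_space_1)
    also have "\<dots> \<le> (\<integral>\<^sup>+\<omega>. (\<Sum>m1<M1. \<Sum>m2<M2. \<integral>\<^sup>+z. U m1 m2 \<omega> z \<partial>gauss_vec n) \<partial>codebook n)"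
      by (rule nn_integral_mono) (rule big)
    also have "\<dots> = (\<Sum>m1<M1. \<integral>\<^sup>+\<omega>. (\<Sum>m2<M2. \<integral>\<^sup>+z. U m1 m2 \<omega> z \<partial>gauss_vec n) \<partial>codebook n)"
      by (rule nn_integral_sum) (intro borel_measurable_sum U_meas)
    also have "\<dots> = (\<Sum>m1<M1. \<Sum>m2<M2. \<integral>\<^sup>+\<omega>. \<integral>\<^sup>+z. U m1 m2 \<omega> z \<partial>gauss_vec n \<partial>codebook n)"
      by (rule sum.cong[OF refl]) (rule nn_integral_sum[OF U_meas])
    also have "\<dots> \<le> (\<Sum>m1<M1. \<Sum>m2<M2. ennreal \<theta>)" by (intro sum_mono U_int)
    also have "\<dots> = ennreal (real M1 * real M2 * \<theta>)"
      using \<theta>0 by (simp add: ennreal_mult ennreal_of_nat_eq_real_of_nat mult.assoc)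
    finally have "real M1 * real M2 * \<epsilon> \<le> real M1 * real M2 * \<theta>" using \<theta>0 by (simp add: ennreal_le_iff)
    then show False using mult_strict_left_mono[OF \<theta> MM] by linarith
  qed
  then obtain \<omega> where \<omega>: "\<omega> \<in> space (codebook n)"
    and avg: "(\<Sum>m1<M1. \<Sum>m2<M2. \<integral>\<^sup>+z. U m1 m2 \<omega> z \<partial>gauss_vec n) \<le> ennreal (real M1 * real M2 * \<epsilon>)"
    by (rule bexE)
  define f1 where "f1 m = sph n P1 (\<omega> (2 * m))" for m
  define f2 where "f2 m = sph n P2 (\<omega> (2 * m + 1))" for m
  \<comment> \<open>Squared distance from the output, the quantity minimised by the decoder.\<close>
  define e where "e m1 m2 y = (\<Sum>j<n. (y j - f1 m1 j - f2 m2 j) * (y j - f1 m1 j - f2 m2 j))" for m1 m2 y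
  have e_meas: "e m1 m2 \<in> borel_measurable (PiM {..<n} (\<lambda>_. lborel))" for m1 m2
  proof -
    have "(\<lambda>y. y j) \<in> borel_measurable (PiM {..<n} (\<lambda>_. lborel :: real measure))" if "j < n" for j
      using measurable_component_singleton[of j "{..<n}" "\<lambda>_. lborel :: real measure"] that by simp
    then show ?thesis unfolding e_def[abs_def]
      by (intro borel_measurable_sum borel_measurable_times borel_measurable_diff borel_measurable_const) auto
  qed
  obtain g where g: "g \<in> PiM {..<n} (\<lambda>_. lborel) \<rightarrow>\<^sub>M count_space UNIV" "\<And>y. g y \<in> {..<M1} \<times> {..<M2}"
    "\<And>y m1 m2. m1 < M1 \<Longrightarrow> m2 < M2 \<Longrightarrow> g y \<noteq> (m1, m2) \<Longrightarrow>
      \<exists>m1' m2'. m1' < M1 \<and> m2' < M2 \<and> (m1', m2') \<noteq> (m1, m2) \<and> e m1' m2' y \<le> e m1 m2 y"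
    apply (rule min_index_decoder[OF M, of e, OF e_meas])
    subgoal premises prems for g by (rule prems(1)[OF prems(2-4)])
    done
  define err where "err m1 m2 = {z \<in> space (gauss_vec n). g (\<lambda>i\<in>{..<n}. f1 m1 i + f2 m2 i + z i) \<noteq> (m1, m2)}" for m1 m2
  have ptw: "1 \<le> U m1 m2 \<omega> z" if m: "m1 < M1" "m2 < M2" and z: "z \<in> err m1 m2" for m1 m2 z
  proof -
    define y where "y = (\<lambda>i\<in>{..<n}. f1 m1 i + f2 m2 i + z i)"
    have "g y \<noteq> (m1, m2)" using z by (simp add: err_def y_def)
    from g(3)[OF m this] obtain m1' m2' where m': "m1' < M1" "m2' < M2" "(m1', m2') \<noteq> (m1, m2)" "e m1' m2' y \<le> e m1 m2 y" by blast
    have ey: "e k1 k2 y = (\<Sum>j<n. (f1 m1 j + f2 m2 j + z j - f1 k1 j - f2 k2 j) * (f1 m1 j + f2 m2 j + z j - f1 k1 j - f2 k2 j))" for k1 k2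
      unfolding e_def by (rule sum.cong) (simp_all add: y_def)
    have e0: "e m1 m2 y = ip n z z" unfolding ey ip_def by simp
    define x y0 where "x = \<omega> (2 * m1)" and "y0 = \<omega> (2 * m2 + 1)"
    show ?thesis
    proof (cases "\<exists>i<3. w i \<le> deficit n P1 P2 i (gram_vec n z x y0)")
      case True
      then have "ev \<Psi> m1 m2 (Suc m1, Suc m2) \<omega> z = 1" unfolding ev_def \<Psi>_def split x_def y0_def by simp
      then show ?thesis unfolding U_def by simp
    next
      case False
      \<comment> \<open>The decoded pair differs in the first message, the second or both; when one
        codeword is shared it cancels from the distance and leaves the \<open>near\<close> condition
        of that kind.\<close>
      have "\<exists>i<3. \<exists>q\<in>S i m1 m2. near n P1 P2 i z x y0 (\<omega> (2 * fst q)) (\<omega> (2 * snd q + 1))"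
      proof -
        consider "m1' \<noteq> m1" "m2' = m2" | "m1' = m1" "m2' \<noteq> m2" | "m1' \<noteq> m1" "m2' \<noteq> m2" using m'(3) by auto
        then show ?thesis
        proof cases
          case 1
          have "(m1', Suc m2) \<in> S 0 m1 m2" using 1 m' by (simp add: S_def)
          moreover have "near n P1 P2 0 z x y0 (\<omega> (2 * m1')) (\<omega> (2 * Suc m2 + 1))"
            using m'(4) unfolding e0 unfolding ey near_def 1 ip_def[of n "\<lambda>j. _ j + _ j - _ j"] by (simp add: signal_def f1_def f2_def x_def y0_def algebra_simps)
          ultimately show ?thesis by (intro exI[of _ 0] conjI bexI[of _ "(m1', Suc m2)"]) simp_all
        next
          case 2
          have "(Suc m1, m2') \<in> S 1 m1 m2" using 2 m' by (simp add: S_def)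
          moreover have "near n P1 P2 1 z x y0 (\<omega> (2 * Suc m1)) (\<omega> (2 * m2' + 1))"
            using m'(4) unfolding e0 unfolding ey near_def 2 ip_def[of n "\<lambda>j. _ j + _ j - _ j"] by (simp add: signal_def f1_def f2_def x_def y0_def algebra_simps)
          ultimately show ?thesis by (intro exI[of _ 1] conjI bexI[of _ "(Suc m1, m2')"]) simp_all
        next
          case 3
          have "(m1', m2') \<in> S 2 m1 m2" using 3 m' by (simp add: S_def)
          moreover have "near n P1 P2 2 z x y0 (\<omega> (2 * m1')) (\<omega> (2 * m2' + 1))"
            using m'(4) unfolding e0 unfolding ey near_def ip_def[of n "\<lambda>j. _ j + _ j - _ j"] by (simp add: signal_def f1_def f2_def x_def y0_def algebra_simps)
          ultimately show ?thesis by (intro exI[of _ 2] conjI bexI[of _ "(m1', m2')"]) simp_all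
        qed
      qed
      then obtain i q where i: "i < 3" and q: "q \<in> S i m1 m2" and nr: "near n P1 P2 i z x y0 (\<omega> (2 * fst q)) (\<omega> (2 * snd q + 1))" by blast
      have "\<not> w i \<le> deficit n P1 P2 i (gram_vec n z x y0)" using False i by blast
      then have "ev (\<Phi> i) m1 m2 q \<omega> z = 1" unfolding ev_def \<Phi>_def split using nr unfolding x_def y0_def by simp
      then have b1: "1 \<le> (\<Sum>q\<in>S i m1 m2. ev (\<Phi> i) m1 m2 q \<omega> z)"
        using member_le_sum[of q "S i m1 m2" "\<lambda>q. ev (\<Phi> i) m1 m2 q \<omega> z"] q S_fin by simp
      have b2: "(\<Sum>q\<in>S i m1 m2. ev (\<Phi> i) m1 m2 q \<omega> z) \<le> (\<Sum>i<3. \<Sum>q\<in>S i m1 m2. ev (\<Phi> i) m1 m2 q \<omega> z)"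
        by (rule member_le_sum[of i "{..<3}" "\<lambda>i. \<Sum>q\<in>S i m1 m2. ev (\<Phi> i) m1 m2 q \<omega> z"]) (use i in simp_all)
      have b3: "(\<Sum>i<3. \<Sum>q\<in>S i m1 m2. ev (\<Phi> i) m1 m2 q \<omega> z) \<le> U m1 m2 \<omega> z"
        unfolding U_def by (rule add_increasing[OF zero_le order_refl])
      show ?thesis by (rule order_trans[OF b1 order_trans[OF b2 b3]])
    qed
  qed
  \<comment> \<open>If the error set is not measurable, \<open>measure\<close> assigns it 0 by
    convention, so that case is immediate.\<close>
  have err_le: "ennreal (measure (gauss_vec n) (err m1 m2)) \<le> (\<integral>\<^sup>+z. U m1 m2 \<omega> z \<partial>gauss_vec n)" if m: "m1 < M1" "m2 < M2" for m1 m2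
  proof (cases "err m1 m2 \<in> sets (gauss_vec n)")
    case True
    have "ennreal (measure (gauss_vec n) (err m1 m2)) = (\<integral>\<^sup>+z. indicator (err m1 m2) z \<partial>gauss_vec n)"
      using True by (simp add: gauss_vec.emeasure_eq_measure)
    also have "\<dots> \<le> (\<integral>\<^sup>+z. U m1 m2 \<omega> z \<partial>gauss_vec n)"
    proof (rule nn_integral_mono)
      fix z show "indicator (err m1 m2) z \<le> U m1 m2 \<omega> z"
        using ptw[OF m, of z] by (cases "z \<in> err m1 m2") auto
    qed
    finally show ?thesis .
  qed (simp add: measure_notin_sets)
  have "ennreal (\<Sum>m1<M1. \<Sum>m2<M2. measure (gauss_vec n) (err m1 m2)) = (\<Sum>m1<M1. \<Sum>m2<M2. ennreal (measure (gauss_vec n) (err m1 m2)))"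
    by (simp add: sum_ennreal sum_nonneg)
  also have "\<dots> \<le> (\<Sum>m1<M1. \<Sum>m2<M2. \<integral>\<^sup>+z. U m1 m2 \<omega> z \<partial>gauss_vec n)" by (intro sum_mono err_le) auto
  also note avg
  finally have "(\<Sum>m1<M1. \<Sum>m2<M2. measure (gauss_vec n) (err m1 m2)) \<le> real M1 * real M2 * \<epsilon>"
    using MM \<theta>0 \<theta> by (simp add: ennreal_le_iff)
  then have error: "1 / (real M1 * real M2) * (\<Sum>m1<M1. \<Sum>m2<M2. measure (gauss_vec n) (err m1 m2)) \<le> \<epsilon>"
    using MM by (simp add: divide_le_eq mult.commute)
  have power: "(\<Sum>i<n. (sph n Q x i)\<^sup>2) \<le> real n * Q" if "0 \<le> Q" for Q x
    using ip_sph_sph_le[OF that, of n x] unfolding ip_def[of n "sph n Q x"] by (simp add: power2_eq_square)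
  have "mac_code n M1 M2 \<epsilon> P1 P2 f1 f2 g"
    unfolding mac_code_def using g(1,2) error power[OF P(1)] power[OF P(2)]
    by (simp add: f1_def f2_def err_def)
  then show ?thesis unfolding exists_mac_code_def by blast
qed


section \<open>Choice of thresholds and constants\<close>

text \<open>\<open>deficit_bad_event\<close> carried back from the triangular coordinates to the
  vectors themselves, with the limit probability identified through
  \<open>gauss_cdf3\<close>.\<close>

lemma bad_event_bound:
  assumes P: "0 < P1" "0 < P2" and \<kappa>: "0 < \<kappa>"
  obtains C n0 where "0 \<le> C" "\<And>n w. n0 \<le> n \<Longrightarrow>
    (\<integral>\<^sup>+z. \<integral>\<^sup>+x. \<integral>\<^sup>+y. of_bool (\<exists>i<3. min (w i) (\<kappa> * sqrt n) \<le> deficit n P1 P2 i (gram_vec n z x y))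
      \<partial>gauss_vec n \<partial>gauss_vec n \<partial>gauss_vec n) \<le> ennreal (1 - gauss_cdf3 (disp_mat P1 P2) w + C / sqrt n)"
proof -
  obtain C n0 where C: "0 \<le> C" "3 \<le> n0" "\<And>n w. n0 \<le> n \<Longrightarrow>
    (\<integral>\<^sup>+\<rho>. \<integral>\<^sup>+\<omega>. indicator {\<omega>. \<exists>i<3. min (w i) (\<kappa> * sqrt n) \<le> deficit5 n P1 P2 i \<rho> \<omega>} \<omega> \<partial>mac5 n \<partial>chi n) \<le>
    (\<integral>\<^sup>+v. indicator {v. \<exists>i<3. w i < lin5 P1 P2 i (fst v) (snd v)} v \<partial>(std_normal \<Otimes>\<^sub>M mac5 n)) + ennreal (C / sqrt n)"
    apply (rule deficit_bad_event[OF P \<kappa>])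
    subgoal premises prems for C n0 by (rule prems(1)[OF prems(2-4)])
    done
  show ?thesis
  proof (rule that[OF C(1)])
    fix n w assume n: "n0 \<le> n"
    have n3: "3 \<le> n" using n C(2) by simp
    define f where "f G = (of_bool (\<exists>i<3. min (w i) (\<kappa> * sqrt n) \<le> deficit n P1 P2 i G) :: ennreal)" for G
    have "Measurable.pred borel (\<lambda>G. \<exists>i<3. min (w i) (\<kappa> * sqrt n) \<le> deficit n P1 P2 i G)" by measurable
    then have f: "f \<in> borel_measurable borel" unfolding f_def[abs_def] of_bool_def by measurable
    have cdf: "gauss_cdf3 (disp_mat P1 P2) w \<le> 1"
      unfolding gauss_cdf3_disp_mat[OF P] by (rule normal4.prob_le_1)
    have "(\<integral>\<^sup>+z. \<integral>\<^sup>+x. \<integral>\<^sup>+y. f (gram_vec n z x y) \<partial>gauss_vec n \<partial>gauss_vec n \<partial>gauss_vec n) =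
      (\<integral>\<^sup>+\<rho>. \<integral>\<^sup>+\<omega>. indicator {\<omega>. \<exists>i<3. min (w i) (\<kappa> * sqrt n) \<le> deficit5 n P1 P2 i \<rho> \<omega>} \<omega> \<partial>mac5 n \<partial>chi n)"
      unfolding nn_integral_gram_vec[OF n3 f] unfolding f_def deficit_gram5 indicator_def mem_Collect_eq ..
    also have "\<dots> \<le> ennreal (1 - gauss_cdf3 (disp_mat P1 P2) w) + ennreal (C / sqrt n)"
      using C(3)[OF n, of w] unfolding nn_integral_lin5_exceed[OF P] .
    also have "\<dots> = ennreal (1 - gauss_cdf3 (disp_mat P1 P2) w + C / sqrt n)"
      using cdf C(1) by (intro ennreal_plus[symmetric]) auto
    finally show "(\<integral>\<^sup>+z. \<integral>\<^sup>+x. \<integral>\<^sup>+y. of_bool (\<exists>i<3. min (w i) (\<kappa> * sqrt n) \<le> deficit n P1 P2 i (gram_vec n z x y))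
      \<partial>gauss_vec n \<partial>gauss_vec n \<partial>gauss_vec n) \<le> ennreal (1 - gauss_cdf3 (disp_mat P1 P2) w + C / sqrt n)"
      unfolding f_def .
  qed
qed

text \<open>\<open>competitor_bound\<close> with constants common to the three kinds, obtained by
  adding the three constants.\<close>

lemma competitor_bound_near:
  assumes P: "0 < P1" "0 < P2" and \<kappa>: "\<And>i. i < 3 \<Longrightarrow> 4 * \<kappa> \<le> ln (1 + tot P1 P2 i)"
  obtains C n0 where "0 \<le> C" "\<And>i n w. i < 3 \<Longrightarrow> n0 \<le> n \<Longrightarrow> w \<le> \<kappa> * sqrt n \<Longrightarrow>
    (\<integral>\<^sup>+z. \<integral>\<^sup>+x. \<integral>\<^sup>+y. \<integral>\<^sup>+x'. \<integral>\<^sup>+y'. of_bool (deficit n P1 P2 i (gram_vec n z x y) < w \<and> near n P1 P2 i z x y x' y')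
      \<partial>gauss_vec n \<partial>gauss_vec n \<partial>gauss_vec n \<partial>gauss_vec n \<partial>gauss_vec n)
    \<le> ennreal (C / n * exp ((real n - 1) * (w / sqrt n - cap_vec P1 P2 i)))"
proof -
  define I where "I i n w = (\<integral>\<^sup>+z. \<integral>\<^sup>+x. \<integral>\<^sup>+y. \<integral>\<^sup>+x'. \<integral>\<^sup>+y'. of_bool (deficit n P1 P2 i (gram_vec n z x y) < w \<and> near n P1 P2 i z x y x' y')
      \<partial>gauss_vec n \<partial>gauss_vec n \<partial>gauss_vec n \<partial>gauss_vec n \<partial>gauss_vec n)" for i n w
  define h where "h i n w = exp ((real n - 1) * (w / sqrt n - cap_vec P1 P2 i)) / n" for i n w
  have h: "0 \<le> h i n w" for i n w by (simp add: h_def)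
  have ex: "\<exists>C n0. 0 \<le> C \<and> (\<forall>n\<ge>n0. \<forall>w\<le>\<kappa> * sqrt n. I i n w \<le> ennreal (C * h i n w))" if i: "i < 3" for i
    apply (rule competitor_bound[OF P i \<kappa>[OF i]])
    subgoal premises prems for C n0
    proof (intro exI[of _ C] exI[of _ n0] conjI allI impI)
      fix n w assume "n0 \<le> n" "w \<le> \<kappa> * sqrt (real n)"
      from prems(3)[OF this] show "I i n w \<le> ennreal (C * h i n w)"
        unfolding I_def near_def h_def by simp
    qed (rule prems(1))
    done
  obtain C0 n0 where 0: "0 \<le> C0 \<and> (\<forall>n\<ge>n0. \<forall>w\<le>\<kappa> * sqrt n. I 0 n w \<le> ennreal (C0 * h 0 n w))" using ex[of 0] by auto
  obtain C1 n1 where 1: "0 \<le> C1 \<and> (\<forall>n\<ge>n1. \<forall>w\<le>\<kappa> * sqrt n. I 1 n w \<le> ennreal (C1 * h 1 n w))" using ex[of 1] by auto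
  obtain C2 n2 where 2: "0 \<le> C2 \<and> (\<forall>n\<ge>n2. \<forall>w\<le>\<kappa> * sqrt n. I 2 n w \<le> ennreal (C2 * h 2 n w))" using ex[of 2] by auto
  show ?thesis
  proof (rule that[of "C0 + C1 + C2" "max n0 (max n1 n2)"])
    show "0 \<le> C0 + C1 + C2" using 0 1 2 by simp
    fix i n :: nat and w :: real assume i: "i < 3" and n: "max n0 (max n1 n2) \<le> n" and w: "w \<le> \<kappa> * sqrt n"
    have nn: "n0 \<le> n" "n1 \<le> n" "n2 \<le> n" using n by auto
    have up: "ennreal (C * h i n w) \<le> ennreal ((C0 + C1 + C2) * h i n w)" if "C \<le> C0 + C1 + C2" for C
      using that h by (intro ennreal_leI mult_right_mono)
    have "I i n w \<le> ennreal ((C0 + C1 + C2) * h i n w)"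
    proof -
      consider "i = 0" | "i = 1" | "i = 2" using i by linarith
      then show ?thesis
      proof cases
        case 1
        have "I i n w \<le> ennreal (C0 * h i n w)" using 0 nn w 1 by simp
        also have "\<dots> \<le> ennreal ((C0 + C1 + C2) * h i n w)" by (rule up) (use \<open>0 \<le> C1 \<and> _\<close> 2 in simp)
        finally show ?thesis .
      next
        case 2
        have "I i n w \<le> ennreal (C1 * h i n w)" using \<open>0 \<le> C1 \<and> _\<close> nn w 2 by simp
        also have "\<dots> \<le> ennreal ((C0 + C1 + C2) * h i n w)" by (rule up) (use 0 \<open>0 \<le> C2 \<and> _\<close> in simp)
        finally show ?thesis .
      next
        case 3
        have "I i n w \<le> ennreal (C2 * h i n w)" using \<open>0 \<le> C2 \<and> _\<close> nn w 3 by simp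
        also have "\<dots> \<le> ennreal ((C0 + C1 + C2) * h i n w)" by (rule up) (use 0 \<open>0 \<le> C1 \<and> _\<close> in simp)
        finally show ?thesis .
      qed
    qed
    then show "(\<integral>\<^sup>+z. \<integral>\<^sup>+x. \<integral>\<^sup>+y. \<integral>\<^sup>+x'. \<integral>\<^sup>+y'. of_bool (deficit n P1 P2 i (gram_vec n z x y) < w \<and> near n P1 P2 i z x y x' y')
      \<partial>gauss_vec n \<partial>gauss_vec n \<partial>gauss_vec n \<partial>gauss_vec n \<partial>gauss_vec n)
      \<le> ennreal ((C0 + C1 + C2) / n * exp ((real n - 1) * (w / sqrt n - cap_vec P1 P2 i)))"
      unfolding I_def h_def by simp
  qed
qed

text \<open>In ln m + (n - 1)(w/sqrt n - cap) the terms n cap cancel, w \<le> z + K/sqrt n absorbs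
  sqrt n z and K, and (ln n)/2 leaves a factor sqrt n, which against 1/n gives 1/sqrt n. Having n -
  1 in place of n adds cap - w/sqrt n, bounded by cap + B. The result does not involve K, so K can
  be chosen afterwards.\<close>

lemma code_size_bound:
  fixes n :: nat and m cap z K B w C :: real
  assumes n: "1 \<le> n" and m: "0 < m" "ln m = n * cap - sqrt n * z + ln n / 2 - K"
    and w: "w \<le> z + K / sqrt n" "- B \<le> w" and B: "0 \<le> B" and C: "0 \<le> C"
  shows "m * (C / n * exp ((real n - 1) * (w / sqrt n - cap))) \<le> C * exp (cap + B) / sqrt n"
proof -
  define s where "s = sqrt n"
  have s: "1 \<le> s" "s * s = n" using n by (auto simp: s_def)
  have "ln s = ln n / 2" using n by (simp add: s_def ln_sqrt)
  then have lm: "ln m = n * cap - s * z + ln s - K" using m(2) by (simp add: s_def)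
  have "s * w \<le> s * (z + K / s)" using w(1) s by (intro mult_left_mono) (auto simp: s_def)
  then have sw: "s * w \<le> s * z + K" using s by (simp add: distrib_left)
  have "- w / s \<le> B"
  proof (cases "0 \<le> w")
    case True
    then have "- w / s \<le> 0" using s by simp
    then show ?thesis using B by linarith
  next
    case False
    then have "- w / s \<le> - w / 1" using s by (intro divide_left_mono) auto
    then show ?thesis using w(2) by simp
  qed
  moreover have "(real n - 1) * (w / s - cap) = s * w - w / s - n * cap + cap"
    using s by (simp add: s(2)[symmetric] field_simps)
  ultimately have "ln m + (real n - 1) * (w / s - cap) \<le> ln s + (cap + B)"
    using lm sw by simp
  then have "exp (ln m + (real n - 1) * (w / s - cap)) \<le> exp (ln s + (cap + B))" by simp
  then have "m * exp ((real n - 1) * (w / s - cap)) \<le> s * exp (cap + B)" using m(1) s by (simp add: exp_add)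
  then have "C / n * (m * exp ((real n - 1) * (w / s - cap))) \<le> C / n * (s * exp (cap + B))" using C by (intro mult_left_mono) auto
  also have "\<dots> = C * exp (cap + B) / s" using s by (simp add: s(2)[symmetric])
  finally show ?thesis by (simp add: s_def mult_ac)
qed

text \<open>The O(1) term takes the form of a constant -K, fixed together with the threshold N
  before n, M1, M2 and the point of \<open>Qinv\<close>.\<close>

theorem theorem2:
  fixes \<epsilon> P1 P2 :: real
  assumes "0 < \<epsilon>" and "\<epsilon> < 1" and "0 < P1" and "0 < P2"
  shows "\<exists>K::real. \<exists>N::nat. \<forall>n\<ge>N. \<forall>M1 M2 :: nat. 1 \<le> M1 \<longrightarrow> 1 \<le> M2 \<longrightarrow>
    (\<exists>z\<in>Qinv (disp_mat P1 P2) \<epsilon>.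
       (\<forall>i<3. (if i = 0 then ln (real M1) else if i = 1 then ln (real M2)
                   else ln (real M1 * real M2))
          = real n * cap_vec P1 P2 i - sqrt (real n) * z i + ln (real n) / 2 - K)) \<longrightarrow>
    exists_mac_code n M1 M2 \<epsilon> P1 P2"
proof -
  note P = assms(3,4)
  have cdf: "gauss_cdf3 (disp_mat P1 P2) z = lin_cdf P1 P2 z" for z
    by (simp add: gauss_cdf3_disp_mat[OF P] lin_cdf_def)
  \<comment> \<open>One truncation level for all three kinds; the sum power P1 + P2 only makes the
    logarithm larger.\<close>
  define \<kappa> where "\<kappa> = min (ln (1 + P1)) (ln (1 + P2)) / 4"
  have \<kappa>: "0 < \<kappa>" using P by (simp add: \<kappa>_def)
  have \<kappa>4: "4 * \<kappa> \<le> ln (1 + tot P1 P2 i)" for i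
  proof -
    have "ln (1 + P1) \<le> ln (1 + (P1 + P2))" using P by simp
    then show ?thesis by (auto simp: \<kappa>_def tot_def min_def)
  qed
  obtain B c where B: "0 \<le> B" and c: "0 < c"
    and low: "\<And>z. 1 - \<epsilon> \<le> lin_cdf P1 P2 z \<Longrightarrow> \<forall>i<3. - B \<le> z i"
    and gain: "\<And>z \<delta>. 1 - \<epsilon> \<le> lin_cdf P1 P2 z \<Longrightarrow> 0 < \<delta> \<Longrightarrow> \<delta> \<le> 1 \<Longrightarrow>
       1 - \<epsilon> / 2 \<le> lin_cdf P1 P2 (\<lambda>i. z i + \<delta>) \<or> lin_cdf P1 P2 z + c * \<delta> \<le> lin_cdf P1 P2 (\<lambda>i. z i + \<delta>)"
    apply (rule lin_cdf_gain[OF P assms(1,2)])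
    subgoal premises prems for B c by (rule prems(1)[OF prems(2-5)])
    done
  obtain Cb nb where Cb: "0 \<le> Cb" and bad: "\<And>n w. nb \<le> n \<Longrightarrow>
    (\<integral>\<^sup>+z. \<integral>\<^sup>+x. \<integral>\<^sup>+y. of_bool (\<exists>i<3. min (w i) (\<kappa> * sqrt n) \<le> deficit n P1 P2 i (gram_vec n z x y))
      \<partial>gauss_vec n \<partial>gauss_vec n \<partial>gauss_vec n) \<le> ennreal (1 - gauss_cdf3 (disp_mat P1 P2) w + Cb / sqrt n)"
    apply (rule bad_event_bound[OF P \<kappa>])
    subgoal premises prems for C n0 by (rule prems(1)[OF prems(2-3)])
    done
  obtain Ct nt where Ct: "0 \<le> Ct" and comp: "\<And>i n w. i < 3 \<Longrightarrow> nt \<le> n \<Longrightarrow> w \<le> \<kappa> * sqrt n \<Longrightarrow>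
    (\<integral>\<^sup>+z. \<integral>\<^sup>+x. \<integral>\<^sup>+y. \<integral>\<^sup>+x'. \<integral>\<^sup>+y'. of_bool (deficit n P1 P2 i (gram_vec n z x y) < w \<and> near n P1 P2 i z x y x' y')
      \<partial>gauss_vec n \<partial>gauss_vec n \<partial>gauss_vec n \<partial>gauss_vec n \<partial>gauss_vec n)
    \<le> ennreal (Ct / n * exp ((real n - 1) * (w / sqrt n - cap_vec P1 P2 i)))"
    apply (rule competitor_bound_near[OF P \<kappa>4])
    subgoal premises prems for C n0 by (rule prems(1)[OF prems(2-3)])
    done
  define C where "C = Cb + Ct * exp (cap_vec P1 P2 0 + B) + Ct * exp (cap_vec P1 P2 1 + B) + Ct * exp (cap_vec P1 P2 2 + B)"
  have C: "0 \<le> C" using Cb Ct by (simp add: C_def)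
  \<comment> \<open>A shift by K/sqrt n gains c K/sqrt n = (C + 1)/sqrt n in the distribution
    function, more than the accumulated error C/sqrt n.\<close>
  define K where "K = (C + 1) / c"
  have K: "0 < K" "c * K = C + 1" using C c by (auto simp: K_def)
  \<comment> \<open>The first bound makes the shift at most 1, as \<open>gain\<close> demands; the
    second makes (C + 1)/sqrt n at most \<epsilon>/2, for the case where the distribution function
    is already at least 1 - \<epsilon>/2.\<close>
  obtain N0 :: nat where N0: "max (K\<^sup>2) ((2 * (C + 1) / \<epsilon>)\<^sup>2) \<le> real N0" using real_arch_simple by blast
  have "exists_mac_code n M1 M2 \<epsilon> P1 P2"
    if n: "max 1 (max N0 (max nb nt)) \<le> n" and M: "1 \<le> M1" "1 \<le> M2" and z: "z \<in> Qinv (disp_mat P1 P2) \<epsilon>"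
      and eq: "\<forall>i<3. (if i = 0 then ln (real M1) else if i = 1 then ln (real M2) else ln (real M1 * real M2))
          = real n * cap_vec P1 P2 i - sqrt (real n) * z i + ln (real n) / 2 - K" for n M1 M2 z
  proof -
    have n1: "1 \<le> n" and nb: "nb \<le> n" and nt: "nt \<le> n" and "N0 \<le> n" using n by auto
    then have nN: "K\<^sup>2 \<le> n" "(2 * (C + 1) / \<epsilon>)\<^sup>2 \<le> n" using N0 by auto
    define s where "s = sqrt n"
    have s: "1 \<le> s" using n1 by (simp add: s_def)
    have Ks: "K \<le> s" using nN(1) K(1) by (simp add: s_def real_le_rsqrt)
    have Cs: "2 * (C + 1) / \<epsilon> \<le> s" using nN(2) by (simp add: s_def real_le_rsqrt)
    define \<delta> where "\<delta> = K / s"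
    have \<delta>: "0 < \<delta>" "\<delta> \<le> 1" using K Ks s by (auto simp: \<delta>_def)
    have F: "1 - \<epsilon> \<le> lin_cdf P1 P2 z" using z by (simp add: Qinv_def cdf)
    have zB: "- B \<le> z i" if "i < 3" for i using low[OF F] that by simp
    \<comment> \<open>Thresholds shifted by \<delta> and truncated, so that both the bad-event bound
      and the competitor bound apply; both operations keep them above -B.\<close>
    define w where "w i = min (z i + \<delta>) (\<kappa> * sqrt n)" for i
    have wB: "- B \<le> w i" if "i < 3" for i
    proof -
      have "0 \<le> \<kappa> * sqrt n" using \<kappa> by simp
      then show ?thesis using zB[OF that] \<delta> B by (auto simp: w_def min_def)
    qed
    define \<tau> where "\<tau> i = Ct / n * exp ((real n - 1) * (w i / sqrt n - cap_vec P1 P2 i))" for i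
    define \<beta> where "\<beta> = 1 - lin_cdf P1 P2 (\<lambda>i. z i + \<delta>) + Cb / sqrt n"
    have cdf1: "lin_cdf P1 P2 y \<le> 1" for y unfolding lin_cdf_def by (rule normal4.prob_le_1)
    have size: "m * \<tau> i \<le> Ct * exp (cap_vec P1 P2 i + B) / s"
      if i: "i < 3" and m: "0 < m" "ln m = n * cap_vec P1 P2 i - sqrt n * z i + ln n / 2 - K" for i m
      unfolding \<tau>_def s_def
      by (rule code_size_bound[OF n1 m _ wB[OF i] B Ct]) (simp add: w_def \<delta>_def s_def)
    have t0: "real M1 * \<tau> 0 \<le> Ct * exp (cap_vec P1 P2 0 + B) / s"
      by (rule size) (use M eq[rule_format, of 0] in auto)
    have t1: "real M2 * \<tau> 1 \<le> Ct * exp (cap_vec P1 P2 1 + B) / s"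
      by (rule size) (use M eq[rule_format, of 1] in auto)
    have t2: "real M1 * real M2 * \<tau> 2 \<le> Ct * exp (cap_vec P1 P2 2 + B) / s"
      by (rule size) (use M eq[rule_format, of 2] in auto)
    have "\<beta> + M1 * \<tau> 0 + M2 * \<tau> 1 + real M1 * real M2 * \<tau> 2 \<le> 1 - lin_cdf P1 P2 (\<lambda>i. z i + \<delta>) + C / s"
      using t0 t1 t2 unfolding \<beta>_def C_def s_def add_divide_distrib by linarith
    also have "\<dots> < \<epsilon>"
    proof -
      \<comment> \<open>Strictness comes from C + 1 in place of C and settles both alternatives of
        \<open>gain\<close>.\<close>
      have Cs1: "C / s < (C + 1) / s" using s by (intro divide_strict_right_mono) auto
      have "(C + 1) / s \<le> \<epsilon> / 2" using Cs s assms(1) by (simp add: divide_le_eq mult.commute)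
      moreover have "c * \<delta> = (C + 1) / s" using K(2) by (simp add: \<delta>_def)
      ultimately show ?thesis using gain[OF F \<delta>] F Cs1 by linarith
    qed
    finally have total: "\<beta> + M1 * \<tau> 0 + M2 * \<tau> 1 + real M1 * real M2 * \<tau> 2 < \<epsilon>" .
    show ?thesis
    proof (rule random_coding[OF M less_imp_le[OF P(1)] less_imp_le[OF P(2)] _ _ _ _ total])
      show "0 \<le> \<beta>" using cdf1[of "\<lambda>i. z i + \<delta>"] Cb by (simp add: \<beta>_def)
      show "0 \<le> \<tau> i" for i using Ct by (simp add: \<tau>_def)
      show "(\<integral>\<^sup>+z. \<integral>\<^sup>+x. \<integral>\<^sup>+y. of_bool (\<exists>i<3. w i \<le> deficit n P1 P2 i (gram_vec n z x y))
        \<partial>gauss_vec n \<partial>gauss_vec n \<partial>gauss_vec n) \<le> ennreal \<beta>"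
        using bad[OF nb, of "\<lambda>i. z i + \<delta>"] unfolding w_def \<beta>_def cdf .
      show "(\<integral>\<^sup>+z. \<integral>\<^sup>+x. \<integral>\<^sup>+y. \<integral>\<^sup>+x'. \<integral>\<^sup>+y'.
        of_bool (deficit n P1 P2 i (gram_vec n z x y) < w i \<and> near n P1 P2 i z x y x' y')
        \<partial>gauss_vec n \<partial>gauss_vec n \<partial>gauss_vec n \<partial>gauss_vec n \<partial>gauss_vec n) \<le> ennreal (\<tau> i)" if "i < 3" for i
        unfolding \<tau>_def by (rule comp[OF that nt]) (simp add: w_def)
    qed
  qed
  then show ?thesis
    by (intro exI[of _ K] exI[of _ "max 1 (max N0 (max nb nt))"] allI impI) (erule bexE, blast)
qed

end
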